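(* Let $M^n=L^2\times_\varphi F^{n-2}(\varepsilon)$, $n\ge 5$, be an Einstein manifold of Ricci curvature $\rho$ such that the warping function $\varphi$ is not constant on any (nonempty) open subset of $L^2$ and the sectional curvature of $M^n$ is not constant on any (nonempty) open subset of $M^n$. Suppose that $F^{n-2}(\varepsilon)$ has constant sectional curvature and let $f\colon M^n\to\mathbb{R}^{n+2}$ be any isometric immersion. Then there is an open dense subset of $M^n$ such that, along each of its connected components $V$, $f$ is, up to a rigid motion of $\mathbb{R}^{n+2}$, an $(n-2)$-rotational submanifold of the following form: there are a constant $c\in\mathbb{R}$, open intervals $I,I_0\subset\mathbb{R}$, a positive function $\varphi\in C^\infty(I)$ with $$\varphi'^2=1-\frac{\rho}{n-1}\varphi^2+\frac{c}{\varphi^{n-3}},\qquad 0<\varphi'^2<1,$$ and an isometric immersion $h\colon U\to\mathbb{R}^{3}$ of an open subset $U$ of $I\times I_0$ endowed with the metric $(1-\varphi'^2(t))\,dt^2+\varphi'^2(t)\,du^2$, such that $V$ is isometric to an open subset of the warped product $U\times_\varphi\mathbb{S}^{n-2}(1)$, where here $U$ is endowed with the metric $dt^2+\varphi'^2(t)\,du^2$, and under this identification $$f(t,u,y)=(h(t,u),\varphi(t)\,\phi(y))\in\mathbb{R}^{3}\oplus\mathbb{R}^{n-1},$$ where $\phi\colon\mathbb{S}^{n-2}(1)\to\mathbb{R}^{n-1}$ is the inclusion.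
   Context: A Riemannian manifold $M^n$ is Einstein with Ricci curvature $\rho$ if $\mathrm{Ric}_M(X,Y)=\rho\langle X,Y\rangle$ for all vector fields $X,Y$ and a constant $\rho\in\mathbb{R}$ ($\rho$ is not normalized). For $m\ge 2$ and $\varepsilon\in\{1,-1,0\}$, $F^m(\varepsilon)$ denotes an Einstein manifold with Ricci curvature $(m-1)\varepsilon$. $L\times_\varphi F$ is the warped product with base $L$, fiber $F$ and warping function $\varphi\in C^\infty(L)$, $\varphi>0$, with metric $g_L+\varphi^2 g_F$; $L^2$ is a two-dimensional Riemannian manifold. $\mathbb{S}^m(1)$ is the unit $m$-sphere. An $(n-2)$-rotational submanifold $f\colon M^n\to\mathbb{R}^{n+p}$ with axis $\mathbb{R}^{p+1}$ over a surface $g\colon L^2\to\mathbb{R}^{p+2}$ is the submanifold generated by the orbits of the points of $g(L)$ (disjoint from $\mathbb{R}^{p+1}$) under the subgroup $SO(n-1)$ of $SO(n+p)$ fixing $\mathbb{R}^{p+1}$ pointwise; here $p=2$ and the surface is $g=(h,\varphi)$. *)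

theory Defs
  imports "HOL-Analysis.Analysis"
begin

section \<open>Smooth maps between Euclidean spaces\<close>

text \<open>Meant for open \<open>S\<close>.\<close>

primrec Ck_on :: "nat \<Rightarrow> 'a::euclidean_space set \<Rightarrow> ('a \<Rightarrow> 'b::real_normed_vector) \<Rightarrow> bool" where
  "Ck_on 0 S f \<longleftrightarrow> continuous_on S f"
| "Ck_on (Suc k) S f \<longleftrightarrow>
     (\<forall>x\<in>S. f differentiable (at x)) \<and>
     (\<forall>v. Ck_on k S (\<lambda>x. frechet_derivative f (at x) v))"

definition smooth_on :: "'a::euclidean_space set \<Rightarrow> ('a \<Rightarrow> 'b::real_normed_vector) \<Rightarrow> bool" where
  "smooth_on S f \<longleftrightarrow> (\<forall>k. Ck_on k S f)"


section \<open>Riemannian manifolds\<close>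

text \<open>
  A Riemannian manifold with points in \<open>'a\<close>, modelled on the Euclidean space \<open>'e\<close>, is given by a
  topology (whose underlying set is the set of points) and by a family of local parametrizations
  \<open>param\<close>, each defined on an open \<open>region\<close> of \<open>'e\<close>, i.e. inverses of coordinate charts.
  Each patch carries the expression of the metric in its coordinates: \<open>metric P x u v\<close> is the inner
  product, at the point with coordinates \<open>x\<close>, of the tangent vectors with components \<open>u\<close> and \<open>v\<close>.
  Values of \<open>param\<close> and \<open>metric\<close> outside \<open>region\<close> are irrelevant.
  The dimension is \<open>DIM('e)\<close>; the atlas need not be maximal.
\<close>

record ('a, 'e) patch =
  region :: "'e set"
  param :: "'e \<Rightarrow> 'a"
  metric :: "'e \<Rightarrow> 'e \<Rightarrow> 'e \<Rightarrow> real"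

record ('a, 'e) riem =
  topo :: "'a topology"
  atlas :: "('a, 'e) patch set"

abbreviation points :: "('a, 'e) riem \<Rightarrow> 'a set" where
  "points M \<equiv> topspace (topo M)"

definition riemannian_metric_on ::
    "'e::euclidean_space set \<Rightarrow> ('e \<Rightarrow> 'e \<Rightarrow> 'e \<Rightarrow> real) \<Rightarrow> bool" where
  "riemannian_metric_on W g \<longleftrightarrow>
     (\<forall>u v. smooth_on W (\<lambda>x. g x u v)) \<and>
     (\<forall>x\<in>W. bilinear (g x) \<and> (\<forall>u v. g x u v = g x v u) \<and> (\<forall>u. u \<noteq> 0 \<longrightarrow> g x u u > 0))"

text \<open>The expression of a map \<open>f\<close> in the coordinates of two patches, and where it is defined.\<close>

definition local_dom :: "('a, 'd) patch \<Rightarrow> ('b, 'e) patch \<Rightarrow> ('a \<Rightarrow> 'b) \<Rightarrow> 'd set" where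
  "local_dom P Q f = {x \<in> region P. f (param P x) \<in> param Q ` region Q}"

definition local_rep :: "('a, 'd) patch \<Rightarrow> ('b, 'e) patch \<Rightarrow> ('a \<Rightarrow> 'b) \<Rightarrow> 'd \<Rightarrow> 'e" where
  "local_rep P Q f = inv_into (region Q) (param Q) \<circ> f \<circ> param P"

definition smooth_in_patches ::
    "('a, 'd::euclidean_space) patch \<Rightarrow> ('b, 'e::euclidean_space) patch \<Rightarrow> ('a \<Rightarrow> 'b) \<Rightarrow> bool" where
  "smooth_in_patches P Q f \<longleftrightarrow> smooth_on (local_dom P Q f) (local_rep P Q f)"

definition metric_preserving_in_patches ::
    "('a, 'd::euclidean_space) patch \<Rightarrow> ('b, 'e::euclidean_space) patch \<Rightarrow> ('a \<Rightarrow> 'b) \<Rightarrow> bool" where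
  "metric_preserving_in_patches P Q f \<longleftrightarrow>
     (\<forall>x\<in>local_dom P Q f. \<forall>u v.
        metric P x u v =
        metric Q (local_rep P Q f x)
          (frechet_derivative (local_rep P Q f) (at x) u)
          (frechet_derivative (local_rep P Q f) (at x) v))"

definition riemannian_manifold :: "('a, 'e::euclidean_space) riem \<Rightarrow> bool" where
  "riemannian_manifold M \<longleftrightarrow>
     Hausdorff_space (topo M) \<and> second_countable (topo M) \<and>
     (\<forall>P\<in>atlas M. open (region P) \<and> openin (topo M) (param P ` region P) \<and>
        embedding_map (top_of_set (region P)) (topo M) (param P) \<and>
        riemannian_metric_on (region P) (metric P)) \<and>
     (\<Union>P\<in>atlas M. param P ` region P) = points M \<and>
     (\<forall>P\<in>atlas M. \<forall>Q\<in>atlas M.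
        smooth_in_patches P Q (\<lambda>p. p) \<and> metric_preserving_in_patches P Q (\<lambda>p. p))"

definition smooth_map ::
    "('a, 'd::euclidean_space) riem \<Rightarrow> ('b, 'e::euclidean_space) riem \<Rightarrow> ('a \<Rightarrow> 'b) \<Rightarrow> bool" where
  "smooth_map M N f \<longleftrightarrow> continuous_map (topo M) (topo N) f \<and>
     (\<forall>P\<in>atlas M. \<forall>Q\<in>atlas N. smooth_in_patches P Q f)"

definition isometry ::
    "('a, 'd::euclidean_space) riem \<Rightarrow> ('b, 'e::euclidean_space) riem \<Rightarrow> ('a \<Rightarrow> 'b) \<Rightarrow> bool" where
  "isometry M N f \<longleftrightarrow> bij_betw f (points M) (points N) \<and>
     smooth_map M N f \<and> smooth_map N M (inv_into (points M) f) \<and>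
     (\<forall>P\<in>atlas M. \<forall>Q\<in>atlas N. metric_preserving_in_patches P Q f)"

definition smooth_function ::
    "('a, 'e::euclidean_space) riem \<Rightarrow> ('a \<Rightarrow> 'b::real_normed_vector) \<Rightarrow> bool" where
  "smooth_function M f \<longleftrightarrow> (\<forall>P\<in>atlas M. smooth_on (region P) (f \<circ> param P))"

definition immersion ::
    "('a, 'e::euclidean_space) riem \<Rightarrow> ('a \<Rightarrow> 'b::euclidean_space) \<Rightarrow> bool" where
  "immersion M f \<longleftrightarrow> smooth_function M f \<and>
     (\<forall>P\<in>atlas M. \<forall>x\<in>region P. inj (frechet_derivative (f \<circ> param P) (at x)))"

definition isometric_immersion ::
    "('a, 'e::euclidean_space) riem \<Rightarrow> ('a \<Rightarrow> 'b::euclidean_space) \<Rightarrow> bool" where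
  "isometric_immersion M f \<longleftrightarrow> immersion M f \<and>
     (\<forall>P\<in>atlas M. \<forall>x\<in>region P. \<forall>u v.
        frechet_derivative (f \<circ> param P) (at x) u \<bullet> frechet_derivative (f \<circ> param P) (at x) v
        = metric P x u v)"

text \<open>The open subset \<open>V\<close> of \<open>M\<close>, with the structure inherited from \<open>M\<close>.\<close>

definition open_submanifold :: "('a, 'e) riem \<Rightarrow> 'a set \<Rightarrow> ('a, 'e) riem" where
  "open_submanifold M V =
     \<lparr>topo = subtopology (topo M) V,
      atlas = (\<lambda>P. P\<lparr>region := {x \<in> region P. param P x \<in> V}\<rparr>) ` atlas M\<rparr>"


section \<open>Curvature\<close>

text \<open>
  \<open>christoffel g x u v\<close> is the value at \<open>x\<close> of the Levi-Civita derivative of \<open>V\<close> along \<open>U\<close>,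
  where \<open>U\<close>, \<open>V\<close> are the vector fields with constant components \<open>u\<close>, \<open>v\<close>; since such fields
  commute, the Koszul formula reduces to the expression below.
\<close>

definition christoffel ::
    "('e::euclidean_space \<Rightarrow> 'e \<Rightarrow> 'e \<Rightarrow> real) \<Rightarrow> 'e \<Rightarrow> 'e \<Rightarrow> 'e \<Rightarrow> 'e" where
  "christoffel g x u v = (THE z. \<forall>w. g x z w =
     (frechet_derivative (\<lambda>y. g y v w) (at x) u
      + frechet_derivative (\<lambda>y. g y u w) (at x) v
      - frechet_derivative (\<lambda>y. g y u v) (at x) w) / 2)"

text \<open>\<open>R(u,v)w = \<nabla>\<^sub>u \<nabla>\<^sub>v w - \<nabla>\<^sub>v \<nabla>\<^sub>u w\<close> for fields with constant components.\<close>

definition curvature_tensor ::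
    "('e::euclidean_space \<Rightarrow> 'e \<Rightarrow> 'e \<Rightarrow> real) \<Rightarrow> 'e \<Rightarrow> 'e \<Rightarrow> 'e \<Rightarrow> 'e \<Rightarrow> 'e" where
  "curvature_tensor g x u v w =
     (frechet_derivative (\<lambda>y. christoffel g y v w) (at x) u
        + christoffel g x u (christoffel g x v w))
     - (frechet_derivative (\<lambda>y. christoffel g y u w) (at x) v
        + christoffel g x v (christoffel g x u w))"

definition sectional_curvature ::
    "('e::euclidean_space \<Rightarrow> 'e \<Rightarrow> 'e \<Rightarrow> real) \<Rightarrow> 'e \<Rightarrow> 'e \<Rightarrow> 'e \<Rightarrow> real" where
  "sectional_curvature g x u v =
     g x (curvature_tensor g x u v v) u / (g x u u * g x v v - (g x u v)\<^sup>2)"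

text \<open>The trace of \<open>u \<mapsto> R(u,v)w\<close>; a trace may be computed in any basis of \<open>'e\<close>.\<close>

definition ricci ::
    "('e::euclidean_space \<Rightarrow> 'e \<Rightarrow> 'e \<Rightarrow> real) \<Rightarrow> 'e \<Rightarrow> 'e \<Rightarrow> 'e \<Rightarrow> real" where
  "ricci g x v w = (\<Sum>b\<in>Basis. curvature_tensor g x b v w \<bullet> b)"

definition einstein :: "('a, 'e::euclidean_space) riem \<Rightarrow> real \<Rightarrow> bool" where
  "einstein M \<rho> \<longleftrightarrow>
     (\<forall>P\<in>atlas M. \<forall>x\<in>region P. \<forall>v w. ricci (metric P) x v w = \<rho> * metric P x v w)"

definition constant_sectional_curvature :: "('a, 'e::euclidean_space) riem \<Rightarrow> bool" where
  "constant_sectional_curvature M \<longleftrightarrow>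
     (\<exists>\<kappa>. \<forall>P\<in>atlas M. \<forall>x\<in>region P. \<forall>u v.
        u \<noteq> v \<longrightarrow> independent {u, v} \<longrightarrow> sectional_curvature (metric P) x u v = \<kappa>)"


section \<open>Particular manifolds\<close>

text \<open>The product \<open>L \<times> F\<close> with the metric \<open>g\<^sub>L + \<phi>\<^sup>2 g\<^sub>F\<close>.\<close>

definition warped_product ::
    "('a, 'd) riem \<Rightarrow> ('a \<Rightarrow> real) \<Rightarrow> ('b, 'e) riem \<Rightarrow> ('a \<times> 'b, 'd \<times> 'e) riem" where
  "warped_product L \<phi> F =
     \<lparr>topo = prod_topology (topo L) (topo F),
      atlas = {\<lparr>region = region P \<times> region Q,
                param = (\<lambda>(x, y). (param P x, param Q y)),
                metric = (\<lambda>(x, y) (u1, u2) (v1, v2).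
                  metric P x u1 v1 + (\<phi> (param P x))\<^sup>2 * metric Q y u2 v2)\<rparr>
              | P Q. P \<in> atlas L \<and> Q \<in> atlas F}\<rparr>"

text \<open>The open set \<open>U\<close> of the \<open>(t,u)\<close>-plane with the metric \<open>a(t) dt\<^sup>2 + b(t) du\<^sup>2\<close>.\<close>

definition plane_domain ::
    "(real \<times> real) set \<Rightarrow> (real \<Rightarrow> real) \<Rightarrow> (real \<Rightarrow> real) \<Rightarrow> (real \<times> real, real \<times> real) riem" where
  "plane_domain U a b =
     \<lparr>topo = top_of_set U,
      atlas = {\<lparr>region = U, param = (\<lambda>x. x),
                metric = (\<lambda>(t, u) (v1, v2) (w1, w2). a t * v1 * w1 + b t * v2 * w2)\<rparr>}\<rparr>"

text \<open>
  The unit sphere of \<open>real ^ 'k\<close> with the induced metric; the atlas consists of all its regular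
  smooth parametrizations. It is a manifold modelled on \<open>'e\<close> if \<open>DIM('e) + 1 = CARD('k)\<close>.
\<close>

definition unit_sphere :: "(real ^ 'k, 'e::euclidean_space) riem" where
  "unit_sphere =
     \<lparr>topo = top_of_set (sphere 0 1),
      atlas = {\<lparr>region = W, param = \<sigma>,
                metric = (\<lambda>x u v. frechet_derivative \<sigma> (at x) u \<bullet> frechet_derivative \<sigma> (at x) v)\<rparr>
              | W \<sigma>. open W \<and> smooth_on W \<sigma> \<and>
                  openin (top_of_set (sphere 0 1)) (\<sigma> ` W) \<and>
                  embedding_map (top_of_set W) (top_of_set (sphere 0 1)) \<sigma> \<and>
                  (\<forall>x\<in>W. inj (frechet_derivative \<sigma> (at x)))}\<rparr>"


section \<open>Rotational submanifolds\<close>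

definition rigid_motion :: "('a::euclidean_space \<Rightarrow> 'a) \<Rightarrow> bool" where
  "rigid_motion T \<longleftrightarrow> (\<exists>A b. orthogonal_transformation A \<and> T = (\<lambda>x. A x + b))"

text \<open>The special orthogonal maps of \<open>'z \<times> (real ^ 'k)\<close> that fix the axis \<open>'z \<times> {0}\<close> pointwise.\<close>

definition axis_rotations :: "('z \<times> (real ^ 'k) \<Rightarrow> 'z \<times> (real ^ 'k)) set" where
  "axis_rotations = {\<lambda>(z, y). (z, A *v y) | A. rotation_matrix A}"

text \<open>
  \<open>f\<close> immerses \<open>M\<close> into the union of the orbits, under the rotations fixing \<open>'z \<times> {0}\<close>, of the
  points of the surface \<open>g\<close>. The space \<open>'z \<times> real\<close> containing the surface is viewed inside
  \<open>'z \<times> (real ^ 'k)\<close> as the span of the axis and of a unit vector \<open>e\<close> orthogonal to it.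
\<close>

definition rotational_submanifold ::
    "('a, 'd::euclidean_space) riem \<Rightarrow> ('a \<Rightarrow> 'z::euclidean_space \<times> (real ^ 'k)) \<Rightarrow>
     ('s, 'e::euclidean_space) riem \<Rightarrow> ('s \<Rightarrow> 'z \<times> real) \<Rightarrow> bool" where
  "rotational_submanifold M f L g \<longleftrightarrow>
     immersion M f \<and> immersion L g \<and> (\<forall>x\<in>points L. snd (g x) \<noteq> 0) \<and>
     (\<exists>e. norm e = 1 \<and>
        f ` points M \<subseteq>
          {R (fst (g x), snd (g x) *\<^sub>R e) | R x. R \<in> axis_rotations \<and> x \<in> points L})"

end

theory Submission
  imports Defs
begin

text \<open>
  On a product chart, the Einstein equation forces the Hessian of \<open>\<phi>\<close> to be a multiple of the metric
  of the surface, and then \<open>(\<bar>\<nabla>\<phi>\<bar>\<^sup>2 + \<rho>/(n-1) \<phi>\<^sup>2 - \<epsilon>) \<phi>\<^bsup>n-3\<^esup>\<close> is a constant \<open>C\<close>, which is the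
  differential equation of the profile function. If \<open>C = 0\<close> the chart has constant sectional curvature.
  Otherwise, near a suitable point of any open set, the curvatures of the horizontal, mixed and
  vertical planes are generic. As the fibers have dimension at least 3 and the codimension is 2, the
  Gauss equation then shows that the mixed part of the second fundamental form vanishes and that the
  vertical part is umbilical. Therefore \<open>\<epsilon> = 1\<close> and \<open>f (x, y) = h x + \<phi> x \<cdot> \<sigma> y\<close>, with \<open>\<sigma>\<close> a
  parametrization of a unit sphere whose span is orthogonal to the image of \<open>dh\<close>. The arc length of
  the gradient curves of \<open>\<phi>\<close> and a conjugate coordinate bring \<open>h\<close> and the metric of the surface into the
  stated form. A maximal disjoint family of such neighbourhoods has a dense union.
\<close>

section \<open>Calculus of smooth maps\<close>

text \<open>Let m be the dimension of the fiber, k = rho / (m + 1) and s = \<open>C\<close> / w^(m +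
  1). The horizontal, mixed and vertical curvatures turn out to be k - m (m - 1) s / 2, k + (m - 1)
  s / 2 and k - s. So \<open>C\<close> = 0 makes them all equal to k. If \<open>C\<close> is not 0,
  then s is injective in w, and each failure of genericity (vertical = 0, mixed = 0, horizontal *
  vertical = mixed^2) happens for at most one value of w, which a nonconstant w can avoid. These
  three conditions are what the algebra uses: the second fundamental form has values in a plane, a
  nonzero mixed part would have a kernel because the fiber has dimension greater than 2, and the
  Gauss equation would then force horizontal * vertical = mixed^2. That \<epsilon> = 1 comes from a
  sign: the normal vector of the vertical part has squared norm w^2 (\<epsilon> - q) with q > 0.
  Derivatives of the metric are kept with lowered indices; raising an index means solving a linear
  system with smooth coefficients, so no inverse matrix is differentiated.\<close>

abbreviation dd :: "'a::euclidean_space \<Rightarrow> ('a \<Rightarrow> 'b::real_normed_vector) \<Rightarrow> 'a \<Rightarrow> 'b" where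
  "dd v f x \<equiv> frechet_derivative f (at x) v"

text \<open>Equality holds also at points where neither derivative exists: the functions agree near
  \<open>x\<close>, so the same maps are derivatives of both, and \<open>frechet_derivative\<close>
  chooses from the same set.\<close>

lemma dd_cong:
  assumes "open S" "x \<in> S" "\<And>y. y \<in> S \<Longrightarrow> f y = g y"
  shows "frechet_derivative f (at x) = frechet_derivative g (at x)"
proof -
  have "(f has_derivative D) (at x) \<longleftrightarrow> (g has_derivative D) (at x)" for D
    using has_derivative_transform_within_open[of f D x UNIV S g]
      has_derivative_transform_within_open[of g D x UNIV S f] assms by auto
  then show ?thesis unfolding frechet_derivative_def by simp
qed

lemma dd_eqI: "(f has_derivative D) (at x) \<Longrightarrow> dd v f x = D v"
  by (metis frechet_derivative_at)

lemma dd_derivative: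
  assumes "f differentiable (at x)"
  shows "(f has_derivative (\<lambda>v. dd v f x)) (at x)"
  using assms frechet_derivative_works by metis

lemma linear_dd:
  assumes "f differentiable (at x)"
  shows "linear (\<lambda>v. dd v f x)"
  using dd_derivative[OF assms] has_derivative_linear by blast

section \<open>Closure properties of C^k and smooth maps\<close>

lemma Ck_on_cong:
  assumes "open S"
  shows "(\<And>x. x \<in> S \<Longrightarrow> f x = g x) \<Longrightarrow> Ck_on k S f \<longleftrightarrow> Ck_on k S g"
proof (induction k arbitrary: f g)
  case 0 then show ?case by (simp cong: continuous_on_cong)
next
  case (Suc k)
  have "f differentiable (at x) \<longleftrightarrow> g differentiable (at x)" if "x \<in> S" for x
    using has_derivative_transform_within_open[of f _ x UNIV S g]
      has_derivative_transform_within_open[of g _ x UNIV S f] assms that Suc.prems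
    unfolding differentiable_def by metis
  moreover have "Ck_on k S (dd v f) \<longleftrightarrow> Ck_on k S (dd v g)" for v
    by (rule Suc.IH) (metis dd_cong[OF assms] Suc.prems)
  ultimately show ?case by auto
qed

lemma smooth_on_cong:
  "open S \<Longrightarrow> (\<And>x. x \<in> S \<Longrightarrow> f x = g x) \<Longrightarrow> smooth_on S f \<longleftrightarrow> smooth_on S g"
  unfolding smooth_on_def using Ck_on_cong by blast

text \<open>\<open>Ck_on\<close> is phrased with \<open>frechet_derivative\<close>. This rule trades
  it for an explicit family \<open>D\<close>, and most closure properties below use it for the
  induction step on \<open>k\<close>.\<close>

lemma Ck_on_SucI:
  assumes "open S" "\<And>x. x \<in> S \<Longrightarrow> (f has_derivative (\<lambda>v. D v x)) (at x)" "\<And>v. Ck_on k S (D v)"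
  shows "Ck_on (Suc k) S f"
proof -
  have "Ck_on k S (dd v f) \<longleftrightarrow> Ck_on k S (D v)" for v
    by (rule Ck_on_cong[OF assms(1)]) (rule dd_eqI[OF assms(2)])
  then show ?thesis using assms by (auto simp: differentiable_def)
qed

lemma Ck_on_SucD: "Ck_on (Suc k) S f \<Longrightarrow> Ck_on k S f"
proof (induction k arbitrary: f)
  case 0
  then show ?case
    by (meson Ck_on.simps differentiable_imp_continuous_within continuous_at_imp_continuous_on)
next
  case (Suc k)
  then show ?case by (metis Ck_on.simps(2))
qed

lemma Ck_on_subset: "Ck_on k S f \<Longrightarrow> T \<subseteq> S \<Longrightarrow> Ck_on k T f"
  by (induction k arbitrary: f) (auto intro: continuous_on_subset)

lemma Ck_on_const [simp]: "Ck_on k S (\<lambda>x. c)"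
  by (induction k arbitrary: c) auto

lemma Ck_on_bounded_linear:
  assumes "bounded_linear A"
  shows "open S \<Longrightarrow> Ck_on k S f \<Longrightarrow> Ck_on k S (\<lambda>x. A (f x))"
proof (induction k arbitrary: f)
  case 0
  then show ?case using assms linear_continuous_on continuous_on_compose2
    by (metis Ck_on.simps(1) bounded_linear.continuous_on)
next
  case (Suc k)
  have d: "((\<lambda>x. A (f x)) has_derivative (\<lambda>v. A (dd v f x))) (at x)" if "x \<in> S" for x
    using bounded_linear.has_derivative[OF assms dd_derivative] Suc.prems that by auto
  show ?case
    by (rule Ck_on_SucI[OF Suc.prems(1) d]) (use Suc in auto)
qed

lemma Ck_on_id: "Ck_on k S (\<lambda>x. x)"
proof (cases k)
  case (Suc j)
  have "dd v (\<lambda>x. x) = (\<lambda>x. v)" for v :: 'a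
    by (rule ext) (rule dd_eqI, rule has_derivative_ident)
  then show ?thesis using Suc by simp
qed simp

lemma Ck_on_add:
  "open S \<Longrightarrow> Ck_on k S f \<Longrightarrow> Ck_on k S g \<Longrightarrow> Ck_on k S (\<lambda>x. f x + g x)"
proof (induction k arbitrary: f g)
  case (Suc k)
  have d: "((\<lambda>x. f x + g x) has_derivative (\<lambda>v. dd v f x + dd v g x)) (at x)" if "x \<in> S" for x
    using Suc.prems that by (auto intro!: has_derivative_add dd_derivative)
  show ?case
    by (rule Ck_on_SucI[OF Suc.prems(1) d]) (use Suc in auto)
qed (auto intro: continuous_intros)

lemma Ck_on_bounded_bilinear:
  assumes "bounded_bilinear B"
  shows "open S \<Longrightarrow> Ck_on k S f \<Longrightarrow> Ck_on k S g \<Longrightarrow> Ck_on k S (\<lambda>x. B (f x) (g x))"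
proof (induction k arbitrary: f g)
  case (Suc k)
  have d: "((\<lambda>x. B (f x) (g x)) has_derivative (\<lambda>v. B (f x) (dd v g x) + B (dd v f x) (g x))) (at x)"
    if "x \<in> S" for x
    using Suc.prems that by (auto intro!: bounded_bilinear.FDERIV[OF assms] dd_derivative)
  show ?case
    by (rule Ck_on_SucI[OF Suc.prems(1) d], assumption, intro Ck_on_add Suc.IH)
      (use Suc Ck_on_SucD[of k S f] Ck_on_SucD[of k S g] in auto)
qed (auto intro: bounded_bilinear.continuous_on[OF assms])

lemma Ck_on_sum:
  "open S \<Longrightarrow> (\<And>i. i \<in> I \<Longrightarrow> Ck_on k S (f i)) \<Longrightarrow> Ck_on k S (\<lambda>x. \<Sum>i\<in>I. f i x)"
  by (induction I rule: infinite_finite_induct) (auto intro: Ck_on_add)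

lemma dd_compose:
  assumes "f differentiable (at x)" "g differentiable (at (f x))"
  shows "dd v (\<lambda>x. g (f x)) x = dd (dd v f x) g (f x)"
    and "(\<lambda>x. g (f x)) differentiable (at x)"
proof -
  have "((\<lambda>x. g (f x)) has_derivative (\<lambda>v. dd (dd v f x) g (f x))) (at x)"
    using diff_chain_at[OF dd_derivative[OF assms(1)] dd_derivative[OF assms(2)]]
    by (simp add: o_def)
  then show "dd v (\<lambda>x. g (f x)) x = dd (dd v f x) g (f x)"
    "(\<lambda>x. g (f x)) differentiable (at x)"
    by (auto simp: dd_eqI differentiable_def)
qed

lemma linear_sum_Basis:
  fixes A :: "'a::euclidean_space \<Rightarrow> 'b::real_vector"
  assumes "linear A"
  shows "A y = (\<Sum>b\<in>Basis. (y \<bullet> b) *\<^sub>R A b)"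
  by (metis (no_types, lifting) assms euclidean_representation linear_sum linear_scale sum.cong)

text \<open>The chain rule differentiates \<open>g\<close> in a direction that depends on
  \<open>x\<close>, to which the induction hypothesis does not apply. Expanding this direction in
  \<open>Basis\<close> leaves scalar functions times derivatives of \<open>g\<close> in fixed
  directions.\<close>

lemma Ck_on_compose:
  assumes "open S" "open T" "f ` S \<subseteq> T"
  shows "Ck_on k S f \<Longrightarrow> Ck_on k T g \<Longrightarrow> Ck_on k S (\<lambda>x. g (f x))"
proof (induction k arbitrary: g)
  case 0
  then show ?case using assms by (auto intro: continuous_on_compose2)
next
  case (Suc k)
  have d: "dd v (\<lambda>x. g (f x)) x = (\<Sum>b\<in>Basis. (dd v f x \<bullet> b) *\<^sub>R dd b g (f x))"
    "(\<lambda>x. g (f x)) differentiable (at x)" if "x \<in> S" for x v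
  proof -
    have gd: "g differentiable (at (f x))" using Suc.prems that assms by auto
    show "dd v (\<lambda>x. g (f x)) x = (\<Sum>b\<in>Basis. (dd v f x \<bullet> b) *\<^sub>R dd b g (f x))"
      using dd_compose(1)[of f x g v, OF _ gd] linear_sum_Basis[OF linear_dd[OF gd], of "dd v f x"]
        Suc.prems(1) that by simp
    show "(\<lambda>x. g (f x)) differentiable (at x)"
      using dd_compose(2)[of f x g] Suc.prems that gd by auto
  qed
  have "Ck_on k S (\<lambda>x. \<Sum>b\<in>Basis. (dd v f x \<bullet> b) *\<^sub>R dd b g (f x))" for v
  proof (intro Ck_on_sum Ck_on_bounded_bilinear[OF bounded_bilinear_scaleR] assms)
    show "Ck_on k S (\<lambda>x. dd v f x \<bullet> b)" for b
      using Suc.prems by (auto intro!: Ck_on_bounded_linear[OF bounded_linear_inner_left] assms)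
    show "Ck_on k S (\<lambda>x. dd b g (f x))" for b
      using Suc.prems Ck_on_SucD[of k S f] by (intro Suc.IH) auto
  qed
  then have "Ck_on k S (dd v (\<lambda>x. g (f x)))" for v
    by (subst Ck_on_cong[OF assms(1) d(1)]) auto
  then show ?case using d(2) by auto
qed

lemma smooth_onD: "smooth_on S f \<Longrightarrow> x \<in> S \<Longrightarrow> f differentiable (at x)"
  unfolding smooth_on_def by (metis Ck_on.simps(2))

lemma smooth_on_dd: "smooth_on S f \<Longrightarrow> smooth_on S (dd v f)"
  unfolding smooth_on_def by (metis Ck_on.simps(2))

lemma smooth_onI:
  "(\<And>x. x \<in> S \<Longrightarrow> f differentiable (at x)) \<Longrightarrow> (\<And>v. smooth_on S (dd v f)) \<Longrightarrow> smooth_on S f"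
  unfolding smooth_on_def by (metis Ck_on.simps(2) Ck_on_SucD)

lemma smooth_on_continuous: "smooth_on S f \<Longrightarrow> continuous_on S f"
  unfolding smooth_on_def by (metis Ck_on.simps(1))

lemma smooth_on_subset: "smooth_on S f \<Longrightarrow> T \<subseteq> S \<Longrightarrow> smooth_on T f"
  unfolding smooth_on_def using Ck_on_subset by blast

lemma smooth_on_empty [simp]: "smooth_on {} f"
  unfolding smooth_on_def
proof
  show "Ck_on k {} f" for k by (induction k arbitrary: f) auto
qed

named_theorems smooth_intros

lemma smooth_on_const [smooth_intros]: "smooth_on S (\<lambda>x. c)"
  and smooth_on_id [smooth_intros]: "smooth_on S (\<lambda>x. x)"
  and smooth_on_add [smooth_intros]:
    "open S \<Longrightarrow> smooth_on S f \<Longrightarrow> smooth_on S g \<Longrightarrow> smooth_on S (\<lambda>x. f x + g x)"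
  and smooth_on_sum [smooth_intros]:
    "open S \<Longrightarrow> (\<And>i. i \<in> I \<Longrightarrow> smooth_on S (h i)) \<Longrightarrow> smooth_on S (\<lambda>x. \<Sum>i\<in>I. h i x)"
  and smooth_on_bounded_linear:
    "bounded_linear A \<Longrightarrow> open S \<Longrightarrow> smooth_on S f \<Longrightarrow> smooth_on S (\<lambda>x. A (f x))"
  and smooth_on_bounded_bilinear:
    "bounded_bilinear B \<Longrightarrow> open S \<Longrightarrow> smooth_on S u \<Longrightarrow> smooth_on S v
      \<Longrightarrow> smooth_on S (\<lambda>x. B (u x) (v x))"
  unfolding smooth_on_def
  by (auto intro: Ck_on_id Ck_on_add Ck_on_sum Ck_on_bounded_linear Ck_on_bounded_bilinear)

lemma smooth_on_compose:
  "smooth_on T g \<Longrightarrow> smooth_on S f \<Longrightarrow> open S \<Longrightarrow> open T \<Longrightarrow> f ` S \<subseteq> T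
    \<Longrightarrow> smooth_on S (\<lambda>x. g (f x))"
  unfolding smooth_on_def using Ck_on_compose by blast

lemmas smooth_on_scaleR [smooth_intros] = smooth_on_bounded_bilinear[OF bounded_bilinear_scaleR]
lemmas smooth_on_inner [smooth_intros] = smooth_on_bounded_bilinear[OF bounded_bilinear_inner]
lemmas smooth_on_mult [smooth_intros] =
  smooth_on_bounded_bilinear[OF bounded_bilinear_mult[where 'a=real]]
lemmas smooth_on_fst [smooth_intros] = smooth_on_bounded_linear[OF bounded_linear_fst]
lemmas smooth_on_snd [smooth_intros] = smooth_on_bounded_linear[OF bounded_linear_snd]

lemma smooth_on_minus [smooth_intros]:
  "open S \<Longrightarrow> smooth_on S f \<Longrightarrow> smooth_on S (\<lambda>x. - f x)"
  by (rule smooth_on_bounded_linear[OF bounded_linear_minus[OF bounded_linear_ident]])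

lemma smooth_on_diff [smooth_intros]:
  "open S \<Longrightarrow> smooth_on S f \<Longrightarrow> smooth_on S g \<Longrightarrow> smooth_on S (\<lambda>x. f x - g x)"
  using smooth_on_add[of S f "\<lambda>x. - g x"] smooth_on_minus[of S g] by simp

lemma smooth_on_power [smooth_intros]:
  "open S \<Longrightarrow> smooth_on S f \<Longrightarrow> smooth_on S (\<lambda>x. (f x :: real) ^ n)"
  by (induction n) (auto intro: smooth_intros)

lemma smooth_on_Pair [smooth_intros]:
  fixes f :: "'c::euclidean_space \<Rightarrow> 'a::real_normed_vector" and g :: "'c \<Rightarrow> 'b::real_normed_vector"
  assumes "open S" "smooth_on S f" "smooth_on S g"
  shows "smooth_on S (\<lambda>x. (f x, g x))"
proof -
  have "bounded_linear (\<lambda>y::'a. (y, 0 :: 'b))" "bounded_linear (\<lambda>y::'b. (0 :: 'a, y))"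
    by (auto intro!: bounded_linear_Pair bounded_linear_ident bounded_linear_zero)
  then have "smooth_on S (\<lambda>x. (f x, 0 :: 'b))" "smooth_on S (\<lambda>x. (0 :: 'a, g x))"
    using smooth_on_bounded_linear[of "\<lambda>y. (y, 0)" S f] smooth_on_bounded_linear[of "\<lambda>y. (0, y)" S g]
      assms by auto
  from smooth_on_add[OF assms(1) this] show ?thesis by simp
qed

text \<open>The derivative -(1/x)^2 is built from \<open>inverse\<close> itself, so the order of
  differentiability can be raised one step at a time.\<close>

lemma smooth_on_inverse_real: "smooth_on {0<..} (inverse :: real \<Rightarrow> real)"
proof -
  have d: "(inverse has_derivative (\<lambda>v. - (inverse x * inverse x) * v)) (at x)" if "x > 0" for x :: real
  proof -
    have "(inverse has_real_derivative - (inverse x * inverse x)) (at x)"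
      using DERIV_inverse[of x UNIV] that by (simp add: power2_eq_square)
    then show ?thesis unfolding has_field_derivative_def by (simp only: fun_eq_iff)
  qed
  have "Ck_on k {0<..} (inverse :: real \<Rightarrow> real)" for k
  proof (induction k)
    case 0 show ?case by (auto intro!: continuous_intros)
  next
    case (Suc k)
    show ?case
      by (rule Ck_on_SucI[OF open_greaterThan d])
        (auto intro!: Ck_on_bounded_bilinear[OF bounded_bilinear_mult] Suc Ck_on_const
          Ck_on_bounded_linear[OF bounded_linear_minus[OF bounded_linear_ident]])
  qed
  then show ?thesis by (simp add: smooth_on_def)
qed

lemma smooth_on_inverse [smooth_intros]:
  fixes f :: "'a::euclidean_space \<Rightarrow> real"
  assumes "open S" "smooth_on S f" "\<And>x. x \<in> S \<Longrightarrow> f x > 0"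
  shows "smooth_on S (\<lambda>x. inverse (f x))"
  using assms by (intro smooth_on_compose[OF smooth_on_inverse_real]) auto

lemma smooth_on_divide [smooth_intros]:
  fixes f :: "'a::euclidean_space \<Rightarrow> real"
  assumes "open S" "smooth_on S g" "smooth_on S f" "\<And>x. x \<in> S \<Longrightarrow> f x > 0"
  shows "smooth_on S (\<lambda>x. g x / f x)"
  unfolding divide_inverse using assms by (intro smooth_intros)

text \<open>Again the derivative, 1 / (2 sqrt x), is built from the function itself; at each stage
  the induction hypothesis is composed with \<open>inverse\<close>.\<close>

lemma smooth_on_sqrt_real: "smooth_on {0<..} sqrt"
proof -
  have d: "(sqrt has_derivative (\<lambda>v. inverse (2 * sqrt x) * v)) (at x)" if "x > 0" for x :: real
    using DERIV_real_sqrt[OF that]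
    unfolding has_field_derivative_def by (rule has_derivative_eq_rhs) (auto simp: field_simps)
  have "Ck_on k {0<..} sqrt" for k
  proof (induction k)
    case 0 show ?case by (auto intro!: continuous_intros)
  next
    case (Suc k)
    have "Ck_on k {0<..} (\<lambda>x::real. 2 * sqrt x)"
      by (intro Ck_on_bounded_bilinear[OF bounded_bilinear_mult] Suc Ck_on_const open_greaterThan)
    then have "Ck_on k {0<..} (\<lambda>x::real. inverse (2 * sqrt x))"
      using Ck_on_compose[OF open_greaterThan open_greaterThan,
          of "\<lambda>x::real. 2 * sqrt x" 0 0 k inverse] smooth_on_inverse_real
      unfolding smooth_on_def by fastforce
    then have "Ck_on k {0<..} (\<lambda>x::real. inverse (2 * sqrt x) * v)" for v
      by (intro Ck_on_bounded_bilinear[OF bounded_bilinear_mult] Ck_on_const open_greaterThan)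
    then show ?case
      by (intro Ck_on_SucI[OF open_greaterThan d]) auto
  qed
  then show ?thesis by (simp add: smooth_on_def)
qed

lemma smooth_on_sqrt [smooth_intros]:
  fixes f :: "'a::euclidean_space \<Rightarrow> real"
  assumes "open S" "smooth_on S f" "\<And>x. x \<in> S \<Longrightarrow> f x > 0"
  shows "smooth_on S (\<lambda>x. sqrt (f x))"
  using assms by (intro smooth_on_compose[OF smooth_on_sqrt_real]) auto

section \<open>Rules for directional derivatives\<close>

lemma dd_bounded_linear:
  assumes "bounded_linear A" "f differentiable (at x)"
  shows "dd v (\<lambda>x. A (f x)) x = A (dd v f x)"
  by (rule dd_eqI) (rule bounded_linear.has_derivative[OF assms(1) dd_derivative[OF assms(2)]])

lemma dd_bounded_bilinear:
  assumes "bounded_bilinear B" "f differentiable (at x)" "g differentiable (at x)"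
  shows "dd v (\<lambda>x. B (f x) (g x)) x = B (f x) (dd v g x) + B (dd v f x) (g x)"
  by (rule dd_eqI) (rule bounded_bilinear.FDERIV[OF assms(1) dd_derivative dd_derivative]; fact)

lemma dd_const [simp]: "dd v (\<lambda>x. c) x = 0"
  by simp

lemma dd_add:
  "f differentiable (at x) \<Longrightarrow> g differentiable (at x)
    \<Longrightarrow> dd v (\<lambda>x. f x + g x) x = dd v f x + dd v g x"
  by (rule dd_eqI) (intro has_derivative_add dd_derivative)

lemma dd_diff:
  "f differentiable (at x) \<Longrightarrow> g differentiable (at x)
    \<Longrightarrow> dd v (\<lambda>x. f x - g x) x = dd v f x - dd v g x"
  by (rule dd_eqI) (intro has_derivative_diff dd_derivative)

lemma dd_uminus: "f differentiable (at x) \<Longrightarrow> dd v (\<lambda>x. - f x) x = - dd v f x"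
  by (rule dd_eqI) (intro has_derivative_minus dd_derivative)

lemmas dd_inner = dd_bounded_bilinear[OF bounded_bilinear_inner]
lemmas dd_scaleR = dd_bounded_bilinear[OF bounded_bilinear_scaleR]
lemmas dd_mult = dd_bounded_bilinear[OF bounded_bilinear_mult[where 'a=real]]

lemma differentiable_fst:
  fixes x :: "'a::euclidean_space \<times> 'b::euclidean_space" and f :: "'a \<Rightarrow> 'c::real_normed_vector"
  shows "f differentiable (at (fst x)) \<Longrightarrow> (\<lambda>x. f (fst x)) differentiable (at x)"
  by (rule dd_compose(2)[where f=fst])
    (simp_all add: bounded_linear_imp_differentiable bounded_linear_fst)

lemma differentiable_snd:
  fixes x :: "'a::euclidean_space \<times> 'b::euclidean_space" and f :: "'b \<Rightarrow> 'c::real_normed_vector"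
  shows "f differentiable (at (snd x)) \<Longrightarrow> (\<lambda>x. f (snd x)) differentiable (at x)"
  by (rule dd_compose(2)[where f=snd])
    (simp_all add: bounded_linear_imp_differentiable bounded_linear_snd)

lemma dd_fst:
  "f differentiable (at (fst x)) \<Longrightarrow> dd v (\<lambda>x. f (fst x)) x = dd (fst v) f (fst x)"
  by (rule dd_eqI) (rule has_derivative_compose[where f=fst]; auto intro!: derivative_eq_intros dd_derivative)

lemma dd_snd:
  "f differentiable (at (snd x)) \<Longrightarrow> dd v (\<lambda>x. f (snd x)) x = dd (snd v) f (snd x)"
  by (rule dd_eqI) (rule has_derivative_compose[where f=snd]; auto intro!: derivative_eq_intros dd_derivative)

lemma smooth_on_comp_fst [smooth_intros]:
  "smooth_on S f \<Longrightarrow> open S \<Longrightarrow> open T \<Longrightarrow> smooth_on (S \<times> T) (\<lambda>x. f (fst x))"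
  by (rule smooth_on_compose) (auto intro: smooth_intros open_Times)

lemma smooth_on_comp_snd [smooth_intros]:
  "smooth_on T f \<Longrightarrow> open S \<Longrightarrow> open T \<Longrightarrow> smooth_on (S \<times> T) (\<lambda>x. f (snd x))"
  by (rule smooth_on_compose) (auto intro: smooth_intros open_Times)

lemma dd_zero_const:
  fixes f :: "'a::euclidean_space \<Rightarrow> 'b::real_normed_vector"
  assumes "convex S" "open S" "\<And>x. x \<in> S \<Longrightarrow> f differentiable (at x)"
    "\<And>x v. x \<in> S \<Longrightarrow> dd v f x = 0"
    and xy: "x \<in> S" "y \<in> S"
  shows "f x = f y"
proof -
  have "(f has_derivative (\<lambda>v. 0)) (at z within S)" if "z \<in> S" for z
    using dd_derivative[OF assms(3)[OF that]] assms(4)[OF that] has_derivative_at_withinI by fastforce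
  then obtain c where "\<And>x. x \<in> S \<Longrightarrow> f x = c"
    using has_derivative_zero_constant[OF assms(1), of f] by metis
  then show ?thesis using xy by simp
qed

lemma Ck_on_eq_on:
  "open S \<Longrightarrow> Ck_on k S g \<Longrightarrow> (\<And>x. x \<in> S \<Longrightarrow> f x = g x) \<Longrightarrow> Ck_on k S f"
  using Ck_on_cong by metis

lemma smooth_on_eq_on:
  "open S \<Longrightarrow> smooth_on S g \<Longrightarrow> (\<And>x. x \<in> S \<Longrightarrow> f x = g x) \<Longrightarrow> smooth_on S f"
  using smooth_on_cong by metis

lemma differentiable_eq_on:
  assumes "open S" "x \<in> S" "g differentiable (at x)" "\<And>x. x \<in> S \<Longrightarrow> f x = g x"
  shows "f differentiable (at x)"
  using has_derivative_transform_within_open[of g _ x UNIV S f] assms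
  unfolding differentiable_def by auto

lemma dd_eq_on:
  "open S \<Longrightarrow> x \<in> S \<Longrightarrow> (\<And>y. y \<in> S \<Longrightarrow> f y = g y) \<Longrightarrow> dd v f x = dd v g x"
  using dd_cong by metis

section \<open>Symmetry of second derivatives\<close>

lemma has_real_derivative_line:
  fixes f :: "'a::euclidean_space \<Rightarrow> real"
  assumes "f differentiable (at (x + s *\<^sub>R u))"
  shows "((\<lambda>s. f (x + s *\<^sub>R u)) has_real_derivative dd u f (x + s *\<^sub>R u)) (at s)"
proof -
  have "((\<lambda>s. f (x + s *\<^sub>R u)) has_derivative (\<lambda>r. dd (r *\<^sub>R u) f (x + s *\<^sub>R u))) (at s)"
    by (rule has_derivative_compose[where f="\<lambda>s. x + s *\<^sub>R u" and g=f,
        OF _ dd_derivative[OF assms]]) (auto intro!: derivative_eq_intros)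
  moreover have "(\<lambda>r. dd (r *\<^sub>R u) f (x + s *\<^sub>R u)) = (*) (dd u f (x + s *\<^sub>R u))"
    using linear_scale[OF linear_dd[OF assms], of _ u] by (auto simp: mult.commute)
  ultimately show ?thesis by (simp add: has_field_derivative_def)
qed

text \<open>The mean value theorem is applied along \<open>u\<close> and then along
  \<open>v\<close>. The second difference on the left is symmetric in \<open>u\<close> and
  \<open>v\<close>, which is what \<open>dd_commute_real\<close> exploits.\<close>

lemma second_difference_mvt:
  fixes f :: "'a::euclidean_space \<Rightarrow> real"
  assumes h: "h > 0" and S: "\<And>s t. 0 \<le> s \<Longrightarrow> s \<le> h \<Longrightarrow> 0 \<le> t \<Longrightarrow> t \<le> h \<Longrightarrow> x + s *\<^sub>R u + t *\<^sub>R v \<in> S"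
    and f: "smooth_on S f"
  obtains s t where "0 \<le> s" "s \<le> h" "0 \<le> t" "t \<le> h"
    "f (x + h *\<^sub>R u + h *\<^sub>R v) - f (x + h *\<^sub>R u) - (f (x + h *\<^sub>R v) - f x)
      = h * (h * dd v (dd u f) (x + s *\<^sub>R u + t *\<^sub>R v))"
proof -
  have d: "((\<lambda>s. f (x + s *\<^sub>R u + h *\<^sub>R v) - f (x + s *\<^sub>R u)) has_real_derivative
      dd u f (x + s *\<^sub>R u + h *\<^sub>R v) - dd u f (x + s *\<^sub>R u)) (at s)" if "0 \<le> s" "s \<le> h" for s
  proof (intro DERIV_diff)
    show "((\<lambda>s. f (x + s *\<^sub>R u)) has_real_derivative dd u f (x + s *\<^sub>R u)) (at s)"
      using S[of s 0] that h by (intro has_real_derivative_line smooth_onD[OF f]) auto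
    have "((\<lambda>s. f ((x + h *\<^sub>R v) + s *\<^sub>R u)) has_real_derivative
        dd u f ((x + h *\<^sub>R v) + s *\<^sub>R u)) (at s)"
      using S[of s h] that h by (intro has_real_derivative_line smooth_onD[OF f]) (auto simp: ac_simps)
    then show "((\<lambda>s. f (x + s *\<^sub>R u + h *\<^sub>R v)) has_real_derivative
        dd u f (x + s *\<^sub>R u + h *\<^sub>R v)) (at s)" by (simp add: ac_simps)
  qed
  obtain s where s: "0 < s" "s < h" "f (x + h *\<^sub>R u + h *\<^sub>R v) - f (x + h *\<^sub>R u) - (f (x + h *\<^sub>R v) - f x)
      = h * (dd u f (x + s *\<^sub>R u + h *\<^sub>R v) - dd u f (x + s *\<^sub>R u))"
    using MVT2[OF h d] by auto
  have d': "((\<lambda>t. dd u f (x + s *\<^sub>R u + t *\<^sub>R v)) has_real_derivative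
      dd v (dd u f) (x + s *\<^sub>R u + t *\<^sub>R v)) (at t)" if "0 \<le> t" "t \<le> h" for t
    using S[of s t] that s by (intro has_real_derivative_line smooth_onD[OF smooth_on_dd[OF f]]) auto
  obtain t where "0 < t" "t < h" "dd u f (x + s *\<^sub>R u + h *\<^sub>R v) - dd u f (x + s *\<^sub>R u)
      = h * dd v (dd u f) (x + s *\<^sub>R u + t *\<^sub>R v)"
    using MVT2[OF h d'] by auto
  then show ?thesis using that[of s t] s by auto
qed

text \<open>If the two values differed, then by continuity the two mixed derivatives would stay
  apart, even at two different points of a small parallelogram at \<open>x\<close>. But the
  symmetric second difference, expressed by \<open>second_difference_mvt\<close> in both orders,
  gives two such points where they coincide.\<close>

lemma dd_commute_real:
  fixes f :: "'a::euclidean_space \<Rightarrow> real"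
  assumes S: "open S" "x \<in> S" and f: "smooth_on S f"
  shows "dd u (dd v f) x = dd v (dd u f) x"
proof (rule ccontr)
  assume ne: "dd u (dd v f) x \<noteq> dd v (dd u f) x"
  define e where "e = \<bar>dd u (dd v f) x - dd v (dd u f) x\<bar> / 2"
  have e: "e > 0" using ne by (simp add: e_def)
  have "\<exists>d>0. \<forall>y. dist y x < d \<longrightarrow> y \<in> S \<and> dist (dd a (dd b f) y) (dd a (dd b f) x) < e" for a b
  proof -
    have "isCont (dd a (dd b f)) x"
      using smooth_on_continuous[OF smooth_on_dd[OF smooth_on_dd[OF f]]] S
      by (metis continuous_on_eq_continuous_at)
    then obtain d1 where "d1 > 0" "\<forall>y. dist y x < d1 \<longrightarrow> dist (dd a (dd b f) y) (dd a (dd b f) x) < e"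
      using e by (auto simp: continuous_at_eps_delta)
    moreover obtain d2 where "d2 > 0" "\<forall>y. dist y x < d2 \<longrightarrow> y \<in> S"
      using S open_dist by metis
    ultimately show ?thesis by (intro exI[of _ "min d1 d2"]) auto
  qed
  then obtain d1 d2 where d: "d1 > 0" "d2 > 0"
    "\<And>y. dist y x < d1 \<Longrightarrow> y \<in> S \<and> dist (dd u (dd v f) y) (dd u (dd v f) x) < e"
    "\<And>y. dist y x < d2 \<Longrightarrow> y \<in> S \<and> dist (dd v (dd u f) y) (dd v (dd u f) x) < e"
    by metis
  \<comment> \<open>The summand 1 keeps \<open>N\<close> positive when \<open>u\<close> and
    \<open>v\<close> are both 0. With the \<open>h\<close> below, the whole parallelogram stays in
    the smaller of the two balls.\<close>
  define N where "N = norm u + norm v + 1"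
  define h where "h = min d1 d2 / (2 * N)"
  have pos: "N > 0" by (simp add: N_def add_nonneg_pos)
  have h: "h > 0" using d pos by (simp add: h_def)
  have "h * N = min d1 d2 / 2" using pos by (simp add: h_def)
  then have hb: "h * (norm u + norm v + 1) = min d1 d2 / 2" by (simp add: N_def)
  have near: "dist (x + s *\<^sub>R u + t *\<^sub>R v) x < min d1 d2" if "0 \<le> s" "s \<le> h" "0 \<le> t" "t \<le> h" for s t
  proof -
    have "dist (x + s *\<^sub>R u + t *\<^sub>R v) x \<le> s * norm u + t * norm v"
      using norm_triangle_ineq[of "s *\<^sub>R u" "t *\<^sub>R v"] that by (simp add: dist_norm add.assoc)
    also have "\<dots> \<le> h * norm u + h * norm v" using that by (intro add_mono mult_right_mono) auto
    also have "\<dots> = min d1 d2 / 2 - h" using hb by (simp add: algebra_simps)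
    also have "\<dots> < min d1 d2" using d h by linarith
    finally show ?thesis .
  qed
  have near': "dist (x + t *\<^sub>R v + s *\<^sub>R u) x < min d1 d2" if "0 \<le> s" "s \<le> h" "0 \<le> t" "t \<le> h" for s t
    using near[OF that] by (simp add: ac_simps)
  obtain s t where st: "0 \<le> s" "s \<le> h" "0 \<le> t" "t \<le> h"
    "f (x + h *\<^sub>R u + h *\<^sub>R v) - f (x + h *\<^sub>R u) - (f (x + h *\<^sub>R v) - f x)
      = h * (h * dd v (dd u f) (x + s *\<^sub>R u + t *\<^sub>R v))"
    using second_difference_mvt[OF h _ f, of x u v] near d(3) by (metis min_less_iff_conj)
  obtain s' t' where st': "0 \<le> s'" "s' \<le> h" "0 \<le> t'" "t' \<le> h"
    "f (x + h *\<^sub>R v + h *\<^sub>R u) - f (x + h *\<^sub>R v) - (f (x + h *\<^sub>R u) - f x)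
      = h * (h * dd u (dd v f) (x + s' *\<^sub>R v + t' *\<^sub>R u))"
    using second_difference_mvt[OF h _ f, of x v u] near' d(3) by (metis min_less_iff_conj)
  have "dd v (dd u f) (x + s *\<^sub>R u + t *\<^sub>R v) = dd u (dd v f) (x + s' *\<^sub>R v + t' *\<^sub>R u)"
  proof -
    have "x + h *\<^sub>R v + h *\<^sub>R u = x + h *\<^sub>R u + h *\<^sub>R v" by simp
    then have "f (x + h *\<^sub>R v + h *\<^sub>R u) = f (x + h *\<^sub>R u + h *\<^sub>R v)" by (rule arg_cong)
    then have "h * (h * dd v (dd u f) (x + s *\<^sub>R u + t *\<^sub>R v))
        = h * (h * dd u (dd v f) (x + s' *\<^sub>R v + t' *\<^sub>R u))"
      using st(5) st'(5) by linarith
    then show ?thesis using h by simp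
  qed
  moreover have "dist (dd v (dd u f) (x + s *\<^sub>R u + t *\<^sub>R v)) (dd v (dd u f) x) < e"
    using d(4) near st by auto
  moreover have "dist (dd u (dd v f) (x + s' *\<^sub>R v + t' *\<^sub>R u)) (dd u (dd v f) x) < e"
    using d(3) near' st' by auto
  moreover have False if "a = b" "\<bar>a - p\<bar> < \<bar>q - p\<bar> / 2" "\<bar>b - q\<bar> < \<bar>q - p\<bar> / 2"
    for a b p q :: real using that abs_triangle_ineq[of "q - a" "a - p"] by (simp add: abs_minus_commute)
  ultimately show False unfolding e_def dist_real_def by blast
qed

lemma dd_commute:
  fixes f :: "'a::euclidean_space \<Rightarrow> 'b::euclidean_space"
  assumes S: "open S" "x \<in> S" and f: "smooth_on S f"
  shows "dd u (dd v f) x = dd v (dd u f) x"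
proof (rule euclidean_eqI)
  fix b :: 'b assume "b \<in> Basis"
  have sm: "smooth_on S (\<lambda>x. f x \<bullet> b)" by (intro smooth_intros S f)
  have 1: "dd a (dd c (\<lambda>x. f x \<bullet> b)) x = dd a (dd c f) x \<bullet> b" for a c
  proof -
    have "dd c (\<lambda>x. f x \<bullet> b) y = dd c f y \<bullet> b" if "y \<in> S" for y
      by (rule dd_bounded_linear[OF bounded_linear_inner_left smooth_onD[OF f that]])
    then have "dd a (dd c (\<lambda>x. f x \<bullet> b)) x = dd a (\<lambda>y. dd c f y \<bullet> b) x"
      by (rule dd_eq_on[OF S])
    also have "\<dots> = dd a (dd c f) x \<bullet> b"
      by (rule dd_bounded_linear[OF bounded_linear_inner_left smooth_onD[OF smooth_on_dd[OF f] S(2)]])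
    finally show ?thesis .
  qed
  show "dd u (dd v f) x \<bullet> b = dd v (dd u f) x \<bullet> b"
    using dd_commute_real[OF S sm, of u v] 1 by simp
qed

section \<open>Regularity of solutions of linear systems\<close>

lemma has_derivative_zero_product:
  fixes p :: "'a::real_normed_vector \<Rightarrow> real"
  assumes p: "isCont p x" "p x = 0" and e: "e differentiable (at x)" "e x = 0"
  shows "((\<lambda>y. p y *\<^sub>R e y) has_derivative (\<lambda>_. 0)) (at x)"
  unfolding has_derivative_at_alt
proof (intro conjI allI impI)
  fix \<epsilon> :: real assume \<epsilon>: "\<epsilon> > 0"
  obtain D where D: "(e has_derivative D) (at x)" using e by (auto simp: differentiable_def)
  then obtain K where K: "\<And>h. norm (D h) \<le> norm h * K" "K > 0"
    using bounded_linear.pos_bounded has_derivative_bounded_linear by metis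
  obtain d1 where d1: "d1 > 0" "\<And>y. norm (y - x) < d1 \<Longrightarrow> norm (e y - e x - D (y - x)) \<le> 1 * norm (y - x)"
    using D unfolding has_derivative_at_alt by (metis zero_less_one)
  have "\<epsilon> / (1 + K) > 0" using \<epsilon> K by simp
  then obtain d2 where d2: "d2 > 0" "\<And>y. norm (y - x) < d2 \<Longrightarrow> \<bar>p y\<bar> < \<epsilon> / (1 + K)"
    using p unfolding continuous_at_eps_delta dist_norm by (metis diff_zero real_norm_def)
  show "\<exists>d>0. \<forall>y. norm (y - x) < d \<longrightarrow>
      norm (p y *\<^sub>R e y - p x *\<^sub>R e x - 0) \<le> \<epsilon> * norm (y - x)"
  proof (intro exI[of _ "min d1 d2"] conjI allI impI)
    fix y assume y: "norm (y - x) < min d1 d2"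
    have "norm (e y) \<le> norm (y - x) + norm (D (y - x))"
      using d1(2)[of y] y e(2) norm_triangle_sub[of "e y" "D (y - x)"] by auto
    also have "\<dots> \<le> (1 + K) * norm (y - x)" using K(1)[of "y - x"] by (simp add: algebra_simps)
    finally have "\<bar>p y\<bar> * norm (e y) \<le> (\<epsilon> / (1 + K)) * ((1 + K) * norm (y - x))"
      using d2(2)[of y] y by (intro mult_mono) auto
    then show "norm (p y *\<^sub>R e y - p x *\<^sub>R e x - 0) \<le> \<epsilon> * norm (y - x)" using K p by simp
  qed (use d1 d2 in auto)
qed simp

text \<open>\<open>L\<close> inverts \<open>A x\<close> from the left at the one point
  \<open>x\<close>. For \<open>z\<close> near \<open>x\<close>, \<open>L\<close> after
  \<open>A z\<close> is the identity up to an error \<open>E z\<close> below 1/2, so the increment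
  of \<open>y\<close> is at most twice the residual \<open>r z\<close>, which tends to 0.\<close>

lemma linear_solve_continuous:
  fixes A :: "'x::euclidean_space \<Rightarrow> 'e::euclidean_space \<Rightarrow> 'w::euclidean_space"
  assumes S: "open S" "x \<in> S" and lin: "\<And>x. x \<in> S \<Longrightarrow> linear (A x)" and L: "linear L" "\<And>v. L (A x v) = v"
    and A: "\<And>b. isCont (\<lambda>x. A x b) x" and B: "isCont B x" and eq: "\<And>x. x \<in> S \<Longrightarrow> A x (y x) = B x"
  shows "isCont y x"
proof -
  define r where "r z = L (B z) - L (A z (y x))" for z
  define E where "E z b = L (A z b) - b" for z b
  have bl: "bounded_linear L" using L(1) linear_conv_bounded_linear by blast
  have Lc: "isCont L z" for z
    using bl linear_continuous_at by blast
  have r: "r \<midarrow>x\<rightarrow> 0"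
  proof -
    have "isCont r x" unfolding r_def
      by (intro continuous_diff isCont_o2[OF _ Lc] A B)
    moreover have "r x = 0" using eq[OF S(2)] by (simp add: r_def)
    ultimately show ?thesis by (simp add: isCont_def)
  qed
  have "(\<lambda>z. \<Sum>b\<in>Basis. norm (E z b)) \<midarrow>x\<rightarrow> (\<Sum>b::'e\<in>Basis. norm (0 :: 'e))"
  proof (intro tendsto_sum tendsto_norm)
    fix b :: 'e
    have "isCont (\<lambda>z. E z b) x" unfolding E_def by (intro continuous_diff isCont_o2[OF A Lc] continuous_const)
    then show "(\<lambda>z. E z b) \<midarrow>x\<rightarrow> 0" using L(2) by (simp add: E_def isCont_def)
  qed
  then have "\<forall>\<^sub>F z in at x. (\<Sum>b\<in>Basis. norm (E z b)) < 1 / 2"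
    by (intro order_tendstoD) auto
  moreover have "\<forall>\<^sub>F z in at x. z \<in> S"
    using S eventually_at_in_open' by blast
  ultimately have "\<forall>\<^sub>F z in at x. norm (y z - y x) \<le> norm (r z) * 2"
  proof eventually_elim
    case (elim z)
    let ?k = "y z - y x"
    have lin': "linear (\<lambda>v. L (A z v))" using linear_compose[OF lin[OF elim(2)] L(1)] by (simp add: o_def)
    have "r z = L (A z ?k)"
      using eq[OF elim(2)] linear_diff[OF lin'] by (simp add: r_def)
    also have "\<dots> = (\<Sum>b\<in>Basis. (?k \<bullet> b) *\<^sub>R (b + E z b))"
      using linear_sum_Basis[OF lin', of ?k] by (simp add: E_def)
    also have "\<dots> = ?k + (\<Sum>b\<in>Basis. (?k \<bullet> b) *\<^sub>R E z b)"
      by (simp add: scaleR_add_right sum.distrib euclidean_representation)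
    finally have "?k = r z - (\<Sum>b\<in>Basis. (?k \<bullet> b) *\<^sub>R E z b)" by simp
    then have "norm ?k \<le> norm (r z) + norm (\<Sum>b\<in>Basis. (?k \<bullet> b) *\<^sub>R E z b)"
      by (metis norm_triangle_ineq4)
    also have "norm (\<Sum>b\<in>Basis. (?k \<bullet> b) *\<^sub>R E z b) \<le> (\<Sum>b\<in>Basis. norm ?k * norm (E z b))"
      by (rule order_trans[OF norm_sum sum_mono]) (auto intro!: mult_right_mono Basis_le_norm)
    also have "\<dots> \<le> norm ?k * (1 / 2)"
      unfolding sum_distrib_left[symmetric] using elim(1) by (intro mult_left_mono) auto
    finally show ?case by simp
  qed
  then have "(\<lambda>z. y z - y x) \<midarrow>x\<rightarrow> 0"
    by (rule tendsto_0_le[OF r])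
  then show ?thesis by (simp add: isCont_def LIM_zero_iff)
qed

text \<open>As in the continuous case, y z is y x + r z minus terms ((y z - y x) \<bullet> b) times
  \<open>E z b\<close>. In each of these one factor is continuous, the other differentiable, and
  both vanish at \<open>x\<close>. By \<open>has_derivative_zero_product\<close> such a term has
  derivative 0, so only the differentiable \<open>r\<close> remains.\<close>

lemma linear_solve_differentiable:
  fixes A :: "'x::euclidean_space \<Rightarrow> 'e::euclidean_space \<Rightarrow> 'w::euclidean_space"
  assumes S: "open S" "x \<in> S" and lin: "\<And>x. x \<in> S \<Longrightarrow> linear (A x)" and L: "linear L" "\<And>v. L (A x v) = v"
    and A: "\<And>b. (\<lambda>x. A x b) differentiable (at x)" and B: "B differentiable (at x)"
    and eq: "\<And>x. x \<in> S \<Longrightarrow> A x (y x) = B x"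
  shows "y differentiable (at x)"
proof -
  have cont: "isCont y x"
    by (rule linear_solve_continuous[where A=A and L=L and B=B, OF S lin L _ _ eq])
      (use A B differentiable_imp_continuous_within in blast)+
  define r where "r z = L (B z) - L (A z (y x))" for z
  define E where "E z b = L (A z b) - b" for z b
  have bl: "bounded_linear L" using L(1) linear_conv_bounded_linear by blast
  have Ld: "(\<lambda>z. L (f z)) differentiable (at x)" if "f differentiable (at x)" for f
    using bounded_linear.has_derivative[OF bl] that unfolding differentiable_def by blast
  have yz: "y x + r z - (\<Sum>b\<in>Basis. ((y z - y x) \<bullet> b) *\<^sub>R E z b) = y z" if z: "z \<in> S" for z
  proof -
    let ?k = "y z - y x"
    have lin': "linear (\<lambda>v. L (A z v))" using linear_compose[OF lin[OF z] L(1)] by (simp add: o_def)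
    have "r z = L (A z ?k)"
      using eq[OF z] linear_diff[OF lin'] by (simp add: r_def)
    also have "\<dots> = (\<Sum>b\<in>Basis. (?k \<bullet> b) *\<^sub>R (b + E z b))"
      using linear_sum_Basis[OF lin', of ?k] by (simp add: E_def)
    also have "\<dots> = ?k + (\<Sum>b\<in>Basis. (?k \<bullet> b) *\<^sub>R E z b)"
      by (simp add: scaleR_add_right sum.distrib euclidean_representation)
    finally show ?thesis by simp
  qed
  have rd: "r differentiable (at x)"
    unfolding r_def by (intro differentiable_diff Ld A B)
  have "((\<lambda>z. ((y z - y x) \<bullet> b) *\<^sub>R E z b) has_derivative (\<lambda>_. 0)) (at x)" for b
  proof (rule has_derivative_zero_product)
    show "isCont (\<lambda>z. (y z - y x) \<bullet> b) x" using cont by (intro continuous_intros)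
    show "(\<lambda>z. E z b) differentiable (at x)" unfolding E_def by (intro differentiable_diff Ld A) simp
  qed (use L in \<open>auto simp: E_def\<close>)
  then have "(\<lambda>z. y x + r z - (\<Sum>b\<in>Basis. ((y z - y x) \<bullet> b) *\<^sub>R E z b)) differentiable (at x)"
    by (intro differentiable_diff differentiable_add differentiable_const rd differentiable_sum)
      (auto simp: differentiable_def)
  then show ?thesis
    by (rule differentiable_eq_on[OF S]) (rule yz[symmetric])
qed

text \<open>A product rule in which the family \<open>A\<close> is controlled only through its
  values on fixed vectors; expanding the moving vector in \<open>Basis\<close> reduces it to
  finitely many of these.\<close>

lemma linear_family_derivative:
  fixes A :: "'x::euclidean_space \<Rightarrow> 'e::euclidean_space \<Rightarrow> 'w::real_normed_vector"
  assumes S: "open S" "x \<in> S" and lin: "\<And>x. x \<in> S \<Longrightarrow> linear (A x)"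
    and A: "\<And>b. (\<lambda>x. A x b) differentiable (at x)" and y: "y differentiable (at x)"
  shows "((\<lambda>z. A z (y z)) has_derivative (\<lambda>v. dd v (\<lambda>z. A z (y x)) x + A x (dd v y x))) (at x)"
proof -
  have eq: "A z w = (\<Sum>b\<in>Basis. (w \<bullet> b) *\<^sub>R A z b)" if "z \<in> S" for z w
    using linear_sum_Basis[OF lin[OF that]] by blast
  have d: "((\<lambda>z. \<Sum>b\<in>Basis. (y z \<bullet> b) *\<^sub>R A z b) has_derivative
      (\<lambda>v. \<Sum>b\<in>Basis. (y x \<bullet> b) *\<^sub>R dd v (\<lambda>z. A z b) x + (dd v y x \<bullet> b) *\<^sub>R A x b)) (at x)"
    by (auto intro!: has_derivative_sum has_derivative_scaleR has_derivative_inner_left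
        dd_derivative A y)
  have d': "((\<lambda>z. \<Sum>b\<in>Basis. (y x \<bullet> b) *\<^sub>R A z b) has_derivative
      (\<lambda>v. \<Sum>b\<in>Basis. (y x \<bullet> b) *\<^sub>R dd v (\<lambda>z. A z b) x)) (at x)"
    by (auto intro!: has_derivative_sum has_derivative_scaleR_right dd_derivative A)
  have "dd v (\<lambda>z. A z (y x)) x = (\<Sum>b\<in>Basis. (y x \<bullet> b) *\<^sub>R dd v (\<lambda>z. A z b) x)" for v
    unfolding dd_eqI[OF d', symmetric] by (rule dd_eq_on[OF S eq])
  then have e: "(\<lambda>v. dd v (\<lambda>z. A z (y x)) x + A x (dd v y x)) =
      (\<lambda>v. \<Sum>b\<in>Basis. (y x \<bullet> b) *\<^sub>R dd v (\<lambda>z. A z b) x + (dd v y x \<bullet> b) *\<^sub>R A x b)"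
    by (subst eq[OF S(2)]) (simp add: sum.distrib)
  show ?thesis
    unfolding e by (rule has_derivative_transform_within_open[OF d S]) (rule eq[symmetric])
qed

lemma Ck_on_linear_family:
  fixes A :: "'x::euclidean_space \<Rightarrow> 'e::euclidean_space \<Rightarrow> 'w::real_normed_vector"
  assumes S: "open S" and lin: "\<And>x. x \<in> S \<Longrightarrow> linear (A x)"
    and A: "\<And>b. Ck_on k S (\<lambda>x. A x b)" and y: "Ck_on k S y"
  shows "Ck_on k S (\<lambda>x. A x (y x))"
proof -
  have "Ck_on k S (\<lambda>x. \<Sum>b\<in>Basis. (y x \<bullet> b) *\<^sub>R A x b)"
    by (intro Ck_on_sum Ck_on_bounded_bilinear[OF bounded_bilinear_scaleR] S A
        Ck_on_bounded_linear[OF bounded_linear_inner_left] y)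
  moreover have "A x (y x) = (\<Sum>b\<in>Basis. (y x \<bullet> b) *\<^sub>R A x b)" if "x \<in> S" for x
    using linear_sum_Basis[OF lin[OF that]] by blast
  ultimately show ?thesis
    by (rule Ck_on_eq_on[OF S])
qed

lemma smooth_on_linear_family:
  fixes A :: "'x::euclidean_space \<Rightarrow> 'e::euclidean_space \<Rightarrow> 'w::real_normed_vector"
  assumes "open S" and "\<And>x. x \<in> S \<Longrightarrow> linear (A x)"
    and "\<And>b. smooth_on S (\<lambda>x. A x b)" and "smooth_on S y"
  shows "smooth_on S (\<lambda>x. A x (y x))"
  using assms unfolding smooth_on_def by (auto intro: Ck_on_linear_family)

text \<open>Differentiating A y = B gives A (dy) = dB - (dA) y, a system for the derivative of
  \<open>y\<close> with the same injective coefficients and a right-hand side of one order less.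
  Hence the induction runs over \<open>B\<close> and \<open>y\<close> together.\<close>

lemma Ck_on_linear_solve:
  fixes A :: "'x::euclidean_space \<Rightarrow> 'e::euclidean_space \<Rightarrow> 'w::euclidean_space"
  assumes S: "open S" and lin: "\<And>x. x \<in> S \<Longrightarrow> linear (A x)" and inj: "\<And>x. x \<in> S \<Longrightarrow> inj (A x)"
  shows "(\<And>b. Ck_on k S (\<lambda>x. A x b)) \<Longrightarrow> Ck_on k S B \<Longrightarrow> (\<And>x. x \<in> S \<Longrightarrow> A x (y x) = B x)
    \<Longrightarrow> Ck_on k S y"
proof (induction k arbitrary: B y)
  case 0
  have "isCont y x" if x: "x \<in> S" for x
  proof -
    obtain L where "linear L" "\<And>v. L (A x v) = v"
      using linear_injective_left_inverse[OF lin[OF x] inj[OF x]] by (metis comp_apply id_apply)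
    then show ?thesis
      using 0 S x by (intro linear_solve_continuous[where A=A and L=L and B=B, OF S x lin])
        (auto simp: continuous_on_eq_continuous_at)
  qed
  then show ?case using S by (simp add: continuous_on_eq_continuous_at)
next
  case (Suc k)
  have yd: "y differentiable (at x)" if x: "x \<in> S" for x
  proof -
    obtain L where L: "linear L" "\<And>v. L (A x v) = v"
      using linear_injective_left_inverse[OF lin[OF x] inj[OF x]] by (metis comp_apply id_apply)
    show ?thesis
      using Suc.prems(1,2) x by (intro linear_solve_differentiable[where A=A and L=L and B=B, OF S x lin L _ _ Suc.prems(3)]) auto
  qed
  have yk: "Ck_on k S y"
    by (rule Suc.IH[OF _ _ Suc.prems(3)]) (use Suc.prems Ck_on_SucD in blast)+
  have "Ck_on k S (dd v y)" for v
  proof (rule Suc.IH)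
    have "linear (\<lambda>w. dd v (\<lambda>z. A z w) x)" if x: "x \<in> S" for x
    proof (rule linearI)
      have d: "(\<lambda>z. A z b) differentiable (at x)" for b using Suc.prems(1) x by auto
      show "dd v (\<lambda>z. A z (a + b)) x = dd v (\<lambda>z. A z a) x + dd v (\<lambda>z. A z b) x" for a b
        using dd_eq_on[OF S x, of "\<lambda>z. A z (a + b)" "\<lambda>z. A z a + A z b" v] dd_add[OF d[of a] d[of b], of v]
          linear_add[OF lin] by simp
      show "dd v (\<lambda>z. A z (c *\<^sub>R b)) x = c *\<^sub>R dd v (\<lambda>z. A z b) x" for c b
        using dd_eq_on[OF S x, of "\<lambda>z. A z (c *\<^sub>R b)" "\<lambda>z. c *\<^sub>R A z b" v]
          dd_bounded_linear[OF bounded_linear_scaleR_right[of c] d[of b], of v] linear_scale[OF lin] by simp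
    qed
    then have "Ck_on k S (\<lambda>x. dd v (\<lambda>z. A z (y x)) x)"
      using Suc.prems(1)
      by (intro Ck_on_linear_family[where A="\<lambda>x w. dd v (\<lambda>z. A z w) x", OF S _ _ yk]) auto
    then show "Ck_on k S (\<lambda>x. dd v B x + - dd v (\<lambda>z. A z (y x)) x)"
      using Suc.prems(2)
      by (intro Ck_on_add[OF S] Ck_on_bounded_linear[OF bounded_linear_minus[OF bounded_linear_ident] S]) auto
    show "A x (dd v y x) = dd v B x + - dd v (\<lambda>z. A z (y x)) x" if x: "x \<in> S" for x
    proof -
      have "dd v (\<lambda>z. A z (y z)) x = dd v (\<lambda>z. A z (y x)) x + A x (dd v y x)"
        by (rule dd_eqI, rule linear_family_derivative[OF S x lin _ yd[OF x]]) (use Suc.prems(1) x in auto)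
      moreover have "dd v (\<lambda>z. A z (y z)) x = dd v B x"
        by (rule dd_eq_on[OF S x Suc.prems(3)])
      ultimately show ?thesis by simp
    qed
    show "Ck_on k S (\<lambda>x. A x b)" for b using Suc.prems(1) Ck_on_SucD by blast
  qed
  then show ?case using yd by auto
qed

lemma smooth_on_linear_solve:
  fixes A :: "'x::euclidean_space \<Rightarrow> 'e::euclidean_space \<Rightarrow> 'w::euclidean_space"
  assumes "open S" "\<And>x. x \<in> S \<Longrightarrow> linear (A x)" "\<And>x. x \<in> S \<Longrightarrow> inj (A x)"
    "\<And>b. smooth_on S (\<lambda>x. A x b)" "smooth_on S B" "\<And>x. x \<in> S \<Longrightarrow> A x (y x) = B x"
  shows "smooth_on S y"
  using assms(4-6) unfolding smooth_on_def
  by (auto intro!: Ck_on_linear_solve[where A=A and B=B, OF assms(1-3)])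
text \<open>With a left inverse \<open>L\<close> of the derivative of \<open>a\<close>, the map
  \<open>\<alpha>\<close>, that is \<open>L\<close> after \<open>a\<close>, has the identity as
  derivative at \<open>z x\<close>, while \<open>\<alpha>\<close> after \<open>z\<close> is
  \<open>L\<close> after \<open>b\<close>, which is differentiable. The expansion of
  \<open>\<alpha>\<close> with constant 1/2 bounds the increment of \<open>z\<close> linearly; using
  it again with a small constant yields the derivative.\<close>

lemma lift_has_derivative:
  fixes z :: "'x::euclidean_space \<Rightarrow> 'e::euclidean_space" and a :: "'e \<Rightarrow> 'w::euclidean_space"
  assumes S: "open S" "x \<in> S" and z: "isCont z x" and eq: "\<And>x. x \<in> S \<Longrightarrow> a (z x) = b x"
    and a: "(a has_derivative a') (at (z x))" and b: "(b has_derivative b') (at x)"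
    and L: "linear L" "\<And>v. L (a' v) = v"
  shows "(z has_derivative (\<lambda>v. L (b' v))) (at x)"
proof -
  have bl: "bounded_linear L" using L(1) linear_conv_bounded_linear by blast
  define \<alpha> where "\<alpha> y = L (a y)" for y
  define \<beta> where "\<beta> y = L (b y)" for y
  have \<alpha>: "(\<alpha> has_derivative (\<lambda>v. v)) (at (z x))"
    using bounded_linear.has_derivative[OF bl a] L by (simp add: \<alpha>_def[abs_def])
  have \<beta>: "(\<beta> has_derivative (\<lambda>v. L (b' v))) (at x)"
    using bounded_linear.has_derivative[OF bl b] by (simp add: \<beta>_def[abs_def])
  obtain K where K: "\<And>h. norm (L (b' h)) \<le> norm h * K" "K > 0"
    using bounded_linear.pos_bounded has_derivative_bounded_linear[OF \<beta>] by metis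
  obtain dS where dS: "dS > 0" "\<And>y. norm (y - x) < dS \<Longrightarrow> y \<in> S"
    using S unfolding open_dist dist_norm by metis
  have est: "\<exists>d>0. \<forall>y. norm (y - x) < d \<longrightarrow>
      norm (\<beta> y - \<beta> x - (z y - z x)) \<le> e * norm (z y - z x)" if e: "e > 0" for e
  proof -
    obtain d1 where d1: "d1 > 0"
      "\<And>w. norm (w - z x) < d1 \<Longrightarrow> norm (\<alpha> w - \<alpha> (z x) - (w - z x)) \<le> e * norm (w - z x)"
      using \<alpha> e unfolding has_derivative_at_alt by metis
    obtain d2 where d2: "d2 > 0" "\<And>y. norm (y - x) < d2 \<Longrightarrow> norm (z y - z x) < d1"
      using z d1(1) unfolding continuous_at_eps_delta dist_norm by metis
    have "\<alpha> (z y) = \<beta> y" if "norm (y - x) < dS" for y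
      using eq[OF dS(2)[OF that]] by (simp add: \<alpha>_def \<beta>_def)
    moreover have "\<alpha> (z x) = \<beta> x" using eq[OF S(2)] by (simp add: \<alpha>_def \<beta>_def)
    ultimately show ?thesis
      using d1 d2 dS(1) by (intro exI[of _ "min d2 dS"]) fastforce
  qed
  show ?thesis
    unfolding has_derivative_at_alt
  proof (intro conjI allI impI)
    show "bounded_linear (\<lambda>v. L (b' v))" by (rule has_derivative_bounded_linear[OF \<beta>])
    fix e :: real assume e: "e > 0"
    \<comment> \<open>The increment of \<open>z\<close> is at most 2 (K + 1) times that of the
      argument, so this choice makes its error e / 2.\<close>
    define e1 where "e1 = e / (2 * (2 * (K + 1)))"
    have e1: "e1 > 0" using e K by (simp add: e1_def)
    obtain d1 where d1: "d1 > 0" "\<And>y. norm (y - x) < d1 \<Longrightarrow>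
        norm (\<beta> y - \<beta> x - (z y - z x)) \<le> e1 * norm (z y - z x)"
      using est[OF e1] by metis
    obtain d2 where d2: "d2 > 0" "\<And>y. norm (y - x) < d2 \<Longrightarrow>
        norm (\<beta> y - \<beta> x - (z y - z x)) \<le> (1/2) * norm (z y - z x)"
      using est[of "1/2"] by auto
    obtain d3 where d3: "d3 > 0" "\<And>y. norm (y - x) < d3 \<Longrightarrow>
        norm (\<beta> y - \<beta> x - L (b' (y - x))) \<le> 1 * norm (y - x)"
      using \<beta> unfolding has_derivative_at_alt by (metis zero_less_one)
    obtain d4 where d4: "d4 > 0" "\<And>y. norm (y - x) < d4 \<Longrightarrow>
        norm (\<beta> y - \<beta> x - L (b' (y - x))) \<le> (e / 2) * norm (y - x)"
      using \<beta> e unfolding has_derivative_at_alt by (metis half_gt_zero)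
    show "\<exists>d>0. \<forall>y. norm (y - x) < d \<longrightarrow> norm (z y - z x - L (b' (y - x))) \<le> e * norm (y - x)"
    proof (intro exI[of _ "min (min d1 d2) (min d3 d4)"] conjI allI impI)
      fix y assume y: "norm (y - x) < min (min d1 d2) (min d3 d4)"
      have "norm (\<beta> y - \<beta> x) \<le> norm (\<beta> y - \<beta> x - L (b' (y - x))) + norm (L (b' (y - x)))"
        using norm_triangle_sub[of "\<beta> y - \<beta> x" "L (b' (y - x))"] by simp
      also have "\<dots> \<le> (K + 1) * norm (y - x)"
        using d3(2)[of y] y K(1)[of "y - x"] by (simp add: algebra_simps)
      finally have "norm (\<beta> y - \<beta> x) \<le> (K + 1) * norm (y - x)" .
      moreover have "norm (z y - z x) \<le> norm (\<beta> y - \<beta> x) + norm (\<beta> y - \<beta> x - (z y - z x))"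
        using norm_triangle_sub[of "z y - z x" "\<beta> y - \<beta> x"] by (simp add: norm_minus_commute)
      ultimately have zb: "norm (z y - z x) \<le> 2 * ((K + 1) * norm (y - x))"
        using d2(2)[of y] y by linarith
      have "norm (z y - z x - L (b' (y - x))) =
          norm ((\<beta> y - \<beta> x - L (b' (y - x))) - (\<beta> y - \<beta> x - (z y - z x)))"
        by (rule arg_cong[where f=norm]) (simp add: algebra_simps)
      also have "\<dots> \<le> norm (\<beta> y - \<beta> x - L (b' (y - x))) + norm (\<beta> y - \<beta> x - (z y - z x))"
        by (rule norm_triangle_ineq4)
      also have "\<dots> \<le> (e / 2) * norm (y - x) + e1 * (2 * ((K + 1) * norm (y - x)))"
        by (intro add_mono order_trans[OF d1(2) mult_left_mono[OF zb]] d4(2)) (use y e1 in auto)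
      also have "e1 * (2 * ((K + 1) * norm (y - x))) = (e / 2) * norm (y - x)"
        using K(2) by (simp add: e1_def field_simps)
      finally show "norm (z y - z x - L (b' (y - x))) \<le> e * norm (y - x)" by (simp add: field_simps)
    qed (use d1 d2 d3 d4 in auto)
  qed
qed

text \<open>Differentiating a (z x) = b x gives a linear system for dz with injective coefficients
  evaluated along \<open>z\<close>. If \<open>z\<close> is of class k, so is dz by
  \<open>Ck_on_linear_solve\<close>, and \<open>z\<close> gains one order per step. This yields
  smoothness of local inverses and of transition maps between parametrizations of the
  sphere.\<close>

lemma smooth_on_lift:
  fixes z :: "'x::euclidean_space \<Rightarrow> 'e::euclidean_space" and a :: "'e \<Rightarrow> 'w::euclidean_space"
  assumes S: "open S" and T: "open T" and z: "continuous_on S z" "z ` S \<subseteq> T"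
    and eq: "\<And>x. x \<in> S \<Longrightarrow> a (z x) = b x"
    and a: "smooth_on T a" "\<And>y. y \<in> T \<Longrightarrow> inj (frechet_derivative a (at y))" and b: "smooth_on S b"
  shows "smooth_on S z"
proof -
  have zT: "z x \<in> T" if "x \<in> S" for x using z(2) that by auto
  have zd: "z differentiable (at x)" if x: "x \<in> S" for x
  proof -
    obtain L where L: "linear L" "L \<circ> frechet_derivative a (at (z x)) = id"
      using linear_injective_left_inverse linear_dd[OF smooth_onD[OF a(1) zT[OF x]]] a(2)[OF zT[OF x]]
      by blast
    have "(z has_derivative (\<lambda>v. L (dd v b x))) (at x)"
      using L z(1) S x
      by (intro lift_has_derivative[OF S x _ eq dd_derivative[OF smooth_onD[OF a(1) zT[OF x]]]
            dd_derivative[OF smooth_onD[OF b x]] L(1)])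
        (auto simp: continuous_on_eq_continuous_at fun_eq_iff)
    then show ?thesis by (auto simp: differentiable_def)
  qed
  have "Ck_on k S z" for k
  proof (induction k)
    case 0 show ?case using z by simp
  next
    case (Suc k)
    have "Ck_on k S (dd v z)" for v
    proof (rule Ck_on_linear_solve[where A="\<lambda>x y. dd y a (z x)" and B="dd v b", OF S])
      show "linear (\<lambda>y. dd y a (z x))" if "x \<in> S" for x
        by (rule linear_dd[OF smooth_onD[OF a(1) zT[OF that]]])
      show "inj (\<lambda>y. dd y a (z x))" if "x \<in> S" for x using a(2)[OF zT[OF that]] by simp
      show "Ck_on k S (\<lambda>x. dd c a (z x))" for c
        using Ck_on_compose[OF S T z(2) Suc] smooth_on_dd[OF a(1)] unfolding smooth_on_def by blast
      show "Ck_on k S (dd v b)" using smooth_on_dd[OF b] unfolding smooth_on_def by blast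
      show "dd (dd v z x) a (z x) = dd v b x" if x: "x \<in> S" for x
      proof -
        have "dd v (\<lambda>x. a (z x)) x = dd v b x" by (rule dd_eq_on[OF S x eq])
        then show ?thesis
          using dd_compose(1)[OF zd[OF x] smooth_onD[OF a(1) zT[OF x]]] by simp
      qed
    qed
    then show ?case using zd by auto
  qed
  then show ?thesis by (simp add: smooth_on_def)
qed

text \<open>The vector field \<open>P\<close> encodes a 1-form through the inner product, and
  \<open>closed\<close> says that this form is closed. The primitive integrates it along the
  segments from a base point \<open>p\<close>.\<close>

lemma poincare_lemma:
  fixes P :: "'a::euclidean_space \<Rightarrow> 'a"
  assumes S: "open S" "convex S" and P: "smooth_on S P"
    and closed: "\<And>x v w. x \<in> S \<Longrightarrow> dd v P x \<bullet> w = dd w P x \<bullet> v"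
  obtains u where "smooth_on S u" "\<And>x v. x \<in> S \<Longrightarrow> dd v u x = P x \<bullet> v"
proof (cases "S = {}")
  case True then show ?thesis using that by auto
next
  case False
  then obtain p where p: "p \<in> S" by auto
  define \<gamma> where "\<gamma> x t = p + t *\<^sub>R (x - p)" for x and t :: real
  define u where "u x = integral {0..1} (\<lambda>t. P (\<gamma> x t) \<bullet> (x - p))" for x
  \<comment> \<open>The gradient in \<open>x\<close> of the integrand of \<open>u\<close>, once
    \<open>closed\<close> has moved the free direction out of the derivative of \<open>P\<close>. It
    is also the derivative in \<open>t\<close> of t P(\<gamma> x t), so its integral is
    \<open>P x\<close>.\<close>
  define G where "G x t = t *\<^sub>R dd (x - p) P (\<gamma> x t) + P (\<gamma> x t)" for x t
  have \<gamma>S: "\<gamma> x t \<in> S" if "x \<in> S" "t \<in> {0..1}" for x t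
    using convexD_alt[OF S(2) p that(1)] that(2) by (simp add: \<gamma>_def algebra_simps)
  have d\<gamma>: "((\<lambda>x. \<gamma> x t) has_derivative (\<lambda>v. t *\<^sub>R v)) (at x)" for x t
    unfolding \<gamma>_def by (auto intro!: derivative_eq_intros)
  have c\<gamma>: "continuous_on (S \<times> {0..1}) (\<lambda>z. \<gamma> (fst z) (snd z))"
    unfolding \<gamma>_def by (intro continuous_intros)
  have cc: "continuous_on (S \<times> {0..1}) (\<lambda>z. f (\<gamma> (fst z) (snd z)))" if "continuous_on S f"
    for f :: "'a \<Rightarrow> 'a"
    by (rule continuous_on_compose2[OF that c\<gamma>]) (use \<gamma>S in auto)
  have dlin: "dd v P y = (\<Sum>b\<in>Basis. (v \<bullet> b) *\<^sub>R dd b P y)" if "y \<in> S" for v y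
    by (rule linear_sum_Basis[OF linear_dd[OF smooth_onD[OF P that]]])
  have cG: "continuous_on (S \<times> {0..1}) (\<lambda>z. G (fst z) (snd z))"
  proof -
    have "continuous_on (S \<times> {0..1}) (\<lambda>z. snd z *\<^sub>R
        (\<Sum>b\<in>Basis. ((fst z - p) \<bullet> b) *\<^sub>R dd b P (\<gamma> (fst z) (snd z))) + P (\<gamma> (fst z) (snd z)))"
      by (intro continuous_intros cc smooth_on_continuous smooth_on_dd P)
    moreover have "G (fst z) (snd z) = snd z *\<^sub>R
        (\<Sum>b\<in>Basis. ((fst z - p) \<bullet> b) *\<^sub>R dd b P (\<gamma> (fst z) (snd z))) + P (\<gamma> (fst z) (snd z))"
      if "z \<in> S \<times> {0..1}" for z
      using that \<gamma>S[of "fst z" "snd z"] by (auto simp: G_def dlin)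
    ultimately show ?thesis by (metis (no_types, lifting) continuous_on_cong)
  qed
  have cGx: "continuous_on {0..1} (G x)" if "x \<in> S" for x
    by (rule continuous_on_compose2[OF cG, of "{0..1}" "\<lambda>t. (x, t)", simplified])
      (use that in \<open>auto intro!: continuous_intros\<close>)
  have cPx: "continuous_on {0..1} (\<lambda>t. P (\<gamma> x t))" if "x \<in> S" for x
    by (rule continuous_on_compose2[OF cc[OF smooth_on_continuous[OF P]], of "{0..1}" "\<lambda>t. (x, t)", simplified])
      (use that in \<open>auto intro!: continuous_intros\<close>)
  have fx: "((\<lambda>x. P (\<gamma> x t) \<bullet> (x - p)) has_derivative blinfun_apply (blinfun_inner_right (G x t)))
      (at x within S)" if x: "x \<in> S" "t \<in> cbox 0 1" for x t
  proof -
    have gS: "\<gamma> x t \<in> S" using \<gamma>S x by auto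
    have 1: "((\<lambda>x. P (\<gamma> x t)) has_derivative (\<lambda>v. dd (t *\<^sub>R v) P (\<gamma> x t))) (at x)"
      by (rule has_derivative_compose[OF d\<gamma> dd_derivative[OF smooth_onD[OF P gS]]])
    have "((\<lambda>x. P (\<gamma> x t) \<bullet> (x - p)) has_derivative
        (\<lambda>v. P (\<gamma> x t) \<bullet> v + dd (t *\<^sub>R v) P (\<gamma> x t) \<bullet> (x - p))) (at x)"
      by (rule has_derivative_eq_rhs[OF has_derivative_inner[OF 1]])
        (auto intro!: derivative_eq_intros)
    moreover have "P (\<gamma> x t) \<bullet> v + dd (t *\<^sub>R v) P (\<gamma> x t) \<bullet> (x - p) = G x t \<bullet> v" for v
      using closed[OF gS, of "t *\<^sub>R v" "x - p"] by (simp add: G_def inner_add_left)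
    then have "(\<lambda>v. P (\<gamma> x t) \<bullet> v + dd (t *\<^sub>R v) P (\<gamma> x t) \<bullet> (x - p))
        = blinfun_apply (blinfun_inner_right (G x t))"
      by (intro ext) simp
    ultimately show ?thesis
      by (metis has_derivative_at_withinI)
  qed
  have GI: "(G x has_integral P x) {0..1}" if x: "x \<in> S" for x
  proof -
    have d: "((\<lambda>t. t *\<^sub>R P (\<gamma> x t)) has_vector_derivative G x t) (at t within {0..1})"
      if t: "t \<in> {0..1}" for t
    proof -
      have "((\<lambda>t. \<gamma> x t) has_derivative (\<lambda>s. s *\<^sub>R (x - p))) (at t within {0..1})"
        unfolding \<gamma>_def by (auto intro!: derivative_eq_intros)
      then have "((\<lambda>t. P (\<gamma> x t)) has_derivative (\<lambda>s. dd (s *\<^sub>R (x - p)) P (\<gamma> x t))) (at t within {0..1})"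
        by (rule has_derivative_compose[where g=P and f="\<gamma> x", OF _ dd_derivative[OF smooth_onD[OF P \<gamma>S[OF x t]]]])
      then have "((\<lambda>t. P (\<gamma> x t)) has_vector_derivative dd (x - p) P (\<gamma> x t)) (at t within {0..1})"
        unfolding has_vector_derivative_def
        using linear_scale[OF linear_dd[OF smooth_onD[OF P \<gamma>S[OF x t]]]] by simp
      from has_vector_derivative_scaleR[OF DERIV_ident this] show ?thesis
        by (simp add: G_def)
    qed
    show ?thesis
      using fundamental_theorem_of_calculus[OF zero_le_one d] by (simp add: \<gamma>_def)
  qed
  have du: "(u has_derivative (\<lambda>v. P x \<bullet> v)) (at x)" if x: "x \<in> S" for x
  proof -
    have "((\<lambda>x. integral (cbox 0 1) (\<lambda>t. P (\<gamma> x t) \<bullet> (x - p))) has_derivative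
        blinfun_apply (integral (cbox 0 1) (\<lambda>t. blinfun_inner_right (G x t)))) (at x within S)"
    proof (rule leibniz_rule[OF fx _ _ x S(2)])
      show "(\<lambda>t. P (\<gamma> x t) \<bullet> (x - p)) integrable_on cbox 0 1" if "x \<in> S" for x
        using cPx[OF that] by (intro integrable_continuous continuous_intros) auto
      show "continuous_on (S \<times> cbox 0 1) (\<lambda>(x, t). blinfun_inner_right (G x t))"
        using bounded_linear.continuous_on[OF bounded_linear_blinfun_inner_right cG]
        by (simp add: split_beta)
    qed
    moreover have "integral (cbox 0 1) (\<lambda>t. blinfun_inner_right (G x t)) = blinfun_inner_right (P x)"
      using has_integral_linear[OF GI[OF x] bounded_linear_blinfun_inner_right]
      by (intro integral_unique) (simp add: o_def)
    moreover have "u = (\<lambda>x. integral (cbox 0 1) (\<lambda>t. P (\<gamma> x t) \<bullet> (x - p)))"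
      by (simp add: u_def[abs_def])
    moreover have "blinfun_apply (blinfun_inner_right (P x)) = (\<lambda>v. P x \<bullet> v)"
      by (intro ext) simp
    ultimately show ?thesis
      using at_within_open[OF x S(1)] by simp
  qed
  have duP: "dd v u x = P x \<bullet> v" if "x \<in> S" for x v by (rule dd_eqI[OF du[OF that]])
  have "smooth_on S u"
  proof (rule smooth_onI)
    show "u differentiable (at x)" if "x \<in> S" for x using du[OF that] by (auto simp: differentiable_def)
    show "smooth_on S (dd v u)" for v
      by (rule smooth_on_eq_on[OF S(1) smooth_on_bounded_linear[OF bounded_linear_inner_left S(1) P]])
        (use duP in auto)
  qed
  then show ?thesis using that duP by blast
qed

text \<open>The bound makes exp (- C t) y(t) nonincreasing; it starts at 0 and cannot become
  negative.\<close>

lemma gronwall_zero: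
  fixes y :: "real \<Rightarrow> real"
  assumes d: "\<And>t. 0 \<le> t \<Longrightarrow> t \<le> 1 \<Longrightarrow> (y has_real_derivative y' t) (at t)"
    and bound: "\<And>t. 0 \<le> t \<Longrightarrow> t \<le> 1 \<Longrightarrow> y' t \<le> C * y t" and y0: "y 0 = 0"
    and nonneg: "\<And>t. 0 \<le> t \<Longrightarrow> t \<le> 1 \<Longrightarrow> y t \<ge> 0"
  shows "y 1 = 0"
proof -
  have "(\<lambda>t. exp (- C * t) * y t) 1 \<le> (\<lambda>t. exp (- C * t) * y t) 0"
  proof (rule DERIV_nonpos_imp_nonincreasing[where f="\<lambda>t. exp (- C * t) * y t"])
    fix t :: real assume t: "0 \<le> t" "t \<le> 1"
    have "((\<lambda>t. exp (- C * t) * y t) has_real_derivative exp (- C * t) * (y' t - C * y t)) (at t)"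
      using d[OF t] by (auto intro!: derivative_eq_intros simp: algebra_simps)
    moreover have "exp (- C * t) * (y' t - C * y t) \<le> 0"
      using bound[OF t] by (simp add: mult_le_0_iff)
    ultimately show "\<exists>z. ((\<lambda>t. exp (- C * t) * y t) has_real_derivative z) (at t) \<and> z \<le> 0" by blast
  qed simp
  then have "exp (- C) * y 1 \<le> 0" using y0 by simp
  then have "y 1 \<le> 0" by (simp add: mult_le_0_iff)
  then show ?thesis using nonneg[of 1] by simp
qed

section \<open>Algebraic curvature tensors\<close>

text \<open>\<open>T a b c d\<close> stands for the inner product of R(a,b)c with d, so
  \<open>T a b b a\<close> is the unnormalized sectional curvature. Linearity is required in the
  first argument and carried over to the others by the symmetries.\<close>

definition curvature_like :: "('e::real_vector \<Rightarrow> 'e \<Rightarrow> 'e \<Rightarrow> 'e \<Rightarrow> real) \<Rightarrow> bool" where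
  "curvature_like T \<longleftrightarrow> (\<forall>b c d. linear (\<lambda>a. T a b c d)) \<and> (\<forall>a b c d. T b a c d = - T a b c d) \<and>
     (\<forall>a b c d. T a b d c = - T a b c d) \<and> (\<forall>a b c d. T a b c d + T b c a d + T c a b d = 0)"

context
  fixes T :: "'e::real_vector \<Rightarrow> 'e \<Rightarrow> 'e \<Rightarrow> 'e \<Rightarrow> real"
  assumes T: "curvature_like T"
begin

lemma curvature_like_antisym: "T b a c d = - T a b c d" "T a b d c = - T a b c d"
  and curvature_like_bianchi: "T a b c d + T b c a d + T c a b d = 0"
  and curvature_like_linear1: "linear (\<lambda>a. T a b c d)"
  using T unfolding curvature_like_def by blast+

text \<open>Octahedron argument: take the Bianchi identity for each of the four choices of the last
  argument; in a suitable combination the antisymmetries cancel everything but the two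
  sides.\<close>

lemma curvature_like_pair: "T a b c d = T c d a b"
  using curvature_like_bianchi[of d b c a] curvature_like_bianchi[of b c a d]
    curvature_like_bianchi[of c a d b] curvature_like_bianchi[of a d b c]
    curvature_like_antisym(1)[of d b c a] curvature_like_antisym(2)[of b d a c]
    curvature_like_antisym(1)[of b c] curvature_like_antisym(1)[of c a] curvature_like_antisym(1)[of a d]
    curvature_like_antisym(1)[of a b] curvature_like_antisym(1)[of c d] curvature_like_antisym(1)[of b d]
    curvature_like_antisym(2)[of b c] curvature_like_antisym(2)[of c a] curvature_like_antisym(2)[of a d]
    curvature_like_antisym(2)[of a b] curvature_like_antisym(2)[of c d] curvature_like_antisym(2)[of b d]
    curvature_like_antisym(2)[of d b]
  by smt

lemma curvature_like_linear:
  "linear (\<lambda>b. T a b c d)" "linear (\<lambda>c. T a b c d)" "linear (\<lambda>d. T a b c d)"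
proof -
  have "(\<lambda>b. T a b c d) = (\<lambda>b. - T b a c d)" for a c d using curvature_like_antisym(1) by blast
  then show 1: "linear (\<lambda>b. T a b c d)" for a c d
    using linear_compose_neg[OF curvature_like_linear1] by simp
  have "(\<lambda>c. T a b c d) = (\<lambda>c. T c d a b)" using curvature_like_pair by blast
  then show "linear (\<lambda>c. T a b c d)" using curvature_like_linear1 by simp
  have "(\<lambda>d. T a b c d) = (\<lambda>d. T c d a b)" using curvature_like_pair by blast
  then show "linear (\<lambda>d. T a b c d)" using 1 by simp
qed

text \<open>Polarizing in the inner pair and then in the outer pair makes \<open>T\<close>
  antisymmetric under exchange of \<open>b\<close> and \<open>c\<close>. The three terms of the
  Bianchi identity then coincide.\<close>

lemma curvature_like_zero:
  assumes z: "\<And>a b. T a b b a = 0"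
  shows "T a b c d = 0"
proof -
  have 1: "T a b c a = 0" for a b c
  proof -
    have "T a (b + c) (b + c) a = T a b b a + T a b c a + (T a c b a + T a c c a)"
      by (simp only: linear_add[OF curvature_like_linear(1)] linear_add[OF curvature_like_linear(2)])
    moreover have "T a c b a = T a b c a"
      using curvature_like_pair[of a c b a] curvature_like_antisym(1)[of b a a c]
        curvature_like_antisym(2)[of a b a c] by simp
    ultimately show ?thesis using z[of a "b + c"] z[of a b] z[of a c] by linarith
  qed
  have 2: "T a b c d = - T d b c a" for a b c d
  proof -
    have "T (a + d) b c (a + d) = T a b c a + T d b c a + (T a b c d + T d b c d)"
      by (simp only: linear_add[OF curvature_like_linear1] linear_add[OF curvature_like_linear(3)])
    then show ?thesis using 1[of "a + d" b c] 1[of a b c] 1[of d b c] by linarith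
  qed
  have 3: "T a b c d = - T a c b d" for a b c d
    using 2[of a b c d] curvature_like_pair[of d b c a] curvature_like_antisym(1)[of c a d b]
      curvature_like_antisym(2)[of a c d b] by simp
  show ?thesis
    using 3[of a b c d] 3[of b c a d] curvature_like_antisym(1)[of b a c d]
      curvature_like_antisym(1)[of a c b d] curvature_like_bianchi[of a b c d] by simp
qed

end

lemma curvature_like_diff:
  assumes T: "curvature_like T" and T': "curvature_like T'"
  shows "curvature_like (\<lambda>a b c d. T a b c d - T' a b c d)"
  unfolding curvature_like_def
proof (intro conjI allI)
  fix a b c d
  show "linear (\<lambda>a. T a b c d - T' a b c d)"
    by (intro linear_compose_sub curvature_like_linear1 T T')
  show "T b a c d - T' b a c d = - (T a b c d - T' a b c d)"
    using curvature_like_antisym(1)[OF T, of a b c d] curvature_like_antisym(1)[OF T', of a b c d] by simp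
  show "T a b d c - T' a b d c = - (T a b c d - T' a b c d)"
    using curvature_like_antisym(2)[OF T, of a b c d] curvature_like_antisym(2)[OF T', of a b c d] by simp
  show "T a b c d - T' a b c d + (T b c a d - T' b c a d) + (T c a b d - T' c a b d) = 0"
    using curvature_like_bianchi[OF T, of a b c d] curvature_like_bianchi[OF T', of a b c d] by simp
qed

text \<open>An antisymmetric pair of arguments enters only through its determinant, because the
  second exterior power of a plane is a line.\<close>

lemma curvature_like_two_dim:
  fixes T :: "'e::euclidean_space \<Rightarrow> 'e \<Rightarrow> 'e \<Rightarrow> 'e \<Rightarrow> real"
  assumes T: "curvature_like T" and B: "Basis = {i, j}" "i \<noteq> j"
  shows "T a b c d = - T i j j i * ((a \<bullet> i) * (b \<bullet> j) - (a \<bullet> j) * (b \<bullet> i))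
    * ((c \<bullet> i) * (d \<bullet> j) - (c \<bullet> j) * (d \<bullet> i))"
proof -
  have e: "x = (x \<bullet> i) *\<^sub>R i + (x \<bullet> j) *\<^sub>R j" for x
    using euclidean_representation[of x, symmetric] unfolding B(1) using B(2) by simp
  have z: "T x x c d = 0" "T c d x x = 0" for x c d
    using curvature_like_antisym[OF T, of x x c d] curvature_like_antisym[OF T, of c d x x] by auto
  note lin = linear_add[OF curvature_like_linear1[OF T]] linear_add[OF curvature_like_linear(1)[OF T]]
    linear_add[OF curvature_like_linear(2)[OF T]] linear_add[OF curvature_like_linear(3)[OF T]]
    linear_scale[OF curvature_like_linear1[OF T]] linear_scale[OF curvature_like_linear(1)[OF T]]
    linear_scale[OF curvature_like_linear(2)[OF T]] linear_scale[OF curvature_like_linear(3)[OF T]]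
  have 1: "T a b c d = ((a \<bullet> i) * (b \<bullet> j) - (a \<bullet> j) * (b \<bullet> i)) * T i j c d" for a b c d
    by (subst e[of a], subst e[of b])
      (simp add: lin z curvature_like_antisym(1)[OF T, of j i] algebra_simps del: scaleR_conv_of_real)
  have "T i j c d = ((c \<bullet> i) * (d \<bullet> j) - (c \<bullet> j) * (d \<bullet> i)) * T i j i j"
    using 1[of c d i j] curvature_like_pair[OF T] by metis
  then show ?thesis
    using 1[of a b c d] curvature_like_antisym(2)[OF T, of i j j i] by simp
qed

lemma linear_dd_family:
  fixes A :: "'x::euclidean_space \<Rightarrow> 'e::euclidean_space \<Rightarrow> 'w::real_normed_vector"
  assumes S: "open S" "x \<in> S" and lin: "\<And>x. x \<in> S \<Longrightarrow> linear (A x)"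
    and A: "\<And>b. (\<lambda>x. A x b) differentiable (at x)"
  shows "linear (\<lambda>b. dd v (\<lambda>z. A z b) x)"
proof (rule linearI)
  show "dd v (\<lambda>z. A z (a + b)) x = dd v (\<lambda>z. A z a) x + dd v (\<lambda>z. A z b) x" for a b
    unfolding dd_add[OF A A, symmetric]
    by (rule dd_eq_on[OF S]) (rule linear_add[OF lin])
  show "dd v (\<lambda>z. A z (c *\<^sub>R b)) x = c *\<^sub>R dd v (\<lambda>z. A z b) x" for c b
    unfolding dd_bounded_linear[OF bounded_linear_scaleR_right A, symmetric]
    by (rule dd_eq_on[OF S]) (rule linear_scale[OF lin])
qed

section \<open>Riemannian metrics in a chart\<close>

text \<open>
  \<open>Gl\<close> are the Christoffel symbols and \<open>Rlow\<close> is the curvature tensor, both with the last index lowered;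
  in this form only derivatives of the metric occur, and none of its inverse.
\<close>

locale metric_chart =
  fixes S :: "'e::euclidean_space set" and g :: "'e \<Rightarrow> 'e \<Rightarrow> 'e \<Rightarrow> real"
  assumes open_S: "open S" and metric: "riemannian_metric_on S g"
begin

definition Gl :: "'e \<Rightarrow> 'e \<Rightarrow> 'e \<Rightarrow> 'e \<Rightarrow> real" where
  "Gl x u v w = (dd u (\<lambda>y. g y v w) x + dd v (\<lambda>y. g y u w) x - dd w (\<lambda>y. g y u v) x) / 2"

definition Rlow :: "'e \<Rightarrow> 'e \<Rightarrow> 'e \<Rightarrow> 'e \<Rightarrow> 'e \<Rightarrow> real" where
  "Rlow x u v w z = dd u (\<lambda>y. Gl y v w z) x - dd v (\<lambda>y. Gl y u w z) x
     - g x (christoffel g x v w) (christoffel g x u z)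
     + g x (christoffel g x u w) (christoffel g x v z)"

lemma smooth_g: "smooth_on S (\<lambda>x. g x u v)"
  using metric by (auto simp: riemannian_metric_on_def)

lemmas diff_g = smooth_onD[OF smooth_g]

lemma g_sym: "x \<in> S \<Longrightarrow> g x u v = g x v u"
  using metric by (auto simp: riemannian_metric_on_def)

lemma g_pos: "x \<in> S \<Longrightarrow> u \<noteq> 0 \<Longrightarrow> g x u u > 0"
  using metric by (auto simp: riemannian_metric_on_def)

lemma g_bilinear: "x \<in> S \<Longrightarrow> bilinear (g x)"
  using metric by (auto simp: riemannian_metric_on_def)

lemmas g_simps =
  bilinear_ladd[OF g_bilinear] bilinear_radd[OF g_bilinear] bilinear_lmul[OF g_bilinear]
  bilinear_rmul[OF g_bilinear] bilinear_lneg[OF g_bilinear] bilinear_rneg[OF g_bilinear]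
  bilinear_lsub[OF g_bilinear] bilinear_rsub[OF g_bilinear] bilinear_lzero[OF g_bilinear]
  bilinear_rzero[OF g_bilinear]

lemma g_linear: "x \<in> S \<Longrightarrow> linear (g x u)" "x \<in> S \<Longrightarrow> linear (\<lambda>u. g x u v)"
  using g_bilinear by (auto simp: bilinear_def)

lemma g_nondegenerate: "x \<in> S \<Longrightarrow> (\<And>w. g x z w = g x z' w) \<Longrightarrow> z = z'"
  using g_pos[of x "z - z'"] by (force simp: g_simps)

text \<open>The matrix \<open>G\<close> of \<open>g x\<close> in \<open>Basis\<close> is injective
  by positivity, hence surjective in finite dimension.\<close>

lemma g_represents:
  assumes "x \<in> S" "linear l"
  shows "\<exists>z. \<forall>w. g x z w = l w"
proof -
  define G where "G z = (\<Sum>b\<in>Basis. g x z b *\<^sub>R b)" for z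
  have G: "G z \<bullet> w = g x z w" for z w
    using linear_sum_Basis[OF g_linear(1)[OF assms(1)], of z w]
    by (simp add: G_def inner_sum_left inner_sum_right mult.commute inner_commute[of _ w])
  have lin: "linear G"
    unfolding G_def by (rule linearI) (simp_all add: g_simps assms algebra_simps sum.distrib scaleR_sum_right)
  have "inj G"
    unfolding linear_injective_0[OF lin] using g_pos[OF assms(1)] G by (metis inner_zero_left less_irrefl)
  then have "surj G" using lin linear_injective_imp_surjective by blast
  then obtain z where "G z = (\<Sum>b\<in>Basis. l b *\<^sub>R b)" by (metis surjD)
  then have "g x z w = l w" for w
    using G[of z w] linear_sum_Basis[OF assms(2), of w]
    by (simp add: inner_sum_left inner_sum_right mult.commute inner_commute[of _ w])
  then show ?thesis by blast
qed

lemma smooth_Gl: "smooth_on S (\<lambda>x. Gl x u v w)"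
  unfolding Gl_def divide_inverse
  by (intro smooth_intros smooth_on_dd[OF smooth_g] open_S)

lemmas diff_Gl = smooth_onD[OF smooth_Gl]

lemma dd_g_sym: "x \<in> S \<Longrightarrow> dd a (\<lambda>y. g y u v) x = dd a (\<lambda>y. g y v u) x"
  by (rule dd_eq_on[OF open_S]) (auto simp: g_sym)

lemma Gl_sym: "x \<in> S \<Longrightarrow> Gl x u v w = Gl x v u w"
  unfolding Gl_def using dd_g_sym[where u=u and v=v] by simp

text \<open>Compatibility of the Levi-Civita connection with the metric, in lowered form.\<close>

lemma dd_g: "x \<in> S \<Longrightarrow> dd u (\<lambda>y. g y v w) x = Gl x u v w + Gl x u w v"
  unfolding Gl_def
  using dd_g_sym[where u=v and v=w] dd_g_sym[where u=u and v=w] dd_g_sym[where u=u and v=v] by (simp add: field_simps)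

lemma Gl_linear:
  assumes x: "x \<in> S"
  shows "linear (\<lambda>u. Gl x u v w)" "linear (\<lambda>v. Gl x u v w)" "linear (\<lambda>w. Gl x u v w)"
proof -
  have 1: "linear (\<lambda>u. dd v (\<lambda>y. g y u w) x)" "linear (\<lambda>u. dd v (\<lambda>y. g y w u) x)"
    "linear (\<lambda>u. dd u (\<lambda>y. g y v w) x)" for v w
    using linear_dd_family[OF open_S x, of "\<lambda>y u. g y u w" v]
      linear_dd_family[OF open_S x, of "\<lambda>y u. g y w u" v] linear_dd[OF diff_g[OF x]]
      g_linear diff_g[OF x] by auto
  have 2: "linear (\<lambda>u. (a u + b u - c u) / 2)" if "linear a" "linear b" "linear c"
    for a b c :: "'e \<Rightarrow> real"
    by (rule linearI) (simp_all add: linear_add[OF that(1)] linear_add[OF that(2)] linear_add[OF that(3)]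
        linear_scale[OF that(1)] linear_scale[OF that(2)] linear_scale[OF that(3)] field_simps)
  show "linear (\<lambda>u. Gl x u v w)" "linear (\<lambda>v. Gl x u v w)" "linear (\<lambda>w. Gl x u v w)"
    unfolding Gl_def by (intro 2 1)+
qed

text \<open>The \<open>THE\<close> in \<open>christoffel\<close> is discharged here: existence by
  \<open>g_represents\<close>, uniqueness by nondegeneracy. Afterwards the connection is handled
  through \<open>Gl\<close>.\<close>

lemma g_christoffel:
  assumes x: "x \<in> S"
  shows "g x (christoffel g x u v) w = Gl x u v w"
proof -
  obtain z where z: "\<forall>w. g x z w = Gl x u v w"
    using g_represents[OF x Gl_linear(3)[OF x]] by blast
  have "\<forall>w. g x (christoffel g x u v) w =
      (dd u (\<lambda>y. g y v w) x + dd v (\<lambda>y. g y u w) x - dd w (\<lambda>y. g y u v) x) / 2"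
    unfolding christoffel_def
  proof (rule theI[of _ z])
    fix y assume "\<forall>w. g x y w = (dd u (\<lambda>y. g y v w) x + dd v (\<lambda>y. g y u w) x - dd w (\<lambda>y. g y u v) x) / 2"
    then have "g x y w = g x z w" for w using z unfolding Gl_def by metis
    then show "y = z" by (rule g_nondegenerate[OF x])
  qed (use z in \<open>simp add: Gl_def\<close>)
  then show ?thesis by (simp add: Gl_def)
qed

lemma christoffel_eqI:
  "x \<in> S \<Longrightarrow> (\<And>w. g x z w = Gl x u v w) \<Longrightarrow> christoffel g x u v = z"
  by (rule g_nondegenerate) (auto simp: g_christoffel)

lemma christoffel_sym: "x \<in> S \<Longrightarrow> christoffel g x u v = christoffel g x v u"
  by (rule christoffel_eqI) (auto simp: g_christoffel Gl_sym)

lemma christoffel_linear: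
  assumes x: "x \<in> S"
  shows "linear (\<lambda>u. christoffel g x u v)" "linear (\<lambda>v. christoffel g x u v)"
proof -
  show 1: "linear (\<lambda>u. christoffel g x u v)" for v
    by (rule linearI; rule christoffel_eqI[OF x])
      (simp_all add: g_simps x g_christoffel linear_add[OF Gl_linear(1)[OF x]] linear_scale[OF Gl_linear(1)[OF x]])
  show "linear (\<lambda>v. christoffel g x u v)"
    using 1[of u] christoffel_sym[OF x, of u] by simp
qed

lemma g_inj: "x \<in> S \<Longrightarrow> inj (\<lambda>z. \<Sum>b\<in>Basis. g x z b *\<^sub>R b)"
  and g_sum_linear: "x \<in> S \<Longrightarrow> linear (\<lambda>z. \<Sum>b\<in>Basis. g x z b *\<^sub>R b)"
proof -
  assume x: "x \<in> S"
  show "inj (\<lambda>z. \<Sum>b\<in>Basis. g x z b *\<^sub>R b)"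
  proof (rule injI, rule g_nondegenerate[OF x])
    fix z z' w assume "(\<Sum>b\<in>Basis. g x z b *\<^sub>R b) = (\<Sum>b\<in>Basis. g x z' b *\<^sub>R b)"
    then have "g x z b = g x z' b" if "b \<in> Basis" for b
      using that euclidean_eq_iff[of "\<Sum>b\<in>Basis. g x z b *\<^sub>R b" "\<Sum>b\<in>Basis. g x z' b *\<^sub>R b"]
      by simp
    then show "g x z w = g x z' w"
      using linear_sum_Basis[OF g_linear(1)[OF x], of z w] linear_sum_Basis[OF g_linear(1)[OF x], of z' w]
      by simp
  qed
  show "linear (\<lambda>z. \<Sum>b\<in>Basis. g x z b *\<^sub>R b)"
    by (rule linearI) (simp_all add: g_simps x algebra_simps sum.distrib scaleR_sum_right)
qed

text \<open>Raising an index keeps smoothness: \<open>z\<close> solves a linear system whose matrix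
  is that of the metric, so \<open>smooth_on_linear_solve\<close> takes the place of a formula with
  the inverse matrix.\<close>

lemma smooth_solve:
  assumes "\<And>x w. x \<in> S \<Longrightarrow> g x (z x) w = l x w" and "\<And>w. smooth_on S (\<lambda>x. l x w)"
  shows "smooth_on S z"
proof (rule smooth_on_linear_solve[where A="\<lambda>x z. \<Sum>b\<in>Basis. g x z b *\<^sub>R b"])
  show "smooth_on S (\<lambda>x. \<Sum>b\<in>Basis. l x b *\<^sub>R b)"
    by (intro smooth_intros open_S assms)
  show "smooth_on S (\<lambda>x. \<Sum>b\<in>Basis. g x c b *\<^sub>R b)" for c
    by (intro smooth_intros open_S smooth_g)
qed (use assms open_S g_inj g_sum_linear in auto)

lemma smooth_christoffel: "smooth_on S (\<lambda>x. christoffel g x u v)"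
  by (rule smooth_solve[OF g_christoffel smooth_Gl])

lemma smooth_g_apply [smooth_intros]:
  assumes "smooth_on S y" "smooth_on S z"
  shows "smooth_on S (\<lambda>x. g x (y x) (z x))"
proof (rule smooth_on_linear_family[where A="\<lambda>x b. g x (y x) b", OF open_S g_linear(1) _ assms(2)])
  show "smooth_on S (\<lambda>x. g x (y x) b)" for b
    by (rule smooth_on_linear_family[where A="\<lambda>x c. g x c b", OF open_S g_linear(2) smooth_g assms(1)])
qed

lemma dd_g_apply:
  assumes x: "x \<in> S" and y: "y differentiable (at x)" and z: "z differentiable (at x)"
  shows "dd u (\<lambda>x. g x (y x) (z x)) x
    = Gl x u (y x) (z x) + Gl x u (z x) (y x) + g x (dd u y x) (z x) + g x (y x) (dd u z x)"
proof -
  have 1: "((\<lambda>a. g a (y a) b) has_derivative (\<lambda>v. dd v (\<lambda>a. g a (y x) b) x + g x (dd v y x) b)) (at x)"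
    for b
    by (rule linear_family_derivative[OF open_S x, where A="\<lambda>a c. g a c b"])
      (use x g_linear diff_g y in auto)
  have "((\<lambda>a. g a (y a) (z a)) has_derivative
      (\<lambda>v. dd v (\<lambda>a. g a (y a) (z x)) x + g x (y x) (dd v z x))) (at x)"
    by (rule linear_family_derivative[OF open_S x, where A="\<lambda>a c. g a (y a) c"])
      (use 1 x g_linear z in \<open>auto simp: differentiable_def\<close>)
  from dd_eqI[OF this, of u] dd_eqI[OF 1[of "z x"], of u] show ?thesis by (simp add: dd_g x)
qed

text \<open>Lowering the index of the derivative of \<open>christoffel\<close> costs two terms from
  the derivative of the metric. One cancels the iterated Christoffel term of
  \<open>curvature_tensor\<close>, the other is the quadratic term of \<open>Rlow\<close>.\<close>

lemma curvature_low:
  assumes x: "x \<in> S"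
  shows "g x (curvature_tensor g x u v w) z = Rlow x u v w z"
proof -
  have d: "(\<lambda>x. christoffel g x a b) differentiable (at x)" for a b
    by (rule smooth_onD[OF smooth_christoffel x])
  have 1: "g x (dd u (\<lambda>y. christoffel g y v w) x) z =
      dd u (\<lambda>y. Gl y v w z) x - Gl x u (christoffel g x v w) z - Gl x u z (christoffel g x v w)"
    for u v w
  proof -
    have "dd u (\<lambda>y. g y (christoffel g y v w) z) x = dd u (\<lambda>y. Gl y v w z) x"
      by (rule dd_eq_on[OF open_S x g_christoffel])
    then show ?thesis
      using dd_g_apply[OF x d[of v w] differentiable_const[of z], of u] by (simp add: g_simps x)
  qed
  show ?thesis
    unfolding curvature_tensor_def Rlow_def
    by (simp add: g_simps x 1 g_christoffel)
      (simp add: g_christoffel[OF x, symmetric] g_sym[OF x])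
qed

lemma Rlow_curvature_like:
  assumes x: "x \<in> S"
  shows "curvature_like (Rlow x)"
  unfolding curvature_like_def
proof (intro conjI allI)
  fix a b c d
  have l: "linear (\<lambda>a. dd b (\<lambda>y. Gl y a c d) x)"
    by (rule linear_dd_family[OF open_S x]) (auto intro: Gl_linear diff_Gl x)
  have l2: "linear (\<lambda>a. dd a (\<lambda>y. Gl y b c d) x)" by (rule linear_dd[OF diff_Gl[OF x]])
  note c = christoffel_linear(1)[OF x]
  show "linear (\<lambda>a. Rlow x a b c d)"
    unfolding Rlow_def
    by (rule linearI) (simp_all add: linear_add[OF l] linear_add[OF l2] linear_add[OF c]
        linear_scale[OF l] linear_scale[OF l2] linear_scale[OF c] g_simps x algebra_simps)
  show "Rlow x b a c d = - Rlow x a b c d" by (simp add: Rlow_def)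
  have s: "dd a (\<lambda>y. Gl y u v w) x = dd a (\<lambda>y. Gl y v u w) x" for a u v w
    by (rule dd_eq_on[OF open_S x Gl_sym])
  show "Rlow x a b c d + Rlow x b c a d + Rlow x c a b d = 0"
    unfolding Rlow_def
    using s[where a=a and u=b and v=c and w=d] s[where a=b and u=c and v=a and w=d] s[where a=c and u=a and v=b and w=d]
      christoffel_sym[OF x, of a b] christoffel_sym[OF x, of b c] christoffel_sym[OF x, of c a]
      g_sym[OF x, of "christoffel g x a b"] g_sym[OF x, of "christoffel g x b c"]
      g_sym[OF x, of "christoffel g x c a"] by simp
  \<comment> \<open>Symmetrized in its last two arguments, \<open>Gl\<close> is a derivative of the
    metric. Antisymmetry of \<open>Rlow\<close> in the last pair thus comes down to commuting second
    derivatives of \<open>g\<close>.\<close>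
  have e: "dd a (\<lambda>y. Gl y b c d) x + dd a (\<lambda>y. Gl y b d c) x = dd a (dd b (\<lambda>y. g y c d)) x" for a b
    unfolding dd_add[OF diff_Gl[OF x] diff_Gl[OF x], symmetric]
    by (rule dd_eq_on[OF open_S x]) (simp add: dd_g)
  show "Rlow x a b d c = - Rlow x a b c d"
    unfolding Rlow_def
    using e[where a=a and b=b] e[where a=b and b=a]
      dd_commute[OF open_S x smooth_g[of c d], where u=a and v=b]
      g_sym[OF x, of "christoffel g x b c"] g_sym[OF x, of "christoffel g x a c"] by simp
qed

text \<open>Strict Cauchy-Schwarz inequality: the Gram determinant is \<open>g x v v\<close> times
  the squared length of the component \<open>w\<close> of \<open>u\<close> orthogonal to
  \<open>v\<close>.\<close>

lemma gram_pos:
  assumes x: "x \<in> S" and uv: "u \<noteq> v" "independent {u, v}"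
  shows "g x u u * g x v v - (g x u v)\<^sup>2 > 0"
proof -
  have v: "v \<noteq> 0" using uv dependent_zero by blast
  define w where "w = u - (g x u v / g x v v) *\<^sub>R v"
  have "w \<noteq> 0"
  proof
    assume "w = 0"
    then have "u = (g x u v / g x v v) *\<^sub>R v" by (simp add: w_def)
    then have "u \<in> span {v}" by (metis span_base span_mul insertI1)
    then show False using uv by (simp add: independent_insert)
  qed
  then have "g x w w > 0" by (rule g_pos[OF x])
  moreover have "g x v v > 0" by (rule g_pos[OF x v])
  moreover have "g x w w * g x v v = g x u u * g x v v - (g x u v)\<^sup>2"
    using \<open>g x v v > 0\<close> by (simp add: w_def g_simps x g_sym[OF x, of v u] power2_eq_square field_simps)
  ultimately show ?thesis by (metis mult_pos_pos)
qed

text \<open>This is the curvature tensor of a space form, a multiple of the Kulkarni-Nomizu square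
  of the metric.\<close>

lemma kulkarni_curvature_like:
  assumes x: "x \<in> S"
  shows "curvature_like (\<lambda>a b c d. k * (g x b c * g x a d - g x a c * g x b d))"
  unfolding curvature_like_def
  by (auto intro!: linearI simp: g_simps x algebra_simps g_sym[OF x])

text \<open>The difference \<open>T\<close> from the tensor of a space form has vanishing sectional
  values, so \<open>curvature_like_zero\<close> applies to it.\<close>

lemma constant_sectional_Rlow:
  assumes x: "x \<in> S" and k: "\<And>u v. u \<noteq> v \<Longrightarrow> independent {u, v} \<Longrightarrow> sectional_curvature g x u v = k"
  shows "Rlow x a b c d = k * (g x b c * g x a d - g x a c * g x b d)"
proof -
  define T where "T a b c d = Rlow x a b c d - k * (g x b c * g x a d - g x a c * g x b d)" for a b c d
  have T: "curvature_like T"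
    unfolding T_def
    by (rule curvature_like_diff[OF Rlow_curvature_like[OF x] kulkarni_curvature_like[OF x]])
  have "T u v v u = 0" for u v
  proof (cases "u \<noteq> v \<and> independent {u, v}")
    case True
    then have "Rlow x u v v u / (g x u u * g x v v - (g x u v)\<^sup>2) = k"
      using k[of u v] by (simp add: sectional_curvature_def curvature_low x)
    then have "Rlow x u v v u = k * (g x u u * g x v v - (g x u v)\<^sup>2)"
      using gram_pos[OF x, of u v] True by (simp add: field_simps)
    then show ?thesis by (simp add: T_def power2_eq_square g_sym[OF x, of v u] algebra_simps)
  next
    case False
    \<comment> \<open>For a dependent pair \<open>sectional_curvature\<close> divides by zero and
      carries no information; here antisymmetry supplies the value 0.\<close>
    have vv: "T w w v u = 0" for w v u using curvature_like_antisym(1)[OF T, of w w v u] by simp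
    show ?thesis
    proof (cases "v = 0")
      case True
      then show ?thesis using linear_0[OF curvature_like_linear(1)[OF T]] by simp
    next
      case v: False
      have "u \<in> span {v}" using False v by (auto simp: independent_insert span_base split: if_splits)
      then obtain r where "u = r *\<^sub>R v" by (auto simp: span_singleton)
      then show ?thesis using vv linear_scale[OF curvature_like_linear1[OF T]] by simp
    qed
  qed
  then have "T a b c d = 0" by (rule curvature_like_zero[OF T])
  then show ?thesis by (simp add: T_def)
qed

lemma ricci_constant:
  assumes x: "x \<in> S" and R: "\<And>a b c d. Rlow x a b c d = k * (g x b c * g x a d - g x a c * g x b d)"
  shows "ricci g x v w = k * (real DIM('e) - 1) * g x v w"
proof -
  have "curvature_tensor g x b v w = k *\<^sub>R (g x v w *\<^sub>R b - g x b w *\<^sub>R v)" for b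
    by (rule g_nondegenerate[OF x]) (simp add: curvature_low x R g_simps algebra_simps)
  then have "ricci g x v w = (\<Sum>b\<in>Basis. k * (g x v w - g x b w * (v \<bullet> b)))"
    unfolding ricci_def by (intro sum.cong) (auto simp: inner_diff_left)
  also have "\<dots> = k * (g x v w * DIM('e) - g x v w)"
    using linear_sum_Basis[OF g_linear(2)[OF x], of v w]
    by (simp add: sum_distrib_left[symmetric] sum_subtractf mult.commute[of _ "v \<bullet> _"])
  finally show ?thesis by (simp add: algebra_simps)
qed

end

section \<open>Curvature in dimension two\<close>

context metric_chart
begin

text \<open>By \<open>curvature_like_two_dim\<close> both tensors are multiples of the same product
  of two determinants. Dividing by the Gram determinant gives \<open>K\<close>, the Gauss
  curvature.\<close>

lemma two_dim_Rlow:
  assumes x: "x \<in> S" and dim: "DIM('e) = 2"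
  obtains K where "\<And>a b c d. Rlow x a b c d = K * (g x b c * g x a d - g x a c * g x b d)"
proof -
  obtain i j :: 'e where B: "Basis = {i, j}" "i \<noteq> j"
    using dim by (metis card_2_iff)
  let ?D = "g x i i * g x j j - (g x i j)\<^sup>2"
  have "independent {i, j}" using independent_Basis B by metis
  then have D: "?D > 0" using gram_pos[OF x B(2)] by blast
  have e: "v = (v \<bullet> i) *\<^sub>R i + (v \<bullet> j) *\<^sub>R j" for v
    using euclidean_representation[of v, symmetric] unfolding B(1) using B(2) by simp
  have gv: "g x u v = (u \<bullet> i) * (v \<bullet> i) * g x i i + (u \<bullet> i) * (v \<bullet> j) * g x i j
      + (u \<bullet> j) * (v \<bullet> i) * g x i j + (u \<bullet> j) * (v \<bullet> j) * g x j j" for u v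
    by (subst e[of u], subst e[of v]) (simp add: g_simps x g_sym[OF x, of j i] algebra_simps)
  have "Rlow x a b c d = (Rlow x i j j i / ?D) * (g x b c * g x a d - g x a c * g x b d)" for a b c d
  proof -
    have k: "g x b c * g x a d - g x a c * g x b d =
        - ?D * ((a \<bullet> i) * (b \<bullet> j) - (a \<bullet> j) * (b \<bullet> i)) * ((c \<bullet> i) * (d \<bullet> j) - (c \<bullet> j) * (d \<bullet> i))"
      unfolding gv[of b c] gv[of a d] gv[of a c] gv[of b d] power2_eq_square
      by (simp add: algebra_simps)
    have 3: "(r / D) * (- D * p * q) = - r * p * q" if "D > 0" for r D p q :: real
      using that by simp
    show ?thesis
      unfolding k curvature_like_two_dim[OF Rlow_curvature_like[OF x] B, of a b c d] by (rule 3[OF D, symmetric])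
  qed
  then show ?thesis using that by blast
qed

end

section \<open>Warped products in a chart\<close>

text \<open>
  \<open>Z\<close> is the gradient of the warping function \<open>w\<close>, \<open>q\<close> the square of its norm and \<open>H\<close> the Hessian of \<open>w\<close>.
\<close>

locale warped_chart =
  L: metric_chart S1 gL + F: metric_chart S2 gF
  for S1 :: "'d::euclidean_space set" and gL and S2 :: "'e::euclidean_space set" and gF +
  fixes w :: "'d \<Rightarrow> real"
  assumes smooth_w: "smooth_on S1 w" and w_pos: "\<And>x. x \<in> S1 \<Longrightarrow> w x > 0"
begin

definition gM :: "'d \<times> 'e \<Rightarrow> 'd \<times> 'e \<Rightarrow> 'd \<times> 'e \<Rightarrow> real" where
  "gM = (\<lambda>(x, y) (u1, u2) (v1, v2). gL x u1 v1 + (w x)\<^sup>2 * gF y u2 v2)"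

lemma gM_eq: "gM x u v = gL (fst x) (fst u) (fst v) + (w (fst x))\<^sup>2 * gF (snd x) (snd u) (snd v)"
  by (simp add: gM_def split_beta)

definition Z :: "'d \<Rightarrow> 'd" where "Z x = (SOME z. \<forall>v. gL x z v = dd v w x)"

definition q :: "'d \<Rightarrow> real" where "q x = gL x (Z x) (Z x)"

definition H :: "'d \<Rightarrow> 'd \<Rightarrow> 'd \<Rightarrow> real" where
  "H x u v = dd u (dd v w) x - dd (christoffel gL x u v) w x"

lemmas diff_w = smooth_onD[OF smooth_w]
lemmas diff_dw = smooth_onD[OF smooth_on_dd[OF smooth_w]]
lemmas linear_dw = linear_dd[OF diff_w]

lemma gL_Z: "x \<in> S1 \<Longrightarrow> gL x (Z x) v = dd v w x"
  using someI_ex[OF L.g_represents[OF _ linear_dw]] unfolding Z_def by blast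

lemma gL_Z': "x \<in> S1 \<Longrightarrow> gL x v (Z x) = dd v w x"
  using gL_Z L.g_sym by metis

lemma smooth_Z: "smooth_on S1 Z"
  by (rule L.smooth_solve[OF gL_Z smooth_on_dd[OF smooth_w]])

lemma smooth_q: "smooth_on S1 q"
  unfolding q_def[abs_def] by (rule L.smooth_g_apply[OF smooth_Z smooth_Z])

lemma q_eq: "x \<in> S1 \<Longrightarrow> q x = dd (Z x) w x"
  by (simp add: q_def gL_Z)

lemma q_pos_iff: "x \<in> S1 \<Longrightarrow> q x > 0 \<longleftrightarrow> (\<exists>v. dd v w x \<noteq> 0)"
  unfolding q_def using gL_Z L.g_pos[of x "Z x"] L.g_simps(9,10)[of x]
  by (metis less_irrefl)

text \<open>Differentiating g(Z, v) = dw(v) along \<open>u\<close>: the covariant derivative of the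
  gradient represents the Hessian.\<close>

lemma nabla_Z: "x \<in> S1 \<Longrightarrow> gL x (dd u Z x + christoffel gL x u (Z x)) v = H x u v"
proof -
  assume x: "x \<in> S1"
  have "dd u (\<lambda>x. gL x (Z x) v) x = dd u (dd v w) x"
    by (rule dd_eq_on[OF L.open_S x gL_Z])
  then have "L.Gl x u (Z x) v + L.Gl x u v (Z x) + gL x (dd u Z x) v = dd u (dd v w) x"
    using L.dd_g_apply[OF x smooth_onD[OF smooth_Z x] differentiable_const[of v], of u]
    by (simp add: L.g_simps x)
  moreover have "L.Gl x u v (Z x) = dd (christoffel gL x u v) w x"
    using L.g_christoffel[OF x, of u v "Z x"] gL_Z'[OF x] by simp
  ultimately show ?thesis by (simp add: H_def L.g_simps x L.g_christoffel)
qed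

lemma dd_q: "x \<in> S1 \<Longrightarrow> dd u q x = 2 * H x u (Z x)"
  unfolding q_def[abs_def]
  using L.dd_g_apply[OF _ smooth_onD[OF smooth_Z] smooth_onD[OF smooth_Z], of x u]
    nabla_Z[of x u "Z x"] L.g_sym[of x "Z x" "dd u Z x"]
  by (simp add: L.g_simps L.g_christoffel)

sublocale M: metric_chart "S1 \<times> S2" gM
proof
  show "open (S1 \<times> S2)" using L.open_S F.open_S by (rule open_Times)
  show "riemannian_metric_on (S1 \<times> S2) gM"
    unfolding riemannian_metric_on_def
  proof (intro conjI allI ballI)
    show "smooth_on (S1 \<times> S2) (\<lambda>x. gM x u v)" for u v
      unfolding gM_eq
      by (intro smooth_intros open_Times L.open_S F.open_S L.smooth_g F.smooth_g smooth_w)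
    fix x assume "x \<in> S1 \<times> S2"
    then have x: "fst x \<in> S1" "snd x \<in> S2" by auto
    show "bilinear (gM x)"
      unfolding bilinear_def
      by (auto intro!: linearI simp: gM_eq L.g_simps F.g_simps x algebra_simps)
    show "gM x u v = gM x v u" for u v
      by (simp add: gM_eq L.g_sym[OF x(1), of "fst u"] F.g_sym[OF x(2), of "snd u"])
    show "u \<noteq> 0 \<longrightarrow> 0 < gM x u u" for u
    proof
      assume "u \<noteq> 0"
      then consider "fst u \<noteq> 0" | "fst u = 0" "snd u \<noteq> 0" by (metis prod.collapse zero_prod_def)
      then show "0 < gM x u u"
      proof cases
        case 1
        have "gF (snd x) (snd u) (snd u) \<ge> 0"
          using F.g_pos[OF x(2), of "snd u"] F.g_simps(9)[OF x(2)] by (cases "snd u = 0") auto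
        then show ?thesis using L.g_pos[OF x(1) 1] by (simp add: gM_eq add_pos_nonneg)
      next
        case 2
        then show ?thesis
          using F.g_pos[OF x(2) 2(2)] w_pos[OF x(1)] by (simp add: gM_eq L.g_simps x)
      qed
    qed
  qed
qed

section \<open>Connection and curvature of the warped product\<close>

lemma dd_separated:
  fixes p r :: "'d \<Rightarrow> real" and s :: "'e \<Rightarrow> real"
  assumes "r differentiable (at (fst x))" "s differentiable (at (snd x))"
  shows "dd u (\<lambda>x. r (fst x) * s (snd x)) x
      = dd (fst u) r (fst x) * s (snd x) + r (fst x) * dd (snd u) s (snd x)"
    and "(\<lambda>x. r (fst x) * s (snd x)) differentiable (at x)"
proof -
  note d = differentiable_fst[OF assms(1)] differentiable_snd[OF assms(2)]
  show "dd u (\<lambda>x. r (fst x) * s (snd x)) x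
      = dd (fst u) r (fst x) * s (snd x) + r (fst x) * dd (snd u) s (snd x)"
    unfolding dd_mult[OF d] by (simp add: dd_fst[OF assms(1)] dd_snd[OF assms(2)])
  show "(\<lambda>x. r (fst x) * s (snd x)) differentiable (at x)"
    by (rule differentiable_mult[OF d])
qed

lemma dd_w2: "x \<in> S1 \<Longrightarrow> dd u (\<lambda>x. (w x)\<^sup>2) x = 2 * w x * dd u w x"
  unfolding power2_eq_square by (simp add: dd_mult diff_w)

lemma diff_w2: "x \<in> S1 \<Longrightarrow> (\<lambda>x. (w x)\<^sup>2) differentiable (at x)"
  by (simp add: diff_w)

lemma dd_gM:
  assumes x: "fst x \<in> S1" "snd x \<in> S2"
  shows "dd u (\<lambda>y. gM y v z) x = dd (fst u) (\<lambda>y. gL y (fst v) (fst z)) (fst x)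
     + (2 * w (fst x) * dd (fst u) w (fst x) * gF (snd x) (snd v) (snd z)
     + (w (fst x))\<^sup>2 * dd (snd u) (\<lambda>y. gF y (snd v) (snd z)) (snd x))"
proof -
  note a = L.diff_g[OF x(1), of "fst v" "fst z"]
  note b = dd_separated[OF diff_w2[OF x(1)] F.diff_g[OF x(2), of "snd v" "snd z"]]
  show ?thesis
    unfolding gM_eq dd_add[OF differentiable_fst[OF a] b(2)] b(1) dd_fst[OF a] dd_w2[OF x(1)] ..
qed

lemma M_Gl:
  assumes x: "fst x \<in> S1" "snd x \<in> S2"
  shows "M.Gl x b c d = L.Gl (fst x) (fst b) (fst c) (fst d)
    + ((w (fst x))\<^sup>2 * F.Gl (snd x) (snd b) (snd c) (snd d)
    + ((w (fst x) * dd (fst b) w (fst x)) * gF (snd x) (snd c) (snd d)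
    + ((w (fst x) * dd (fst c) w (fst x)) * gF (snd x) (snd b) (snd d)
    + (- w (fst x) * dd (fst d) w (fst x)) * gF (snd x) (snd b) (snd c))))"
  unfolding M.Gl_def dd_gM[OF x] L.Gl_def F.Gl_def by (simp add: field_simps)

text \<open>O'Neill's formulas: the fibers are umbilical with curvature vector - grad w / w, and a
  mixed derivative scales the vertical vector by dw / w. They are verified by pairing with every
  vector.\<close>

lemma M_christoffel:
  assumes x: "fst x \<in> S1" "snd x \<in> S2"
  shows "christoffel gM x b c =
    (christoffel gL (fst x) (fst b) (fst c) - (w (fst x) * gF (snd x) (snd b) (snd c)) *\<^sub>R Z (fst x),
     christoffel gF (snd x) (snd b) (snd c) + (dd (fst b) w (fst x) / w (fst x)) *\<^sub>R snd c
       + (dd (fst c) w (fst x) / w (fst x)) *\<^sub>R snd b)"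
proof (rule M.christoffel_eqI)
  show "x \<in> S1 \<times> S2" using x by (auto simp: mem_Times_iff)
  show "gM x (christoffel gL (fst x) (fst b) (fst c) - (w (fst x) * gF (snd x) (snd b) (snd c)) *\<^sub>R Z (fst x),
     christoffel gF (snd x) (snd b) (snd c) + (dd (fst b) w (fst x) / w (fst x)) *\<^sub>R snd c
       + (dd (fst c) w (fst x) / w (fst x)) *\<^sub>R snd b) d = M.Gl x b c d" for d
    unfolding M_Gl[OF x] gM_eq
    using w_pos[OF x(1)]
    by (simp add: L.g_simps F.g_simps x L.g_christoffel F.g_christoffel gL_Z power2_eq_square field_simps)
qed

text \<open>Each summand of \<open>M_Gl\<close> is a function of the base point times one of the
  fiber point, so \<open>dd_separated\<close> differentiates termwise. Derivatives of
  \<open>gF\<close> are rewritten by \<open>F.dd_g\<close>, which leaves lowered Christoffel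
  symbols.\<close>

lemma dd_M_Gl:
  assumes x: "fst x \<in> S1" "snd x \<in> S2"
  shows "dd a (\<lambda>y. M.Gl y b c d) x = dd (fst a) (\<lambda>y. L.Gl y (fst b) (fst c) (fst d)) (fst x)
    + ((2 * w (fst x) * dd (fst a) w (fst x)) * F.Gl (snd x) (snd b) (snd c) (snd d)
      + (w (fst x))\<^sup>2 * dd (snd a) (\<lambda>y. F.Gl y (snd b) (snd c) (snd d)) (snd x)
    + ((dd (fst a) w (fst x) * dd (fst b) w (fst x) + w (fst x) * dd (fst a) (dd (fst b) w) (fst x))
        * gF (snd x) (snd c) (snd d)
      + w (fst x) * dd (fst b) w (fst x)
        * (F.Gl (snd x) (snd a) (snd c) (snd d) + F.Gl (snd x) (snd a) (snd d) (snd c))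
    + ((dd (fst a) w (fst x) * dd (fst c) w (fst x) + w (fst x) * dd (fst a) (dd (fst c) w) (fst x))
        * gF (snd x) (snd b) (snd d)
      + w (fst x) * dd (fst c) w (fst x)
        * (F.Gl (snd x) (snd a) (snd b) (snd d) + F.Gl (snd x) (snd a) (snd d) (snd b))
    - ((dd (fst a) w (fst x) * dd (fst d) w (fst x) + w (fst x) * dd (fst a) (dd (fst d) w) (fst x))
        * gF (snd x) (snd b) (snd c)
      + w (fst x) * dd (fst d) w (fst x)
        * (F.Gl (snd x) (snd a) (snd b) (snd c) + F.Gl (snd x) (snd a) (snd c) (snd b))))))"
proof -
  have S: "open (S1 \<times> S2)" "x \<in> S1 \<times> S2" using x M.open_S by (auto simp: mem_Times_iff)
  have wd: "(\<lambda>x. w x * dd v w x) differentiable (at (fst x))"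
    "(\<lambda>x. - w x * dd v w x) differentiable (at (fst x))" for v
    by (intro differentiable_mult differentiable_minus diff_w diff_dw x)+
  have dwd: "dd u (\<lambda>x. w x * dd v w x) (fst x) = dd u w (fst x) * dd v w (fst x) + w (fst x) * dd u (dd v w) (fst x)"
    "dd u (\<lambda>x. - w x * dd v w x) (fst x)
      = - (dd u w (fst x) * dd v w (fst x) + w (fst x) * dd u (dd v w) (fst x))" for u v
    by (simp_all add: dd_mult dd_uminus diff_w diff_dw x differentiable_minus)
  note l = L.diff_Gl[OF x(1), of "fst b" "fst c" "fst d"]
  note s0 = dd_separated[OF diff_w2[OF x(1)] F.diff_Gl[OF x(2), of "snd b" "snd c" "snd d"]]
  note s1 = dd_separated[OF wd(1)[of "fst b"] F.diff_g[OF x(2), of "snd c" "snd d"]]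
  note s2 = dd_separated[OF wd(1)[of "fst c"] F.diff_g[OF x(2), of "snd b" "snd d"]]
  note s3 = dd_separated[OF wd(2)[of "fst d"] F.diff_g[OF x(2), of "snd b" "snd c"]]
  have "dd a (\<lambda>y. M.Gl y b c d) x = dd a (\<lambda>x. L.Gl (fst x) (fst b) (fst c) (fst d)
    + ((w (fst x))\<^sup>2 * F.Gl (snd x) (snd b) (snd c) (snd d)
    + ((w (fst x) * dd (fst b) w (fst x)) * gF (snd x) (snd c) (snd d)
    + ((w (fst x) * dd (fst c) w (fst x)) * gF (snd x) (snd b) (snd d)
    + (- w (fst x) * dd (fst d) w (fst x)) * gF (snd x) (snd b) (snd c))))) x"
    by (rule dd_eq_on[OF S]) (rule M_Gl; auto)
  also have "\<dots> = dd (fst a) (\<lambda>y. L.Gl y (fst b) (fst c) (fst d)) (fst x)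
    + ((2 * w (fst x) * dd (fst a) w (fst x)) * F.Gl (snd x) (snd b) (snd c) (snd d)
      + (w (fst x))\<^sup>2 * dd (snd a) (\<lambda>y. F.Gl y (snd b) (snd c) (snd d)) (snd x)
    + ((dd (fst a) w (fst x) * dd (fst b) w (fst x) + w (fst x) * dd (fst a) (dd (fst b) w) (fst x))
        * gF (snd x) (snd c) (snd d)
      + w (fst x) * dd (fst b) w (fst x)
        * dd (snd a) (\<lambda>y. gF y (snd c) (snd d)) (snd x)
    + ((dd (fst a) w (fst x) * dd (fst c) w (fst x) + w (fst x) * dd (fst a) (dd (fst c) w) (fst x))
        * gF (snd x) (snd b) (snd d)
      + w (fst x) * dd (fst c) w (fst x)
        * dd (snd a) (\<lambda>y. gF y (snd b) (snd d)) (snd x)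
    + (- (dd (fst a) w (fst x) * dd (fst d) w (fst x) + w (fst x) * dd (fst a) (dd (fst d) w) (fst x))
        * gF (snd x) (snd b) (snd c)
      + - w (fst x) * dd (fst d) w (fst x)
        * dd (snd a) (\<lambda>y. gF y (snd b) (snd c)) (snd x)))))"
    unfolding dd_add[OF differentiable_fst[OF l]
        differentiable_add[OF s0(2) differentiable_add[OF s1(2) differentiable_add[OF s2(2) s3(2)]]]]
      dd_add[OF s0(2) differentiable_add[OF s1(2) differentiable_add[OF s2(2) s3(2)]]]
      dd_add[OF s1(2) differentiable_add[OF s2(2) s3(2)]] dd_add[OF s2(2) s3(2)]
      s0(1) s1(1) s2(1) s3(1) dd_fst[OF l] dd_w2[OF x(1)] dwd ..
  finally show ?thesis by (simp add: F.dd_g x) (simp add: algebra_simps)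
qed

text \<open>The derivatives are abbreviated to opaque functions, after which the claim is a
  polynomial identity modulo the listed symmetries. The Hessian arises as \<open>D\<close> minus
  \<open>N\<close>, the second derivative of \<open>w\<close> corrected by the horizontal
  Christoffel symbol, and \<open>q\<close> as the squared length of the \<open>Z\<close> in
  \<open>M_christoffel\<close>.\<close>

lemma M_Rlow:
  assumes x: "fst x \<in> S1" "snd x \<in> S2"
  shows "M.Rlow x a b c d = L.Rlow (fst x) (fst a) (fst b) (fst c) (fst d)
    + (w (fst x))\<^sup>2 * (F.Rlow (snd x) (snd a) (snd b) (snd c) (snd d)
       - q (fst x) * (gF (snd x) (snd b) (snd c) * gF (snd x) (snd a) (snd d)
          - gF (snd x) (snd a) (snd c) * gF (snd x) (snd b) (snd d)))
    - w (fst x) * (H (fst x) (fst a) (fst d) * gF (snd x) (snd b) (snd c)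
       + H (fst x) (fst b) (fst c) * gF (snd x) (snd a) (snd d)
       - H (fst x) (fst a) (fst c) * gF (snd x) (snd b) (snd d)
       - H (fst x) (fst b) (fst d) * gF (snd x) (snd a) (snd c))"
proof -
  define W where "W = w (fst x)"
  define P where "P v = dd (fst v) w (fst x)" for v :: "'d \<times> 'e"
  define D where "D u v = dd (fst u) (dd (fst v) w) (fst x)" for u v :: "'d \<times> 'e"
  define N where "N u v = dd (christoffel gL (fst x) (fst u) (fst v)) w (fst x)" for u v :: "'d \<times> 'e"
  define G where "G u v = gF (snd x) (snd u) (snd v)" for u v :: "'d \<times> 'e"
  define X where "X a b c = F.Gl (snd x) (snd a) (snd b) (snd c)" for a b c :: "'d \<times> 'e"
  define Y where "Y a b c d = dd (snd a) (\<lambda>y. F.Gl y (snd b) (snd c) (snd d)) (snd x)" for a b c d :: "'d \<times> 'e"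
  define YL where "YL a b c d = dd (fst a) (\<lambda>y. L.Gl y (fst b) (fst c) (fst d)) (fst x)" for a b c d :: "'d \<times> 'e"
  define C where "C a b c d = gF (snd x) (christoffel gF (snd x) (snd a) (snd b))
      (christoffel gF (snd x) (snd c) (snd d))" for a b c d :: "'d \<times> 'e"
  define CL where "CL a b c d = gL (fst x) (christoffel gL (fst x) (fst a) (fst b))
      (christoffel gL (fst x) (fst c) (fst d))" for a b c d :: "'d \<times> 'e"
  have W: "W > 0" using w_pos x by (simp add: W_def)
  have t1: "dd a (\<lambda>y. M.Gl y b c d) x = YL a b c d + (2 * W * P a * X b c d + W\<^sup>2 * Y a b c d
      + ((P a * P b + W * D a b) * G c d + W * P b * (X a c d + X a d c)
      + ((P a * P c + W * D a c) * G b d + W * P c * (X a b d + X a d b)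
      - ((P a * P d + W * D a d) * G b c + W * P d * (X a b c + X a c b)))))" for a b c d
    unfolding dd_M_Gl[OF x] W_def P_def D_def G_def X_def Y_def YL_def ..
  have fl: "gF (snd x) (snd u) (christoffel gF (snd x) (snd a) (snd b)) = X a b u" for u a b :: "'d \<times> 'e"
    unfolding X_def F.g_christoffel[OF x(2), symmetric] by (rule F.g_sym[OF x(2)])
  have t3: "gM x (christoffel gM x b c) (christoffel gM x a d) =
      CL b c a d - W * G a d * N b c - W * G b c * N a d + W\<^sup>2 * G b c * G a d * q (fst x)
      + W\<^sup>2 * C b c a d + W * P a * X b c d + W * P d * X b c a + W * P b * X a d c + W * P c * X a d b
      + P b * P a * G c d + P b * P d * G c a + P c * P a * G b d + P c * P d * G b a" for a b c d
    unfolding gM_eq M_christoffel[OF x] fst_conv snd_conv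
      W_def[symmetric] P_def[symmetric] G_def[symmetric]
    using W
    by (simp add: L.g_simps F.g_simps x gL_Z gL_Z' fl F.g_christoffel q_eq[symmetric]
        linear_diff[OF linear_dw] linear_scale[OF linear_dw]
        X_def[symmetric] C_def[symmetric] CL_def[symmetric] N_def[symmetric] G_def[symmetric])
      (simp add: field_simps power2_eq_square)
  have GS: "G u v = G v u" for u v using F.g_sym[OF x(2)] by (simp add: G_def)
  have XS: "X u v z = X v u z" for u v z using F.Gl_sym[OF x(2)] by (simp add: X_def)
  have DS: "D u v = D v u" for u v
    unfolding D_def using dd_commute[OF L.open_S x(1) smooth_w] by blast
  have H: "H (fst x) (fst u) (fst v) = D u v - N u v" for u v :: "'d \<times> 'e"
    by (simp add: H_def D_def N_def)
  have RL: "L.Rlow (fst x) (fst a) (fst b) (fst c) (fst d) = YL a b c d - YL b a c d - CL b c a d + CL a c b d"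
    by (simp add: L.Rlow_def YL_def CL_def)
  have RF: "F.Rlow (snd x) (snd a) (snd b) (snd c) (snd d) = Y a b c d - Y b a c d - C b c a d + C a c b d"
    by (simp add: F.Rlow_def Y_def C_def)
  show ?thesis
    unfolding M.Rlow_def t1 t3 H RL RF W_def[symmetric] G_def[symmetric]
    using GS[of a b] GS[of c a] GS[of c b] GS[of d a] GS[of d b] GS[of d c]
      XS[of b a c] XS[of b a d] XS[of c a b] XS[of c a d] XS[of d a b] XS[of d a c] XS[of c b a]
      XS[of c b d] XS[of d b a] XS[of d b c] DS[of b a]
    by (simp add: algebra_simps)
qed

end

section \<open>Algebra of the second fundamental form\<close>

lemma linear_kernel_nonzero:
  fixes l :: "'a::euclidean_space \<Rightarrow> 'b::euclidean_space"
  assumes "linear l" "DIM('b) < DIM('a)"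
  obtains v where "v \<noteq> 0" "l v = 0"
proof -
  have "\<not> inj l"
  proof
    assume "inj l"
    then have "dim (l ` UNIV) = dim (UNIV :: 'a set)"
      using dim_image_eq[OF assms(1), of UNIV] by (simp add: inj_on_subset)
    then show False using assms(2) dim_subset_UNIV[of "range l"] by simp
  qed
  then show ?thesis using linear_injective_0[OF assms(1)] that by blast
qed

lemma plane_frame:
  fixes \<eta> :: "'z::euclidean_space"
  assumes N: "subspace N" "dim N = 2" and \<eta>: "\<eta> \<in> N" "norm \<eta> = 1"
  obtains \<xi> where "\<xi> \<in> N" "norm \<xi> = 1" "\<xi> \<bullet> \<eta> = 0" "\<eta> \<bullet> \<xi> = 0"
    "\<And>v. v \<in> N \<Longrightarrow> v = (v \<bullet> \<xi>) *\<^sub>R \<xi> + (v \<bullet> \<eta>) *\<^sub>R \<eta>"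
proof -
  have \<eta>\<eta>: "\<eta> \<bullet> \<eta> = 1" using \<eta> by (simp add: norm_eq_1)
  have "\<not> N \<subseteq> span {\<eta>}"
  proof
    assume "N \<subseteq> span {\<eta>}"
    then have "dim N \<le> card {\<eta>}" by (rule dim_le_card) simp
    then show False using N by simp
  qed
  then obtain \<zeta> where \<zeta>: "\<zeta> \<in> N" "\<zeta> \<notin> span {\<eta>}" by auto
  define \<xi>' where "\<xi>' = \<zeta> - (\<zeta> \<bullet> \<eta>) *\<^sub>R \<eta>"
  have \<xi>': "\<xi>' \<in> N" "\<xi>' \<noteq> 0" "\<xi>' \<bullet> \<eta> = 0"
    using \<zeta> N(1) \<eta> \<eta>\<eta> unfolding \<xi>'_def
    by (auto simp: subspace_diff subspace_mul inner_diff_left span_singleton)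
  define \<xi> where "\<xi> = \<xi>' /\<^sub>R norm \<xi>'"
  have \<xi>: "\<xi> \<in> N" "norm \<xi> = 1" "\<xi> \<bullet> \<eta> = 0" "\<xi> \<bullet> \<xi> = 1" "\<xi> \<noteq> 0"
    using \<xi>' N(1) norm_eq_1[of "\<xi>' /\<^sub>R norm \<xi>'"] by (auto simp: \<xi>_def subspace_mul)
  have ne: "\<xi> \<noteq> \<eta>" using \<xi> \<eta>\<eta> by auto
  have "pairwise orthogonal {\<xi>, \<eta>}"
    using \<xi> by (auto simp: pairwise_def orthogonal_def inner_commute)
  moreover have "0 \<notin> {\<xi>, \<eta>}" using \<xi> \<eta> by auto
  ultimately have "independent {\<xi>, \<eta>}" by (rule pairwise_orthogonal_independent)
  then have sp: "N \<subseteq> span {\<xi>, \<eta>}"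
    using card_ge_dim_independent[of "{\<xi>, \<eta>}" N] \<xi> \<eta> N(2) ne by auto
  have "v = (v \<bullet> \<xi>) *\<^sub>R \<xi> + (v \<bullet> \<eta>) *\<^sub>R \<eta>" if v: "v \<in> N" for v
  proof -
    obtain a where "v - a *\<^sub>R \<xi> \<in> span {\<eta>}"
      using sp v span_breakdown_eq[of v \<xi> "{\<eta>}"] by auto
    then obtain b where "v - a *\<^sub>R \<xi> = b *\<^sub>R \<eta>" by (auto simp: span_singleton)
    then have "v = a *\<^sub>R \<xi> + b *\<^sub>R \<eta>" by (simp add: algebra_simps)
    then show ?thesis using \<xi> \<eta>\<eta> by (simp add: inner_add_left inner_commute[of \<eta> \<xi>])
  qed
  then show ?thesis using that \<xi> by (metis inner_commute)
qed

section \<open>Positive definite forms and umbilicity\<close>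

locale posdef_form =
  fixes G :: "'e::euclidean_space \<Rightarrow> 'e \<Rightarrow> real"
  assumes bil: "bilinear G" and sym: "G u v = G v u" and pos: "u \<noteq> 0 \<Longrightarrow> G u u > 0"
begin

lemmas simps = bilinear_ladd[OF bil] bilinear_radd[OF bil] bilinear_lmul[OF bil] bilinear_rmul[OF bil]
  bilinear_lsub[OF bil] bilinear_rsub[OF bil] bilinear_lzero[OF bil] bilinear_rzero[OF bil]

lemma linear_form: "linear (G u)" using bil by (simp add: bilinear_def)

lemma orthogonal1:
  assumes "DIM('e) \<ge> 2"
  obtains v where "v \<noteq> 0" "G u v = 0"
  using linear_kernel_nonzero[OF linear_form[of u]] assms by auto

lemma orthogonal2:
  assumes "DIM('e) \<ge> 3"
  obtains v where "v \<noteq> 0" "G u v = 0" "G z v = 0"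
proof -
  have 1: "linear (\<lambda>v. (G u v, G z v))" by (auto intro!: linearI simp: simps)
  have 2: "DIM(real \<times> real) < DIM('e)" using assms by simp
  obtain v where "v \<noteq> 0" "(G u v, G z v) = 0" by (rule linear_kernel_nonzero[OF 1 2])
  then show ?thesis using that[of v] by (simp add: zero_prod_def)
qed

lemma gram:
  assumes "v \<noteq> 0" "\<And>t. u \<noteq> t *\<^sub>R v"
  shows "G u u * G v v - G u v * G u v > 0"
proof -
  define w where "w = u - (G u v / G v v) *\<^sub>R v"
  have "G w w > 0" using assms(2) by (intro pos) (simp add: w_def)
  moreover have v: "G v v > 0" by (rule pos[OF assms(1)])
  moreover have "G w w * G v v = G u u * G v v - G u v * G u v"
    using v by (simp add: w_def simps sym[of v u] field_simps)
  ultimately show ?thesis by (metis mult_pos_pos)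
qed

text \<open>For each nonzero \<open>u\<close> the hypothesis gives B u = r u * G u. Symmetry of both
  forms equates the ratios of two vectors that are not orthogonal; orthogonal ones are linked
  through their sum.\<close>

lemma proportional:
  assumes B: "bilinear B" "\<And>u v. B u v = B v u" and z: "\<And>u v. G u v = 0 \<Longrightarrow> B u v = 0"
  obtains c where "\<And>u v. B u v = c * G u v"
proof -
  note Bs = bilinear_radd[OF B(1)] bilinear_rmul[OF B(1)] bilinear_rsub[OF B(1)] bilinear_lzero[OF B(1)]
  define r where "r u = B u u / G u u" for u
  have 1: "B u v = r u * G u v" if "u \<noteq> 0" for u v
  proof -
    have "G u (v - (G u v / G u u) *\<^sub>R u) = 0" using pos[OF that] by (simp add: simps)
    from z[OF this] show ?thesis by (simp add: Bs r_def)
  qed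
  have 2: "r u = r v" if "u \<noteq> 0" "v \<noteq> 0" "G u v \<noteq> 0" for u v
    using 1[of u v] 1[of v u] that B(2)[of u v] sym[of u v] by simp
  have 3: "r u = r v" if uv: "u \<noteq> 0" "v \<noteq> 0" for u v
  proof (cases "G u v = 0")
    case True
    have ne: "G u (u + v) \<noteq> 0" "G v (u + v) \<noteq> 0"
      using True pos[OF uv(1)] pos[OF uv(2)] sym[of u v] by (simp_all add: simps)
    moreover have "u + v \<noteq> 0" using ne(1) bilinear_rzero[OF bil, of u] by metis
    ultimately show ?thesis using 2[of u "u + v"] 2[of v "u + v"] uv by simp
  qed (use 2 uv in auto)
  obtain e :: 'e where e: "e \<noteq> 0" using nonzero_Basis nonempty_Basis by blast
  have "B u v = r e * G u v" for u v
    using 1[of u v] 3[of u e] e by (cases "u = 0") (auto simp: Bs simps)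
  then show ?thesis using that by blast
qed

text \<open>\<open>eq\<close> is the Gauss equation of a hypersurface of curvature \<open>C\<close>.
  Dimension 3 leaves room for a \<open>w\<close> orthogonal to a given orthogonal pair
  \<open>u\<close>, \<open>z\<close>. Two instances of \<open>eq\<close> then combine to B u z times
  the Gram determinant of \<open>B\<close> on \<open>w\<close>, \<open>z\<close>, and a third
  instance makes this determinant nonzero. So \<open>B\<close> vanishes on orthogonal pairs.\<close>

lemma umbilic:
  assumes dim: "DIM('e) \<ge> 3" and B: "bilinear B" "\<And>u v. B u v = B v u"
    and eq: "\<And>u v w z. B u z * B v w - B u w * B v z = C * (G v w * G u z - G u w * G v z)"
    and C: "C \<noteq> 0"
  obtains c where "\<And>u v. B u v = c * G u v" "c * c = C"
proof -
  note Bs = bilinear_lzero[OF B(1)] bilinear_rzero[OF B(1)]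
  have "B u z = 0" if uz: "G u z = 0" for u z
  proof (cases "z = 0")
    case False
    obtain w where w: "w \<noteq> 0" "G u w = 0" "G z w = 0" using orthogonal2[OF dim] by blast
    have "B u z * B w w = B u w * B w z" using eq[of u z w w] uz w by simp
    moreover have "B u w * B z z = B u z * B z w" using eq[of u w z z] uz w by simp
    ultimately have "B u z * (B w w * B z z - B z w * B z w) = 0"
      using B(2)[of w z] by algebra
    moreover have "B w w * B z z - B z w * B z w \<noteq> 0"
      using eq[of w w z z] C pos[OF False] pos[OF w(1)] w B(2)[of w z] sym[of w z] by simp
    ultimately show ?thesis by simp
  qed (simp add: Bs)
  then obtain c where c: "\<And>u v. B u v = c * G u v" using proportional[OF B] by blast
  obtain e :: 'e where e: "e \<noteq> 0" using nonzero_Basis nonempty_Basis by blast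
  obtain v where v: "v \<noteq> 0" "G e v = 0" using orthogonal1[of e] dim by auto
  have "c * c * (G e e * G v v) = C * (G e e * G v v)"
    using eq[of e e v v] v unfolding c by (simp add: algebra_simps)
  then have "c * c = C" using pos[OF e] pos[OF v(1)] by simp
  then show ?thesis using that c by blast
qed

end

text \<open>
  \<open>\<alpha>\<close> is a second fundamental form with values in a normal plane \<open>N\<close>; \<open>K1\<close>, \<open>K2\<close>, \<open>K3\<close> are the horizontal,
  mixed and vertical coefficients of the curvature tensor in the Gauss equation.
\<close>

locale split_form = GL: posdef_form GL + GF: posdef_form GF
  for GL :: "'d::euclidean_space \<Rightarrow> 'd \<Rightarrow> real" and GF :: "'e::euclidean_space \<Rightarrow> 'e \<Rightarrow> real" +
  fixes \<alpha> :: "'d \<times> 'e \<Rightarrow> 'd \<times> 'e \<Rightarrow> 'z::euclidean_space" and N :: "'z set" and K1 K2 K3 :: real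
  assumes dims: "DIM('d) = 2" "DIM('e) \<ge> 3" and N: "subspace N" "dim N = 2"
    and \<alpha>: "bilinear \<alpha>" "\<And>u v. \<alpha> u v = \<alpha> v u" "\<And>u v. \<alpha> u v \<in> N"
    and gauss: "\<And>a b c d. \<alpha> a d \<bullet> \<alpha> b c - \<alpha> a c \<bullet> \<alpha> b d =
      K1 * (GL (fst b) (fst c) * GL (fst a) (fst d) - GL (fst a) (fst c) * GL (fst b) (fst d))
      + K3 * (GF (snd b) (snd c) * GF (snd a) (snd d) - GF (snd a) (snd c) * GF (snd b) (snd d))
      + K2 * (GL (fst a) (fst d) * GF (snd b) (snd c) + GL (fst b) (fst c) * GF (snd a) (snd d)
        - GL (fst a) (fst c) * GF (snd b) (snd d) - GL (fst b) (fst d) * GF (snd a) (snd c))"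
    and K: "K2 \<noteq> 0" "K3 \<noteq> 0" "K1 * K3 \<noteq> K2 * K2"
begin

section \<open>Horizontal, mixed and vertical blocks of the second fundamental form, and the Gauss
  equation sorted by type\<close>

definition h where "h x y = \<alpha> (x, 0) (y, 0)"
definition \<beta> where "\<beta> x v = \<alpha> (x, 0) (0, v)"
definition \<gamma> where "\<gamma> v u = \<alpha> (0, v) (0, u)"

lemma G1: "\<beta> x z \<bullet> \<gamma> v u = \<beta> x u \<bullet> \<gamma> v z"
  using gauss[of "(x, 0)" "(0, z)" "(0, v)" "(0, u)"] by (simp add: \<beta>_def \<gamma>_def GL.simps GF.simps)

lemma G2: "\<beta> x z \<bullet> \<beta> y u = \<beta> x u \<bullet> \<beta> y z"
  using gauss[of "(x, 0)" "(0, z)" "(y, 0)" "(0, u)"] by (simp add: \<beta>_def \<gamma>_def GL.simps GF.simps)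

lemma G3: "\<beta> x u \<bullet> \<beta> y v - h x y \<bullet> \<gamma> v u = - K2 * (GL x y * GF v u)"
  using gauss[of "(x, 0)" "(0, u)" "(0, v)" "(y, 0)"] \<alpha>(2)[of "(0, v)" "(y, 0)"]
  by (simp add: \<beta>_def \<gamma>_def h_def GL.simps GF.simps)

lemma G5: "h x z \<bullet> h y u - h x u \<bullet> h y z = K1 * (GL y u * GL x z - GL x u * GL y z)"
  using gauss[of "(x, 0)" "(z, 0)" "(y, 0)" "(u, 0)"] by (simp add: h_def GL.simps GF.simps)

lemma G6: "\<gamma> x z \<bullet> \<gamma> y u - \<gamma> x u \<bullet> \<gamma> y z = K3 * (GF y u * GF x z - GF x u * GF y z)"
  using gauss[of "(0, x)" "(0, z)" "(0, y)" "(0, u)"] by (simp add: \<gamma>_def GL.simps GF.simps)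

lemma sym: "h x y = h y x" "\<gamma> u v = \<gamma> v u"
  using \<alpha>(2) by (auto simp: h_def \<gamma>_def)

lemma in_N: "h x y \<in> N" "\<beta> x v \<in> N" "\<gamma> u v \<in> N"
  using \<alpha>(3) by (auto simp: h_def \<beta>_def \<gamma>_def)

lemma bilinear_\<gamma>: "bilinear \<gamma>" and linear_\<beta>: "linear (\<beta> x)" "linear (\<lambda>x. \<beta> x v)"
proof -
  have l: "linear (\<alpha> z)" "linear (\<lambda>u. \<alpha> u z)" for z using \<alpha>(1) unfolding bilinear_def by blast+
  have i: "linear (\<lambda>u::'e. (0::'d, u))" "linear (\<lambda>u::'d. (u, 0::'e))" by (auto intro!: linearI)
  show "bilinear \<gamma>" "linear (\<beta> x)" "linear (\<lambda>x. \<beta> x v)"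
    unfolding bilinear_def \<gamma>_def \<beta>_def
    using linear_compose[OF i(1) l(1)] linear_compose[OF i(1) l(2)] linear_compose[OF i(2) l(2)]
    by (simp_all add: o_def)
qed

lemma frame_inner:
  assumes "u \<in> N" "v \<in> N" and f: "\<And>v. v \<in> N \<Longrightarrow> v = (v \<bullet> \<xi>) *\<^sub>R \<xi> + (v \<bullet> \<eta>) *\<^sub>R \<eta>"
  shows "u \<bullet> v = (u \<bullet> \<xi>) * (v \<bullet> \<xi>) + (u \<bullet> \<eta>) * (v \<bullet> \<eta>)"
  by (subst f[OF assms(2)]) (simp add: inner_add_right mult.commute)

lemma bilinear_component: "bilinear (\<lambda>u v. \<gamma> u v \<bullet> \<xi>)"
  unfolding bilinear_def
  by (auto intro!: linearI simp: bilinear_ladd[OF bilinear_\<gamma>] bilinear_radd[OF bilinear_\<gamma>]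
      bilinear_lmul[OF bilinear_\<gamma>] bilinear_rmul[OF bilinear_\<gamma>] inner_add_left)

text \<open>
  If \<open>\<beta> x\<close> is not zero, it still has a kernel vector \<open>u\<close>, as \<open>DIM('e) > dim N\<close>. By \<open>G1\<close> a nonzero value
  \<open>\<gamma> u w0\<close> is orthogonal to those of \<open>\<beta> x\<close>. The component of \<open>\<gamma>\<close> in its direction \<open>\<eta>\<close> is
  a multiple of \<open>GF\<close>, the other one has rank at most 1, and \<open>G5\<close> becomes \<open>K1 * K3 = K2 * K2\<close>.
\<close>

lemma \<beta>_zero: "\<beta> x v = 0"
proof (rule ccontr)
  assume ne: "\<beta> x v \<noteq> 0"
  note Bs = linear_add[OF linear_\<beta>(1)] linear_scale[OF linear_\<beta>(1)]
  obtain n1 where n1: "n1 \<in> N" "norm n1 = 1"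
  proof -
    have "\<beta> x v /\<^sub>R norm (\<beta> x v) \<in> N" using in_N(2) N(1) by (simp add: subspace_mul)
    then show ?thesis using that ne by (metis norm_sgn sgn_div_norm)
  qed
  obtain n2 where n2: "\<And>v. v \<in> N \<Longrightarrow> v = (v \<bullet> n2) *\<^sub>R n2 + (v \<bullet> n1) *\<^sub>R n1"
    using plane_frame[OF N n1] by metis
  have l1: "linear (\<lambda>v. (\<beta> x v \<bullet> n2, \<beta> x v \<bullet> n1))"
    by (auto intro!: linearI simp: Bs inner_add_left)
  have l2: "DIM(real \<times> real) < DIM('e)" using dims by simp
  obtain u where "u \<noteq> 0" "(\<beta> x u \<bullet> n2, \<beta> x u \<bullet> n1) = 0" by (rule linear_kernel_nonzero[OF l1 l2])
  then have u: "u \<noteq> 0" "\<beta> x u \<bullet> n2 = 0" "\<beta> x u \<bullet> n1 = 0"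
    by (simp_all add: zero_prod_def)
  have u0: "\<beta> x u = 0" using n2[OF in_N(2)[of x u]] u by simp
  obtain u' where u': "u' \<noteq> 0" "GF u u' = 0" using GF.orthogonal1[of u] dims by auto
  \<comment> \<open>Otherwise \<open>G6\<close> on the orthogonal pair \<open>u\<close>,
    \<open>u'\<close> would make \<open>K3\<close> zero.\<close>
  have "\<exists>w0. \<gamma> u w0 \<noteq> 0"
  proof (rule ccontr)
    assume "\<nexists>w0. \<gamma> u w0 \<noteq> 0"
    then have "0 = K3 * (GF u' u' * GF u u)" using G6[of u u u' u'] u' by simp
    then show False using K GF.pos u u' by (metis less_irrefl mult_eq_0_iff)
  qed
  then obtain w0 where w0: "\<gamma> u w0 \<noteq> 0" by blast
  define \<eta> where "\<eta> = \<gamma> u w0 /\<^sub>R norm (\<gamma> u w0)"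
  have \<eta>: "\<eta> \<in> N" "norm \<eta> = 1" using w0 in_N(3) N(1) by (auto simp: \<eta>_def subspace_mul)
  have \<beta>\<eta>: "\<beta> x z \<bullet> \<eta> = 0" for z
    using G1[of x z w0 u] u0 sym(2)[of u w0] by (simp add: \<eta>_def)
  obtain \<xi> where \<xi>: "\<xi> \<in> N" "norm \<xi> = 1" "\<xi> \<bullet> \<eta> = 0" "\<eta> \<bullet> \<xi> = 0"
    and f: "\<And>v. v \<in> N \<Longrightarrow> v = (v \<bullet> \<xi>) *\<^sub>R \<xi> + (v \<bullet> \<eta>) *\<^sub>R \<eta>"
    using plane_frame[OF N \<eta>] by metis
  note fi = frame_inner[OF _ _ f]
  define b where "b z = \<beta> x z \<bullet> \<xi>" for z
  define P where "P u v = \<gamma> u v \<bullet> \<xi>" for u v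
  define Q where "Q u v = \<gamma> u v \<bullet> \<eta>" for u v
  have b: "linear b" unfolding b_def by (auto intro!: linearI simp: Bs inner_add_left)
  have "b v \<noteq> 0" using f[OF in_N(2)[of x v]] ne by (auto simp: b_def \<beta>\<eta>)
  then obtain e where e: "b e = 1"
    using linear_scale[OF b, of "1 / b v" v] by auto
  have C: "b z * P v u = b u * P v z" for z v u
    using G1[of x z v u] fi[OF in_N(2) in_N(3)] by (simp add: b_def P_def \<beta>\<eta>)
  have Psym: "P u v = P v u" "Q u v = Q v u" for u v using sym by (auto simp: P_def Q_def)
  define \<mu> where "\<mu> = P e e"
  have P: "P u v = \<mu> * (b u * b v)" for u v
    using C[of e u v] C[of e e u] Psym(1)[of e u] e by (simp add: \<mu>_def algebra_simps)
  \<comment> \<open>The rank one form \<open>P\<close> has vanishing 2 by 2 minors, so it drops out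
    of \<open>G6\<close> and \<open>Q\<close> alone satisfies the Gauss equation of curvature
    \<open>K3\<close>.\<close>
  have Q6: "Q a d * Q b' c - Q a c * Q b' d = K3 * (GF b' c * GF a d - GF a c * GF b' d)" for a d b' c
  proof -
    have "\<gamma> u v \<bullet> \<gamma> u' v' = P u v * P u' v' + Q u v * Q u' v'" for u v u' v'
      using fi[OF in_N(3)[of u v] in_N(3)[of u' v']] by (simp add: P_def Q_def)
    then show ?thesis using G6[of a d b' c] by (simp add: P algebra_simps)
  qed
  obtain c where c: "\<And>u v. Q u v = c * GF u v" "c * c = K3"
    using GF.umbilic[OF dims(2) bilinear_component[of \<eta>, folded Q_def] Psym(2) Q6 K(2)] by blast
  have c0: "c \<noteq> 0" using c(2) K by auto
  define s where "s y = \<beta> y e \<bullet> \<xi>" for y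
  have b\<xi>: "\<beta> y z \<bullet> \<xi> = s y * b z" for y z
    using G2[of x e y z] fi[OF in_N(2) in_N(2)] e by (simp add: \<beta>\<eta> b_def[symmetric] s_def algebra_simps)
  \<comment> \<open>In \<open>G1\<close> with \<open>k\<close> orthogonal to \<open>z\<close> the
    \<xi> components cancel, being products of values of \<open>b\<close>; what remains isolates the
    \<eta> component.\<close>
  have dy: "\<beta> y z \<bullet> \<eta> = 0" for y z
  proof -
    obtain k where k: "k \<noteq> 0" "GF z k = 0" using GF.orthogonal1[of z] dims by auto
    have "(\<beta> y z \<bullet> \<eta>) * (c * GF k k) = (\<beta> y k \<bullet> \<eta>) * (c * GF k z)"
      using G1[of y z k k] fi[OF in_N(2)[of y z] in_N(3)[of k k]] fi[OF in_N(2)[of y k] in_N(3)[of k z]]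
      by (simp add: P_def[symmetric] Q_def[symmetric] P c(1) b\<xi> algebra_simps)
    then show ?thesis using k GF.sym[of z k] GF.pos[OF k(1)] c0 by simp
  qed
  have sl: "linear s" unfolding s_def
    by (auto intro!: linearI simp: linear_add[OF linear_\<beta>(2)] linear_scale[OF linear_\<beta>(2)] inner_add_left)
  have sx: "s x = 1" using e by (simp add: s_def b_def)
  obtain y where y: "y \<noteq> 0" "s y = 0" using linear_kernel_nonzero[OF sl] dims by auto
  have \<beta>y: "\<beta> y z = 0" for z using f[OF in_N(2)[of y z]] by (simp add: b\<xi> dy y)
  obtain k where k: "k \<noteq> 0" "b k = 0" using linear_kernel_nonzero[OF b] dims by auto
  have kk: "GF k k > 0" by (rule GF.pos[OF k(1)])
  have hg: "h x' y' \<bullet> \<gamma> v u = (h x' y' \<bullet> \<xi>) * (\<mu> * (b v * b u)) + (h x' y' \<bullet> \<eta>) * (c * GF v u)" for x' y' v u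
    using fi[OF in_N(1)[of x' y'] in_N(3)[of v u]] by (simp add: P_def[symmetric] Q_def[symmetric] P c(1))
  have hy\<eta>: "(h x' y \<bullet> \<eta>) * c = K2 * GL x' y" for x'
    using G3[of x' k y k] kk unfolding hg by (simp add: \<beta>y k)
  have hy\<xi>: "(h x' y \<bullet> \<xi>) * \<mu> = 0" for x'
    using G3[of x' e y e] arg_cong[OF hy\<eta>[of x'], of "\<lambda>t. t * GF e e"]
    unfolding hg by (simp add: \<beta>y e algebra_simps)
  have bx: "\<beta> x z \<bullet> \<beta> x z' = b z * b z'" for z z'
    using fi[OF in_N(2)[of x z] in_N(2)[of x z']] by (simp add: \<beta>\<eta> b_def)
  have hx\<eta>: "(h x x \<bullet> \<eta>) * c = K2 * GL x x"
    using G3[of x k x k] kk unfolding hg bx by (simp add: k)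
  \<comment> \<open>In particular \<mu> is not 0, so \<open>hy\<xi>\<close> removes the \<xi>
    component of every h(x', y). Hence \<open>G5\<close> on the plane of \<open>x\<close> and
    \<open>y\<close> sees \<eta> components only, and these are multiples of
    \<open>GL\<close>.\<close>
  have hx\<xi>: "(h x x \<bullet> \<xi>) * \<mu> = 1"
  proof -
    have "(h x x \<bullet> \<eta>) * (c * GF e e) = K2 * (GL x x * GF e e)" using hx\<eta> by algebra
    moreover have "1 - ((h x x \<bullet> \<xi>) * \<mu> + (h x x \<bullet> \<eta>) * (c * GF e e)) = - K2 * (GL x x * GF e e)"
      using G3[of x e x e] unfolding hg bx by (simp only: e mult_1_right)
    ultimately show ?thesis by linarith
  qed
  then have hy\<xi>': "h x' y \<bullet> \<xi> = 0" for x' using hy\<xi>[of x'] by auto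
  have "h x x \<bullet> h y y - h x y \<bullet> h y x = K1 * (GL y y * GL x x - GL x y * GL y x)" by (rule G5)
  then have "(h x x \<bullet> \<eta>) * (h y y \<bullet> \<eta>) - (h x y \<bullet> \<eta>) * (h x y \<bullet> \<eta>) = K1 * (GL y y * GL x x - GL x y * GL x y)"
    using fi[OF in_N(1)[of x x] in_N(1)[of y y]] fi[OF in_N(1)[of x y] in_N(1)[of y x]]
    by (simp add: hy\<xi>' sym(1)[of y x] GL.sym[of y x])
  then have "(h x x \<bullet> \<eta> * c) * (h y y \<bullet> \<eta> * c) - (h x y \<bullet> \<eta> * c) * (h x y \<bullet> \<eta> * c)
      = K1 * (c * c) * (GL y y * GL x x - GL x y * GL x y)" by algebra
  then have "(K2 * K2) * (GL y y * GL x x - GL x y * GL x y) = (K1 * K3) * (GL y y * GL x x - GL x y * GL x y)"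
    unfolding hy\<eta> hx\<eta> c(2) by (simp add: algebra_simps)
  moreover have "GL x x * GL y y - GL x y * GL x y > 0"
    by (rule GL.gram[OF y(1)]) (use linear_scale[OF sl] y sx in auto)
  ultimately show False using K(3) by (simp add: mult.commute)
qed

text \<open>With the mixed part gone, \<open>G3\<close> says that the product of
  \<open>h x y\<close> and \<gamma> is K2 times that of the two metrics. As \<open>K2\<close> is not
  0, some \<open>h x0 x0\<close> is nonzero and the component of \<gamma> along it is a multiple of
  \<open>GF\<close>. The component \<open>Q\<close> along the other normal direction
  remains.\<close>

theorem split:
  obtains \<nu> where "\<And>x v. \<alpha> (x, 0) (0, v) = 0" "\<And>u v. \<alpha> (0, u) (0, v) = GF u v *\<^sub>R \<nu>"
    "\<nu> \<in> N" "\<nu> \<bullet> \<nu> = K3"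
proof -
  have hg: "h x y \<bullet> \<gamma> v u = K2 * (GL x y * GF v u)" for x y v u
    using G3[of x u y v] by (simp add: \<beta>_zero)
  obtain x0 :: 'd where x0: "x0 \<noteq> 0" using nonzero_Basis nonempty_Basis by blast
  obtain e :: 'e where e: "e \<noteq> 0" using nonzero_Basis nonempty_Basis by blast
  define \<zeta> where "\<zeta> = h x0 x0"
  have \<zeta>: "\<zeta> \<noteq> 0"
    using hg[of x0 x0 e e] GL.pos[OF x0] GF.pos[OF e] K by (auto simp: \<zeta>_def)
  define \<xi> where "\<xi> = \<zeta> /\<^sub>R norm \<zeta>"
  have \<xi>: "\<xi> \<in> N" "norm \<xi> = 1" using \<zeta> in_N(1) N(1) by (auto simp: \<xi>_def \<zeta>_def subspace_mul)
  obtain \<eta> where \<eta>: "\<eta> \<in> N" "norm \<eta> = 1"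
    and f: "\<And>v. v \<in> N \<Longrightarrow> v = (v \<bullet> \<eta>) *\<^sub>R \<eta> + (v \<bullet> \<xi>) *\<^sub>R \<xi>"
    using plane_frame[OF N \<xi>] by metis
  note fi = frame_inner[OF _ _ f]
  define p where "p = K2 * GL x0 x0 / norm \<zeta>"
  have P: "\<gamma> u v \<bullet> \<xi> = p * GF u v" for u v
    using hg[of x0 x0 u v] by (simp add: \<xi>_def \<zeta>_def[symmetric] p_def inner_commute field_simps)
  have p0: "p \<noteq> 0" using K \<zeta> GL.pos[OF x0] by (simp add: p_def)
  define Q where "Q u v = \<gamma> u v \<bullet> \<eta>" for u v
  have Q: "bilinear Q" "Q u v = Q v u" for u v
    unfolding Q_def using bilinear_component sym by auto
  have Q6: "Q a d * Q b c - Q a c * Q b d = (K3 - p * p) * (GF b c * GF a d - GF a c * GF b d)" for a d b c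
  proof -
    have "\<gamma> u v \<bullet> \<gamma> u' v' = Q u v * Q u' v' + p * GF u v * (p * GF u' v')" for u v u' v'
      using fi[OF in_N(3)[of u v] in_N(3)[of u' v']] by (simp add: P Q_def)
    then show ?thesis using G6[of a d b c] by (simp add: algebra_simps)
  qed
  obtain c where c: "\<And>u v. Q u v = c * GF u v"
  proof (cases "K3 = p * p")
    case False
    then have "K3 - p * p \<noteq> 0" by simp
    then show ?thesis by (rule GF.umbilic[OF dims(2) Q Q6]) (rule that)
  next
    case True
    \<comment> \<open>Here \<open>Q\<close> has vanishing minors and \<open>umbilic\<close> does not
      apply. Instead, an \<open>h x y\<close> with nonzero \<eta> component lets one solve this
      equation for \<open>Q\<close>. If there were none, \<open>G5\<close> would give K1 * K3 = K2 *
      K2.\<close>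
    have hpq: "(h x y \<bullet> \<eta>) * Q v u + (h x y \<bullet> \<xi>) * (p * GF v u) = K2 * (GL x y * GF v u)" for x y u v
      using hg[of x y v u] fi[OF in_N(1)[of x y] in_N(3)[of v u]] by (simp add: P Q_def)
    have "\<exists>x y. h x y \<bullet> \<eta> \<noteq> 0"
    proof (rule ccontr)
      assume "\<nexists>x y. h x y \<bullet> \<eta> \<noteq> 0"
      then have h\<eta>: "h x y \<bullet> \<eta> = 0" for x y by blast
      have h\<xi>: "(h x y \<bullet> \<xi>) * p = K2 * GL x y" for x y
        using hpq[of x y e e] GF.pos[OF e] by (simp add: h\<eta>)
      obtain y where y: "y \<noteq> 0" "GL x0 y = 0" using GL.orthogonal1[of x0] dims by auto
      have "(h x0 x0 \<bullet> \<xi>) * (h y y \<bullet> \<xi>) - (h x0 y \<bullet> \<xi>) * (h y x0 \<bullet> \<xi>) = K1 * (GL y y * GL x0 x0)"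
        using G5[of x0 x0 y y] y fi[OF in_N(1)[of x0 x0] in_N(1)[of y y]]
          fi[OF in_N(1)[of x0 y] in_N(1)[of y x0]] by (simp add: h\<eta>)
      then have "(h x0 x0 \<bullet> \<xi> * p) * (h y y \<bullet> \<xi> * p) - (h x0 y \<bullet> \<xi> * p) * (h y x0 \<bullet> \<xi> * p)
          = K1 * (p * p) * (GL y y * GL x0 x0)" by algebra
      then have "(K2 * K2) * (GL y y * GL x0 x0) = (K1 * K3) * (GL y y * GL x0 x0)"
        unfolding h\<xi> True[symmetric] using y by (simp add: algebra_simps)
      then show False using K(3) GL.pos[OF x0] GL.pos[OF y(1)] by simp
    qed
    then obtain x y where "h x y \<bullet> \<eta> \<noteq> 0" by blast
    then have "Q v u = ((K2 * GL x y - (h x y \<bullet> \<xi>) * p) / (h x y \<bullet> \<eta>)) * GF v u" for v u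
      using hpq[of x y v u] by (simp add: field_simps)
    then show ?thesis using that by blast
  qed
  define \<nu> where "\<nu> = c *\<^sub>R \<eta> + p *\<^sub>R \<xi>"
  have \<gamma>: "\<gamma> u v = GF u v *\<^sub>R \<nu>" for u v
    using f[OF in_N(3)[of u v]] c[of u v] P[of u v]
    by (simp add: Q_def \<nu>_def algebra_simps)
  obtain v where v: "v \<noteq> 0" "GF e v = 0" using GF.orthogonal1[of e] dims by auto
  have "(\<nu> \<bullet> \<nu>) * (GF e e * GF v v) = K3 * (GF e e * GF v v)"
    using G6[of e e v v] v by (simp add: \<gamma> algebra_simps)
  then have "\<nu> \<bullet> \<nu> = K3" using GF.pos[OF e] GF.pos[OF v(1)] by simp
  moreover have "\<nu> \<in> N" unfolding \<nu>_def using \<xi> \<eta> N(1) by (intro subspace_add subspace_mul)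
  ultimately show ?thesis using that[OF _ _ _] \<gamma> \<beta>_zero unfolding \<gamma>_def \<beta>_def by blast
qed

end

lemma sum_Basis_prod:
  "(\<Sum>b\<in>(Basis :: ('a::euclidean_space \<times> 'b::euclidean_space) set). f b :: real)
    = (\<Sum>i\<in>Basis. f (i, 0)) + (\<Sum>i\<in>Basis. f (0, i))"
proof -
  have "inj_on (\<lambda>u::'a. (u, 0::'b)) Basis" "inj_on (\<lambda>v::'b. (0::'a, v)) Basis"
    by (auto intro!: inj_onI)
  moreover have "(\<lambda>u::'a. (u, 0::'b)) ` Basis \<inter> (\<lambda>v::'b. (0::'a, v)) ` Basis = {}"
    using nonzero_Basis by auto
  ultimately show ?thesis
    unfolding Basis_prod_def by (simp add: sum.union_disjoint sum.reindex)
qed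

section \<open>Einstein warped products\<close>

text \<open>
  It turns out that the Hessian of \<open>w\<close> is \<open>lam\<close> times \<open>gL\<close>, that \<open>K1\<close> is the curvature of \<open>gL\<close> and that
  \<open>C\<close> is constant.
\<close>

locale einstein_warped = warped_chart S1 gL S2 gF w
  for S1 :: "'d::euclidean_space set" and gL and S2 :: "'e::euclidean_space set" and gF and w +
  fixes rho kappa :: real
  assumes dims: "DIM('d) = 2" "DIM('e) \<ge> 3" and S2_nonempty: "S2 \<noteq> {}"
    and F_curv: "\<And>y a b c d. y \<in> S2 \<Longrightarrow>
      F.Rlow y a b c d = kappa * (gF y b c * gF y a d - gF y a c * gF y b d)"
    and einst: "\<And>x v u. x \<in> S1 \<times> S2 \<Longrightarrow> ricci gM x v u = rho * gM x v u"
begin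

definition lam :: "'d \<Rightarrow> real" where
  "lam x = ((real DIM('e) - 1) * (kappa - q x) - rho * (w x)\<^sup>2) / (2 * w x)"

definition K1 :: "'d \<Rightarrow> real" where "K1 x = rho + real DIM('e) * lam x / w x"

definition C :: "'d \<Rightarrow> real" where
  "C x = (q x + rho / (real DIM('e) + 1) * (w x)\<^sup>2 - kappa) * w x ^ (DIM('e) - 1)"

text \<open>In the trace over a basis adapted to the product, the surface contributes its Ricci
  tensor K gL and each vertical direction contributes - H / w.\<close>

lemma horizontal_ricci:
  assumes x: "x \<in> S1"
    and K: "\<And>a b c d. L.Rlow x a b c d = K * (gL x b c * gL x a d - gL x a c * gL x b d)"
  shows "K * gL x v u - real DIM('e) * H x v u / w x = rho * gL x v u"
proof -
  obtain y where y: "y \<in> S2" using S2_nonempty by auto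
  have xy: "(x, y) \<in> S1 \<times> S2" using x y by auto
  have w: "w x > 0" by (rule w_pos[OF x])
  have T: "curvature_tensor gM (x, y) b (v, 0) (u, 0) =
      (K *\<^sub>R (gL x v u *\<^sub>R fst b - gL x (fst b) u *\<^sub>R v), (- H x v u / w x) *\<^sub>R snd b)" for b
    by (rule M.g_nondegenerate[OF xy], unfold M.curvature_low[OF xy])
      (use w in \<open>simp add: M_Rlow K F_curv gM_eq L.g_simps F.g_simps x y algebra_simps power2_eq_square\<close>)
  have "ricci gM (x, y) (v, 0) (u, 0) =
      (\<Sum>i\<in>Basis. K * (gL x v u - gL x i u * (v \<bullet> i))) + (\<Sum>i\<in>(Basis::'e set). - H x v u / w x)"
    unfolding ricci_def T by (subst sum_Basis_prod) (simp add: inner_diff_left)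
  also have "\<dots> = K * gL x v u - real DIM('e) * H x v u / w x"
    using linear_sum_Basis[OF L.g_linear(2)[OF x], of v u] dims
    by (simp add: sum_distrib_left[symmetric] sum_subtractf mult.commute[of _ "v \<bullet> _"] algebra_simps)
  finally show ?thesis
    using einst[OF xy, of "(v, 0)" "(u, 0)"] by (simp add: gM_eq F.g_simps y)
qed

text \<open>On vertical vectors each of the two horizontal directions contributes - w l, and the
  fiber directions contribute the Ricci tensor of a space form of curvature kappa - q, each times
  the fiber metric.\<close>

lemma vertical_ricci:
  assumes x: "x \<in> S1" and H: "\<And>u v. H x u v = l * gL x u v"
    and K: "\<And>a b c d. L.Rlow x a b c d = K * (gL x b c * gL x a d - gL x a c * gL x b d)"
  shows "- 2 * w x * l + (real DIM('e) - 1) * (kappa - q x) = rho * (w x)\<^sup>2"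
proof -
  obtain y where y: "y \<in> S2" using S2_nonempty by auto
  have xy: "(x, y) \<in> S1 \<times> S2" using x y by auto
  have w: "w x > 0" by (rule w_pos[OF x])
  have T: "curvature_tensor gM (x, y) b (0, v) (0, u) =
      ((- w x * l * gF y v u) *\<^sub>R fst b, (kappa - q x) *\<^sub>R (gF y v u *\<^sub>R snd b - gF y (snd b) u *\<^sub>R v))" for b v u
    by (rule M.g_nondegenerate[OF xy], unfold M.curvature_low[OF xy])
      (simp add: M_Rlow K F_curv H gM_eq L.g_simps F.g_simps x y algebra_simps)
  have "ricci gM (x, y) (0, v) (0, u) = (\<Sum>i\<in>(Basis::'d set). - w x * l * gF y v u)
      + (\<Sum>i\<in>Basis. (kappa - q x) * (gF y v u - gF y i u * (v \<bullet> i)))" for v u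
    unfolding ricci_def T by (subst sum_Basis_prod) (simp add: inner_diff_left)
  also have "\<dots> v u = (- 2 * w x * l + (real DIM('e) - 1) * (kappa - q x)) * gF y v u" for v u
  proof -
    have "(\<Sum>i\<in>Basis. c * (gF y v u - gF y i u * (v \<bullet> i))) = c * (real DIM('e) * gF y v u - gF y v u)" for c
      using linear_sum_Basis[OF F.g_linear(2)[OF y], of v u, symmetric]
      by (simp add: sum_distrib_left[symmetric] sum_subtractf mult.commute[of _ "v \<bullet> _"])
    note s = this
    show ?thesis unfolding s by (simp add: dims algebra_simps)
  qed
  finally have eq: "(- 2 * w x * l + (real DIM('e) - 1) * (kappa - q x)) * gF y v u = rho * (w x)\<^sup>2 * gF y v u"
    for v u using einst[OF xy, of "(0, v)" "(0, u)"] by (simp add: gM_eq L.g_simps x)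
  obtain e :: 'e where e: "e \<noteq> 0" using nonzero_Basis nonempty_Basis by blast
  show ?thesis using eq[of e e] F.g_pos[OF y e] by simp
qed

text \<open>The curvature of a surface is a scalar \<open>K\<close>, so the horizontal Einstein
  equation solves for the Hessian and makes it a multiple \<open>l\<close> of the metric. The
  vertical equation expresses \<open>l\<close> through \<open>q\<close> and \<open>w\<close>, which
  is \<open>lam\<close>; the horizontal one then returns \<open>K\<close>.\<close>

lemma L_curvature_and_hessian:
  assumes x: "x \<in> S1"
  shows "L.Rlow x a b c d = K1 x * (gL x b c * gL x a d - gL x a c * gL x b d)"
    and "H x u v = lam x * gL x u v"
proof -
  obtain K where K: "\<And>a b c d. L.Rlow x a b c d = K * (gL x b c * gL x a d - gL x a c * gL x b d)"
    using L.two_dim_Rlow[OF x dims(1)] by blast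
  define l where "l = w x * (K - rho) / DIM('e)"
  have w: "w x > 0" by (rule w_pos[OF x])
  have H: "H x u v = l * gL x u v" for u v
    using horizontal_ricci[OF x K, of u v] w dims by (simp add: l_def field_simps)
  have "- 2 * w x * l + (real DIM('e) - 1) * (kappa - q x) = rho * (w x)\<^sup>2"
    by (rule vertical_ricci[OF x H K])
  then have l: "l = lam x" using w by (simp add: lam_def field_simps)
  have "K = K1 x" unfolding K1_def l[symmetric] using w dims by (simp add: l_def)
  then show "L.Rlow x a b c d = K1 x * (gL x b c * gL x a d - gL x a c * gL x b d)"
    "H x u v = lam x * gL x u v" using K H l by auto
qed

section \<open>The first integral \<open>C\<close>\<close>

lemma dd_q_lam: "x \<in> S1 \<Longrightarrow> dd u q x = 2 * lam x * dd u w x"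
  using dd_q[of x u] L_curvature_and_hessian(2)[of x u "Z x"] gL_Z'[of x u] by simp

lemma smooth_C: "smooth_on S1 C"
  unfolding C_def[abs_def] by (intro smooth_intros L.open_S smooth_q smooth_w)

text \<open>By \<open>dd_q_lam\<close> the derivative of \<open>C\<close> is a multiple of dw, and
  its factor vanishes by the definition of \<open>lam\<close>.\<close>

lemma dd_C:
  assumes x: "x \<in> S1"
  shows "dd u C x = 0"
proof -
  define k where "k = rho / (real DIM('e) + 1)"
  \<comment> \<open>Turns the exponents into \<open>Suc n\<close> and \<open>n\<close>, so that no
    truncated subtraction is left; the fiber dimension is at least 3.\<close>
  define n where "n = DIM('e) - 2"
  have n: "DIM('e) - 1 = Suc n" "real DIM('e) = real n + 2" using dims by (auto simp: n_def)
  have w: "w x > 0" by (rule w_pos[OF x])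
  have d: "(w has_derivative (\<lambda>v. dd v w x)) (at x)" "(q has_derivative (\<lambda>v. dd v q x)) (at x)"
    using dd_derivative diff_w[OF x] smooth_onD[OF smooth_q x] by auto
  have "(C has_derivative (\<lambda>v. (dd v q x + k * (2 * w x * dd v w x)) * w x ^ Suc n
      + (q x + k * (w x)\<^sup>2 - kappa) * (real (Suc n) * dd v w x * w x ^ n))) (at x)"
    unfolding C_def[abs_def] k_def[symmetric] n(1)
    by (auto intro!: derivative_eq_intros d simp: power2_eq_square algebra_simps simp del: power_Suc)
  then have "dd u C x = (dd u q x + k * (2 * w x * dd u w x)) * w x ^ Suc n
      + (q x + k * (w x)\<^sup>2 - kappa) * (real (Suc n) * dd u w x * w x ^ n)" by (rule dd_eqI)
  also have "\<dots> = dd u w x * w x ^ n * ((2 * lam x * w x + 2 * k * (w x)\<^sup>2)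
      + (q x + k * (w x)\<^sup>2 - kappa) * real (Suc n))"
    by (simp add: dd_q_lam x algebra_simps power2_eq_square)
  also have "2 * lam x * w x = (real n + 1) * (kappa - q x) - rho * (w x)\<^sup>2"
    using w by (simp add: lam_def n(2))
  finally have "dd u C x = dd u w x * w x ^ n * ((real n + 1) * (kappa - q x) - rho * (w x)\<^sup>2
      + 2 * k * (w x)\<^sup>2 + (q x + k * (w x)\<^sup>2 - kappa) * real (Suc n))" by simp
  moreover have "rho * t = (real n + 3) * k * t" for t by (simp add: k_def n(2) add.commute)
  from this[of "(w x)\<^sup>2"] have "(real n + 1) * (kappa - q x) - rho * (w x)\<^sup>2
      + 2 * k * (w x)\<^sup>2 + (q x + k * (w x)\<^sup>2 - kappa) * real (Suc n) = 0"
    by (simp add: algebra_simps)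
  ultimately show ?thesis by simp
qed

lemma M_curvature:
  assumes x: "fst x \<in> S1" "snd x \<in> S2"
  shows "M.Rlow x a b c d = K1 (fst x) * (gL (fst x) (fst b) (fst c) * gL (fst x) (fst a) (fst d)
        - gL (fst x) (fst a) (fst c) * gL (fst x) (fst b) (fst d))
    + (w (fst x))\<^sup>2 * (kappa - q (fst x)) * (gF (snd x) (snd b) (snd c) * gF (snd x) (snd a) (snd d)
        - gF (snd x) (snd a) (snd c) * gF (snd x) (snd b) (snd d))
    + (- w (fst x) * lam (fst x)) * (gL (fst x) (fst a) (fst d) * gF (snd x) (snd b) (snd c)
       + gL (fst x) (fst b) (fst c) * gF (snd x) (snd a) (snd d)
       - gL (fst x) (fst a) (fst c) * gF (snd x) (snd b) (snd d)
       - gL (fst x) (fst b) (fst d) * gF (snd x) (snd a) (snd c))"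
  unfolding M_Rlow[OF x] L_curvature_and_hessian[OF x(1)] F_curv[OF x(2)] by (simp add: algebra_simps)

text \<open>With \<open>C\<close> = 0 the coefficients in \<open>M_curvature\<close> become k, k w^4
  and k w^2, which are those of constant curvature k for the metric gL + w^2 gF.\<close>

lemma sectional_if_C_zero:
  assumes x: "fst x \<in> S1" "snd x \<in> S2" and C: "C (fst x) = 0" and uv: "u \<noteq> v" "independent {u, v}"
  shows "sectional_curvature gM x u v = rho / (real DIM('e) + 1)"
proof -
  define k where "k = rho / (real DIM('e) + 1)"
  have w: "w (fst x) > 0" by (rule w_pos[OF x(1)])
  have kq: "kappa - q (fst x) = k * (w (fst x))\<^sup>2" using C w by (simp add: C_def k_def)
  have r: "rho * t = k * (real DIM('e) + 1) * t" for t by (simp add: k_def)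
  have "lam (fst x) * (2 * w (fst x)) = (real DIM('e) - 1) * (k * (w (fst x))\<^sup>2) - rho * (w (fst x))\<^sup>2"
    using w by (simp add: lam_def kq)
  then have "(2 * w (fst x)) * (- lam (fst x)) = (2 * w (fst x)) * (k * w (fst x))"
    unfolding r[of "(w (fst x))\<^sup>2"] by (simp add: algebra_simps power2_eq_square)
  then have lam: "- lam (fst x) = k * w (fst x)" using w by (metis mult_left_cancel zero_neq_numeral mult_eq_0_iff less_irrefl)
  have "K1 (fst x) = rho - real DIM('e) * (- lam (fst x)) / w (fst x)" by (simp add: K1_def)
  also have "\<dots> = rho - real DIM('e) * k" unfolding lam using w by simp
  also have "\<dots> = k" using r[of 1] by (simp add: algebra_simps)
  finally have K1: "K1 (fst x) = k" .
  have "M.Rlow x u v v u = k * (gM x u u * gM x v v - (gM x u v)\<^sup>2)"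
  proof -
    have l: "- w (fst x) * lam (fst x) = k * (w (fst x))\<^sup>2"
      using lam by (simp add: power2_eq_square) (metis minus_mult_right mult.left_commute)
    show ?thesis
      unfolding M_curvature[OF x] kq l K1 gM_eq L.g_sym[OF x(1), of "fst v" "fst u"]
        F.g_sym[OF x(2), of "snd v" "snd u"]
      by (simp add: algebra_simps power2_eq_square)
  qed
  moreover have "x \<in> S1 \<times> S2" using x by (simp add: mem_Times_iff)
  ultimately show ?thesis
    using M.gram_pos[of x u v] uv by (simp add: sectional_curvature_def M.curvature_low k_def)
qed

end

section \<open>Isometric immersions in a chart\<close>

locale immersed_chart = metric_chart S g for S :: "'e::euclidean_space set" and g +
  fixes X :: "'e \<Rightarrow> 'z::euclidean_space"
  assumes smooth_X: "smooth_on S X"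
    and isometric: "\<And>x u v. x \<in> S \<Longrightarrow> dd u X x \<bullet> dd v X x = g x u v"
begin

text \<open>Gauss formula: the tangential part of the second derivative is the image of the
  Christoffel symbol, so the difference is the second fundamental form.\<close>

definition \<alpha> where "\<alpha> x u v = dd u (dd v X) x - dd (christoffel g x u v) X x"

lemmas diff_X = smooth_onD[OF smooth_X]
lemmas diff_dX = smooth_onD[OF smooth_on_dd[OF smooth_X]]
lemmas diff_ddX = smooth_onD[OF smooth_on_dd[OF smooth_on_dd[OF smooth_X]]]
lemmas linear_dX = linear_dd[OF diff_X]

lemma ddX_sym: "x \<in> S \<Longrightarrow> dd u (dd v X) x = dd v (dd u X) x"
  by (rule dd_commute[OF open_S _ smooth_X])

lemma dd_g_X: "x \<in> S \<Longrightarrow>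
  dd a (\<lambda>y. g y u v) x = dd a (dd u X) x \<bullet> dd v X x + dd u X x \<bullet> dd a (dd v X) x"
proof -
  assume x: "x \<in> S"
  have "dd a (\<lambda>y. g y u v) x = dd a (\<lambda>y. dd u X y \<bullet> dd v X y) x"
    by (rule dd_eq_on[OF open_S x]) (simp add: isometric)
  then show ?thesis using dd_inner[OF diff_dX[OF x] diff_dX[OF x]] by simp
qed

text \<open>Differentiate the isometry condition in three directions and combine as in the Koszul
  formula.\<close>

lemma second_derivative_tangential:
  assumes x: "x \<in> S"
  shows "dd u (dd v X) x \<bullet> dd z X x = Gl x u v z"
  unfolding Gl_def
  using dd_g_X[OF x, where a=u and u=v and v=z] dd_g_X[OF x, where a=v and u=u and v=z]
    dd_g_X[OF x, where a=z and u=u and v=v]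
    ddX_sym[OF x, of u v] ddX_sym[OF x, of u z] ddX_sym[OF x, of v z]
  by (simp add: inner_commute)

lemma \<alpha>_normal: "x \<in> S \<Longrightarrow> \<alpha> x u v \<bullet> dd z X x = 0"
  by (simp add: \<alpha>_def inner_diff_left second_derivative_tangential isometric g_christoffel)

lemma \<alpha>_sym: "x \<in> S \<Longrightarrow> \<alpha> x u v = \<alpha> x v u"
  unfolding \<alpha>_def using ddX_sym[of x u v] christoffel_sym[of x u v] by simp

lemma \<alpha>_bilinear:
  assumes x: "x \<in> S"
  shows "bilinear (\<alpha> x)"
proof -
  have 1: "linear (\<lambda>u. \<alpha> x u v)" for v
    unfolding \<alpha>_def
    by (intro linear_compose_sub linear_dd[OF diff_dX[OF x]]
        linear_compose[OF christoffel_linear(1)[OF x] linear_dX[OF x], unfolded o_def])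
  moreover have "linear (\<lambda>v. \<alpha> x u v)" for u
    using 1[of u] \<alpha>_sym[OF x, of u] by simp
  ultimately show ?thesis by (simp add: bilinear_def)
qed

lemma second_derivative: "dd u (dd v X) x = \<alpha> x u v + dd (christoffel g x u v) X x"
  by (simp add: \<alpha>_def)

text \<open>\<open>Gl\<close> is the product of a second derivative of \<open>X\<close> with a first
  one. Differentiated once more, it gives a third derivative, symmetric in \<open>a\<close> and
  \<open>b\<close>, and a product of two second derivatives. The tangential part of the latter
  cancels the quadratic terms of \<open>Rlow\<close>, the normal part is the claim.\<close>

lemma gauss_equation:
  assumes x: "x \<in> S"
  shows "\<alpha> x a d \<bullet> \<alpha> x b c - \<alpha> x a c \<bullet> \<alpha> x b d = Rlow x a b c d"
proof -
  have n: "dd z X x \<bullet> \<alpha> x u v = 0" for z u v using \<alpha>_normal[OF x] by (simp add: inner_commute)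
  have 1: "dd a (\<lambda>y. Gl y b c d) x = dd a (dd b (dd c X)) x \<bullet> dd d X x
      + \<alpha> x b c \<bullet> \<alpha> x a d + g x (christoffel g x b c) (christoffel g x a d)" for a b
  proof -
    have "dd a (\<lambda>y. Gl y b c d) x = dd a (\<lambda>y. dd b (dd c X) y \<bullet> dd d X y) x"
      by (rule dd_eq_on[OF open_S x]) (simp add: second_derivative_tangential)
    also have "\<dots> = dd b (dd c X) x \<bullet> dd a (dd d X) x + dd a (dd b (dd c X)) x \<bullet> dd d X x"
      by (rule dd_inner[OF diff_ddX[OF x] diff_dX[OF x]])
    finally show ?thesis
      by (simp add: second_derivative[where u=b and v=c] second_derivative[where u=a and v=d] inner_add_left inner_add_right
          \<alpha>_normal x n isometric)
  qed
  have "dd a (dd b (dd c X)) x = dd b (dd a (dd c X)) x"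
    by (rule dd_commute[OF open_S x smooth_on_dd[OF smooth_X]])
  then show ?thesis
    unfolding Rlow_def 1 using g_sym[OF x, of "christoffel g x a c" "christoffel g x b d"]
    by (simp add: inner_commute)
qed

lemma dX_inj: "x \<in> S \<Longrightarrow> inj (frechet_derivative X (at x))"
  using linear_injective_0[OF linear_dX] isometric g_pos by (metis inner_zero_left less_irrefl)

lemma normal_space:
  assumes x: "x \<in> S" and dim: "DIM('z) = DIM('e) + 2"
  shows "subspace {v. \<forall>u. dd u X x \<bullet> v = 0}" "dim {v. \<forall>u. dd u X x \<bullet> v = 0} = 2"
proof -
  have T: "subspace (range (frechet_derivative X (at x)))"
    using linear_subspace_image[OF linear_dX[OF x] subspace_UNIV] .
  have dT: "dim (range (frechet_derivative X (at x))) = DIM('e)"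
    using dim_image_eq[OF linear_dX[OF x], of UNIV] dX_inj[OF x] by (simp add: inj_on_subset)
  have e: "{v. \<forall>u. dd u X x \<bullet> v = 0} = {v. \<forall>t \<in> range (frechet_derivative X (at x)). orthogonal t v}"
    by (auto simp: orthogonal_def)
  show "subspace {v. \<forall>u. dd u X x \<bullet> v = 0}"
    by (auto simp: subspace_def inner_add_right)
  have "dim {v \<in> UNIV. \<forall>t \<in> range (frechet_derivative X (at x)). orthogonal t v}
      + dim (range (frechet_derivative X (at x))) = dim (UNIV :: 'z set)"
    by (rule dim_subspace_orthogonal_to_vectors[OF T subspace_UNIV]) simp
  then show "dim {v. \<forall>u. dd u X x \<bullet> v = 0} = 2" using dT dim e by simp
qed

end

text \<open>The sum \<open>y\<close> of the squares satisfies y' <= 2 M card(I) y, where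
  \<open>M\<close> bounds the coefficients on [0, 1], and \<open>gronwall_zero\<close>
  applies.\<close>

lemma linear_ode_zero:
  fixes a :: "'i \<Rightarrow> real \<Rightarrow> real"
  assumes I: "finite I"
    and d: "\<And>i t. i \<in> I \<Longrightarrow> 0 \<le> t \<Longrightarrow> t \<le> 1 \<Longrightarrow>
      (a i has_real_derivative (\<Sum>j\<in>I. c i j t * a j t)) (at t)"
    and c: "\<And>i j. i \<in> I \<Longrightarrow> j \<in> I \<Longrightarrow> continuous_on {0..1} (c i j)"
    and a0: "\<And>i. i \<in> I \<Longrightarrow> a i 0 = 0" and i: "i \<in> I"
  shows "a i 1 = 0"
proof -
  have "\<exists>B. \<forall>t\<in>{0..1}. \<bar>c i j t\<bar> \<le> B" if ij: "i \<in> I" "j \<in> I" for i j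
    using compact_continuous_image[OF c[OF ij] compact_Icc] compact_imp_bounded
    by (metis (no_types, lifting) bounded_iff image_eqI real_norm_def)
  then obtain B where B: "\<And>i j t. i \<in> I \<Longrightarrow> j \<in> I \<Longrightarrow> t \<in> {0..1} \<Longrightarrow> \<bar>c i j t\<bar> \<le> B i j" by metis
  define M where "M = (\<Sum>i\<in>I. \<Sum>j\<in>I. \<bar>B i j\<bar>)"
  have M: "\<bar>c i j t\<bar> \<le> M" if "i \<in> I" "j \<in> I" "t \<in> {0..1}" for i j t
  proof -
    have "\<bar>c i j t\<bar> \<le> \<bar>B i j\<bar>" using B[OF that] by linarith
    also have "\<dots> \<le> (\<Sum>j\<in>I. \<bar>B i j\<bar>)" by (rule member_le_sum) (use that I in auto)
    also have "\<dots> \<le> M" unfolding M_def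
      by (rule member_le_sum[where f="\<lambda>i. \<Sum>j\<in>I. \<bar>B i j\<bar>"]) (use that I in \<open>auto intro: sum_nonneg\<close>)
    finally show ?thesis .
  qed
  define y where "y t = (\<Sum>i\<in>I. (a i t)\<^sup>2)" for t
  define y' where "y' t = (\<Sum>i\<in>I. 2 * (a i t * (\<Sum>j\<in>I. c i j t * a j t)))" for t
  have "y 1 = 0"
  proof (rule gronwall_zero[where y=y and y'=y' and C="2 * (M * card I)"])
    fix t :: real assume t: "0 \<le> t" "t \<le> 1"
    show "(y has_real_derivative y' t) (at t)"
      unfolding y_def y'_def using d[OF _ t]
      by (auto intro!: derivative_eq_intros sum.cong)
    have "y' t \<le> (\<Sum>i\<in>I. 2 * (\<bar>a i t\<bar> * (\<Sum>j\<in>I. M * \<bar>a j t\<bar>)))"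
      unfolding y'_def
    proof (rule sum_mono)
      fix i assume i: "i \<in> I"
      have "a i t * (\<Sum>j\<in>I. c i j t * a j t) \<le> \<bar>a i t\<bar> * \<bar>\<Sum>j\<in>I. c i j t * a j t\<bar>"
        by (metis abs_ge_self abs_mult)
      also have "\<bar>\<Sum>j\<in>I. c i j t * a j t\<bar> \<le> (\<Sum>j\<in>I. M * \<bar>a j t\<bar>)"
        using M[OF i] t by (intro order_trans[OF sum_abs] sum_mono) (auto simp: abs_mult intro!: mult_right_mono)
      finally show "2 * (a i t * (\<Sum>j\<in>I. c i j t * a j t)) \<le> 2 * (\<bar>a i t\<bar> * (\<Sum>j\<in>I. M * \<bar>a j t\<bar>))"
        by (simp add: mult_left_mono)
    qed
    also have "\<dots> = 2 * (M * (\<Sum>i\<in>I. \<bar>a i t\<bar>)\<^sup>2)"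
      by (simp add: sum_distrib_left[symmetric] sum_distrib_right[symmetric] power2_eq_square algebra_simps)
    also have "\<dots> \<le> 2 * (M * (card I * y t))"
    proof -
      have "(\<Sum>i\<in>I. \<bar>a i t\<bar>)\<^sup>2 \<le> (\<Sum>i\<in>I. \<bar>a i t\<bar>\<^sup>2) * card I"
        by (rule sum_squared_le_sum_of_squares)
      then show ?thesis using M_def by (auto simp: y_def mult.commute intro!: mult_left_mono sum_nonneg)
    qed
    finally show "y' t \<le> 2 * (M * card I) * y t" by simp
  qed (use a0 in \<open>auto simp: y_def intro: sum_nonneg\<close>)
  then show ?thesis
    using i I by (simp add: y_def sum_nonneg_eq_0_iff)
qed

section \<open>Umbilical immersions\<close>

context immersed_chart
begin

lemma dd_dX_field:
  assumes x: "x \<in> S" and Y: "Y differentiable (at x)"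
  shows "dd a (\<lambda>x. dd (Y x) X x) x = \<alpha> x a (Y x) + dd (christoffel g x a (Y x)) X x + dd (dd a Y x) X x"
proof -
  have "((\<lambda>x. dd (Y x) X x) has_derivative (\<lambda>v. dd v (dd (Y x) X) x + dd (dd v Y x) X x)) (at x)"
    by (rule linear_family_derivative[OF open_S x, where A="\<lambda>x v. dd v X x"])
      (use x linear_dX diff_dX Y in auto)
  from dd_eqI[OF this, of a] show ?thesis by (simp add: \<alpha>_def)
qed

text \<open>The tangential part of the derivative of \<mu> comes from differentiating the
  orthogonality of \<mu> and dX, and it has no \<mu> component since \<mu> has constant length. The
  rest, \<open>n\<close>, is excluded by the Codazzi equation: symmetry of third derivatives makes
  g(u, v) times the \<open>n\<close> component of d\<mu>(b) symmetric in \<open>u\<close> and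
  \<open>b\<close>, and a \<open>u\<close> orthogonal to \<open>a\<close> makes one side 0.\<close>

lemma umbilic_normal_derivative:
  assumes dim: "DIM('e) \<ge> 2" and \<alpha>: "\<And>x u v. x \<in> S \<Longrightarrow> \<alpha> x u v = g x u v *\<^sub>R \<mu> x"
    and \<mu>: "smooth_on S \<mu>" "\<And>x. x \<in> S \<Longrightarrow> \<mu> x \<bullet> \<mu> x = k" and x: "x \<in> S"
  shows "dd a \<mu> x = - k *\<^sub>R dd a X x"
proof -
  interpret G: posdef_form "g x"
    by unfold_locales (use x g_bilinear g_sym g_pos in auto)
  note d\<mu> = smooth_onD[OF \<mu>(1) x]
  have \<mu>X: "\<mu> y \<bullet> dd z X y = 0" if y: "y \<in> S" for y z
  proof -
    obtain e :: 'e where e: "e \<noteq> 0" using nonzero_Basis nonempty_Basis by blast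
    show ?thesis using \<alpha>_normal[OF y, of e e z] g_pos[OF y e] by (simp add: \<alpha> y)
  qed
  have 1: "dd a \<mu> x \<bullet> dd z X x = - k * g x a z" for a z
  proof -
    have "dd a (\<lambda>y. \<mu> y \<bullet> dd z X y) x = 0"
      using dd_eq_on[OF open_S x, of "\<lambda>y. \<mu> y \<bullet> dd z X y" "\<lambda>y. 0" a] \<mu>X by simp
    then have "\<mu> x \<bullet> dd a (dd z X) x + dd a \<mu> x \<bullet> dd z X x = 0"
      using dd_inner[OF d\<mu> diff_dX[OF x]] by simp
    moreover have "\<mu> x \<bullet> dd a (dd z X) x = k * g x a z"
      using second_derivative[where u=a and v=z and x=x] \<mu>(2)[OF x]
      by (simp add: \<alpha> x inner_add_right \<mu>X mult.commute)
    ultimately show ?thesis by simp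
  qed
  have 2: "dd a \<mu> x \<bullet> \<mu> x = 0" for a
  proof -
    have "dd a (\<lambda>y. \<mu> y \<bullet> \<mu> y) x = 0"
      using dd_eq_on[OF open_S x, of "\<lambda>y. \<mu> y \<bullet> \<mu> y" "\<lambda>y. k" a] \<mu>(2) by simp
    then show ?thesis using dd_inner[OF d\<mu> d\<mu>] by (simp add: inner_commute)
  qed
  define n where "n = dd a \<mu> x + k *\<^sub>R dd a X x"
  have nX: "dd z X x \<bullet> n = 0" for z
    using 1[of a z] isometric[OF x, of z a] g_sym[OF x, of z a] by (simp add: n_def inner_add_right inner_commute)
  have n\<mu>: "\<mu> x \<bullet> n = 0" using 2[of a] \<mu>X[OF x, of a] by (simp add: n_def inner_add_right inner_commute)
  have cod: "g x u v * (dd b \<mu> x \<bullet> n) = g x b v * (dd u \<mu> x \<bullet> n)" for u v b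
  proof -
    have 3: "dd b (dd u (dd v X)) x \<bullet> n = g x u v * (dd b \<mu> x \<bullet> n)" for b u
    proof -
      note dc = smooth_onD[OF smooth_christoffel x, of u v]
      have dX': "(\<lambda>y. dd (christoffel g y u v) X y) differentiable (at x)"
        using linear_family_derivative[OF open_S x, where A="\<lambda>x v. dd v X x" and y="\<lambda>y. christoffel g y u v"]
          linear_dX diff_dX[OF x] dc unfolding differentiable_def by blast
      have dg: "(\<lambda>y. g y u v *\<^sub>R \<mu> y) differentiable (at x)"
        by (intro differentiable_scaleR diff_g x d\<mu>)
      have "dd b (dd u (dd v X)) x = dd b (\<lambda>y. g y u v *\<^sub>R \<mu> y + dd (christoffel g y u v) X y) x"
        by (rule dd_eq_on[OF open_S x]) (simp add: second_derivative \<alpha>)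
      also have "\<dots> = g x u v *\<^sub>R dd b \<mu> x + dd b (\<lambda>y. g y u v) x *\<^sub>R \<mu> x
          + (g x b (christoffel g x u v) *\<^sub>R \<mu> x + dd (christoffel g x b (christoffel g x u v)) X x
            + dd (dd b (\<lambda>y. christoffel g y u v) x) X x)"
        unfolding dd_add[OF dg dX'] dd_scaleR[OF diff_g[OF x] d\<mu>] dd_dX_field[OF x dc] by (simp add: \<alpha> x)
      finally show ?thesis by (simp add: inner_add_left nX n\<mu>)
    qed
    have "dd b (dd u (dd v X)) x = dd u (dd b (dd v X)) x"
      by (rule dd_commute[OF open_S x smooth_on_dd[OF smooth_X]])
    then show ?thesis using 3[of b u] 3[of u b] by simp
  qed
  obtain u where u: "u \<noteq> 0" "g x a u = 0" using G.orthogonal1[OF dim] by blast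
  have "dd a \<mu> x \<bullet> n = 0" using cod[of u u a] u G.pos[OF u(1)] by simp
  then have "n \<bullet> n = 0" using nX[of a] by (simp add: n_def inner_add_left)
  then show ?thesis by (simp add: n_def eq_neg_iff_add_eq_0)
qed

end

section \<open>Generic immersions of Einstein warped products\<close>

text \<open>\<open>generic\<close> lists the nondegeneracies that \<open>split_form\<close> asks
  for, up to powers of \<open>w\<close>: there K2 = - w lam and K3 = w^2 (kappa - q).
  \<open>q_nonzero\<close> says that the gradient of \<open>w\<close> has no zero, on which
  \<open>kappa_one\<close> and the coordinates of the base rely.\<close>

locale generic_immersion = einstein_warped S1 gL S2 gF w rho kappa
  for S1 :: "'d::euclidean_space set" and gL and S2 :: "'e::euclidean_space set" and gF and w and rho kappa +
  fixes X :: "'d \<times> 'e \<Rightarrow> 'z::euclidean_space"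
  assumes smooth_immersion: "smooth_on (S1 \<times> S2) X"
    and isometric_immersion: "\<And>x u v. x \<in> S1 \<times> S2 \<Longrightarrow> dd u X x \<bullet> dd v X x = gM x u v"
    and codim: "DIM('z) = DIM('d) + DIM('e) + 2"
    and convex_S1: "convex S1" and convex_S2: "convex S2" and S1_nonempty: "S1 \<noteq> {}"
    and q_nonzero: "\<And>x. x \<in> S1 \<Longrightarrow> q x \<noteq> 0"
    and generic: "\<And>x. x \<in> S1 \<Longrightarrow> lam x \<noteq> 0" "\<And>x. x \<in> S1 \<Longrightarrow> kappa - q x \<noteq> 0"
      "\<And>x. x \<in> S1 \<Longrightarrow> K1 x * (kappa - q x) \<noteq> (lam x)\<^sup>2"
    and kappa_values: "kappa \<in> {1, -1, 0}"
begin

sublocale I: immersed_chart "S1 \<times> S2" gM X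
  by unfold_locales (use smooth_immersion isometric_immersion in auto)

lemma q_pos: "x \<in> S1 \<Longrightarrow> q x > 0"
  using q_nonzero[of x] L.g_pos[of x "Z x"] L.g_simps(9)[of x "Z x"] unfolding q_def
  by (cases "Z x = 0") auto

text \<open>\<open>split\<close> is applied to the normal space, a plane because the codimension is
  2; the Gauss equation and \<open>M_curvature\<close> supply its hypothesis
  \<open>gauss\<close>.\<close>

lemma second_fundamental_form:
  assumes x: "x \<in> S1 \<times> S2"
  obtains \<nu> where "\<And>u v. I.\<alpha> x (u, 0) (0, v) = 0" "\<And>u v. I.\<alpha> x (0, u) (0, v) = gF (snd x) u v *\<^sub>R \<nu>"
    "\<And>u. dd u X x \<bullet> \<nu> = 0" "\<nu> \<bullet> \<nu> = (w (fst x))\<^sup>2 * (kappa - q (fst x))"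
proof -
  have x': "fst x \<in> S1" "snd x \<in> S2" using x by auto
  let ?N = "{v. \<forall>u. dd u X x \<bullet> v = 0}"
  have w: "w (fst x) > 0" by (rule w_pos[OF x'(1)])
  interpret split_form "gL (fst x)" "gF (snd x)" "I.\<alpha> x" ?N "K1 (fst x)" "- w (fst x) * lam (fst x)"
    "(w (fst x))\<^sup>2 * (kappa - q (fst x))"
  proof
    show "bilinear (gL (fst x))" "\<And>u v. gL (fst x) u v = gL (fst x) v u" "\<And>u. u \<noteq> 0 \<Longrightarrow> gL (fst x) u u > 0"
      using L.g_bilinear L.g_sym L.g_pos x' by auto
    show "bilinear (gF (snd x))" "\<And>u v. gF (snd x) u v = gF (snd x) v u" "\<And>u. u \<noteq> 0 \<Longrightarrow> gF (snd x) u u > 0"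
      using F.g_bilinear F.g_sym F.g_pos x' by auto
    show "DIM('d) = 2" "DIM('e) \<ge> 3" by (fact dims)+
    show "subspace ?N" "dim ?N = 2" using I.normal_space[OF x] codim by auto
    show "bilinear (I.\<alpha> x)" "\<And>u v. I.\<alpha> x u v = I.\<alpha> x v u" by (rule I.\<alpha>_bilinear[OF x] I.\<alpha>_sym[OF x])+
    show "I.\<alpha> x u v \<in> ?N" for u v using I.\<alpha>_normal[OF x] by (simp add: inner_commute)
    show "- w (fst x) * lam (fst x) \<noteq> 0" "(w (fst x))\<^sup>2 * (kappa - q (fst x)) \<noteq> 0"
      using w generic[OF x'(1)] by auto
    show "K1 (fst x) * ((w (fst x))\<^sup>2 * (kappa - q (fst x))) \<noteq> - w (fst x) * lam (fst x) * (- w (fst x) * lam (fst x))"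
      using w generic(3)[OF x'(1)] by (simp add: power2_eq_square)
  qed (simp only: I.gauss_equation[OF x] M_curvature[OF x'])
  show ?thesis
  proof (rule split)
    fix \<nu> assume a: "\<And>u v. I.\<alpha> x (u, 0) (0, v) = 0" "\<And>u v. I.\<alpha> x (0, u) (0, v) = gF (snd x) u v *\<^sub>R \<nu>"
      "\<nu> \<in> ?N" "\<nu> \<bullet> \<nu> = (w (fst x))\<^sup>2 * (kappa - q (fst x))"
    show thesis by (intro that[of \<nu>] a(1,2,4)) (use a(3) in blast)
  qed
qed

lemma kappa_one: "kappa = 1"
proof -
  obtain x y where "x \<in> S1" "y \<in> S2" using S1_nonempty S2_nonempty by auto
  then have "(x, y) \<in> S1 \<times> S2" by simp
  from second_fundamental_form[OF this] obtain \<nu> :: 'z where "\<nu> \<bullet> \<nu> = (w x)\<^sup>2 * (kappa - q x)"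
    by (metis fst_conv)
  then have "kappa - q x \<ge> 0"
    using w_pos[OF \<open>x \<in> S1\<close>] inner_ge_zero[of \<nu>] by (simp add: zero_le_mult_iff)
  then show ?thesis using q_pos[OF \<open>x \<in> S1\<close>] kappa_values by auto
qed

lemma q_less_one: "x \<in> S1 \<Longrightarrow> q x < 1"
proof -
  assume x: "x \<in> S1"
  obtain y where "y \<in> S2" using S2_nonempty by auto
  then have "(x, y) \<in> S1 \<times> S2" using x by simp
  from second_fundamental_form[OF this] obtain \<nu> :: 'z where "\<nu> \<bullet> \<nu> = (w x)\<^sup>2 * (kappa - q x)"
    by (metis fst_conv)
  then have "kappa - q x \<ge> 0"
    using w_pos[OF x] inner_ge_zero[of \<nu>] by (simp add: zero_le_mult_iff)
  then show ?thesis using generic(2)[OF x] kappa_one by auto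
qed

text \<open>The mixed second fundamental form vanishes, so the Gauss formula leaves only the
  Christoffel term.\<close>

lemma mixed_derivative:
  assumes x: "x \<in> S1 \<times> S2"
  shows "dd (u, 0) (dd (0, v) X) x = (dd u w (fst x) / w (fst x)) *\<^sub>R dd (0, v) X x"
proof -
  have x': "fst x \<in> S1" "snd x \<in> S2" using x by auto
  have "christoffel gM x (u, 0) (0, v) = (dd u w (fst x) / w (fst x)) *\<^sub>R (0, v)"
    unfolding M_christoffel[OF x']
    by (simp add: F.g_simps x' linear_0[OF linear_dw[OF x'(1)]] linear_0[OF L.christoffel_linear(2)[OF x'(1)]]
        linear_0[OF F.christoffel_linear(1)[OF x'(2)]])
  moreover have "I.\<alpha> x (u, 0) (0, v) = 0" using second_fundamental_form[OF x] by metis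
  ultimately show ?thesis
    using I.second_derivative[where u="(u, 0)" and v="(0, v)" and x=x] linear_scale[OF I.linear_dX[OF x], of _ "(0, v)"]
    by (simp del: scaleR_Pair)
qed

lemma dX_fst:
  assumes "x \<in> S1" "y \<in> S2"
  shows "dd u (\<lambda>x. X (x, y)) x = dd (u, 0) X (x, y)" "(\<lambda>x. X (x, y)) differentiable (at x)"
proof -
  have "((\<lambda>x. X (x, y)) has_derivative (\<lambda>u. dd (u, 0) X (x, y))) (at x)"
    by (rule has_derivative_compose[where f="\<lambda>x. (x, y)" and g=X, OF _ dd_derivative[OF I.diff_X]])
      (use assms in \<open>auto intro!: derivative_eq_intros\<close>)
  then show "dd u (\<lambda>x. X (x, y)) x = dd (u, 0) X (x, y)" "(\<lambda>x. X (x, y)) differentiable (at x)"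
    by (auto simp: dd_eqI differentiable_def)
qed

lemma dX_snd:
  assumes "x \<in> S1" "y \<in> S2"
  shows "dd v (\<lambda>y. X (x, y)) y = dd (0, v) X (x, y)" "(\<lambda>y. X (x, y)) differentiable (at y)"
proof -
  have "((\<lambda>y. X (x, y)) has_derivative (\<lambda>v. dd (0, v) X (x, y))) (at y)"
    by (rule has_derivative_compose[where f="\<lambda>y. (x, y)" and g=X, OF _ dd_derivative[OF I.diff_X]])
      (use assms in \<open>auto intro!: derivative_eq_intros\<close>)
  then show "dd v (\<lambda>y. X (x, y)) y = dd (0, v) X (x, y)" "(\<lambda>y. X (x, y)) differentiable (at y)"
    by (auto simp: dd_eqI differentiable_def)
qed

lemma smooth_slices:
  assumes "x \<in> S1" "y \<in> S2"
  shows "smooth_on S1 (\<lambda>x. X (x, y))" "smooth_on S2 (\<lambda>y. X (x, y))"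
  by (rule smooth_on_compose[OF smooth_immersion];
      use assms L.open_S F.open_S in \<open>auto intro!: smooth_intros open_Times\<close>)+

text \<open>By \<open>mixed_derivative\<close> the vertical derivative divided by \<open>w\<close>
  has derivative 0 along the base.\<close>

lemma vertical_derivative_scaling:
  assumes "p \<in> S1" "x \<in> S1" "y \<in> S2"
  shows "dd (0, v) X (x, y) = (w x / w p) *\<^sub>R dd (0, v) X (p, y)"
proof -
  define f where "f x = inverse (w x) *\<^sub>R dd (0, v) X (x, y)" for x
  have "f x = f p"
  proof (rule dd_zero_const[OF convex_S1 L.open_S _ _ assms(2,1)])
    fix z u assume z: "z \<in> S1"
    have w: "w z > 0" by (rule w_pos[OF z])
    have zy: "(z, y) \<in> S1 \<times> S2" using z assms by auto
    have 1: "((\<lambda>x. dd (0, v) X (x, y)) has_derivative (\<lambda>u. dd (u, 0) (dd (0, v) X) (z, y))) (at z)"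
      by (rule has_derivative_compose[where f="\<lambda>x. (x, y)" and g="dd (0, v) X", OF _ dd_derivative[OF I.diff_dX]])
        (use zy in \<open>auto intro!: derivative_eq_intros\<close>)
    have 2: "((\<lambda>x. inverse (w x)) has_derivative (\<lambda>u. - (inverse (w z) * dd u w z * inverse (w z)))) (at z)"
      using w by (intro Deriv.has_derivative_inverse dd_derivative diff_w z) auto
    have "(f has_derivative (\<lambda>u. inverse (w z) *\<^sub>R dd (u, 0) (dd (0, v) X) (z, y)
        + (- (inverse (w z) * dd u w z * inverse (w z))) *\<^sub>R dd (0, v) X (z, y))) (at z)"
      unfolding f_def by (rule has_derivative_scaleR[OF 2 1])
    moreover have "(\<lambda>u. inverse (w z) *\<^sub>R dd (u, 0) (dd (0, v) X) (z, y)
        + (- (inverse (w z) * dd u w z * inverse (w z))) *\<^sub>R dd (0, v) X (z, y)) = (\<lambda>u. 0)"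
      using w by (intro ext) (simp add: mixed_derivative[OF zy] divide_inverse algebra_simps)
    ultimately have "(f has_derivative (\<lambda>u. 0)) (at z)" by simp
    then show "f differentiable (at z)" "dd u f z = 0"
      by (auto simp: dd_eqI differentiable_def)
  qed
  then have "w x *\<^sub>R (inverse (w x) *\<^sub>R dd (0, v) X (x, y)) = w x *\<^sub>R (inverse (w p) *\<^sub>R dd (0, v) X (p, y))"
    by (simp only: f_def)
  then show ?thesis using w_pos[OF assms(2)] by (simp add: divide_inverse)
qed

text \<open>
  The partial derivatives of \<open>X\<close> along the fiber scale with \<open>w\<close>, so that \<open>X (x, y) = w x s y + h0 x\<close>. The
  immersion \<open>s\<close> of the fiber is umbilical: its second fundamental form is \<open>gF\<close> times a unit normal field
  \<open>\<mu>\<close> with \<open>d\<mu> = - ds\<close>, so \<open>s\<close> and \<open>\<sigma> = - \<mu>\<close> differ by a translation.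
\<close>

theorem immersion_splits:
  obtains \<sigma> :: "'e \<Rightarrow> 'z" and h :: "'d \<Rightarrow> 'z" where
    "smooth_on S2 \<sigma>" "smooth_on S1 h"
    "\<And>x y. x \<in> S1 \<Longrightarrow> y \<in> S2 \<Longrightarrow> X (x, y) = w x *\<^sub>R \<sigma> y + h x"
    "\<And>y. y \<in> S2 \<Longrightarrow> \<sigma> y \<bullet> \<sigma> y = 1"
    "\<And>y u v. y \<in> S2 \<Longrightarrow> dd u \<sigma> y \<bullet> dd v \<sigma> y = gF y u v"
    "\<And>y u v. y \<in> S2 \<Longrightarrow> dd u (dd v \<sigma>) y = dd (christoffel gF y u v) \<sigma> y - gF y u v *\<^sub>R \<sigma> y"
    "\<And>y v. y \<in> S2 \<Longrightarrow> \<sigma> y \<bullet> dd v \<sigma> y = 0"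
    "\<And>x y u. x \<in> S1 \<Longrightarrow> y \<in> S2 \<Longrightarrow> dd u h x \<bullet> \<sigma> y = 0"
    "\<And>x y u v. x \<in> S1 \<Longrightarrow> y \<in> S2 \<Longrightarrow> dd u h x \<bullet> dd v \<sigma> y = 0"
    "\<And>x u v. x \<in> S1 \<Longrightarrow> dd u h x \<bullet> dd v h x = gL x u v - dd u w x * dd v w x"
proof -
  obtain p where p: "p \<in> S1" using S1_nonempty by auto
  obtain p2 where p2: "p2 \<in> S2" using S2_nonempty by auto
  have wp: "w p > 0" by (rule w_pos[OF p])
  define s where "s y = X (p, y) /\<^sub>R w p" for y
  have s_smooth: "smooth_on S2 s"
    unfolding s_def[abs_def]
    by (rule smooth_on_bounded_linear[OF bounded_linear_scaleR_right F.open_S smooth_slices(2)[OF p p2]])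
  have ds: "dd v s y = inverse (w p) *\<^sub>R dd (0, v) X (p, y)" if "y \<in> S2" for y v
    unfolding s_def[abs_def]
    using dd_bounded_linear[OF bounded_linear_scaleR_right dX_snd(2)[OF p that]] dX_snd(1)[OF p that] by simp
  have dXv: "dd (0, v) X (x, y) = w x *\<^sub>R dd v s y" if "x \<in> S1" "y \<in> S2" for x y v
    using vertical_derivative_scaling[OF p that] ds[OF that(2)] by (simp add: divide_inverse)
  define h0 where "h0 x = X (x, p2) - w x *\<^sub>R s p2" for x
  have X0: "X (x, y) = w x *\<^sub>R s y + h0 x" if x: "x \<in> S1" and y: "y \<in> S2" for x y
  proof -
    have "X (x, y) - w x *\<^sub>R s y = X (x, p2) - w x *\<^sub>R s p2"
    proof (rule dd_zero_const[OF convex_S2 F.open_S _ _ y p2, where f="\<lambda>y. X (x, y) - w x *\<^sub>R s y"])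
      fix z v assume z: "z \<in> S2"
      note sd = smooth_onD[OF s_smooth z]
      show "(\<lambda>y. X (x, y) - w x *\<^sub>R s y) differentiable (at z)"
        by (intro differentiable_diff dX_snd x z differentiable_scaleR sd) simp
      have "(\<lambda>y. w x *\<^sub>R s y) differentiable (at z)" by (intro differentiable_scaleR sd) simp
      then show "dd v (\<lambda>y. X (x, y) - w x *\<^sub>R s y) z = 0"
        using dd_diff[OF dX_snd(2)[OF x z]] dd_bounded_linear[OF bounded_linear_scaleR_right sd]
          dX_snd(1)[OF x z] dXv[OF x z] by simp
    qed
    then show ?thesis by (simp add: h0_def algebra_simps)
  qed
  interpret s: immersed_chart S2 gF s
  proof
    fix y u v assume y: "y \<in> S2"
    have "dd (0, u) X (p, y) \<bullet> dd (0, v) X (p, y) = (w p)\<^sup>2 * gF y u v"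
      using isometric_immersion[of "(p, y)"] p y by (simp add: gM_eq L.g_simps)
    then show "dd u s y \<bullet> dd v s y = gF y u v"
      using wp by (simp add: dXv[OF p y] power2_eq_square)
  qed (rule s_smooth)
  define Zh where "Zh x y = dd (Z x, 0) X (x, y)" for x y
  have \<alpha>: "\<exists>\<mu>. (\<forall>u v. s.\<alpha> y u v = gF y u v *\<^sub>R \<mu>) \<and> \<mu> \<bullet> \<mu> = 1 \<and> (\<forall>u. dd (u, 0) X (x, y) \<bullet> \<mu> = - dd u w x)"
    if x: "x \<in> S1" and y: "y \<in> S2" for x y
  proof -
    have xy: "(x, y) \<in> S1 \<times> S2" using x y by simp
    have w: "w x > 0" by (rule w_pos[OF x])
    obtain \<nu> where \<nu>: "\<And>u v. I.\<alpha> (x, y) (0, u) (0, v) = gF y u v *\<^sub>R \<nu>"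
      "\<And>u. dd u X (x, y) \<bullet> \<nu> = 0" "\<nu> \<bullet> \<nu> = (w x)\<^sup>2 * (kappa - q x)"
      using second_fundamental_form[OF xy] by (metis fst_conv snd_conv)
    \<comment> \<open>The second derivative of the slice \<open>s\<close> has two parts normal to
      it: \<nu>, and, from the Christoffel symbol, the image of the gradient of \<open>w\<close>.
      Their squared lengths 1 - q and q add up to 1.\<close>
    define \<mu> where "\<mu> = inverse (w x) *\<^sub>R \<nu> - Zh x y"
    have zz: "Zh x y \<bullet> Zh x y = q x" "\<nu> \<bullet> Zh x y = 0"
      using isometric_immersion[OF xy, of "(Z x, 0)" "(Z x, 0)"] \<nu>(2)[of "(Z x, 0)"]
      by (auto simp: Zh_def gM_eq F.g_simps y q_def inner_commute)
    have "\<mu> \<bullet> \<mu> = 1"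
      using zz w \<nu>(3) kappa_one
      by (simp add: \<mu>_def inner_diff_left inner_diff_right inner_commute[of "Zh x y" \<nu>] power2_eq_square field_simps)
    moreover have "dd (u, 0) X (x, y) \<bullet> \<mu> = - dd u w x" for u
      using isometric_immersion[OF xy, of "(u, 0)" "(Z x, 0)"] \<nu>(2)[of "(u, 0)"] gL_Z'[OF x, of u]
      by (simp add: \<mu>_def inner_diff_right Zh_def gM_eq F.g_simps y)
    moreover have "s.\<alpha> y u v = gF y u v *\<^sub>R \<mu>" for u v
    proof -
      have "dd (0, u) (dd (0, v) X) (x, y) = w x *\<^sub>R dd u (dd v s) y"
      proof -
        have 1: "((\<lambda>y. dd (0, v) X (x, y)) has_derivative (\<lambda>u. dd (0, u) (dd (0, v) X) (x, y))) (at y)"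
          by (rule has_derivative_compose[where f="\<lambda>y. (x, y)" and g="dd (0, v) X", OF _ dd_derivative[OF I.diff_dX]])
            (use xy in \<open>auto intro!: derivative_eq_intros\<close>)
        have "dd u (\<lambda>y. dd (0, v) X (x, y)) y = dd u (\<lambda>y. w x *\<^sub>R dd v s y) y"
          by (rule dd_eq_on[OF F.open_S y]) (rule dXv[OF x])
        then show ?thesis
          using dd_eqI[OF 1, of u] dd_bounded_linear[OF bounded_linear_scaleR_right s.diff_dX[OF y]] by simp
      qed
      moreover have "christoffel gM (x, y) (0, u) (0, v) = (- (w x * gF y u v)) *\<^sub>R (Z x, 0) + (0, christoffel gF y u v)"
        using M_christoffel[of "(x, y)" "(0, u)" "(0, v)"] x y
        by (simp add: linear_0[OF linear_dw[OF x]] linear_0[OF L.christoffel_linear(2)[OF x]])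
      then have "dd (christoffel gM (x, y) (0, u) (0, v)) X (x, y) =
          (- (w x * gF y u v)) *\<^sub>R Zh x y + w x *\<^sub>R dd (christoffel gF y u v) s y"
        using linear_add[OF I.linear_dX[OF xy]] linear_scale[OF I.linear_dX[OF xy], of "w x * gF y u v" "(Z x, 0)"]
          linear_diff[OF I.linear_dX[OF xy]]
          dXv[OF x y] by (simp add: Zh_def del: scaleR_Pair add_Pair)
      ultimately have "w x *\<^sub>R dd u (dd v s) y = gF y u v *\<^sub>R \<nu> - (w x * gF y u v) *\<^sub>R Zh x y
          + w x *\<^sub>R dd (christoffel gF y u v) s y"
        using I.second_derivative[where u="(0, u)" and v="(0, v)" and x="(x, y)"] \<nu>(1) by (simp add: algebra_simps)
      then have "w x *\<^sub>R s.\<alpha> y u v = w x *\<^sub>R (gF y u v *\<^sub>R \<mu>)"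
        using w by (simp add: s.\<alpha>_def \<mu>_def algebra_simps)
      then show ?thesis using w by (simp only: scaleR_cancel_left) simp
    qed
    ultimately show ?thesis by blast
  qed
  obtain e :: 'e where e: "e \<noteq> 0" using nonzero_Basis nonempty_Basis by blast
  \<comment> \<open>The vector found above was obtained separately for each \<open>x\<close>. It is
    determined by \<open>s.\<alpha>\<close>, which does not see \<open>x\<close>, and this formula
    exhibits it as a smooth function of \<open>y\<close>.\<close>
  define \<mu> where "\<mu> y = inverse (gF y e e) *\<^sub>R s.\<alpha> y e e" for y
  have \<mu>: "s.\<alpha> y u v = gF y u v *\<^sub>R \<mu> y" "\<mu> y \<bullet> \<mu> y = 1" "dd (u', 0) X (x, y) \<bullet> \<mu> y = - dd u' w x"
    if x: "x \<in> S1" and y: "y \<in> S2" for x y u v u'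
  proof -
    obtain \<mu>' where m: "\<forall>u v. s.\<alpha> y u v = gF y u v *\<^sub>R \<mu>'" "\<mu>' \<bullet> \<mu>' = 1"
        "\<forall>u. dd (u, 0) X (x, y) \<bullet> \<mu>' = - dd u w x"
      using \<alpha>[OF x y] by blast
    have "\<mu> y = \<mu>'" using m(1) F.g_pos[OF y e] by (simp add: \<mu>_def)
    then show "s.\<alpha> y u v = gF y u v *\<^sub>R \<mu> y" "\<mu> y \<bullet> \<mu> y = 1" "dd (u', 0) X (x, y) \<bullet> \<mu> y = - dd u' w x"
      using m by auto
  qed
  have \<mu>_smooth: "smooth_on S2 \<mu>"
  proof -
    have "smooth_on S2 (\<lambda>y. dd (christoffel gF y e e) s y)"
      by (rule smooth_on_linear_family[where A="\<lambda>y v. dd v s y", OF F.open_S])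
        (auto intro: s.linear_dX smooth_on_dd s_smooth F.smooth_christoffel)
    then show ?thesis
      unfolding \<mu>_def[abs_def] s.\<alpha>_def
      by (intro smooth_intros F.open_S smooth_on_dd s_smooth F.smooth_g F.g_pos e)
  qed
  have d\<mu>: "dd v \<mu> y = - dd v s y" if "y \<in> S2" for y v
    using s.umbilic_normal_derivative[OF _ \<mu>(1)[OF p] \<mu>_smooth \<mu>(2)[OF p] that, of v] dims by simp
  define \<sigma> where "\<sigma> y = - \<mu> y" for y
  have \<sigma>_smooth: "smooth_on S2 \<sigma>"
    unfolding \<sigma>_def[abs_def] by (rule smooth_on_minus[OF F.open_S \<mu>_smooth])
  have d\<sigma>: "dd v \<sigma> y = dd v s y" if "y \<in> S2" for y v
    unfolding \<sigma>_def[abs_def] using dd_uminus[OF smooth_onD[OF \<mu>_smooth that]] d\<mu>[OF that] by simp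
  \<comment> \<open>\<open>s\<close> and \<sigma> have the same derivative, so they differ by this
    constant, which is absorbed into \<open>h\<close>.\<close>
  define c where "c = s p2 - \<sigma> p2"
  have sc: "s y = \<sigma> y + c" if y: "y \<in> S2" for y
  proof -
    have "s y - \<sigma> y = s p2 - \<sigma> p2"
    proof (rule dd_zero_const[OF convex_S2 F.open_S _ _ y p2, where f="\<lambda>y. s y - \<sigma> y"])
      fix z v assume z: "z \<in> S2"
      note d = smooth_onD[OF s_smooth z] smooth_onD[OF \<sigma>_smooth z]
      show "(\<lambda>y. s y - \<sigma> y) differentiable (at z)" by (intro differentiable_diff d)
      show "dd v (\<lambda>y. s y - \<sigma> y) z = 0" using dd_diff[OF d] d\<sigma>[OF z] by simp
    qed
    then show ?thesis by (simp add: c_def algebra_simps)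
  qed
  define h where "h x = h0 x + w x *\<^sub>R c" for x
  have Xs: "X (x, y) = w x *\<^sub>R \<sigma> y + h x" if "x \<in> S1" "y \<in> S2" for x y
    using X0[OF that] sc[OF that(2)] by (simp add: h_def algebra_simps)
  have h_smooth: "smooth_on S1 h"
    unfolding h_def[abs_def] h0_def[abs_def]
    by (intro smooth_intros L.open_S smooth_slices(1)[OF p p2] smooth_w)
  have dXh: "dd (u, 0) X (x, y) = dd u w x *\<^sub>R \<sigma> y + dd u h x" if x: "x \<in> S1" and y: "y \<in> S2" for x y u
  proof -
    note wd = diff_w[OF x] and hd = smooth_onD[OF h_smooth x]
    have sd: "(\<lambda>x. w x *\<^sub>R \<sigma> y) differentiable (at x)" by (intro differentiable_scaleR wd) simp
    have "dd (u, 0) X (x, y) = dd u (\<lambda>x. w x *\<^sub>R \<sigma> y + h x) x"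
      unfolding dX_fst(1)[OF x y, symmetric]
      by (rule dd_eq_on[OF L.open_S x]) (rule Xs[OF _ y])
    then show ?thesis
      using dd_add[OF sd hd] dd_scaleR[OF wd differentiable_const[of "\<sigma> y"]] by simp
  qed
  have \<sigma>\<sigma>: "\<sigma> y \<bullet> \<sigma> y = 1" if "y \<in> S2" for y using \<mu>(2)[OF p that] by (simp add: \<sigma>_def)
  have \<sigma>d: "\<sigma> y \<bullet> dd v \<sigma> y = 0" if y: "y \<in> S2" for y v
  proof -
    note d = smooth_onD[OF \<sigma>_smooth y]
    have "dd v (\<lambda>y. \<sigma> y \<bullet> \<sigma> y) y = 0"
      using dd_eq_on[OF F.open_S y, of "\<lambda>y. \<sigma> y \<bullet> \<sigma> y" "\<lambda>y. 1" v] \<sigma>\<sigma> by simp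
    then show ?thesis using dd_inner[OF d d] by (simp add: inner_commute)
  qed
  have h\<sigma>: "dd u h x \<bullet> \<sigma> y = 0" if "x \<in> S1" "y \<in> S2" for x y u
    using \<mu>(3)[OF that, of u] \<sigma>\<sigma>[OF that(2)] dXh[OF that, of u]
    by (simp add: \<sigma>_def inner_add_left inner_diff_left)
  have hd\<sigma>: "dd u h x \<bullet> dd v \<sigma> y = 0" if xy: "x \<in> S1" "y \<in> S2" for x y u v
  proof -
    have "dd (u, 0) X (x, y) \<bullet> dd (0, v) X (x, y) = 0"
      using isometric_immersion[of "(x, y)"] xy by (simp add: gM_eq L.g_simps F.g_simps)
    then show ?thesis
      using dXh[OF xy, of u] dXv[OF xy, of v] d\<sigma>[OF xy(2), of v] \<sigma>d[OF xy(2), of v] w_pos[OF xy(1)]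
      by (simp add: inner_add_left)
  qed
  show ?thesis
  proof (rule that[OF \<sigma>_smooth h_smooth Xs \<sigma>\<sigma> _ _ \<sigma>d h\<sigma> hd\<sigma>])
    show "dd u \<sigma> y \<bullet> dd v \<sigma> y = gF y u v" if "y \<in> S2" for y u v
      using d\<sigma>[OF that] s.isometric[OF that] by simp
    show "dd u (dd v \<sigma>) y = dd (christoffel gF y u v) \<sigma> y - gF y u v *\<^sub>R \<sigma> y" if y: "y \<in> S2" for y u v
    proof -
      have "dd u (dd v \<sigma>) y = dd u (dd v s) y"
        by (rule dd_eq_on[OF F.open_S y]) (rule d\<sigma>)
      then show ?thesis
        using \<mu>(1)[OF p y, of u v] d\<sigma>[OF y] by (simp add: s.\<alpha>_def \<sigma>_def algebra_simps)
    qed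
    show "dd u h x \<bullet> dd v h x = gL x u v - dd u w x * dd v w x" if x: "x \<in> S1" for x u v
    proof -
      have "\<sigma> p2 \<bullet> dd u h x = 0" for u using h\<sigma>[OF x p2, of u] by (simp add: inner_commute)
      then show ?thesis
        using isometric_immersion[of "(x, p2)" "(u, 0)" "(v, 0)"] x p2 h\<sigma>[OF x p2] \<sigma>\<sigma>[OF p2]
        unfolding dXh[OF x p2] by (simp add: gM_eq F.g_simps inner_add_left inner_add_right algebra_simps)
    qed
  qed
qed

end

section \<open>Local inverses and rigid motions\<close>

text \<open>The inverse is a continuous lift of the identity through \<open>f\<close>, so
  \<open>smooth_on_lift\<close> applies; invariance of domain supplies openness.\<close>

lemma smooth_inverse:
  fixes f :: "'a::euclidean_space \<Rightarrow> 'b::euclidean_space"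
  assumes S: "open S" and f: "smooth_on S f" "inj_on f S" and d: "\<And>x. x \<in> S \<Longrightarrow> inj (frechet_derivative f (at x))"
    and dim: "DIM('b) \<le> DIM('a)"
  shows "open (f ` S)" "smooth_on (f ` S) (inv_into S f)"
proof -
  show o: "open (f ` S)"
    by (rule invariance_of_domain_gen[OF S smooth_on_continuous[OF f(1)] f(2) dim])
  have "continuous_on (f ` S) (inv_into S f)"
    by (rule continuous_on_inverse_open[OF S smooth_on_continuous[OF f(1)] dim]) (simp add: f(2))
  then show "smooth_on (f ` S) (inv_into S f)"
    by (rule smooth_on_lift[where a=f and b="\<lambda>x. x", OF o S _ _ _ f(1) d smooth_on_id])
      (auto simp: inv_into_into f_inv_into_f)
qed

text \<open>The inverse function argument wants the derivative continuous in operator norm, which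
  \<open>onorm_componentwise\<close> bounds by the partial derivatives along
  \<open>Basis\<close>.\<close>

lemma smooth_locally_injective:
  fixes f :: "'a::euclidean_space \<Rightarrow> 'b::euclidean_space"
  assumes S: "open S" "x \<in> S" and f: "smooth_on S f" and d: "inj (frechet_derivative f (at x))"
  obtains r where "r > 0" "ball x r \<subseteq> S" "inj_on f (ball x r)"
proof -
  obtain L where L: "linear L" "L \<circ> frechet_derivative f (at x) = id"
    using linear_injective_left_inverse[OF linear_dd[OF smooth_onD[OF f S(2)]] d] by blast
  obtain d0 where d0: "d0 > 0" "ball x d0 \<subseteq> S" using S open_contains_ball by blast
  have close: "\<exists>d>0. \<forall>y. dist x y < d \<longrightarrow> onorm (\<lambda>v. dd v f y - dd v f x) < e" if e: "e > 0" for e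
  proof -
    have "continuous_on S (\<lambda>y. \<Sum>b\<in>Basis. norm (dd b f y - dd b f x))"
      by (intro continuous_intros smooth_on_continuous smooth_on_dd f)
    then have "isCont (\<lambda>y. \<Sum>b\<in>Basis. norm (dd b f y - dd b f x)) x"
      using S by (simp add: continuous_on_eq_continuous_at)
    then obtain d1 where d1: "d1 > 0"
      "\<forall>y. dist y x < d1 \<longrightarrow> dist (\<Sum>b\<in>Basis. norm (dd b f y - dd b f x)) (\<Sum>b\<in>(Basis::'a set). norm (dd b f x - dd b f x)) < e"
      using e unfolding continuous_at_eps_delta by meson
    show ?thesis
    proof (intro exI[of _ "min d0 d1"] conjI allI impI)
      fix y assume y: "dist x y < min d0 d1"
      then have "y \<in> S" using d0 by auto
      then have "bounded_linear (\<lambda>v. dd v f y - dd v f x)"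
        using f S by (intro bounded_linear_sub has_derivative_bounded_linear[OF dd_derivative] smooth_onD[OF f])
      then have "onorm (\<lambda>v. dd v f y - dd v f x) \<le> (\<Sum>b\<in>Basis. norm (dd b f y - dd b f x))"
        by (rule onorm_componentwise)
      also have "\<dots> < e" using d1(2)[rule_format, of y] y by (simp add: dist_commute sum_nonneg)
      finally show "onorm (\<lambda>v. dd v f y - dd v f x) < e" .
    qed (use d0 d1 in auto)
  qed
  show ?thesis
    by (rule has_derivative_locally_injective[where f=f and f'="\<lambda>y v. dd v f y" and g'=L, OF S(2,1)])
      (use L linear_conv_bounded_linear dd_derivative smooth_onD[OF f] close that in \<open>auto simp: eta_contract_eq\<close>)
qed

text \<open>\<open>A\<close> is glued from an isometry of \<open>W\<close> onto the second factor
  and one of the orthogonal complement of \<open>W\<close> onto the first, applied to the two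
  components given by the orthogonal projection \<open>P\<close> onto \<open>W\<close>.\<close>

lemma split_isometry:
  fixes W :: "('a::euclidean_space \<times> 'b::euclidean_space) set"
  assumes W: "subspace W" "dim W = DIM('b)"
  obtains A :: "'a \<times> 'b \<Rightarrow> 'a \<times> 'b" where "orthogonal_transformation A" "\<And>z. z \<in> W \<Longrightarrow> fst (A z) = 0"
    "\<And>z. (\<And>v. v \<in> W \<Longrightarrow> z \<bullet> v = 0) \<Longrightarrow> snd (A z) = 0"
proof -
  define W' where "W' = {z. \<forall>v\<in>W. orthogonal v z}"
  have W': "subspace W'" unfolding W'_def by (rule subspace_orthogonal_to_vectors)
  have "dim {z \<in> UNIV. \<forall>v\<in>W. orthogonal v z} + dim W = dim (UNIV :: ('a \<times> 'b) set)"
    by (rule dim_subspace_orthogonal_to_vectors[OF W(1) subspace_UNIV]) simp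
  then have dW': "dim W' = DIM('a)" using W(2) by (simp add: W'_def)
  have l: "linear (\<lambda>x::'a. (x, 0::'b))" "linear (\<lambda>y::'b. (0::'a, y))" by (auto intro!: linearI)
  define F1 where "F1 = range (\<lambda>x::'a. (x, 0::'b))"
  define F2 where "F2 = range (\<lambda>y::'b. (0::'a, y))"
  have F: "subspace F1" "subspace F2"
    unfolding F1_def F2_def by (rule linear_subspace_image[OF _ subspace_UNIV], rule l)+
  have dF: "dim F1 = DIM('a)" "dim F2 = DIM('b)"
    unfolding F1_def F2_def by (subst dim_image_eq[OF l(1)] dim_image_eq[OF l(2)]; auto intro!: inj_onI)+
  obtain f1 g1 where f1: "linear f1" "f1 ` W' = F1" "\<And>x. x \<in> W' \<Longrightarrow> norm (f1 x) = norm x"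
    using isometries_subspaces[OF W' F(1)] dW' dF by metis
  obtain f2 g2 where f2: "linear f2" "f2 ` W = F2" "\<And>x. x \<in> W \<Longrightarrow> norm (f2 x) = norm x"
    using isometries_subspaces[OF W(1) F(2)] W(2) dF by metis
  obtain B where B: "B \<subseteq> W" "pairwise orthogonal B" "\<And>x. x \<in> B \<Longrightarrow> norm x = 1" "independent B" "span B = W"
    using orthonormal_basis_subspace[OF W(1)] by metis
  have fB: "finite B" using B(4) independent_imp_finite by blast
  define P where "P z = (\<Sum>b\<in>B. (z \<bullet> b) *\<^sub>R b)" for z
  have PW: "P z \<in> W" for z unfolding P_def using B(1) W(1) by (intro subspace_sum subspace_mul) auto
  have Pl: "linear P"
    unfolding P_def by (rule linearI) (simp_all add: inner_add_left scaleR_add_left sum.distrib scaleR_sum_right)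
  have Pb: "P z \<bullet> b = z \<bullet> b" if b: "b \<in> B" for z b
  proof -
    have "P z \<bullet> b = (\<Sum>c\<in>B. (z \<bullet> c) * (c \<bullet> b))" by (simp add: P_def inner_sum_left)
    also have "\<dots> = (\<Sum>c\<in>B. if c = b then z \<bullet> b else 0)"
      using B(2,3) b by (intro sum.cong) (auto simp: pairwise_def orthogonal_def norm_eq_1)
    finally show ?thesis using b fB by simp
  qed
  have PW': "z - P z \<in> W'" for z
  proof -
    have "orthogonal (z - P z) v" if "v \<in> span B" for v
      by (rule orthogonal_to_span[OF that]) (simp add: orthogonal_def inner_diff_left Pb)
    then show ?thesis using B(5) by (auto simp: W'_def orthogonal_commute)
  qed
  have PidW: "P z = z" if "z \<in> W" for z
  proof -
    have "z - P z \<in> W" using that PW W(1) by (simp add: subspace_diff)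
    then have "orthogonal (z - P z) (z - P z)" using PW'[of z] by (auto simp: W'_def)
    then show ?thesis by (simp add: orthogonal_def)
  qed
  have Pz0: "P z = 0" if "\<And>v. v \<in> W \<Longrightarrow> z \<bullet> v = 0" for z
    unfolding P_def using that B(1) by (intro sum.neutral) auto
  define A where "A z = f1 (z - P z) + f2 (P z)" for z
  have Al: "linear A"
    unfolding A_def
    by (intro linear_compose_add linear_compose[OF Pl f2(1), unfolded o_def]
        linear_compose[OF linear_compose_sub[OF linear_ident Pl] f1(1), unfolded o_def])
  have o1: "snd (f1 (z - P z)) = 0" for z
  proof -
    have "f1 (z - P z) \<in> F1" using f1(2) PW' by blast
    then show ?thesis by (auto simp: F1_def)
  qed
  have o2: "fst (f2 (P z)) = 0" for z
  proof -
    have "f2 (P z) \<in> F2" using f2(2) PW by blast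
    then show ?thesis by (auto simp: F2_def)
  qed
  have "norm (A z) = norm z" for z
  proof -
    have "(norm (A z))\<^sup>2 = (norm (f1 (z - P z)))\<^sup>2 + (norm (f2 (P z)))\<^sup>2"
      using o1[of z] o2[of z] by (simp add: A_def power2_norm_eq_inner inner_prod_def)
    also have "\<dots> = (norm (z - P z))\<^sup>2 + (norm (P z))\<^sup>2" using f1(3)[OF PW'] f2(3)[OF PW] by simp
    also have "\<dots> = (norm z)\<^sup>2"
      using PW'[of z] PW[of z] norm_add_Pythagorean[of "z - P z" "P z"] by (simp add: W'_def orthogonal_commute)
    finally show ?thesis by simp
  qed
  then have a1: "orthogonal_transformation A" using Al by (simp add: orthogonal_transformation)
  have a2: "fst (A z) = 0" if "z \<in> W" for z
    using o2[of z] PidW[OF that] linear_0[OF f1(1)] by (simp add: A_def)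
  have a3: "snd (A z) = 0" if "\<And>v. v \<in> W \<Longrightarrow> z \<bullet> v = 0" for z
    using o1[of z] Pz0[OF that] linear_0[OF f2(1)] by (simp add: A_def)
  show ?thesis by (rule that[OF a1 a2 a3])
qed

text \<open>Along a segment from \<open>p\<close>, the products with \<open>c\<close> of \<sigma>
  and of its partial derivatives satisfy a homogeneous linear system, because \<open>eq\<close>
  expresses second derivatives by \<sigma> and first ones. They start at 0, so they stay 0.\<close>

lemma (in metric_chart) orthogonal_to_sphere_span:
  fixes \<sigma> :: "'e \<Rightarrow> 'z::euclidean_space"
  assumes \<sigma>: "smooth_on S \<sigma>" "convex S" and p: "p \<in> S" "y \<in> S"
    and eq: "\<And>y u v. y \<in> S \<Longrightarrow> dd u (dd v \<sigma>) y = dd (christoffel g y u v) \<sigma> y - g y u v *\<^sub>R \<sigma> y"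
    and c: "\<sigma> p \<bullet> c = 0" "\<And>v. dd v \<sigma> p \<bullet> c = 0"
  shows "\<sigma> y \<bullet> c = 0"
proof -
  define d where "d = y - p"
  define \<gamma> where "\<gamma> t = p + t *\<^sub>R d" for t
  have \<gamma>S: "\<gamma> t \<in> S" if "0 \<le> t" "t \<le> 1" for t
    using convexD_alt[OF \<sigma>(2) p(1) p(2), of t] that by (simp add: \<gamma>_def d_def algebra_simps)
  have \<gamma>c: "continuous_on {0..1} \<gamma>" unfolding \<gamma>_def by (intro continuous_intros)
  \<comment> \<open>The system is indexed by \<open>insert 0 Basis\<close>: the zero vector is not
    in \<open>Basis\<close> and labels the component of \<sigma> itself.\<close>
  define a where "a i t = (if i = 0 then \<sigma> (\<gamma> t) else dd i \<sigma> (\<gamma> t)) \<bullet> c" for i :: 'e and t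
  define C where "C i j t = (if i = 0 then (if j = 0 then 0 else d \<bullet> j)
    else (if j = 0 then - g (\<gamma> t) d i else christoffel g (\<gamma> t) d i \<bullet> j))" for i j :: 'e and t
  have z: "(0::'e) \<notin> Basis" by (simp add: zero_not_in_Basis)
  have lin: "dd v \<sigma> y \<bullet> c = (\<Sum>b\<in>Basis. (v \<bullet> b) * (dd b \<sigma> y \<bullet> c))" if "y \<in> S" for y v
    using linear_sum_Basis[OF linear_dd[OF smooth_onD[OF \<sigma>(1) that]], of v] by (simp add: inner_sum_left)
  have sum0: "(\<Sum>j\<in>insert 0 Basis. C i j t * a j t) = C i 0 t * a 0 t + (\<Sum>j\<in>Basis. C i j t * a j t)" for i t
    using z by simp
  have nz: "j \<noteq> 0" if "j \<in> Basis" for j :: 'e using z that by auto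
  have "a 0 1 = 0"
  proof (rule linear_ode_zero[where I="insert 0 Basis" and c=C])
    fix i :: 'e and t :: real assume i: "i \<in> insert 0 Basis" and t: "0 \<le> t" "t \<le> 1"
    note gS = \<gamma>S[OF t]
    show "(a i has_real_derivative (\<Sum>j\<in>insert 0 Basis. C i j t * a j t)) (at t)"
    proof (cases "i = 0")
      case True
      have "((\<lambda>t. \<sigma> (p + t *\<^sub>R d) \<bullet> c) has_real_derivative dd d (\<lambda>y. \<sigma> y \<bullet> c) (p + t *\<^sub>R d)) (at t)"
        by (rule has_real_derivative_line[of "\<lambda>y. \<sigma> y \<bullet> c"]; rule smooth_onD[where S=S])
          (use gS \<sigma>(1) open_S in \<open>auto simp: \<gamma>_def intro!: smooth_intros\<close>)
      moreover have "dd d (\<lambda>y. \<sigma> y \<bullet> c) (\<gamma> t) = dd d \<sigma> (\<gamma> t) \<bullet> c"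
        by (rule dd_bounded_linear[OF bounded_linear_inner_left smooth_onD[OF \<sigma>(1) gS]])
      moreover have "(\<Sum>j\<in>insert 0 Basis. C i j t * a j t) = dd d \<sigma> (\<gamma> t) \<bullet> c"
      proof -
        have "(\<Sum>j\<in>Basis. C i j t * a j t) = (\<Sum>j\<in>Basis. (d \<bullet> j) * (dd j \<sigma> (\<gamma> t) \<bullet> c))"
          by (rule sum.cong) (simp_all add: C_def a_def nz True)
        then show ?thesis unfolding sum0 lin[OF gS, of d] by (simp add: C_def True)
      qed
      moreover have "a i = (\<lambda>t. \<sigma> (p + t *\<^sub>R d) \<bullet> c)" using True by (simp add: a_def[abs_def] \<gamma>_def)
      ultimately show ?thesis by (simp only: \<gamma>_def)
    next
      case False
      have "((\<lambda>t. dd i \<sigma> (p + t *\<^sub>R d) \<bullet> c) has_real_derivative dd d (\<lambda>y. dd i \<sigma> y \<bullet> c) (p + t *\<^sub>R d)) (at t)"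
        by (rule has_real_derivative_line[of "\<lambda>y. dd i \<sigma> y \<bullet> c"]; rule smooth_onD[where S=S])
          (use gS \<sigma>(1) open_S in \<open>auto simp: \<gamma>_def intro!: smooth_intros smooth_on_dd\<close>)
      moreover have "dd d (\<lambda>y. dd i \<sigma> y \<bullet> c) (\<gamma> t) = dd d (dd i \<sigma>) (\<gamma> t) \<bullet> c"
        by (rule dd_bounded_linear[OF bounded_linear_inner_left smooth_onD[OF smooth_on_dd[OF \<sigma>(1)] gS]])
      moreover have "(\<Sum>j\<in>insert 0 Basis. C i j t * a j t) = dd d (dd i \<sigma>) (\<gamma> t) \<bullet> c"
      proof -
        have "(\<Sum>j\<in>Basis. C i j t * a j t)
            = (\<Sum>j\<in>Basis. (christoffel g (\<gamma> t) d i \<bullet> j) * (dd j \<sigma> (\<gamma> t) \<bullet> c))"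
          by (rule sum.cong) (simp_all add: C_def a_def nz False)
        then show ?thesis
          unfolding sum0 eq[OF gS] inner_diff_left lin[OF gS, of "christoffel g (\<gamma> t) d i"]
          by (simp add: C_def a_def False)
      qed
      moreover have "a i = (\<lambda>t. dd i \<sigma> (p + t *\<^sub>R d) \<bullet> c)" using False by (simp add: a_def[abs_def] \<gamma>_def)
      ultimately show ?thesis by (simp only: \<gamma>_def)
    qed
  next
    fix i j :: 'e
    have "continuous_on {0..1} (\<lambda>t. g (\<gamma> t) d i)" "continuous_on {0..1} (\<lambda>t. christoffel g (\<gamma> t) d i \<bullet> j)"
      by (intro continuous_intros continuous_on_compose2[OF smooth_on_continuous[OF smooth_g] \<gamma>c]
          continuous_on_compose2[OF smooth_on_continuous[OF smooth_christoffel] \<gamma>c]; use \<gamma>S in auto)+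
    then show "continuous_on {0..1} (C i j)"
      unfolding C_def by (cases "i = 0"; cases "j = 0") (auto intro!: continuous_intros)
  next
    show "a i 0 = 0" for i using c by (simp add: a_def \<gamma>_def)
  qed auto
  then show ?thesis by (simp add: a_def \<gamma>_def d_def)
qed

text \<open>\<open>W\<close> is generated by \<open>s p\<close> and the first derivatives of
  \<open>s\<close> at \<open>p\<close>. It has dimension DIM('e) + 1, contains all values of
  \<open>s\<close> by \<open>orthogonal_to_sphere_span\<close>, and is orthogonal to the derivatives
  of \<open>k\<close>. Turning \<open>W\<close> into the second factor separates the two terms of
  \<open>X\<close>, and the translation in \<open>T\<close> removes the constant second component of
  \<open>k\<close>.\<close>

theorem rotational_form:
  fixes X :: "'d::euclidean_space \<times> 'e::euclidean_space \<Rightarrow> 'a::euclidean_space \<times> 'b::euclidean_space"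
  assumes gi: "generic_immersion S1 gL S2 gF w rho kappa X" and dim: "DIM('b) = DIM('e) + 1"
  obtains T and h :: "'d \<Rightarrow> 'a" and \<sigma> :: "'e \<Rightarrow> 'b" where
    "rigid_motion T" "smooth_on S2 \<sigma>" "smooth_on S1 h"
    "\<And>x y. x \<in> S1 \<Longrightarrow> y \<in> S2 \<Longrightarrow> T (X (x, y)) = (h x, w x *\<^sub>R \<sigma> y)"
    "\<And>y. y \<in> S2 \<Longrightarrow> norm (\<sigma> y) = 1"
    "\<And>y u v. y \<in> S2 \<Longrightarrow> dd u \<sigma> y \<bullet> dd v \<sigma> y = gF y u v"
    "\<And>x u v. x \<in> S1 \<Longrightarrow> dd u h x \<bullet> dd v h x = gL x u v - dd u w x * dd v w x"
proof -
  interpret generic_immersion S1 gL S2 gF w rho kappa X by (rule gi)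
  obtain s k where s: "smooth_on S2 s" "smooth_on S1 k"
    "\<And>x y. x \<in> S1 \<Longrightarrow> y \<in> S2 \<Longrightarrow> X (x, y) = w x *\<^sub>R s y + k x"
    "\<And>y. y \<in> S2 \<Longrightarrow> s y \<bullet> s y = 1"
    "\<And>y u v. y \<in> S2 \<Longrightarrow> dd u s y \<bullet> dd v s y = gF y u v"
    "\<And>y u v. y \<in> S2 \<Longrightarrow> dd u (dd v s) y = dd (christoffel gF y u v) s y - gF y u v *\<^sub>R s y"
    "\<And>y v. y \<in> S2 \<Longrightarrow> s y \<bullet> dd v s y = 0"
    "\<And>x y u. x \<in> S1 \<Longrightarrow> y \<in> S2 \<Longrightarrow> dd u k x \<bullet> s y = 0"
    "\<And>x y u v. x \<in> S1 \<Longrightarrow> y \<in> S2 \<Longrightarrow> dd u k x \<bullet> dd v s y = 0"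
    "\<And>x u v. x \<in> S1 \<Longrightarrow> dd u k x \<bullet> dd v k x = gL x u v - dd u w x * dd v w x"
    by (rule immersion_splits) blast
  obtain p where p: "p \<in> S2" using S2_nonempty by auto
  obtain p1 where p1: "p1 \<in> S1" using S1_nonempty by auto
  define R where "R = range (frechet_derivative s (at p))"
  define W where "W = span (insert (s p) R)"
  note ls = linear_dd[OF smooth_onD[OF s(1) p]]
  have R: "subspace R" unfolding R_def by (rule linear_subspace_image[OF ls subspace_UNIV])
  have "inj (frechet_derivative s (at p))"
    unfolding linear_injective_0[OF ls] using s(5)[OF p] F.g_pos[OF p] by (metis inner_zero_left less_irrefl)
  then have dR: "dim R = DIM('e)"
    unfolding R_def using dim_image_eq[OF ls, of UNIV] by (simp add: inj_on_subset)
  have "s p \<notin> R"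
  proof
    assume "s p \<in> R"
    then obtain v where "s p = dd v s p" by (auto simp: R_def)
    then show False using s(7)[OF p, of v] s(4)[OF p] by simp
  qed
  then have dW: "dim W = DIM('b)"
    unfolding W_def using dim_insert[of "s p" R] R dR dim by (simp add: span_eq_iff[THEN iffD2, OF R])
  have perp: "z \<bullet> v = 0" if "z \<bullet> s p = 0" "\<And>u. z \<bullet> dd u s p = 0" "v \<in> W" for z v
  proof -
    have "orthogonal z v"
      by (rule orthogonal_to_span[OF that(3)[unfolded W_def]]) (use that in \<open>auto simp: R_def orthogonal_def\<close>)
    then show ?thesis by (simp add: orthogonal_def)
  qed
  have sW: "s y \<in> W" if y: "y \<in> S2" for y
  proof -
    \<comment> \<open>\<open>b\<close> is the part of \<open>s y\<close> orthogonal to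
      \<open>W\<close>. By uniqueness for the linear system \<open>s y\<close> is orthogonal to it,
      which forces b = 0.\<close>
    obtain a b where ab: "a \<in> span W" "\<And>v. v \<in> span W \<Longrightarrow> orthogonal b v" "s y = a + b"
      using orthogonal_subspace_decomp_exists[of W "s y"] by metis
    have bW: "b \<bullet> v = 0" if "v \<in> W" for v using ab(2)[of v] that span_base by (auto simp: orthogonal_def)
    have "s y \<bullet> b = 0"
    proof (rule F.orthogonal_to_sphere_span[OF s(1) convex_S2 p y s(6)])
      have "s p \<in> W" "dd v s p \<in> W" for v unfolding W_def by (auto intro!: span_base simp: R_def)
      then show "s p \<bullet> b = 0" "\<And>v. dd v s p \<bullet> b = 0" using bW by (metis inner_commute)+
    qed
    moreover have "a \<bullet> b = 0" using ab(1,2) by (simp add: orthogonal_def inner_commute)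
    ultimately have "b = 0" using ab(3) by (simp add: inner_add_left)
    then show ?thesis using ab by (simp add: W_def span_span)
  qed
  obtain A where A: "orthogonal_transformation A" "\<And>z. z \<in> W \<Longrightarrow> fst (A z) = (0::'a)"
    "\<And>z. (\<And>v. v \<in> W \<Longrightarrow> z \<bullet> v = 0) \<Longrightarrow> snd (A z) = (0::'b)"
    using split_isometry[of W] dW subspace_span W_def by metis
  have Al: "linear A" "bounded_linear A" and An: "A u \<bullet> A v = u \<bullet> v" for u v
    using A(1) unfolding orthogonal_transformation_def linear_conv_bounded_linear by blast+
  have kW: "snd (A (dd u k x)) = 0" if "x \<in> S1" for x u
    by (rule A(3)) (use perp[of "dd u k x"] s(8,9)[OF that p] in blast)
  have dk: "snd (A (k x)) = snd (A (k p1))" if x: "x \<in> S1" for x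
  proof (rule dd_zero_const[OF convex_S1 L.open_S _ _ x p1, where f="\<lambda>x. snd (A (k x))"])
    fix z u assume z: "z \<in> S1"
    have "((\<lambda>x. snd (A (k x))) has_derivative (\<lambda>u. snd (A (dd u k z)))) (at z)"
      by (intro has_derivative_snd bounded_linear.has_derivative[OF Al(2)] dd_derivative smooth_onD[OF s(2) z])
    then show "(\<lambda>x. snd (A (k x))) differentiable (at z)" "dd u (\<lambda>x. snd (A (k x))) z = 0"
      using kW[OF z] by (auto simp: dd_eqI differentiable_def)
  qed
  define T where "T z = A z + (0, - snd (A (k p1)))" for z
  define h where "h x = fst (A (k x))" for x
  define \<sigma> where "\<sigma> y = snd (A (s y))" for y
  have As: "A (s y) = (0, \<sigma> y)" if "y \<in> S2" for y
    using A(2)[OF sW[OF that]] by (simp add: \<sigma>_def prod_eq_iff)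
  have d\<sigma>: "A (dd u s y) = (0, dd u \<sigma> y)" if y: "y \<in> S2" for y u
  proof -
    note sd = smooth_onD[OF s(1) y]
    have "((\<lambda>y. A (s y)) has_derivative (\<lambda>u. A (dd u s y))) (at y)"
      by (rule bounded_linear.has_derivative[OF Al(2) dd_derivative[OF sd]])
    note d = has_derivative_fst[OF this] has_derivative_snd[OF this]
    have "dd u (\<lambda>y. fst (A (s y))) y = dd u (\<lambda>y. 0) y"
      by (rule dd_eq_on[OF F.open_S y]) (simp add: As)
    then have "fst (A (dd u s y)) = 0" using dd_eqI[OF d(1), of u] by simp
    moreover have "snd (A (dd u s y)) = dd u \<sigma> y" using dd_eqI[OF d(2), of u] by (simp add: \<sigma>_def[abs_def])
    ultimately show ?thesis by (simp add: prod_eq_iff)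
  qed
  have dh: "A (dd u k x) = (dd u h x, 0)" if x: "x \<in> S1" for x u
  proof -
    have "((\<lambda>x. A (k x)) has_derivative (\<lambda>u. A (dd u k x))) (at x)"
      by (rule bounded_linear.has_derivative[OF Al(2) dd_derivative[OF smooth_onD[OF s(2) x]]])
    from dd_eqI[OF has_derivative_fst[OF this], of u] show ?thesis
      using kW[OF x] by (simp add: h_def[abs_def] prod_eq_iff)
  qed
  show ?thesis
  proof (rule that)
    show "rigid_motion T" unfolding rigid_motion_def T_def using A(1) by blast
    show "smooth_on S2 \<sigma>" unfolding \<sigma>_def[abs_def]
      by (intro smooth_on_snd smooth_on_bounded_linear[OF Al(2)] F.open_S s(1))
    show "smooth_on S1 h" unfolding h_def[abs_def]
      by (intro smooth_on_fst smooth_on_bounded_linear[OF Al(2)] L.open_S s(2))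
    show "T (X (x, y)) = (h x, w x *\<^sub>R \<sigma> y)" if "x \<in> S1" "y \<in> S2" for x y
      unfolding T_def s(3)[OF that] linear_add[OF Al(1)] linear_scale[OF Al(1)]
      using As[OF that(2)] dk[OF that(1)] by (simp add: h_def prod_eq_iff)
    show "norm (\<sigma> y) = 1" if y: "y \<in> S2" for y
      using An[of "s y" "s y"] s(4)[OF y] As[OF y] by (simp add: norm_eq_1)
    show "dd u \<sigma> y \<bullet> dd v \<sigma> y = gF y u v" if y: "y \<in> S2" for y u v
      using An[of "dd u s y" "dd v s y"] s(5)[OF y] d\<sigma>[OF y] by simp
    show "dd u h x \<bullet> dd v h x = gL x u v - dd u w x * dd v w x" if x: "x \<in> S1" for x u v
      using An[of "dd u k x" "dd v k x"] s(10)[OF x] dh[OF x] by simp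
  qed
qed

section \<open>Coordinates on the base\<close>

text \<open>\<open>T\<close> is a primitive of 1 / sqrt G. When \<open>G\<close> expresses the
  squared gradient of a function by its value, this is arc length along the gradient curves, and the
  inverse \<psi> solves \<psi>' = sqrt (G \<psi>). In dimension one every 1-form is closed, so
  \<open>poincare_lemma\<close> provides the primitive.\<close>

lemma arclength_profile:
  fixes G :: "real \<Rightarrow> real"
  assumes J: "open J" "convex J" and G: "smooth_on J G" "\<And>s. s \<in> J \<Longrightarrow> G s > 0"
  obtains T \<psi> where "smooth_on J T" "open (T ` J)" "is_interval (T ` J)" "smooth_on (T ` J) \<psi>"
    "\<And>s. s \<in> J \<Longrightarrow> \<psi> (T s) = s" "\<And>s v. s \<in> J \<Longrightarrow> dd v T s = v / sqrt (G s)"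
    "\<And>s. s \<in> J \<Longrightarrow> deriv \<psi> (T s) = sqrt (G s)"
proof -
  define P where "P s = inverse (sqrt (G s))" for s
  have P: "smooth_on J P" unfolding P_def[abs_def] using G by (intro smooth_intros J) auto
  have closed: "dd v P s \<bullet> u = dd u P s \<bullet> v" if "s \<in> J" for s v u
    using linear_scale[OF linear_dd[OF smooth_onD[OF P that]], of v 1]
      linear_scale[OF linear_dd[OF smooth_onD[OF P that]], of u 1] by simp
  obtain T where T: "smooth_on J T" "\<And>s v. s \<in> J \<Longrightarrow> dd v T s = P s \<bullet> v"
    using poincare_lemma[OF J P closed] by blast
  have dT: "dd v T s = v / sqrt (G s)" if "s \<in> J" for s v
    using T(2)[OF that] by (simp add: P_def divide_inverse mult.commute)
  have DT: "(T has_real_derivative inverse (sqrt (G s))) (at s)" if "s \<in> J" for s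
  proof -
    have "(\<lambda>v. dd v T s) = (*) (inverse (sqrt (G s)))" using T(2)[OF that] by (auto simp: P_def)
    then show ?thesis
      using dd_derivative[OF smooth_onD[OF T(1) that]] by (simp add: has_field_derivative_def)
  qed
  have mono: "T a < T b" if ab: "a \<in> J" "b \<in> J" "a < b" for a b
  proof (rule DERIV_pos_imp_increasing[OF ab(3)])
    fix x assume "a \<le> x" "x \<le> b"
    then have "x \<in> J" using J(2) ab(1,2) unfolding is_interval_convex_1[symmetric] is_interval_1 by blast
    then show "\<exists>y. (T has_real_derivative y) (at x) \<and> 0 < y" using DT[of x] G(2)[of x] by auto
  qed
  have inj: "inj_on T J" by (rule inj_onI) (metis mono less_irrefl linorder_neqE)
  have dinj: "inj (frechet_derivative T (at s))" if "s \<in> J" for s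
    by (rule injI) (use dT[OF that] G(2)[OF that] in simp)
  note inv = smooth_inverse[OF J(1) T(1) inj dinj]
  have int: "is_interval (T ` J)"
    using connected_continuous_image[OF smooth_on_continuous[OF T(1)] convex_connected[OF J(2)]]
    by (simp add: is_interval_connected_1)
  define \<psi> where "\<psi> = inv_into J T"
  have \<psi>T: "\<psi> (T s) = s" if "s \<in> J" for s using that inj by (simp add: \<psi>_def)
  have d\<psi>: "deriv \<psi> (T s) = sqrt (G s)" if s: "s \<in> J" for s
  proof -
    have Ts: "T s \<in> T ` J" using s by simp
    have \<psi>d: "\<psi> differentiable (at (T s))" using inv(2) smooth_onD[OF _ Ts] by (simp add: \<psi>_def)
    have "dd 1 (\<lambda>s. \<psi> (T s)) s = dd (dd 1 T s) \<psi> (T s)"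
      by (rule dd_compose(1)[OF smooth_onD[OF T(1) s] \<psi>d])
    moreover have "dd 1 (\<lambda>s. \<psi> (T s)) s = dd 1 (\<lambda>s. s) s" by (rule dd_eq_on[OF J(1) s \<psi>T])
    moreover have "dd (1::real) (\<lambda>s::real. s) s = 1" by simp
    ultimately have "1 = dd (1 / sqrt (G s)) \<psi> (T s)" using dT[OF s] by simp
    also have "\<dots> = (1 / sqrt (G s)) * dd 1 \<psi> (T s)"
      using linear_scale[OF linear_dd[OF \<psi>d], of "1 / sqrt (G s)" 1] by (simp only: real_scaleR_def mult_1_right)
    finally have d1: "dd 1 \<psi> (T s) = sqrt (G s)" using G(2)[OF s] by (simp add: field_simps)
    have "dd v \<psi> (T s) = dd 1 \<psi> (T s) * v" for v
      using linear_scale[OF linear_dd[OF \<psi>d], of v 1] by simp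
    then have eq: "(\<lambda>v. dd v \<psi> (T s)) = (*) (dd 1 \<psi> (T s))" by blast
    have "(\<psi> has_real_derivative dd 1 \<psi> (T s)) (at (T s))"
      unfolding has_field_derivative_def by (subst eq[symmetric]) (rule dd_derivative[OF \<psi>d])
    then show ?thesis using d1 DERIV_imp_deriv by metis
  qed
  show ?thesis
    by (rule that[of T \<psi>]) (use T(1) inv int \<psi>T dT d\<psi> in \<open>auto simp: \<psi>_def\<close>)
qed

context generic_immersion
begin

text \<open>
  The form \<open>\<iota>\<^sub>Z vol / q\<close> is closed, since \<open>div Z = 2 lam\<close> and \<open>dq Z = 2 lam q\<close>; a primitive of it is
  the second coordinate.
\<close>

lemma angular_coordinate:
  obtains u where "smooth_on S1 u"
    "\<And>x v v'. x \<in> S1 \<Longrightarrow> q x * gL x v v' = dd v w x * dd v' w x + (q x)\<^sup>2 * dd v u x * dd v' u x"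
proof -
  obtain i j :: 'd where B: "Basis = {i, j}" "i \<noteq> j"
    using dims(1) by (metis card_2_iff)
  have on: "i \<bullet> i = 1" "j \<bullet> j = 1" "i \<bullet> j = 0" "j \<bullet> i = 0"
  proof -
    have "i \<in> Basis" "j \<in> Basis" unfolding B(1) by blast+
    then show "i \<bullet> i = 1" "j \<bullet> j = 1" "i \<bullet> j = 0" "j \<bullet> i = 0"
      using inner_not_same_Basis[of i j] inner_not_same_Basis[of j i] B(2) by simp_all
  qed
  have e: "v = (v \<bullet> i) *\<^sub>R i + (v \<bullet> j) *\<^sub>R j" for v
    using euclidean_representation[of v, symmetric] unfolding B(1) using B(2) by simp
  \<comment> \<open>\<open>D\<close> is the area density, \<open>cr\<close> the determinant of
    components, \<open>tr\<close> the trace of the connection. With these, the product of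
    \<open>P x\<close> with v is D cr(Z, v) / q, the area form contracted with \<open>Z\<close> and
    divided by \<open>q\<close>.\<close>
  define D2 where "D2 x = gL x i i * gL x j j - gL x i j * gL x i j" for x
  define D where "D x = sqrt (D2 x)" for x
  define cr where "cr a b = (a \<bullet> i) * (b \<bullet> j) - (a \<bullet> j) * (b \<bullet> i)" for a b
  define tr where "tr x v = christoffel gL x v i \<bullet> i + christoffel gL x v j \<bullet> j" for x v
  define r where "r x = D x / q x" for x
  define P where "P x = (r x * (Z x \<bullet> i)) *\<^sub>R j - (r x * (Z x \<bullet> j)) *\<^sub>R i" for x
  have D2pos: "D2 x > 0" if "x \<in> S1" for x
    using L.gram_pos[OF that B(2)] independent_Basis[where 'a='d] B(1) by (simp add: D2_def power2_eq_square)
  have gij: "gL x a b = (a \<bullet> i) * (b \<bullet> i) * gL x i i + ((a \<bullet> i) * (b \<bullet> j) + (a \<bullet> j) * (b \<bullet> i)) * gL x i j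
      + (a \<bullet> j) * (b \<bullet> j) * gL x j j" if x: "x \<in> S1" for x a b
    by (subst e[of a], subst e[of b]) (simp add: L.g_simps x L.g_sym[OF x, of j i] algebra_simps)
  have smD2: "smooth_on S1 D2" unfolding D2_def[abs_def] by (intro smooth_intros L.open_S L.smooth_g)
  have smr: "smooth_on S1 r" unfolding r_def[abs_def] D_def
    by (intro smooth_intros L.open_S smD2 smooth_q D2pos q_pos)
  have smP: "smooth_on S1 P" unfolding P_def[abs_def]
    by (intro smooth_intros L.open_S smr smooth_Z)
  \<comment> \<open>Jacobi's formula: the logarithmic derivative of the Gram determinant is twice
    the trace of the connection.\<close>
  have dD2: "dd v D2 x = 2 * D2 x * tr x v" if x: "x \<in> S1" for x v
  proof -
    have g1: "L.Gl x v a b = (christoffel gL x v a \<bullet> i) * gL x i b + (christoffel gL x v a \<bullet> j) * gL x j b" for a b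
      unfolding L.g_christoffel[OF x, symmetric]
      by (subst e[of "christoffel gL x v a"]) (simp add: L.g_simps x)
    note d = L.diff_g[OF x]
    have "dd v D2 x = gL x i i * dd v (\<lambda>x. gL x j j) x + dd v (\<lambda>x. gL x i i) x * gL x j j
        - (gL x i j * dd v (\<lambda>x. gL x i j) x + dd v (\<lambda>x. gL x i j) x * gL x i j)"
      unfolding D2_def[abs_def] dd_diff[OF differentiable_mult[OF d d] differentiable_mult[OF d d]] dd_mult[OF d d] ..
    then show ?thesis
      unfolding L.dd_g[OF x] g1 D2_def tr_def by (simp add: L.g_sym[OF x, of j i] algebra_simps)
  qed
  have dr: "dd v r x = r x * (tr x v - dd v q x / q x)" if x: "x \<in> S1" for x v
  proof -
    have D2x: "D2 x > 0" and qx: "q x > 0" using D2pos q_pos x by auto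
    have 1: "((\<lambda>x. sqrt (D2 x)) has_derivative (\<lambda>v. dd v D2 x * inverse (2 * sqrt (D2 x)))) (at x)"
    proof -
      have "(sqrt has_derivative (\<lambda>v. v * inverse (2 * sqrt (D2 x)))) (at (D2 x))"
        using DERIV_real_sqrt[OF D2x] unfolding has_field_derivative_def
        by (rule has_derivative_eq_rhs) (auto simp: field_simps)
      then show ?thesis
        by (rule has_derivative_compose[OF dd_derivative[OF smooth_onD[OF smD2 x]]])
    qed
    have "((\<lambda>x. sqrt (D2 x) / q x) has_derivative
        (\<lambda>v. (dd v D2 x * inverse (2 * sqrt (D2 x)) * q x - sqrt (D2 x) * dd v q x) / (q x * q x))) (at x)"
      using qx by (intro has_derivative_divide'[OF 1 dd_derivative[OF smooth_onD[OF smooth_q x]]]) simp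
    from dd_eqI[OF this, of v] have "dd v r x = (2 * D2 x * tr x v * inverse (2 * D x) * q x - D x * dd v q x) / (q x * q x)"
      by (simp add: r_def[abs_def] D_def dD2[OF x])
    moreover have D: "D2 x = D x * D x" "D x > 0" using D2x by (auto simp: D_def)
    moreover have "(2 * (d * d) * t * inverse (2 * d) * b - d * s) / (b * b) = d / b * (t - s / b)"
      if "d > 0" "b > 0" for d t b s :: real using that by (simp add: field_simps)
    ultimately have "dd v r x = D x / q x * (tr x v - dd v q x / q x)" using qx by metis
    then show ?thesis by (simp only: r_def)
  qed
  have dZ: "dd v Z x = lam x *\<^sub>R v - christoffel gL x v (Z x)" if x: "x \<in> S1" for x v
  proof -
    have "dd v Z x + christoffel gL x v (Z x) = lam x *\<^sub>R v"
      by (rule L.g_nondegenerate[OF x])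
        (simp add: nabla_Z[OF x] L_curvature_and_hessian(2)[OF x] L.g_simps x)
    then show ?thesis by (simp add: eq_diff_eq)
  qed
  have comp: "dd v (\<lambda>x. r x * (Z x \<bullet> a)) x = r x * ((tr x v - dd v q x / q x) * (Z x \<bullet> a)
      + (lam x *\<^sub>R v - christoffel gL x v (Z x)) \<bullet> a)" if x: "x \<in> S1" for x v a
  proof -
    have zd: "(\<lambda>x. Z x \<bullet> a) differentiable (at x)"
      by (rule smooth_onD[OF _ x]) (intro smooth_intros L.open_S smooth_Z)
    have z1: "dd v (\<lambda>x. Z x \<bullet> a) x = dd v Z x \<bullet> a"
      by (rule dd_bounded_linear[OF bounded_linear_inner_left smooth_onD[OF smooth_Z x]])
    show ?thesis
      unfolding dd_mult[OF smooth_onD[OF smr x] zd] z1 dr[OF x] dZ[OF x] by (simp add: algebra_simps)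
  qed
  have dP: "dd v P x = (dd v (\<lambda>x. r x * (Z x \<bullet> i)) x) *\<^sub>R j - (dd v (\<lambda>x. r x * (Z x \<bullet> j)) x) *\<^sub>R i"
    if x: "x \<in> S1" for x v
  proof -
    have d: "(\<lambda>x. r x * (Z x \<bullet> a)) differentiable (at x)" for a
      by (rule smooth_onD[OF _ x]) (intro smooth_intros L.open_S smooth_Z smr)
    show ?thesis
      unfolding P_def[abs_def]
      by (rule dd_eqI) (intro has_derivative_diff has_derivative_scaleR_left dd_derivative d)
  qed
  \<comment> \<open>The form of \<open>P\<close> is closed because the coordinate divergence of r Z
    vanishes: the traces of the connection cancel, and the covariant divergence 2 lam of
    \<open>Z\<close> cancels against dq(Z) / q.\<close>
  have div: "dd i (\<lambda>x. r x * (Z x \<bullet> i)) x + dd j (\<lambda>x. r x * (Z x \<bullet> j)) x = 0" if x: "x \<in> S1" for x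
  proof -
    have qx: "q x > 0" by (rule q_pos[OF x])
    have ez: "f (Z x) = (Z x \<bullet> i) * f i + (Z x \<bullet> j) * f j" if "linear f" for f :: "'d \<Rightarrow> real"
      by (subst e[of "Z x"]) (simp add: linear_add[OF that] linear_scale[OF that])
    have "linear (\<lambda>v. tr x v)" unfolding tr_def
      by (rule linearI) (simp_all add: linear_add[OF L.christoffel_linear(1)[OF x]]
          linear_scale[OF L.christoffel_linear(1)[OF x]] inner_add_left algebra_simps)
    then have 1: "tr x (Z x) = (Z x \<bullet> i) * tr x i + (Z x \<bullet> j) * tr x j" by (rule ez)
    have 2: "dd (Z x) q x = (Z x \<bullet> i) * dd i q x + (Z x \<bullet> j) * dd j q x"
      by (rule ez[OF linear_dd[OF smooth_onD[OF smooth_q x]]])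
    have 3: "dd (Z x) q x = 2 * lam x * q x" using dd_q_lam[OF x, of "Z x"] q_eq[OF x] by simp
    have 4: "tr x (Z x) = christoffel gL x i (Z x) \<bullet> i + christoffel gL x j (Z x) \<bullet> j"
      using L.christoffel_sym[OF x, of "Z x"] by (simp add: tr_def)
    have "dd i (\<lambda>x. r x * (Z x \<bullet> i)) x + dd j (\<lambda>x. r x * (Z x \<bullet> j)) x
        = r x * (tr x (Z x) - dd (Z x) q x / q x + 2 * lam x
          - (christoffel gL x i (Z x) \<bullet> i + christoffel gL x j (Z x) \<bullet> j))"
      unfolding comp[OF x] 1 2 by (simp add: inner_diff_left on algebra_simps add_divide_distrib)
    then show ?thesis using 3 4 qx by simp
  qed
  have closed: "dd v P x \<bullet> v' = dd v' P x \<bullet> v" if x: "x \<in> S1" for x v v'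
  proof -
    have lP: "linear (\<lambda>v. dd v P x)" by (rule linear_dd[OF smooth_onD[OF smP x]])
    have ev: "dd v P x = (v \<bullet> i) *\<^sub>R dd i P x + (v \<bullet> j) *\<^sub>R dd j P x" for v
      by (subst e[of v]) (simp only: linear_add[OF lP] linear_scale[OF lP])
    have ij: "dd i P x \<bullet> j = dd j P x \<bullet> i"
      using div[OF x] by (simp add: dP[OF x] inner_diff_left on)
    have ip: "a \<bullet> b = (a \<bullet> i) * (b \<bullet> i) + (a \<bullet> j) * (b \<bullet> j)" for a b
      by (subst e[of b]) (simp add: inner_add_right mult.commute)
    show ?thesis
      unfolding ev[of v] ev[of v'] inner_add_left inner_scaleR_left
        ip[of "dd i P x" v] ip[of "dd i P x" v'] ip[of "dd j P x" v] ip[of "dd j P x" v'] ij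
      by (simp add: algebra_simps)
  qed
  obtain u where u: "smooth_on S1 u" "\<And>x v. x \<in> S1 \<Longrightarrow> dd v u x = P x \<bullet> v"
    using poincare_lemma[OF L.open_S convex_S1 smP closed] by blast
  have "q x * gL x v v' = dd v w x * dd v' w x + (q x)\<^sup>2 * dd v u x * dd v' u x" if x: "x \<in> S1" for x v v'
  proof -
    have "q x > 0" by (rule q_pos[OF x])
    then have "q x * dd v u x = D x * cr (Z x) v" for v
      using u(2)[OF x, of v] unfolding P_def r_def cr_def
      by (simp add: inner_diff_left inner_commute[of i v] inner_commute[of j v] field_simps)
    then have "(q x)\<^sup>2 * dd v u x * dd v' u x = (D x * cr (Z x) v) * (D x * cr (Z x) v')"
      by (metis (no_types, opaque_lifting) mult.assoc mult.left_commute power2_eq_square)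
    also have "\<dots> = D2 x * cr (Z x) v * cr (Z x) v'" using D2pos[OF x] by (simp add: D_def)
    \<comment> \<open>Lagrange's identity in the plane: a product of two determinants with
      \<open>Z\<close> is a difference of products of the metric.\<close>
    also have "\<dots> = gL x (Z x) (Z x) * gL x v v' - gL x (Z x) v * gL x (Z x) v'"
      unfolding D2_def cr_def gij[OF x, of "Z x"] gij[OF x, of v v'] by (simp add: algebra_simps)
    finally show ?thesis by (simp add: gL_Z[OF x] q_def)
  qed
  then show ?thesis using that u(1) by blast
qed

lemma q_profile:
  assumes p: "p \<in> S1" and x: "x \<in> S1"
  shows "q x = 1 - rho / (real DIM('e) + 1) * (w x)\<^sup>2 + C p / w x ^ (DIM('e) - 1)"
proof -
  define cp where "cp = C p"
  have "C x = cp"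
    unfolding cp_def by (rule dd_zero_const[OF convex_S1 L.open_S smooth_onD[OF smooth_C] dd_C x p])
  then have "cp = (q x + rho / (real DIM('e) + 1) * (w x)\<^sup>2 - kappa) * w x ^ (DIM('e) - 1)"
    by (simp add: C_def)
  then have "q x = kappa - rho / (real DIM('e) + 1) * (w x)\<^sup>2 + cp / w x ^ (DIM('e) - 1)"
    using w_pos[OF x] by simp
  then have "q x = 1 - rho / (real DIM('e) + 1) * (w x)\<^sup>2 + cp / w x ^ (DIM('e) - 1)"
    by (simp only: kappa_one)
  then show ?thesis by (simp only: cp_def)
qed

end

text \<open>The first coordinate is a function of \<open>w\<close> with dt = dw / sqrt q, the second
  is the angular coordinate \<open>a\<close>. Since q gL = dw^2 + q^2 da^2, the metric is dt^2 + q
  da^2; the metric induced by \<open>k\<close>, which is gL - dw^2, becomes (1 - q) dt^2 + q da^2.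
  Here q = \<psi>'^2.\<close>

theorem chart_normal_form:
  fixes X :: "'d::euclidean_space \<times> 'e::euclidean_space \<Rightarrow> 'a::euclidean_space \<times> 'b::euclidean_space"
  assumes gi: "generic_immersion S1 gL S2 gF w rho kappa X" and dim: "DIM('b) = DIM('e) + 1"
    and p1: "p1 \<in> S1" and p2: "p2 \<in> S2"
  obtains r1 r2 :: real and c :: real and I :: "real set" and \<psi> :: "real \<Rightarrow> real"
    and \<tau> :: "'d \<Rightarrow> real \<times> real" and h :: "real \<times> real \<Rightarrow> 'a" and \<sigma> :: "'e \<Rightarrow> 'b" and T
  where "r1 > 0" "ball p1 r1 \<subseteq> S1" "r2 > 0" "ball p2 r2 \<subseteq> S2"
    "open I" "is_interval I" "smooth_on I \<psi>"
    "\<And>t. t \<in> I \<Longrightarrow> \<psi> t > 0 \<and>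
      (deriv \<psi> t)\<^sup>2 = 1 - rho / (real DIM('e) + 1) * (\<psi> t)\<^sup>2 + c / \<psi> t ^ (DIM('e) - 1) \<and>
      0 < (deriv \<psi> t)\<^sup>2 \<and> (deriv \<psi> t)\<^sup>2 < 1"
    "smooth_on (ball p1 r1) \<tau>" "inj_on \<tau> (ball p1 r1)"
    "\<And>x. x \<in> ball p1 r1 \<Longrightarrow> inj (frechet_derivative \<tau> (at x))"
    "\<And>x. x \<in> ball p1 r1 \<Longrightarrow> fst (\<tau> x) \<in> I" "\<And>x. x \<in> ball p1 r1 \<Longrightarrow> \<psi> (fst (\<tau> x)) = w x"
    "\<And>x u v. x \<in> ball p1 r1 \<Longrightarrow> gL x u v = fst (dd u \<tau> x) * fst (dd v \<tau> x)
      + (deriv \<psi> (fst (\<tau> x)))\<^sup>2 * snd (dd u \<tau> x) * snd (dd v \<tau> x)"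
    "smooth_on (\<tau> ` ball p1 r1) h"
    "\<And>z a b. z \<in> \<tau> ` ball p1 r1 \<Longrightarrow> dd a h z \<bullet> dd b h z
      = (1 - (deriv \<psi> (fst z))\<^sup>2) * fst a * fst b + (deriv \<psi> (fst z))\<^sup>2 * snd a * snd b"
    "smooth_on (ball p2 r2) \<sigma>" "inj_on \<sigma> (ball p2 r2)"
    "\<And>y. y \<in> ball p2 r2 \<Longrightarrow> norm (\<sigma> y) = 1"
    "\<And>y u v. y \<in> ball p2 r2 \<Longrightarrow> dd u \<sigma> y \<bullet> dd v \<sigma> y = gF y u v"
    "rigid_motion T"
    "\<And>x y. x \<in> ball p1 r1 \<Longrightarrow> y \<in> ball p2 r2 \<Longrightarrow> T (X (x, y)) = (h (\<tau> x), w x *\<^sub>R \<sigma> y)"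
proof -
  interpret generic_immersion S1 gL S2 gF w rho kappa X by (rule gi)
  obtain T k \<sigma> where T: "rigid_motion T" and \<sigma>: "smooth_on S2 \<sigma>" and k: "smooth_on S1 k"
    and TX: "\<And>x y. x \<in> S1 \<Longrightarrow> y \<in> S2 \<Longrightarrow> T (X (x, y)) = (k x, w x *\<^sub>R \<sigma> y)"
    and \<sigma>1: "\<And>y. y \<in> S2 \<Longrightarrow> norm (\<sigma> y) = 1"
    and d\<sigma>: "\<And>y u v. y \<in> S2 \<Longrightarrow> dd u \<sigma> y \<bullet> dd v \<sigma> y = gF y u v"
    and dk: "\<And>x u v. x \<in> S1 \<Longrightarrow> dd u k x \<bullet> dd v k x = gL x u v - dd u w x * dd v w x"
    by (rule rotational_form[OF gi dim]) blast
  obtain a where a: "smooth_on S1 a"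
    "\<And>x v v'. x \<in> S1 \<Longrightarrow> q x * gL x v v' = dd v w x * dd v' w x + (q x)\<^sup>2 * dd v a x * dd v' a x"
    by (rule angular_coordinate) blast
  define c where "c = C p1"
  \<comment> \<open>By the first integral, \<open>q\<close> is this function of \<open>w\<close>.
    The interval \<open>J\<close> below consists of values for which it lies in (0, 1); it will be
    the range of \<psi>.\<close>
  define G where "G s = 1 - rho / (real DIM('e) + 1) * s\<^sup>2 + c / s ^ (DIM('e) - 1)" for s
  have qG: "q x = G (w x)" if "x \<in> S1" for x
    unfolding G_def c_def by (rule q_profile[OF p1 that])
  have G: "smooth_on {0<..} G"
    unfolding G_def[abs_def] by (intro smooth_intros) auto
  have "open ({0<..} \<inter> G -` {0<..<1})"
    by (rule continuous_open_preimage[OF smooth_on_continuous[OF G]]) auto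
  moreover have "w p1 \<in> {0<..} \<inter> G -` {0<..<1}"
    using w_pos[OF p1] q_pos[OF p1] q_less_one[OF p1] qG[OF p1] by auto
  ultimately obtain \<delta> where \<delta>: "\<delta> > 0" "ball (w p1) \<delta> \<subseteq> {0<..} \<inter> G -` {0<..<1}"
    using open_contains_ball by blast
  define J where "J = ball (w p1) \<delta>"
  have J: "open J" "convex J" "smooth_on J G" "\<And>s. s \<in> J \<Longrightarrow> s > 0 \<and> G s > 0 \<and> G s < 1"
    using \<delta>(2) smooth_on_subset[OF G] by (auto simp: J_def)
  obtain Tt \<psi> where Tt: "smooth_on J Tt" "open (Tt ` J)" "is_interval (Tt ` J)" "smooth_on (Tt ` J) \<psi>"
    "\<And>s. s \<in> J \<Longrightarrow> \<psi> (Tt s) = s" "\<And>s v. s \<in> J \<Longrightarrow> dd v Tt s = v / sqrt (G s)"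
    "\<And>s. s \<in> J \<Longrightarrow> deriv \<psi> (Tt s) = sqrt (G s)"
    by (rule arclength_profile[OF J(1-3)]) (use J(4) in blast)+
  define S where "S = S1 \<inter> w -` J"
  have S: "open S" unfolding S_def
    by (rule continuous_open_preimage[OF smooth_on_continuous[OF smooth_w] L.open_S J(1)])
  have SD: "x \<in> S1" "w x \<in> J" if "x \<in> S" for x using that by (auto simp: S_def)
  have p1S: "p1 \<in> S" using p1 \<delta>(1) by (simp add: S_def J_def)
  define \<tau> where "\<tau> x = (Tt (w x), a x)" for x
  have \<tau>s: "smooth_on S \<tau>" unfolding \<tau>_def[abs_def]
    by (intro smooth_intros S smooth_on_compose[OF Tt(1)] smooth_on_subset[OF smooth_w] smooth_on_subset[OF a(1)] J(1))
      (use SD in auto)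
  have d\<tau>: "dd v \<tau> x = (dd v w x / sqrt (q x), dd v a x)" if x: "x \<in> S" for x v
  proof -
    note x' = SD[OF x]
    have "((\<lambda>x. Tt (w x)) has_derivative (\<lambda>v. dd (dd v w x) Tt (w x))) (at x)"
      by (rule has_derivative_compose[OF dd_derivative[OF diff_w[OF x'(1)]] dd_derivative[OF smooth_onD[OF Tt(1) x'(2)]]])
    then have "(\<tau> has_derivative (\<lambda>v. (dd (dd v w x) Tt (w x), dd v a x))) (at x)"
      unfolding \<tau>_def[abs_def] by (intro has_derivative_Pair dd_derivative[OF smooth_onD[OF a(1) x'(1)]])
    from dd_eqI[OF this, of v] show ?thesis using Tt(6)[OF x'(2)] qG[OF x'(1)] by simp
  qed
  have \<psi>\<tau>: "deriv \<psi> (fst (\<tau> x)) = sqrt (q x)" "\<psi> (fst (\<tau> x)) = w x" "fst (\<tau> x) \<in> Tt ` J" if "x \<in> S" for x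
    using Tt(5,7)[OF SD(2)[OF that]] qG[OF SD(1)[OF that]] SD(2)[OF that] by (auto simp: \<tau>_def)
  have g\<tau>: "gL x u v = fst (dd u \<tau> x) * fst (dd v \<tau> x)
      + (deriv \<psi> (fst (\<tau> x)))\<^sup>2 * snd (dd u \<tau> x) * snd (dd v \<tau> x)" if x: "x \<in> S" for x u v
  proof -
    have qx: "q x > 0" by (rule q_pos[OF SD(1)[OF x]])
    have "q x * gL x u v = q x * (dd u w x / sqrt (q x) * (dd v w x / sqrt (q x)) + q x * dd u a x * dd v a x)"
      using a(2)[OF SD(1)[OF x], of u v] qx by (simp add: field_simps power2_eq_square)
    then show ?thesis using qx by (simp add: d\<tau>[OF x] \<psi>\<tau>[OF x])
  qed
  have \<tau>inj: "inj (frechet_derivative \<tau> (at x))" if x: "x \<in> S" for x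
    unfolding linear_injective_0[OF linear_dd[OF smooth_onD[OF \<tau>s x]]]
  proof (intro allI impI)
    fix v assume "dd v \<tau> x = 0"
    then have "gL x v v = 0" unfolding g\<tau>[OF x] by simp
    then show "v = 0" using L.g_pos[OF SD(1)[OF x]] by (metis less_irrefl)
  qed
  obtain r1 where r1: "r1 > 0" "ball p1 r1 \<subseteq> S" "inj_on \<tau> (ball p1 r1)"
    by (rule smooth_locally_injective[OF S p1S \<tau>s \<tau>inj[OF p1S]])
  have \<sigma>inj: "inj (frechet_derivative \<sigma> (at p2))"
    unfolding linear_injective_0[OF linear_dd[OF smooth_onD[OF \<sigma> p2]]]
    using d\<sigma>[OF p2] F.g_pos[OF p2] by (metis inner_zero_left less_irrefl)
  obtain r2 where r2: "r2 > 0" "ball p2 r2 \<subseteq> S2" "inj_on \<sigma> (ball p2 r2)"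
    by (rule smooth_locally_injective[OF F.open_S p2 \<sigma> \<sigma>inj])
  define B where "B = ball p1 r1"
  have B: "open B" "B \<subseteq> S" "inj_on \<tau> B" "smooth_on B \<tau>" "\<And>x. x \<in> B \<Longrightarrow> x \<in> S"
    using r1 smooth_on_subset[OF \<tau>s] by (auto simp: B_def)
  have dimle: "DIM(real \<times> real) \<le> DIM('d)" using dims by simp
  have \<tau>injB: "inj (frechet_derivative \<tau> (at x))" if "x \<in> B" for x
    by (rule \<tau>inj[OF B(5)[OF that]])
  have inv: "open (\<tau> ` B)" "smooth_on (\<tau> ` B) (inv_into B \<tau>)"
    using smooth_inverse[OF B(1,4,3) _ dimle] \<tau>injB by auto
  define i where "i = inv_into B \<tau>"
  have i: "i z \<in> B" "\<tau> (i z) = z" if "z \<in> \<tau> ` B" for z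
    using that by (auto simp: i_def inv_into_into f_inv_into_f)
  have i\<tau>: "i (\<tau> x) = x" if "x \<in> B" for x using that B(3) by (simp add: i_def)
  have i_smooth: "smooth_on (\<tau> ` B) i" using inv(2) by (simp add: i_def)
  define h where "h z = k (i z)" for z
  have iB: "i ` \<tau> ` B \<subseteq> S1" using i SD(1) B(5) by blast
  have hs: "smooth_on (\<tau> ` B) h" unfolding h_def[abs_def]
    by (rule smooth_on_compose[OF k i_smooth inv(1) L.open_S iB])
  have dh: "dd a h z \<bullet> dd b h z = (1 - (deriv \<psi> (fst z))\<^sup>2) * fst a * fst b + (deriv \<psi> (fst z))\<^sup>2 * snd a * snd b"
    if z: "z \<in> \<tau> ` B" for z a b
  proof -
    define x where "x = i z"
    have x: "x \<in> B" "\<tau> x = z" "x \<in> S" "x \<in> S1" using i[OF z] B(5) SD(1) by (auto simp: x_def)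
    have qx: "q x > 0" by (rule q_pos[OF x(4)])
    note id = smooth_onD[OF i_smooth z]
    have 1: "dd v h z = dd (dd v i z) k x" for v
      unfolding h_def[abs_def] x_def by (rule dd_compose(1)[OF id]) (use k x(4) smooth_onD in \<open>simp add: x_def\<close>)
    have 2: "dd (dd v i z) \<tau> x = v" for v
    proof -
      have "dd v (\<lambda>z. \<tau> (i z)) z = dd v (\<lambda>z. z) z"
        by (rule dd_eq_on[OF inv(1) z]) (rule i(2))
      then show ?thesis
        using dd_compose(1)[OF id, of \<tau> v] smooth_onD[OF \<tau>s x(3)] by (simp add: x_def)
    qed
    have 3: "dd (dd v i z) w x = sqrt (q x) * fst v" for v
    proof -
      have "fst v = dd (dd v i z) w x / sqrt (q x)"
        using arg_cong[OF d\<tau>[OF x(3), of "dd v i z"], of fst] unfolding 2 by simp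
      then show ?thesis using qx by simp
    qed
    show ?thesis
      unfolding 1 dk[OF x(4)] g\<tau>[OF x(3)] 2 3 x(2)
      using \<psi>\<tau>(1)[OF x(3)] qx unfolding x(2) by (simp add: algebra_simps)
  qed
  show ?thesis
  proof (rule that[of r1 r2 "Tt ` J" \<psi> c \<tau> h \<sigma> T])
    show "\<psi> t > 0 \<and> (deriv \<psi> t)\<^sup>2 = 1 - rho / (real DIM('e) + 1) * (\<psi> t)\<^sup>2 + c / \<psi> t ^ (DIM('e) - 1) \<and>
      0 < (deriv \<psi> t)\<^sup>2 \<and> (deriv \<psi> t)\<^sup>2 < 1" if t: "t \<in> Tt ` J" for t
    proof -
      obtain s where s: "s \<in> J" "t = Tt s" using t by auto
      show ?thesis using Tt(5,7)[OF s(1)] J(4)[OF s(1)] s(2) by (simp add: G_def)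
    qed
    show "T (X (x, y)) = (h (\<tau> x), w x *\<^sub>R \<sigma> y)" if "x \<in> ball p1 r1" "y \<in> ball p2 r2" for x y
    proof -
      have "x \<in> S1" "y \<in> S2" "x \<in> B" using that r1(2) r2(2) SD(1) by (auto simp: B_def)
      then show ?thesis using TX i\<tau> by (simp add: h_def)
    qed
    show "inj_on \<tau> (ball p1 r1)" "inj_on \<sigma> (ball p2 r2)" by fact+
  qed (use r1 r2 Tt(2,3,4) B \<tau>inj \<psi>\<tau> g\<tau> hs dh T \<sigma>1 d\<sigma> smooth_on_subset[OF \<sigma> r2(2)] SD(1) in \<open>auto simp: B_def\<close>)
qed

section \<open>Patches and isometries\<close>

text \<open>
  The patches below may be modelled on a Euclidean space other than that of the atlas of \<open>X\<close>: the
  parametrization \<open>(x, y) \<mapsto> ((t, u), \<sigma> y)\<close> of the target is taken in the coordinates of the source.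
\<close>

definition regular_patch :: "('a, 'e::euclidean_space) riem \<Rightarrow> ('a, 'd::euclidean_space) patch \<Rightarrow> bool" where
  "regular_patch X P \<longleftrightarrow> open (region P) \<and> inj_on (param P) (region P) \<and>
     continuous_map (top_of_set (region P)) (topo X) (param P) \<and>
     (\<forall>U. open U \<longrightarrow> U \<subseteq> region P \<longrightarrow> openin (topo X) (param P ` U))"

definition compatible :: "('a, 'd::euclidean_space) patch \<Rightarrow> ('a, 'e::euclidean_space) patch \<Rightarrow> bool" where
  "compatible P Q \<longleftrightarrow> smooth_in_patches P Q (\<lambda>p. p) \<and> metric_preserving_in_patches P Q (\<lambda>p. p)"

definition regular_atlas :: "('a, 'e::euclidean_space) riem \<Rightarrow> bool" where
  "regular_atlas X \<longleftrightarrow> (\<forall>P\<in>atlas X. regular_patch X P) \<and> (\<forall>P\<in>atlas X. \<forall>Q\<in>atlas X. compatible P Q)"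

text \<open>Two manifolds with global patches over the same region are compared through the identity
  of that region, which is how the isometry of the theorem is obtained.\<close>

definition global_patch :: "('a, 'e::euclidean_space) riem \<Rightarrow> ('a, 'd::euclidean_space) patch \<Rightarrow> bool" where
  "global_patch X G \<longleftrightarrow> regular_patch X G \<and> param G ` region G = points X \<and>
     (\<forall>Q\<in>atlas X. regular_patch X Q \<and> compatible G Q \<and> compatible Q G)"

lemma regular_patchD:
  assumes "regular_patch X P"
  shows "open (region P)" "inj_on (param P) (region P)"
    "continuous_map (top_of_set (region P)) (topo X) (param P)"
    "\<And>U. open U \<Longrightarrow> U \<subseteq> region P \<Longrightarrow> openin (topo X) (param P ` U)"
    "param P ` region P \<subseteq> points X"
proof -
  show "open (region P)" "inj_on (param P) (region P)"
    and c: "continuous_map (top_of_set (region P)) (topo X) (param P)"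
    and "\<And>U. open U \<Longrightarrow> U \<subseteq> region P \<Longrightarrow> openin (topo X) (param P ` U)"
    using assms by (auto simp: regular_patch_def)
  show "param P ` region P \<subseteq> points X" using continuous_map_image_subset_topspace[OF c] by simp
qed

lemma regular_patch_preimage:
  assumes "regular_patch X P" "openin (topo X) V"
  shows "open {x \<in> region P. param P x \<in> V}"
  using openin_continuous_map_preimage[OF regular_patchD(3)[OF assms(1)] assms(2)]
    regular_patchD(1)[OF assms(1)] openin_open_eq by auto

lemma regular_patch_embedding:
  assumes "open (region P)" "openin (topo X) (param P ` region P)"
    "embedding_map (top_of_set (region P)) (topo X) (param P)"
  shows "regular_patch X P"
  unfolding regular_patch_def
proof (intro conjI allI impI)
  have h: "homeomorphic_map (top_of_set (region P)) (subtopology (topo X) (param P ` region P)) (param P)"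
    using assms(3) by (simp add: embedding_map_def)
  show "inj_on (param P) (region P)" using homeomorphic_imp_injective_map[OF h] by simp
  show "continuous_map (top_of_set (region P)) (topo X) (param P)"
    using homeomorphic_imp_continuous_map[OF h] by (simp add: continuous_map_in_subtopology)
  fix U assume U: "open U" "U \<subseteq> region P"
  then have "openin (top_of_set (region P)) U" by (simp add: open_subset)
  then have "openin (subtopology (topo X) (param P ` region P)) (param P ` U)"
    using homeomorphic_imp_open_map[OF h] by (simp add: open_map_def)
  then show "openin (topo X) (param P ` U)" using assms(2) openin_trans_full by blast
qed (rule assms(1))

lemma riemannian_manifold_regular_atlas: "riemannian_manifold M \<Longrightarrow> regular_atlas M"
  unfolding riemannian_manifold_def regular_atlas_def compatible_def
  by (auto intro: regular_patch_embedding)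

section \<open>Local representatives and isometries\<close>

lemma local_rep_props:
  assumes "x \<in> local_dom P Q f"
  shows "local_rep P Q f x \<in> region Q" "param Q (local_rep P Q f x) = f (param P x)"
  using assms unfolding local_dom_def local_rep_def by (auto simp: inv_into_into f_inv_into_f)

lemma local_rep_eqI:
  assumes "inj_on (param Q) (region Q)" "y \<in> region Q" "param Q y = f (param P x)"
  shows "local_rep P Q f x = y"
  using assms by (simp add: local_rep_def flip: assms(3))

lemma open_local_dom:
  assumes P: "regular_patch X P" and Q: "regular_patch X Q"
  shows "open (local_dom P Q (\<lambda>p. p))"
  unfolding local_dom_def by (rule regular_patch_preimage[OF P regular_patchD(4)[OF Q]])
    (use regular_patchD(1)[OF Q] in auto)

text \<open>\<open>local_rep\<close> is built from \<open>inv_into\<close>. On the open set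
  \<open>D\<close> it coincides with the explicit \<open>T\<close>, and therefore so do the
  derivatives.\<close>

lemma patches_by_transition:
  assumes D: "local_dom P Q f = D" "open D" and Q: "inj_on (param Q) (region Q)"
    and T: "\<And>x. x \<in> D \<Longrightarrow> T x \<in> region Q" "\<And>x. x \<in> D \<Longrightarrow> param Q (T x) = f (param P x)"
    and sm: "smooth_on D T"
    and m: "\<And>x u v. x \<in> D \<Longrightarrow> metric P x u v = metric Q (T x) (dd u T x) (dd v T x)"
  shows "smooth_in_patches P Q f" "metric_preserving_in_patches P Q f"
proof -
  have e: "local_rep P Q f x = T x" if "x \<in> D" for x
    by (rule local_rep_eqI[where y="T x" and P=P and x=x and f=f, OF Q T(1)[OF that] T(2)[OF that]])
  show "smooth_in_patches P Q f"
    unfolding smooth_in_patches_def D by (rule smooth_on_eq_on[OF D(2) sm e])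
  show "metric_preserving_in_patches P Q f"
    unfolding metric_preserving_in_patches_def D
  proof (intro ballI allI)
    fix x u v assume x: "x \<in> D"
    have d: "dd u (local_rep P Q f) x = dd u T x" for u by (rule dd_eq_on[OF D(2) x e])
    show "metric P x u v = metric Q (local_rep P Q f x) (dd u (local_rep P Q f) x) (dd v (local_rep P Q f) x)"
      unfolding d e[OF x] by (rule m[OF x])
  qed
qed

lemma compatibleD:
  assumes "compatible P Q"
  shows "smooth_on (local_dom P Q (\<lambda>p. p)) (local_rep P Q (\<lambda>p. p))"
    "\<And>x u v. x \<in> local_dom P Q (\<lambda>p. p) \<Longrightarrow> metric P x u v = metric Q (local_rep P Q (\<lambda>p. p) x)
      (dd u (local_rep P Q (\<lambda>p. p)) x) (dd v (local_rep P Q (\<lambda>p. p)) x)"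
  using assms unfolding compatible_def smooth_in_patches_def metric_preserving_in_patches_def by auto

lemma continuous_local_rep:
  fixes P :: "('a, 'p::euclidean_space) patch" and Q :: "('a, 'q::euclidean_space) patch"
  assumes P: "regular_patch X P" and Q: "regular_patch X Q"
  shows "continuous_on (local_dom P Q (\<lambda>p. p)) (local_rep P Q (\<lambda>p. p))"
  unfolding continuous_on_open_vimage[OF open_local_dom[OF P Q]]
proof (intro allI impI)
  fix B :: "'q set" assume B: "open B"
  have "open {x \<in> region P. param P x \<in> param Q ` (B \<inter> region Q)}"
    by (rule regular_patch_preimage[OF P regular_patchD(4)[OF Q]])
      (use regular_patchD(1)[OF Q] B in auto)
  moreover have "local_rep P Q (\<lambda>p. p) -` B \<inter> local_dom P Q (\<lambda>p. p)
      = {x \<in> region P. param P x \<in> param Q ` (B \<inter> region Q)}"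
    using local_rep_props[of _ P Q "\<lambda>p. p"] local_rep_eqI[OF regular_patchD(2)[OF Q], of _ "\<lambda>p. p" P]
    by (auto simp: local_dom_def)
  ultimately show "open (local_rep P Q (\<lambda>p. p) -` B \<inter> local_dom P Q (\<lambda>p. p))" by simp
qed

text \<open>Read through \<open>G\<close> and \<open>G'\<close>, the map is the identity of the
  common region. In patches P and Q it is therefore the transition from P to \<open>G\<close>
  followed by the one from \<open>G'\<close> to Q.\<close>

lemma global_patch_map:
  assumes G: "global_patch X G" and G': "global_patch Y G'"
    and reg: "region G = region G'" and met: "\<And>x u v. x \<in> region G \<Longrightarrow> metric G x u v = metric G' x u v"
    and f: "\<And>x. x \<in> region G \<Longrightarrow> f (param G x) = param G' x"
  shows "smooth_map X Y f" "\<And>P Q. P \<in> atlas X \<Longrightarrow> Q \<in> atlas Y \<Longrightarrow> metric_preserving_in_patches P Q f"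
proof -
  have g: "regular_patch X G" "param G ` region G = points X" and g': "regular_patch Y G'" "param G' ` region G' = points Y"
    using G G' by (auto simp: global_patch_def)
  have c: "continuous_map (topo X) (topo Y) f"
    unfolding continuous_map_def
  proof (intro conjI allI impI)
    show "f \<in> points X \<rightarrow> points Y"
    proof
      fix a assume "a \<in> points X"
      then obtain x where "x \<in> region G" "a = param G x" using g(2) by auto
      then show "f a \<in> points Y" using f reg g'(2) by auto
    qed
    fix U assume "openin (topo Y) U"
    then have "open {x \<in> region G'. param G' x \<in> U}" by (rule regular_patch_preimage[OF g'(1)])
    then have "openin (topo X) (param G ` {x \<in> region G'. param G' x \<in> U})"
      by (rule regular_patchD(4)[OF g(1)]) (auto simp: reg)
    moreover have "{x \<in> points X. f x \<in> U} = param G ` {x \<in> region G'. param G' x \<in> U}"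
      unfolding g(2)[symmetric] using f reg by (auto intro!: imageI)
    ultimately show "openin (topo X) {x \<in> points X. f x \<in> U}" by simp
  qed
  have 1: "smooth_in_patches P Q f" "metric_preserving_in_patches P Q f" if P: "P \<in> atlas X" and Q: "Q \<in> atlas Y" for P Q
  proof -
    have rP: "regular_patch X P" "compatible P G" and rQ: "regular_patch Y Q" "compatible G' Q"
      using G G' P Q by (auto simp: global_patch_def)
    define A where "A = local_rep P G (\<lambda>p. p)"
    define C where "C = local_rep G' Q (\<lambda>p. p)"
    have dA: "local_dom P G (\<lambda>p. p) = region P"
      using regular_patchD(5)[OF rP(1)] g(2) by (auto simp: local_dom_def)
    have A: "A x \<in> region G" "param G (A x) = param P x" if "x \<in> region P" for x
      using local_rep_props[of x P G "\<lambda>p. p"] that dA by (auto simp: A_def)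
    have C: "C x \<in> region Q" "param Q (C x) = param G' x" if "x \<in> local_dom G' Q (\<lambda>p. p)" for x
      using local_rep_props[OF that] by (auto simp: C_def)
    define D where "D = local_dom P Q f"
    have fA: "f (param P x) = param G' (A x)" if "x \<in> region P" for x
      using f[OF A(1)[OF that]] A(2)[OF that] by simp
    have D: "D = {x \<in> region P. A x \<in> local_dom G' Q (\<lambda>p. p)}"
      using fA A(1) reg by (auto simp: D_def local_dom_def)
    have smA: "smooth_on (region P) A" using compatibleD(1)[OF rP(2)] dA by (simp add: A_def)
    have oP: "open (region P)" by (rule regular_patchD(1)[OF rP(1)])
    have oL: "open (local_dom G' Q (\<lambda>p. p))" by (rule open_local_dom[OF g'(1) rQ(1)])
    have oD: "open D"
      using continuous_open_preimage[OF smooth_on_continuous[OF smA] oP oL]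
      by (simp add: D Int_def vimage_def conj_commute)
    have smC: "smooth_on (local_dom G' Q (\<lambda>p. p)) C" using compatibleD(1)[OF rQ(2)] by (simp add: C_def)
    have sm: "smooth_on D (\<lambda>x. C (A x))"
      by (rule smooth_on_compose[OF smC smooth_on_subset[OF smA] oD oL]) (auto simp: D)
    have m: "metric P x u v = metric Q (C (A x)) (dd u (\<lambda>x. C (A x)) x) (dd v (\<lambda>x. C (A x)) x)" if x: "x \<in> D" for x u v
    proof -
      have x': "x \<in> region P" "A x \<in> local_dom G' Q (\<lambda>p. p)" using x by (auto simp: D)
      note ch = dd_compose(1)[OF smooth_onD[OF smA x'(1)] smooth_onD[OF smC x'(2)]]
      show ?thesis
        using compatibleD(2)[OF rP(2), of x u v] compatibleD(2)[OF rQ(2) x'(2), of "dd u A x" "dd v A x"]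
          met[OF A(1)[OF x'(1)], of "dd u A x" "dd v A x"] x'(1) dA
        unfolding ch by (simp add: A_def C_def)
    qed
    note t = patches_by_transition[where P=P and Q=Q and f=f and T="\<lambda>x. C (A x)",
        OF D_def[symmetric] oD regular_patchD(2)[OF rQ(1)] _ _ sm m]
    show "smooth_in_patches P Q f" "metric_preserving_in_patches P Q f"
      by (rule t; use C fA D in auto)+
  qed
  show "smooth_map X Y f" using c 1 by (auto simp: smooth_map_def)
  show "metric_preserving_in_patches P Q f" if "P \<in> atlas X" "Q \<in> atlas Y" for P Q using 1 that by blast
qed

theorem isometry_of_global_patches:
  assumes G: "global_patch X G" and G': "global_patch Y G'"
    and reg: "region G = region G'" and met: "\<And>x u v. x \<in> region G \<Longrightarrow> metric G x u v = metric G' x u v"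
    and f: "\<And>x. x \<in> region G \<Longrightarrow> f (param G x) = param G' x"
  shows "isometry X Y f"
proof -
  have g: "inj_on (param G) (region G)" "param G ` region G = points X"
    and g': "inj_on (param G') (region G')" "param G' ` region G' = points Y"
    using G G' regular_patchD(2) by (auto simp: global_patch_def)
  have inj: "inj_on f (points X)"
    unfolding g(2)[symmetric] using f g'(1) reg by (auto simp: inj_on_def)
  have "f ` points X = points Y"
    unfolding g(2)[symmetric] g'(2)[symmetric] using f reg by (auto simp: image_image cong: image_cong)
  then have "bij_betw f (points X) (points Y)" using inj by (simp add: bij_betw_def)
  moreover have "inv_into (points X) f (param G' x) = param G x" if "x \<in> region G'" for x
    using that f[of x] reg g(2) inj by (metis imageI inv_into_f_f)
  then have "smooth_map Y X (inv_into (points X) f)"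
    using global_patch_map(1)[OF G' G reg[symmetric], of "inv_into (points X) f"] met reg by simp
  ultimately show ?thesis
    using global_patch_map[OF G G' reg met f] by (simp add: isometry_def)
qed

section \<open>Restriction to open subsets\<close>

lemma regular_patch_restrict:
  assumes P: "regular_patch X P" and V: "openin (topo X) V"
  shows "regular_patch (open_submanifold X V) (P\<lparr>region := {x \<in> region P. param P x \<in> V}\<rparr>)"
proof -
  let ?R = "{x \<in> region P. param P x \<in> V}"
  have "continuous_map (top_of_set ?R) (topo X) (param P)"
    using continuous_map_from_subtopology_mono[OF regular_patchD(3)[OF P]] by auto
  then have "continuous_map (top_of_set ?R) (subtopology (topo X) V) (param P)"
    by (simp add: continuous_map_in_subtopology image_subset_iff)
  moreover have "openin (subtopology (topo X) V) (param P ` U)" if "open U" "U \<subseteq> ?R" for U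
    using regular_patchD(4)[OF P that(1)] that(2) by (auto simp: openin_subtopology)
  ultimately show ?thesis
    using regular_patch_preimage[OF P V] regular_patchD(2)[OF P]
    by (auto simp: regular_patch_def open_submanifold_def intro: inj_on_subset)
qed

text \<open>Shrinking the target region changes the \<open>inv_into\<close> behind
  \<open>local_rep\<close>; injectivity on the larger region shows that its values stay the
  same.\<close>

lemma compatible_restrict:
  assumes PQ: "compatible P Q" and P: "regular_patch X P" and Q: "regular_patch X Q"
    and B: "open B" "B \<subseteq> region P" and C: "open C" "C \<subseteq> region Q"
  shows "compatible (P\<lparr>region := B\<rparr>) (Q\<lparr>region := C\<rparr>)"
proof -
  define D where "D = local_dom (P\<lparr>region := B\<rparr>) (Q\<lparr>region := C\<rparr>) (\<lambda>p. p)"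
  have "D = B \<inter> {x \<in> region P. param P x \<in> param Q ` C}"
    using B by (auto simp: D_def local_dom_def)
  then have oD: "open D"
    using B regular_patch_preimage[OF P regular_patchD(4)[OF Q C]] by auto
  have DD: "D \<subseteq> local_dom P Q (\<lambda>p. p)" using B C by (auto simp: D_def local_dom_def)
  have T: "local_rep P Q (\<lambda>p. p) x \<in> C" "param Q (local_rep P Q (\<lambda>p. p) x) = param P x" if x: "x \<in> D" for x
  proof -
    obtain y where y: "y \<in> C" "param P x = param Q y" using x by (auto simp: D_def local_dom_def)
    then have "local_rep P Q (\<lambda>p. p) x = y"
      using C by (intro local_rep_eqI[OF regular_patchD(2)[OF Q]]) auto
    then show "local_rep P Q (\<lambda>p. p) x \<in> C" "param Q (local_rep P Q (\<lambda>p. p) x) = param P x" using y by auto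
  qed
  have m: "metric P x u v = metric Q (local_rep P Q (\<lambda>p. p) x)
      (dd u (local_rep P Q (\<lambda>p. p)) x) (dd v (local_rep P Q (\<lambda>p. p)) x)" if "x \<in> D" for x u v
    using compatibleD(2)[OF PQ] DD that by blast
  have "inj_on (param Q) C" using regular_patchD(2)[OF Q] C(2) by (rule inj_on_subset)
  then show ?thesis
    unfolding compatible_def
    by (intro conjI patches_by_transition[where D=D and T="local_rep P Q (\<lambda>p. p)"])
      (simp_all add: D_def[symmetric] oD T smooth_on_subset[OF compatibleD(1)[OF PQ] DD], auto intro: m)
qed

lemma global_patch_restrict:
  assumes X: "regular_atlas X" and P: "P \<in> atlas X" and B: "open B" "B \<subseteq> region P"
  shows "global_patch (open_submanifold X (param P ` B)) (P\<lparr>region := B\<rparr>)"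
proof -
  define V where "V = param P ` B"
  have rP: "regular_patch X P" using X P by (simp add: regular_atlas_def)
  have V: "openin (topo X) V" unfolding V_def by (rule regular_patchD(4)[OF rP B])
  have BV: "B = {x \<in> region P. param P x \<in> V}"
    using B regular_patchD(2)[OF rP] by (auto simp: V_def inj_on_def)
  have "regular_patch (open_submanifold X V) (P\<lparr>region := B\<rparr>)"
    by (subst BV) (rule regular_patch_restrict[OF rP V])
  moreover have "points (open_submanifold X V) = V"
    using openin_subset[OF V] by (auto simp: open_submanifold_def)
  moreover have "regular_patch (open_submanifold X V) Q' \<and> compatible (P\<lparr>region := B\<rparr>) Q' \<and> compatible Q' (P\<lparr>region := B\<rparr>)"
    if Q': "Q' \<in> atlas (open_submanifold X V)" for Q'
  proof -
    obtain Q where Q: "Q \<in> atlas X" "Q' = Q\<lparr>region := {x \<in> region Q. param Q x \<in> V}\<rparr>"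
      using Q' by (auto simp: open_submanifold_def)
    have rQ: "regular_patch X Q" and PQ: "compatible P Q" "compatible Q P"
      using X P Q(1) by (auto simp: regular_atlas_def)
    have oC: "open {x \<in> region Q. param Q x \<in> V}" by (rule regular_patch_preimage[OF rQ V])
    show ?thesis
      unfolding Q(2)
      using regular_patch_restrict[OF rQ V] compatible_restrict[OF PQ(1) rP rQ B oC]
        compatible_restrict[OF PQ(2) rQ rP oC _ B] by auto
  qed
  ultimately show ?thesis
    unfolding global_patch_def V_def[symmetric] by (simp add: V_def)
qed

section \<open>Products of patches\<close>

definition prod_patch ::
    "('a, 'd) patch \<Rightarrow> ('a \<Rightarrow> real) \<Rightarrow> ('b, 'e) patch \<Rightarrow> ('a \<times> 'b, 'd \<times> 'e) patch" where
  "prod_patch P \<phi> Q = \<lparr>region = region P \<times> region Q,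
     param = (\<lambda>(x, y). (param P x, param Q y)),
     metric = (\<lambda>(x, y) (u1, u2) (v1, v2).
       metric P x u1 v1 + (\<phi> (param P x))\<^sup>2 * metric Q y u2 v2)\<rparr>"

lemma prod_patch_simps:
  "region (prod_patch P \<phi> Q) = region P \<times> region Q"
  "param (prod_patch P \<phi> Q) z = (param P (fst z), param Q (snd z))"
  "metric (prod_patch P \<phi> Q) z u v =
     metric P (fst z) (fst u) (fst v) + (\<phi> (param P (fst z)))\<^sup>2 * metric Q (snd z) (snd u) (snd v)"
  by (simp_all add: prod_patch_def split_beta)

lemma warped_product_simps:
  "topo (warped_product L \<phi> F) = prod_topology (topo L) (topo F)"
  "atlas (warped_product L \<phi> F) = {prod_patch P \<phi> Q | P Q. P \<in> atlas L \<and> Q \<in> atlas F}"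
  by (simp_all add: warped_product_def prod_patch_def)

lemma prod_patch_image: "param (prod_patch P \<phi> Q) ` (A \<times> B) = param P ` A \<times> param Q ` B"
  unfolding prod_patch_def by force

lemma regular_prod_patch:
  fixes P :: "('a, 'p::euclidean_space) patch" and Q :: "('b, 'q::euclidean_space) patch"
  assumes P: "regular_patch X P" and Q: "regular_patch Y Q"
  shows "regular_patch (warped_product X \<phi> Y) (prod_patch P \<phi> Q)"
  unfolding regular_patch_def prod_patch_simps(1) warped_product_simps(1)
proof (intro conjI allI impI)
  show "open (region P \<times> region Q)"
    by (rule open_Times[OF regular_patchD(1)[OF P] regular_patchD(1)[OF Q]])
  show "inj_on (param (prod_patch P \<phi> Q)) (region P \<times> region Q)"
    using regular_patchD(2)[OF P] regular_patchD(2)[OF Q] by (auto simp: inj_on_def prod_patch_simps)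
  have "continuous_map (prod_topology (top_of_set (region P)) (top_of_set (region Q))) (topo X) (param P \<circ> fst)"
    "continuous_map (prod_topology (top_of_set (region P)) (top_of_set (region Q))) (topo Y) (param Q \<circ> snd)"
    by (rule continuous_map_compose[OF continuous_map_fst regular_patchD(3)[OF P]]
        continuous_map_compose[OF continuous_map_snd regular_patchD(3)[OF Q]])+
  then show "continuous_map (top_of_set (region P \<times> region Q)) (prod_topology (topo X) (topo Y)) (param (prod_patch P \<phi> Q))"
    unfolding continuous_map_pairwise by (simp add: o_def prod_patch_simps)
  fix U :: "('p \<times> 'q) set" assume U: "open U" "U \<subseteq> region P \<times> region Q"
  show "openin (prod_topology (topo X) (topo Y)) (param (prod_patch P \<phi> Q) ` U)"
    unfolding openin_prod_topology_alt
  proof (intro allI impI)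
    fix a b assume "(a, b) \<in> param (prod_patch P \<phi> Q) ` U"
    then obtain x y where xy: "(x, y) \<in> U" "a = param P x" "b = param Q y"
      by (auto simp: prod_patch_simps)
    obtain A B where AB: "open A" "open B" "(x, y) \<in> A \<times> B" "A \<times> B \<subseteq> U"
      using open_prod_elim[OF U(1) xy(1)] by blast
    have "A \<subseteq> region P" "B \<subseteq> region Q" using AB U(2) by auto
    then have "openin (topo X) (param P ` A)" "openin (topo Y) (param Q ` B)"
      using AB regular_patchD(4) P Q by blast+
    moreover have "param P ` A \<times> param Q ` B \<subseteq> param (prod_patch P \<phi> Q) ` U"
      using AB(4) unfolding prod_patch_image[of P \<phi> Q A B, symmetric] by blast
    ultimately show "\<exists>U' V. openin (topo X) U' \<and> openin (topo Y) V \<and> a \<in> U' \<and> b \<in> V \<and>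
        U' \<times> V \<subseteq> param (prod_patch P \<phi> Q) ` U"
      using AB(3) xy by blast
  qed
qed

lemma compatible_prod_patch:
  assumes P: "regular_patch X P" "regular_patch X P'" "compatible P P'"
    and Q: "regular_patch Y Q" "regular_patch Y Q'" "compatible Q Q'"
  shows "compatible (prod_patch P \<phi> Q) (prod_patch P' \<phi> Q')"
proof -
  define D1 where "D1 = local_dom P P' (\<lambda>p. p)"
  define D2 where "D2 = local_dom Q Q' (\<lambda>p. p)"
  define T1 where "T1 = local_rep P P' (\<lambda>p. p)"
  define T2 where "T2 = local_rep Q Q' (\<lambda>p. p)"
  define T where "T z = (T1 (fst z), T2 (snd z))" for z
  have o: "open D1" "open D2"
    unfolding D1_def D2_def by (rule open_local_dom[OF P(1,2)] open_local_dom[OF Q(1,2)])+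
  have s: "smooth_on D1 T1" "smooth_on D2 T2"
    unfolding D1_def D2_def T1_def T2_def by (rule compatibleD(1)[OF P(3)] compatibleD(1)[OF Q(3)])+
  have D: "local_dom (prod_patch P \<phi> Q) (prod_patch P' \<phi> Q') (\<lambda>p. p) = D1 \<times> D2"
    unfolding local_dom_def D1_def D2_def prod_patch_simps prod_patch_image by auto
  have T1: "T1 x \<in> region P'" "param P' (T1 x) = param P x" if "x \<in> D1" for x
    using local_rep_props[OF that[unfolded D1_def]] by (auto simp: T1_def)
  have T2: "T2 x \<in> region Q'" "param Q' (T2 x) = param Q x" if "x \<in> D2" for x
    using local_rep_props[OF that[unfolded D2_def]] by (auto simp: T2_def)
  have sT: "smooth_on (D1 \<times> D2) T"
    unfolding T_def[abs_def] by (intro smooth_intros s o open_Times)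
  have dT: "dd u T z = (dd (fst u) T1 (fst z), dd (snd u) T2 (snd z))" if z: "fst z \<in> D1" "snd z \<in> D2" for u z
  proof -
    have "((\<lambda>z. T1 (fst z)) has_derivative (\<lambda>u. dd (fst u) T1 (fst z))) (at z)"
      "((\<lambda>z. T2 (snd z)) has_derivative (\<lambda>u. dd (snd u) T2 (snd z))) (at z)"
      by (rule has_derivative_compose[where g=T1 and f=fst] has_derivative_compose[where g=T2 and f=snd];
          use z s smooth_onD in \<open>auto intro!: derivative_eq_intros dd_derivative\<close>)+
    from dd_eqI[OF has_derivative_Pair[OF this], of u] show ?thesis by (simp add: T_def[abs_def])
  qed
  have inj: "inj_on (param (prod_patch P' \<phi> Q')) (region (prod_patch P' \<phi> Q'))"
    using regular_patchD(2)[OF regular_prod_patch[OF P(2) Q(2)]] .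
  have m: "metric (prod_patch P \<phi> Q) z u v = metric (prod_patch P' \<phi> Q') (T z) (dd u T z) (dd v T z)"
    if "z \<in> D1 \<times> D2" for z u v
  proof -
    have z: "fst z \<in> D1" "snd z \<in> D2" using that by auto
    show ?thesis
      unfolding prod_patch_simps dT[OF z]
      using compatibleD(2)[OF P(3), of "fst z" "fst u" "fst v"] compatibleD(2)[OF Q(3), of "snd z" "snd u" "snd v"]
        z T1(2)[OF z(1)] by (simp add: T_def D1_def D2_def T1_def T2_def)
  qed
  show ?thesis
    unfolding compatible_def
    by (intro conjI patches_by_transition[OF D open_Times[OF o] inj _ _ sT m])
      (auto simp: prod_patch_simps T_def T1 T2)
qed

lemma global_prod_patch:
  assumes G: "global_patch X G" and H: "global_patch Y H"
  shows "global_patch (warped_product X \<phi> Y) (prod_patch G \<phi> H)"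
proof -
  have g: "regular_patch X G" "param G ` region G = points X"
    "\<And>Q. Q \<in> atlas X \<Longrightarrow> regular_patch X Q \<and> compatible G Q \<and> compatible Q G"
    and h: "regular_patch Y H" "param H ` region H = points Y"
    "\<And>Q. Q \<in> atlas Y \<Longrightarrow> regular_patch Y Q \<and> compatible H Q \<and> compatible Q H"
    using G H by (auto simp: global_patch_def)
  have "regular_patch (warped_product X \<phi> Y) R \<and> compatible (prod_patch G \<phi> H) R
      \<and> compatible R (prod_patch G \<phi> H)" if R: "R \<in> atlas (warped_product X \<phi> Y)" for R
  proof -
    obtain P Q where PQ: "P \<in> atlas X" "Q \<in> atlas Y" "R = prod_patch P \<phi> Q"
      using R by (auto simp: warped_product_simps)
    note p = g(3)[OF PQ(1)] and q = h(3)[OF PQ(2)]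
    show ?thesis
      unfolding PQ(3) using regular_prod_patch[of X P Y Q \<phi>] p q g(1) h(1)
        compatible_prod_patch[of X G P Y H Q \<phi>] compatible_prod_patch[of X P G Y Q H \<phi>] by blast
  qed
  then show ?thesis
    unfolding global_patch_def prod_patch_simps(1) prod_patch_image
    using regular_prod_patch[OF g(1) h(1)] g(2) h(2)
    by (simp add: warped_product_simps(1) topspace_prod_topology)
qed

lemma open_submanifold_warped_product:
  "open_submanifold (warped_product X \<phi> Y) (A \<times> B) =
    warped_product (open_submanifold X A) \<phi> (open_submanifold Y B)"
proof -
  have r: "prod_patch P \<phi> Q\<lparr>region := {z \<in> region P \<times> region Q. param (prod_patch P \<phi> Q) z \<in> A \<times> B}\<rparr>
      = prod_patch (P\<lparr>region := {x \<in> region P. param P x \<in> A}\<rparr>) \<phi> (Q\<lparr>region := {x \<in> region Q. param Q x \<in> B}\<rparr>)"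
    for P :: "('a, 'c) patch" and Q :: "('b, 'd) patch"
    by (auto simp: prod_patch_def)
  have "(\<lambda>P. P\<lparr>region := {x \<in> region P. param P x \<in> A \<times> B}\<rparr>) ` {prod_patch P \<phi> Q | P Q. P \<in> atlas X \<and> Q \<in> atlas Y}
      = {prod_patch P \<phi> Q | P Q. P \<in> (\<lambda>P. P\<lparr>region := {x \<in> region P. param P x \<in> A}\<rparr>) ` atlas X \<and>
          Q \<in> (\<lambda>Q. Q\<lparr>region := {x \<in> region Q. param Q x \<in> B}\<rparr>) ` atlas Y}" (is "?l = ?r")
  proof (intro equalityI subsetI)
    fix R assume "R \<in> ?l"
    then obtain P Q where "P \<in> atlas X" "Q \<in> atlas Y"
      "R = prod_patch P \<phi> Q\<lparr>region := {z \<in> region P \<times> region Q. param (prod_patch P \<phi> Q) z \<in> A \<times> B}\<rparr>"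
      by (auto simp: prod_patch_simps(1))
    then show "R \<in> ?r" unfolding r by blast
  next
    fix R assume "R \<in> ?r"
    then obtain P Q where "P \<in> atlas X" "Q \<in> atlas Y"
      "R = prod_patch (P\<lparr>region := {x \<in> region P. param P x \<in> A}\<rparr>) \<phi> (Q\<lparr>region := {x \<in> region Q. param Q x \<in> B}\<rparr>)"
      by blast
    then show "R \<in> ?l" unfolding r[symmetric] by (force simp: prod_patch_simps(1))
  qed
  then show ?thesis
    unfolding open_submanifold_def
    by (simp add: warped_product_simps) (simp add: warped_product_def prod_patch_def subtopology_Times)
qed


text \<open>Besides the identity, \<tau> is a second chart of the plane domain, with transitions
  \<tau> and its inverse. It carries the coordinates of the source over to the target.\<close>

lemma global_patch_plane:
  fixes \<tau> :: "'d::euclidean_space \<Rightarrow> real \<times> real"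
  assumes B: "open B" and \<tau>: "smooth_on B \<tau>" "inj_on \<tau> B" "\<And>x. x \<in> B \<Longrightarrow> inj (frechet_derivative \<tau> (at x))"
    and dim: "DIM('d) = 2"
  shows "global_patch
    \<lparr>topo = top_of_set (\<tau> ` B), atlas = {\<lparr>region = \<tau> ` B, param = (\<lambda>x. x), metric = g\<rparr>}\<rparr>
    \<lparr>region = B, param = \<tau>, metric = (\<lambda>x u v. g (\<tau> x) (dd u \<tau> x) (dd v \<tau> x))\<rparr>"
    (is "global_patch ?X ?G")
proof -
  have dim': "DIM(real \<times> real) \<le> DIM('d)" using dim by simp
  have c\<tau>: "continuous_on B \<tau>" by (rule smooth_on_continuous[OF \<tau>(1)])
  have o: "open (\<tau> ` U)" if "open U" "U \<subseteq> B" for U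
    by (rule invariance_of_domain_gen[OF that(1) continuous_on_subset[OF c\<tau> that(2)] inj_on_subset[OF \<tau>(2) that(2)] dim'])
  have inv: "smooth_on (\<tau> ` B) (inv_into B \<tau>)"
    using smooth_inverse(2)[OF B \<tau>(1,2) _ dim'] \<tau>(3) by auto
  define Q where "Q = \<lparr>region = \<tau> ` B, param = (\<lambda>x. x), metric = g\<rparr>"
  have rG: "regular_patch ?X ?G"
    unfolding regular_patch_def using B \<tau>(2) c\<tau> o
    by (auto intro!: open_subset simp: continuous_map_in_subtopology)
  have rQ: "regular_patch ?X Q"
    unfolding regular_patch_def Q_def using o[OF B] by (auto intro!: open_subset)
  have d1: "local_dom ?G Q (\<lambda>p. p) = B" "local_dom Q ?G (\<lambda>p. p) = \<tau> ` B"
    by (auto simp: local_dom_def Q_def)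
  have "compatible ?G Q"
    unfolding compatible_def
    by (intro conjI patches_by_transition[where T=\<tau>, OF d1(1) B _ _ _ \<tau>(1)]) (auto simp: Q_def)
  moreover have "compatible Q ?G"
  proof -
    have i: "inv_into B \<tau> z \<in> B" "\<tau> (inv_into B \<tau> z) = z" if "z \<in> \<tau> ` B" for z
      using that by (auto simp: inv_into_into f_inv_into_f)
    have "dd (dd v (inv_into B \<tau>) z) \<tau> (inv_into B \<tau> z) = v" if z: "z \<in> \<tau> ` B" for z v
    proof -
      have "dd v (\<lambda>z. \<tau> (inv_into B \<tau> z)) z = dd v (\<lambda>z. z) z"
        by (rule dd_eq_on[OF o[OF B] z]) (use i in auto)
      then show ?thesis
        using dd_compose(1)[OF smooth_onD[OF inv z] smooth_onD[OF \<tau>(1) i(1)[OF z]], of v] by simp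
    qed
    then show ?thesis
      unfolding compatible_def
      by (intro conjI patches_by_transition[where T="inv_into B \<tau>", OF d1(2) o[OF B] _ _ _ inv])
        (use i \<tau>(2) in \<open>auto simp: Q_def\<close>)
  qed
  ultimately show ?thesis
    unfolding global_patch_def using rG rQ by (auto simp: Q_def)
qed

text \<open>A transition map is a continuous lift of one regular parametrization through another,
  hence smooth by \<open>smooth_on_lift\<close>. Both metrics are induced from the ambient space, so
  by the chain rule it preserves them.\<close>

lemma regular_atlas_unit_sphere: "regular_atlas (unit_sphere :: (real ^ 'k, 'e::euclidean_space) riem)"
proof -
  let ?S = "unit_sphere :: (real ^ 'k, 'e) riem"
  have r: "regular_patch ?S P" "smooth_on (region P) (param P)"
    "\<And>x. x \<in> region P \<Longrightarrow> inj (frechet_derivative (param P) (at x))"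
    "\<And>x u v. metric P x u v = dd u (param P) x \<bullet> dd v (param P) x" if P: "P \<in> atlas ?S" for P
  proof -
    show "regular_patch ?S P"
      by (rule regular_patch_embedding) (use P in \<open>auto simp: unit_sphere_def\<close>)
    show "smooth_on (region P) (param P)" "\<And>x. x \<in> region P \<Longrightarrow> inj (frechet_derivative (param P) (at x))"
      "\<And>x u v. metric P x u v = dd u (param P) x \<bullet> dd v (param P) x"
      using P by (auto simp: unit_sphere_def)
  qed
  have "compatible P Q" if P: "P \<in> atlas ?S" and Q: "Q \<in> atlas ?S" for P Q
  proof -
    define D where "D = local_dom P Q (\<lambda>p. p)"
    define T where "T = local_rep P Q (\<lambda>p. p)"
    have oD: "open D" unfolding D_def by (rule open_local_dom[OF r(1)[OF P] r(1)[OF Q]])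
    have DP: "D \<subseteq> region P" by (auto simp: D_def local_dom_def)
    have T: "T x \<in> region Q" "param Q (T x) = param P x" if "x \<in> D" for x
      using local_rep_props[OF that[unfolded D_def]] by (auto simp: T_def)
    have sT: "smooth_on D T"
      by (rule smooth_on_lift[where a="param Q" and b="param P" and T="region Q", OF oD regular_patchD(1)[OF r(1)[OF Q]]])
        (use continuous_local_rep[OF r(1)[OF P] r(1)[OF Q]] T r[OF Q] smooth_on_subset[OF r(2)[OF P] DP]
          in \<open>auto simp: D_def T_def\<close>)
    have m: "metric P x u v = metric Q (T x) (dd u T x) (dd v T x)" if x: "x \<in> D" for x u v
    proof -
      have "dd u (param P) x = dd (dd u T x) (param Q) (T x)" for u
      proof -
        have "dd u (\<lambda>x. param Q (T x)) x = dd u (param P) x"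
          by (rule dd_eq_on[OF oD x T(2)])
        then show ?thesis
          using dd_compose(1)[OF smooth_onD[OF sT x] smooth_onD[OF r(2)[OF Q] T(1)[OF x]], of u] by simp
      qed
      then show ?thesis by (simp add: r(4)[OF P] r(4)[OF Q])
    qed
    show ?thesis
      unfolding compatible_def
      by (intro conjI patches_by_transition[OF D_def[symmetric] oD regular_patchD(2)[OF r(1)[OF Q]] T sT m])
  qed
  then show ?thesis using r(1) by (auto simp: regular_atlas_def)
qed

lemma unit_sphere_patch:
  fixes \<sigma> :: "'e::euclidean_space \<Rightarrow> real ^ 'k"
  assumes B: "open B" and \<sigma>: "smooth_on B \<sigma>" "inj_on \<sigma> B" "\<And>x. x \<in> B \<Longrightarrow> inj (frechet_derivative \<sigma> (at x))"
    and n: "\<And>x. x \<in> B \<Longrightarrow> norm (\<sigma> x) = 1" and dim: "DIM('e) + 1 = CARD('k)"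
  shows "\<lparr>region = B, param = \<sigma>, metric = (\<lambda>x u v. dd u \<sigma> x \<bullet> dd v \<sigma> x)\<rparr> \<in> atlas unit_sphere"
proof -
  have c\<sigma>: "continuous_on B \<sigma>" by (rule smooth_on_continuous[OF \<sigma>(1)])
  \<comment> \<open>Invariance of domain for the cone over \<open>\<sigma>\<close>.\<close>
  have o: "openin (top_of_set (sphere 0 1)) (\<sigma> ` U)" if U: "open U" "U \<subseteq> B" for U
  proof -
    define k where "k z = snd z *\<^sub>R \<sigma> (fst z)" for z :: "'e \<times> real"
    have nk: "norm (k z) = snd z" if "z \<in> U \<times> {0<..}" for z
      using that U(2) n by (auto simp: k_def)
    have "inj_on k (U \<times> {0<..})"
    proof (rule inj_onI)
      fix z z' assume z: "z \<in> U \<times> {0<..}" "z' \<in> U \<times> {0<..}" "k z = k z'"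
      then have s: "snd z = snd z'" using nk by metis
      then have "\<sigma> (fst z) = \<sigma> (fst z')" using z by (auto simp: k_def)
      moreover have "fst z \<in> B" "fst z' \<in> B" using z U(2) by auto
      ultimately have "fst z = fst z'" using \<sigma>(2) by (simp add: inj_on_eq_iff)
      then show "z = z'" using s by (simp add: prod_eq_iff)
    qed
    moreover have "continuous_on (U \<times> {0<..}) k"
      unfolding k_def using U(2)
      by (intro continuous_intros continuous_on_compose2[OF c\<sigma>]) auto
    ultimately have "open (k ` (U \<times> {0<..}))"
      using U(1) dim by (intro invariance_of_domain_gen open_Times) auto
    moreover have "\<sigma> ` U = sphere 0 1 \<inter> k ` (U \<times> {0<..})"
    proof (intro equalityI subsetI)
      fix y assume "y \<in> \<sigma> ` U"
      then obtain x where "x \<in> U" "y = \<sigma> x" by auto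
      then show "y \<in> sphere 0 1 \<inter> k ` (U \<times> {0<..})"
        using n U(2) by (auto simp: k_def intro!: image_eqI[of _ _ "(x, 1)"])
    next
      fix y assume "y \<in> sphere 0 1 \<inter> k ` (U \<times> {0<..})"
      then obtain z where "z \<in> U \<times> {0<..}" "y = k z" "norm y = 1" by auto
      then show "y \<in> \<sigma> ` U" using nk[of z] by (auto simp: k_def)
    qed
    ultimately show ?thesis by (simp add: openin_open_Int)
  qed
  have "embedding_map (top_of_set B) (top_of_set (sphere 0 1)) \<sigma>"
  proof (rule injective_open_imp_embedding_map)
    show "continuous_map (top_of_set B) (top_of_set (sphere 0 1)) \<sigma>"
      using c\<sigma> n by (auto simp: continuous_map_in_subtopology)
    show "open_map (top_of_set B) (top_of_set (sphere 0 1)) \<sigma>"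
      unfolding open_map_def using o B by (auto simp: openin_open_eq)
  qed (use \<sigma>(2) in simp)
  then show ?thesis
    using B \<sigma> o[OF B] by (auto simp: unit_sphere_def)
qed

section \<open>Generic points\<close>

context einstein_warped
begin

text \<open>The last expression is w^2 times the horizontal times the vertical curvature minus the
  square of the mixed one. Besides s = 0 it has the single zero s = 2 k m / (m - 1).
  \<open>generic_ball\<close> reads its exceptional values off these factors.\<close>

lemma curvature_functions:
  assumes x: "x \<in> S1"
  defines "k \<equiv> rho / (real DIM('e) + 1)" and "m \<equiv> real DIM('e)" and "s \<equiv> C x / w x ^ (DIM('e) + 1)"
  shows "kappa - q x = (w x)\<^sup>2 * (k - s)" "lam x = - w x * (2 * k + (m - 1) * s) / 2"
    "K1 x * (kappa - q x) - (lam x)\<^sup>2 = (w x)\<^sup>2 * s * (m + 1) * ((m - 1) * s / 4 - k * m / 2)"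
proof -
  have w: "w x > 0" by (rule w_pos[OF x])
  have m: "m + 1 > 0" by (simp add: m_def)
  have rho: "rho = (m + 1) * k" using m by (simp add: k_def m_def)
  have p: "w x ^ (DIM('e) + 1) = w x ^ (DIM('e) - 1) * (w x)\<^sup>2"
    using dims(2) by (simp flip: power_add)
  have "(w x)\<^sup>2 * s = q x + k * (w x)\<^sup>2 - kappa"
    unfolding s_def C_def k_def p using w by simp
  then show 1: "kappa - q x = (w x)\<^sup>2 * (k - s)" by (simp add: algebra_simps)
  have "lam x = ((m - 1) * ((w x)\<^sup>2 * (k - s)) - rho * (w x)\<^sup>2) / (2 * w x)"
    by (simp only: lam_def 1 m_def)
  also have "\<dots> = ((m - 1) * ((w x)\<^sup>2 * (k - s)) - (m + 1) * k * (w x)\<^sup>2) / (2 * w x)"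
    by (simp only: rho)
  also have "\<dots> = - w x * (2 * k + (m - 1) * s) / 2"
    using w by (simp add: field_simps power2_eq_square)
  finally show 2: "lam x = - w x * (2 * k + (m - 1) * s) / 2" .
  have "K1 x = rho + m * (- w x * (2 * k + (m - 1) * s) / 2) / w x" by (simp only: K1_def 2 m_def)
  also have "\<dots> = (m + 1) * k + m * (- w x * (2 * k + (m - 1) * s) / 2) / w x" by (simp only: rho)
  also have "\<dots> = k - m * (m - 1) * s / 2" using w by (simp add: field_simps)
  finally have 3: "K1 x = k - m * (m - 1) * s / 2" .
  show "K1 x * (kappa - q x) - (lam x)\<^sup>2 = (w x)\<^sup>2 * s * (m + 1) * ((m - 1) * s / 4 - k * m / 2)"
    unfolding 1 2 3 by (simp add: field_simps power2_eq_square)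
qed

text \<open>Where \<open>w\<close> is not constant, there is a ball with q nonzero, on which
  \<open>w\<close> takes an interval of values. As \<open>C\<close> is a nonzero constant, the
  quantity \<open>s\<close> of \<open>curvature_functions\<close> is injective in \<open>w\<close>,
  so a finite set of bad values cannot exhaust this interval. Continuity enlarges the good point to
  a ball.\<close>

lemma generic_ball:
  assumes S1: "convex S1" "S1 \<noteq> {}" and C: "\<And>x. x \<in> S1 \<Longrightarrow> C x \<noteq> 0" and nc: "\<not> w constant_on S1"
  obtains p r where "r > 0" "ball p r \<subseteq> S1"
    "\<And>x. x \<in> ball p r \<Longrightarrow> q x \<noteq> 0 \<and> lam x \<noteq> 0 \<and> kappa - q x \<noteq> 0 \<and> K1 x * (kappa - q x) \<noteq> (lam x)\<^sup>2"
proof -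
  obtain x0 where x0: "x0 \<in> S1" using S1 by auto
  define c where "c = C x0"
  have Cc: "C x = c" if "x \<in> S1" for x
    unfolding c_def by (rule dd_zero_const[OF S1(1) L.open_S smooth_onD[OF smooth_C] dd_C that x0])
  have c0: "c \<noteq> 0" using C[OF x0] by (simp add: c_def)
  have nonconst: "\<exists>x\<in>S1. q x \<noteq> 0"
  proof (rule ccontr)
    assume "\<not> (\<exists>x\<in>S1. q x \<noteq> 0)"
    then have "dd v w x = 0" if "x \<in> S1" for x v using q_pos_iff[OF that] that by auto
    then have "w x = w x0" if "x \<in> S1" for x
      by (intro dd_zero_const[OF S1(1) L.open_S diff_w _ that x0])
    then show False using nc by (auto simp: constant_on_def)
  qed
  then obtain p0 where p0: "p0 \<in> S1" "q p0 \<noteq> 0" by auto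
  have qc: "continuous_on S1 q" by (rule smooth_on_continuous[OF smooth_q])
  have wc: "continuous_on S1 w" by (rule smooth_on_continuous[OF smooth_w])
  have "open (S1 \<inter> q -` (- {0}))" by (rule continuous_open_preimage[OF qc L.open_S]) auto
  moreover have "p0 \<in> S1 \<inter> q -` (- {0})" using p0 by simp
  ultimately obtain r0 where r0: "r0 > 0" "ball p0 r0 \<subseteq> S1 \<inter> q -` (- {0})"
    using open_contains_ball by blast
  have "\<exists>y\<in>ball p0 r0. w y \<noteq> w p0"
  proof (rule ccontr)
    assume "\<not> (\<exists>y\<in>ball p0 r0. w y \<noteq> w p0)"
    then have eq: "w y = w p0" if "y \<in> ball p0 r0" for y using that by blast
    have "p0 \<in> ball p0 r0" using r0(1) by simp
    then have "dd v w p0 = dd v (\<lambda>x. w p0) p0" for v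
      by (rule dd_eq_on[OF open_ball]) (rule eq)
    then have "dd v w p0 = 0" for v by (simp only: dd_const)
    then have "\<not> q p0 > 0" unfolding q_pos_iff[OF p0(1)] by blast
    moreover have "q p0 \<ge> 0" unfolding q_def
      using L.g_pos[OF p0(1), of "Z p0"] L.g_simps(9)[OF p0(1)] by (cases "Z p0 = 0") auto
    ultimately show False using p0(2) by simp
  qed
  then obtain y where y: "y \<in> ball p0 r0" "w y \<noteq> w p0" by auto
  have "connected (w ` ball p0 r0)"
    using r0 by (intro connected_continuous_image continuous_on_subset[OF wc]) auto
  moreover have "w p0 \<in> w ` ball p0 r0" "w y \<in> w ` ball p0 r0" using y r0 by auto
  ultimately have "{min (w p0) (w y)..max (w p0) (w y)} \<subseteq> w ` ball p0 r0"
    by (intro connected_contains_Icc) (auto simp: min_def max_def)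
  moreover have "infinite {min (w p0) (w y)..max (w p0) (w y)}"
    using y(2) by (intro infinite_Icc) (auto simp: min_def max_def)
  ultimately have inf: "infinite (w ` ball p0 r0)" using finite_subset by blast
  define k where "k = rho / (real DIM('e) + 1)"
  define m where "m = real DIM('e)"
  \<comment> \<open>The zeros in \<open>s\<close> of the factors in
    \<open>curvature_functions\<close>, apart from s = 0, which \<open>c0\<close> excludes.\<close>
  define F where "F = {k, - 2 * k / (m - 1), 2 * k * m / (m - 1)}"
  define \<theta> where "\<theta> t = c / t ^ (DIM('e) + 1)" for t
  have "inj_on \<theta> {0<..}"
  proof (rule inj_onI)
    fix a b :: real assume "a \<in> {0<..}" "b \<in> {0<..}" "\<theta> a = \<theta> b"
    then have "a ^ (DIM('e) + 1) = b ^ (DIM('e) + 1)" "a \<ge> 0" "b \<ge> 0" using c0 by (auto simp: \<theta>_def field_simps)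
    then show "a = b" by (metis power_eq_imp_eq_base add_gr_0 zero_less_one)
  qed
  then have "finite (\<theta> -` F \<inter> {0<..})" by (intro finite_vimage_IntI) (auto simp: F_def)
  then have "\<not> w ` ball p0 r0 \<subseteq> \<theta> -` F \<inter> {0<..}" using inf finite_subset by blast
  then obtain p where p: "p \<in> ball p0 r0" "\<theta> (w p) \<notin> F" using w_pos r0(2) by blast
  have pS: "p \<in> S1" "q p \<noteq> 0" using p r0 by auto
  have wp: "w p > 0" by (rule w_pos[OF pS(1)])
  have m3: "m \<ge> 3" using dims by (simp add: m_def)
  define s where "s = C p / w p ^ (DIM('e) + 1)"
  have s: "s = \<theta> (w p)" by (simp add: s_def \<theta>_def Cc[OF pS(1)])
  have s0: "s \<noteq> 0" using c0 wp by (simp add: s \<theta>_def)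
  have sF: "k - s \<noteq> 0" "2 * k + (m - 1) * s \<noteq> 0" "(m - 1) * s / 4 - k * m / 2 \<noteq> 0"
    using p(2) m3 unfolding F_def s[symmetric] by (auto simp: field_simps)
  note cf = curvature_functions[OF pS(1), folded k_def m_def s_def]
  have gp: "lam p \<noteq> 0" "kappa - q p \<noteq> 0" "K1 p * (kappa - q p) \<noteq> (lam p)\<^sup>2"
  proof -
    show "kappa - q p \<noteq> 0" unfolding cf(1) using wp sF(1) by simp
    show "lam p \<noteq> 0" unfolding cf(2) using wp sF(2) by simp
    have "K1 p * (kappa - q p) - (lam p)\<^sup>2 \<noteq> 0" unfolding cf(3) using wp s0 m3 sF(3) by simp
    then show "K1 p * (kappa - q p) \<noteq> (lam p)\<^sup>2" by simp
  qed
  have lc: "continuous_on S1 lam" unfolding lam_def[abs_def]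
    by (intro continuous_intros qc wc) (use w_pos in force)
  have Kc: "continuous_on S1 K1" unfolding K1_def[abs_def]
    by (intro continuous_intros lc wc) (use w_pos in force)
  have "open (S1 \<inter> (\<lambda>x. q x * lam x * (kappa - q x) * (K1 x * (kappa - q x) - (lam x)\<^sup>2)) -` (- {0}))"
    by (rule continuous_open_preimage[OF _ L.open_S]) (auto intro!: continuous_intros qc lc Kc)
  moreover have "p \<in> S1 \<inter> (\<lambda>x. q x * lam x * (kappa - q x) * (K1 x * (kappa - q x) - (lam x)\<^sup>2)) -` (- {0})"
    using pS gp by simp
  ultimately obtain r where "r > 0"
    "ball p r \<subseteq> S1 \<inter> (\<lambda>x. q x * lam x * (kappa - q x) * (K1 x * (kappa - q x) - (lam x)\<^sup>2)) -` (- {0})"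
    using open_contains_ball by blast
  then show ?thesis by (intro that[of r p]) auto
qed

end

text \<open>If the union of a maximal disjoint family missed a nonempty open set, that set would
  contain a further member. Each member is connected and open, and it is closed in the union because
  the others are open; so the components of the union are the members.\<close>

lemma dense_union_of_components:
  assumes ex: "\<And>B. openin X B \<Longrightarrow> B \<noteq> {} \<Longrightarrow>
      \<exists>V. openin X V \<and> connectedin X V \<and> V \<noteq> {} \<and> V \<subseteq> B \<and> P V"
  obtains D where "openin X D" "X closure_of D = topspace X"
    "\<And>V. V \<in> connected_components_of (subtopology X D) \<Longrightarrow> P V"
proof -
  define A where "A = {\<C>. (\<forall>V\<in>\<C>. openin X V \<and> connectedin X V \<and> V \<noteq> {} \<and> P V) \<and> pairwise disjnt \<C>}"
  have "\<exists>M\<in>A. \<forall>\<C>\<in>A. M \<subseteq> \<C> \<longrightarrow> \<C> = M"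
  proof (rule subset_Zorn')
    fix K assume K: "subset.chain A K"
    then have KA: "K \<subseteq> A" and ch: "\<And>a b. a \<in> K \<Longrightarrow> b \<in> K \<Longrightarrow> a \<subseteq> b \<or> b \<subseteq> a"
      by (auto simp: subset.chain_def)
    have "pairwise disjnt (\<Union>K)"
    proof (rule pairwiseI)
      fix a b assume "a \<in> \<Union>K" "b \<in> \<Union>K" "a \<noteq> b"
      then obtain u where u: "u \<in> K" "a \<in> u" "b \<in> u" using ch by blast
      moreover from u(1) have "pairwise disjnt u" using KA by (auto simp: A_def)
      ultimately show "disjnt a b" using \<open>a \<noteq> b\<close> by (auto dest: pairwiseD)
    qed
    then show "\<Union>K \<in> A" using KA by (fastforce simp: A_def)
  qed
  then obtain \<C> where C: "\<C> \<in> A" and max: "\<And>\<D>. \<D> \<in> A \<Longrightarrow> \<C> \<subseteq> \<D> \<Longrightarrow> \<D> = \<C>" by blast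
  have CV: "openin X V" "connectedin X V" "V \<noteq> {}" "P V" if "V \<in> \<C>" for V using C that by (auto simp: A_def)
  have dis: "disjnt U V" if "U \<in> \<C>" "V \<in> \<C>" "U \<noteq> V" for U V using C that by (auto simp: A_def pairwise_def)
  define D where "D = \<Union>\<C>"
  have D: "openin X D" unfolding D_def using CV(1) by (intro openin_Union) auto
  have "X closure_of D = topspace X"
    unfolding dense_intersects_open
  proof (intro allI impI)
    fix T assume T: "openin X T \<and> T \<noteq> {}"
    show "D \<inter> T \<noteq> {}"
    proof
      assume DT: "D \<inter> T = {}"
      obtain V where V: "openin X V" "connectedin X V" "V \<noteq> {}" "V \<subseteq> T" "P V" using ex T by blast
      have dV: "disjnt V U" if "U \<in> \<C>" for U using that DT V(4) by (auto simp: D_def disjnt_def)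
      have "insert V \<C> \<in> A"
        using C V dV by (auto simp: A_def pairwise_insert disjnt_sym)
      then have "V \<in> \<C>" using max[of "insert V \<C>"] by auto
      then show False using dV[of V] V(3) by (auto simp: disjnt_def)
    qed
  qed
  moreover have "P V" if V: "V \<in> connected_components_of (subtopology X D)" for V
  proof -
    let ?Y = "subtopology X D"
    have "V \<noteq> {}" "V \<subseteq> D"
      using nonempty_connected_components_of[OF V] connected_components_of_subset[OF V] by auto
    then obtain x where x: "x \<in> V" "x \<in> D" by blast
    then obtain U where U: "U \<in> \<C>" "x \<in> U" "x \<in> V" by (auto simp: D_def)
    have UD: "U \<subseteq> D" using U by (auto simp: D_def)
    have tY: "topspace ?Y = D" using openin_subset[OF D] by auto
    have oU: "openin ?Y U" using CV(1)[OF U(1)] UD by (auto simp: openin_subtopology)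
    have "openin X (\<Union>(\<C> - {U}))" using CV(1) by (intro openin_Union) auto
    moreover have "D - U = \<Union>(\<C> - {U})" using dis U(1) by (fastforce simp: D_def disjnt_def)
    ultimately have "openin ?Y (topspace ?Y - U)" unfolding tY by (auto simp: openin_subtopology)
    then have cU: "closedin ?Y U" using UD tY by (simp add: closedin_def)
    have "connectedin ?Y U" using CV(2)[OF U(1)] UD by (simp add: connectedin_subtopology)
    then have "U \<subseteq> V" using connected_components_of_maximal[OF V] U by (auto simp: disjnt_def)
    moreover have "V \<subseteq> U"
      using connectedin_clopen_cases[OF connectedin_connected_components_of[OF V] cU oU] U by (auto simp: disjnt_def)
    ultimately show ?thesis using CV(4)[OF U(1)] by simp
  qed
  ultimately show ?thesis using that D by blast
qed

section \<open>The rotational normal form\<close>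

text \<open>The body of the conclusion for a single component \<open>V\<close>, named so that the
  topological argument can treat it as an abstract property.\<close>

definition rotational_normal_form ::
    "nat \<Rightarrow> real \<Rightarrow> ('l \<times> 'f, (real ^ 2) \<times> (real ^ 'm)) riem \<Rightarrow>
     ('l \<times> 'f \<Rightarrow> (real ^ 3) \<times> (real ^ 'k)) \<Rightarrow> ('l \<times> 'f) set \<Rightarrow> bool" where
  "rotational_normal_form n \<rho> M f V \<longleftrightarrow>
      (\<exists>(c::real) (I::real set) (I0::real set) (\<psi>::real \<Rightarrow> real) (U::(real \<times> real) set)
        (h::real \<times> real \<Rightarrow> real ^ 3)
        (N::((real \<times> real) \<times> (real ^ 'k), (real \<times> real) \<times> (real ^ 'm)) riem) W \<Phi> T.
        open I \<and> is_interval I \<and> open I0 \<and> is_interval I0 \<and>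
        smooth_on I \<psi> \<and>
        (\<forall>t\<in>I. \<psi> t > 0 \<and>
           (deriv \<psi> t)\<^sup>2 = 1 - \<rho> / (real n - 1) * (\<psi> t)\<^sup>2 + c / (\<psi> t) ^ (n - 3) \<and>
           0 < (deriv \<psi> t)\<^sup>2 \<and> (deriv \<psi> t)\<^sup>2 < 1) \<and>
        open U \<and> U \<subseteq> I \<times> I0 \<and>
        isometric_immersion
          (plane_domain U (\<lambda>t. 1 - (deriv \<psi> t)\<^sup>2) (\<lambda>t. (deriv \<psi> t)\<^sup>2)) h \<and>
        N = warped_product (plane_domain U (\<lambda>t. 1) (\<lambda>t. (deriv \<psi> t)\<^sup>2))
              (\<lambda>(t, u). \<psi> t) unit_sphere \<and>
        openin (topo N) W \<and>
        isometry (open_submanifold M V) (open_submanifold N W) \<Phi> \<and>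
        rigid_motion T \<and>
        rotational_submanifold (open_submanifold M V) (T \<circ> f)
          (plane_domain U (\<lambda>t. 1) (\<lambda>t. (deriv \<psi> t)\<^sup>2)) (\<lambda>(t, u). (h (t, u), \<psi> t)) \<and>
        (\<forall>p\<in>V. \<forall>t u y. \<Phi> p = ((t, u), y) \<longrightarrow> T (f p) = (h (t, u), \<psi> t *\<^sub>R y)))"

lemma immersion_rigid_motion:
  assumes M: "\<And>P. P \<in> atlas M \<Longrightarrow> open (region P)" and f: "immersion M f" and T: "rigid_motion T"
  shows "immersion (open_submanifold M V) (T \<circ> f)"
proof -
  obtain A b where A: "orthogonal_transformation A" "T = (\<lambda>x. A x + b)"
    using T by (auto simp: rigid_motion_def)
  have Al: "linear A" "bounded_linear A" using A(1) by (auto simp: orthogonal_transformation_def linear_conv_bounded_linear)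
  have Ai: "inj A" using A(1) orthogonal_transformation_inj by blast
  have "smooth_on (region P) (T \<circ> f \<circ> param P) \<and> (\<forall>x\<in>region P. inj (frechet_derivative (T \<circ> f \<circ> param P) (at x)))"
    if P: "P \<in> atlas M" for P
  proof -
    have s: "smooth_on (region P) (f \<circ> param P)" and i: "\<And>x. x \<in> region P \<Longrightarrow> inj (frechet_derivative (f \<circ> param P) (at x))"
      using f P by (auto simp: immersion_def smooth_function_def)
    have e: "T \<circ> f \<circ> param P = (\<lambda>x. A ((f \<circ> param P) x) + b)" by (auto simp: A(2))
    have "smooth_on (region P) (T \<circ> f \<circ> param P)"
      unfolding e by (intro smooth_intros smooth_on_bounded_linear[OF Al(2)] s M P)
    moreover have "inj (frechet_derivative (T \<circ> f \<circ> param P) (at x))" if x: "x \<in> region P" for x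
    proof -
      have "((\<lambda>x. A ((f \<circ> param P) x) + b) has_derivative (\<lambda>v. A (dd v (f \<circ> param P) x))) (at x)"
        by (intro has_derivative_add_const bounded_linear.has_derivative[OF Al(2)] dd_derivative smooth_onD[OF s x])
      from frechet_derivative_at[OF this]
      have "frechet_derivative (T \<circ> f \<circ> param P) (at x) = A \<circ> frechet_derivative (f \<circ> param P) (at x)"
        unfolding e by (simp add: o_def)
      then show ?thesis using inj_compose[OF Ai i[OF x]] by simp
    qed
    ultimately show ?thesis by blast
  qed
  then show ?thesis
    unfolding immersion_def smooth_function_def open_submanifold_def
    by (auto intro: smooth_on_subset)
qed

lemma plane_domain_open_submanifold: "open_submanifold (plane_domain U a b) U = plane_domain U a b"
  by (simp add: open_submanifold_def plane_domain_def subtopology_subtopology)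

text \<open>From dimension 2 on, the rotation group acts transitively on the unit sphere.\<close>

lemma rotation_of_axis:
  fixes y :: "real ^ 'k"
  assumes "2 \<le> CARD('k)" "norm y = 1"
  obtains R where "R \<in> (axis_rotations :: ('z \<times> (real ^ 'k) \<Rightarrow> 'z \<times> (real ^ 'k)) set)"
    "\<And>z s. R (z, s *\<^sub>R axis i 1) = (z, s *\<^sub>R y)"
proof -
  obtain A where A: "rotation_matrix A" "A *v axis i 1 = y"
    using rotation_matrix_exists_basis[OF assms] by blast
  show ?thesis
    by (rule that[of "\<lambda>(z, y). (z, A *v y)"])
      (use A in \<open>auto simp: axis_rotations_def matrix_vector_mult_scaleR\<close>)
qed

text \<open>\<open>G\<close> and \<open>S\<close> are \<tau> and \<sigma> read as patches of the
  target. The product patches of source and target then have the same region, the isometry is the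
  identity in these coordinates, and equality of the metrics is what is assumed of \<tau> and
  \<sigma>.\<close>

lemma rotational_normal_formI:
  fixes L :: "('l, real ^ 2) riem" and F :: "('f, real ^ 'm) riem"
    and f :: "'l \<times> 'f \<Rightarrow> (real ^ 3) \<times> (real ^ 'k)" and \<tau> :: "real ^ 2 \<Rightarrow> real \<times> real"
  assumes L: "regular_atlas L" "P \<in> atlas L" and F: "regular_atlas F" "Q \<in> atlas F"
    and M: "M = warped_product L \<phi> F" and f: "immersion M f"
    and card: "CARD('k) = CARD('m) + 1" "n = CARD('m) + 2"
    and B1: "open B1" "B1 \<subseteq> region P" and B2: "open B2" "B2 \<subseteq> region Q"
    and I: "open I" "is_interval I" "smooth_on I \<psi>"
    and ode: "\<And>t. t \<in> I \<Longrightarrow> \<psi> t > 0 \<and>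
      (deriv \<psi> t)\<^sup>2 = 1 - \<rho> / (real DIM(real ^ 'm) + 1) * (\<psi> t)\<^sup>2 + c / \<psi> t ^ (DIM(real ^ 'm) - 1) \<and>
      0 < (deriv \<psi> t)\<^sup>2 \<and> (deriv \<psi> t)\<^sup>2 < 1"
    and \<tau>: "smooth_on B1 \<tau>" "inj_on \<tau> B1" "\<And>x. x \<in> B1 \<Longrightarrow> inj (frechet_derivative \<tau> (at x))"
    "\<And>x. x \<in> B1 \<Longrightarrow> fst (\<tau> x) \<in> I" "\<And>x. x \<in> B1 \<Longrightarrow> \<psi> (fst (\<tau> x)) = \<phi> (param P x)"
    "\<And>x u v. x \<in> B1 \<Longrightarrow> metric P x u v = fst (dd u \<tau> x) * fst (dd v \<tau> x)
      + (deriv \<psi> (fst (\<tau> x)))\<^sup>2 * snd (dd u \<tau> x) * snd (dd v \<tau> x)"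
    and h: "smooth_on (\<tau> ` B1) h"
    "\<And>z a b. z \<in> \<tau> ` B1 \<Longrightarrow> dd a h z \<bullet> dd b h z
      = (1 - (deriv \<psi> (fst z))\<^sup>2) * fst a * fst b + (deriv \<psi> (fst z))\<^sup>2 * snd a * snd b"
    and \<sigma>: "smooth_on B2 \<sigma>" "inj_on \<sigma> B2" "\<And>y. y \<in> B2 \<Longrightarrow> norm (\<sigma> y) = 1"
    "\<And>y u v. y \<in> B2 \<Longrightarrow> dd u \<sigma> y \<bullet> dd v \<sigma> y = metric Q y u v"
    and \<sigma>inj: "\<And>y. y \<in> B2 \<Longrightarrow> inj (frechet_derivative \<sigma> (at y))"
    and T: "rigid_motion T"
    "\<And>x y. x \<in> B1 \<Longrightarrow> y \<in> B2 \<Longrightarrow> T (f (param P x, param Q y)) = (h (\<tau> x), \<phi> (param P x) *\<^sub>R \<sigma> y)"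
  shows "rotational_normal_form n \<rho> M f (param P ` B1 \<times> param Q ` B2)"
proof -
  define U where "U = \<tau> ` B1"
  define b where "b t = (deriv \<psi> t)\<^sup>2" for t
  define \<omega> where "\<omega> = (\<lambda>(t::real, u::real). \<psi> t)"
  define pl where "pl = plane_domain U (\<lambda>t. 1) b"
  define N :: "((real \<times> real) \<times> (real ^ 'k), (real \<times> real) \<times> (real ^ 'm)) riem"
    where "N = warped_product pl \<omega> unit_sphere"
  define W where "W = U \<times> \<sigma> ` B2"
  define V where "V = param P ` B1 \<times> param Q ` B2"
  have m2: "DIM(real \<times> real) \<le> DIM(real ^ 2)" by simp
  have U: "open U" unfolding U_def
    by (rule invariance_of_domain_gen[OF B1(1) smooth_on_continuous[OF \<tau>(1)] \<tau>(2) m2])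
  define S where "S = \<lparr>region = B2, param = \<sigma>, metric = (\<lambda>x u v. dd u \<sigma> x \<bullet> dd v \<sigma> x)\<rparr>"
  have S: "S \<in> atlas unit_sphere"
    unfolding S_def by (rule unit_sphere_patch[OF B2(1) \<sigma>(1,2) \<sigma>inj \<sigma>(3)]) (use card in auto)
  have gS: "global_patch (open_submanifold (unit_sphere :: (real ^ 'k, real ^ 'm) riem) (\<sigma> ` B2)) S"
    using global_patch_restrict[OF regular_atlas_unit_sphere S, of B2] B2(1) by (simp add: S_def)
  define G where "G = \<lparr>region = B1, param = \<tau>,
    metric = (\<lambda>x u v. (\<lambda>(t, u) (v1, v2) (w1, w2). 1 * v1 * w1 + b t * v2 * w2) (\<tau> x) (dd u \<tau> x) (dd v \<tau> x))\<rparr>"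
  have gG: "global_patch pl G"
    unfolding pl_def plane_domain_def G_def U_def
    by (rule global_patch_plane[OF B1(1) \<tau>(1,2,3)]) auto
  have gN: "global_patch (open_submanifold N W) (prod_patch G \<omega> S)"
    unfolding N_def W_def open_submanifold_warped_product
    using global_prod_patch[OF gG gS] plane_domain_open_submanifold[of U "\<lambda>t. 1" b] by (simp add: pl_def)
  define P' where "P' = P\<lparr>region := B1\<rparr>"
  define Q' where "Q' = Q\<lparr>region := B2\<rparr>"
  have gM: "global_patch (open_submanifold M V) (prod_patch P' \<phi> Q')"
    unfolding M V_def open_submanifold_warped_product P'_def Q'_def
    by (rule global_prod_patch[OF global_patch_restrict[OF L B1] global_patch_restrict[OF F B2]])
  define R where "R z = (param P (fst z), param Q (snd z))" for z
  have R: "param (prod_patch P' \<phi> Q') = R" "region (prod_patch P' \<phi> Q') = B1 \<times> B2"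
    by (auto simp: prod_patch_def P'_def Q'_def R_def split_beta)
  have Rinj: "inj_on R (B1 \<times> B2)" and RV: "R ` (B1 \<times> B2) = V" and pV: "points (open_submanifold M V) = V"
  proof -
    have g: "regular_patch (open_submanifold M V) (prod_patch P' \<phi> Q')" "R ` (B1 \<times> B2) = points (open_submanifold M V)"
      using gM R by (auto simp: global_patch_def)
    show "inj_on R (B1 \<times> B2)" using regular_patchD(2)[OF g(1)] R by simp
    show RV: "R ` (B1 \<times> B2) = V" unfolding R_def V_def by force
    then show "points (open_submanifold M V) = V" using g(2) by simp
  qed
  \<comment> \<open>Defined through the inverse of the parametrization \<open>R\<close>, so that in
    coordinates it is the pair of \<tau> and \<sigma>.\<close>
  define \<Phi> where "\<Phi> p = (\<tau> (fst (inv_into (B1 \<times> B2) R p)), \<sigma> (snd (inv_into (B1 \<times> B2) R p)))" for p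
  have \<Phi>: "\<Phi> (R z) = (\<tau> (fst z), \<sigma> (snd z))" if "z \<in> B1 \<times> B2" for z
    using Rinj that by (simp add: \<Phi>_def)
  have iso: "isometry (open_submanifold M V) (open_submanifold N W) \<Phi>"
  proof (rule isometry_of_global_patches[OF gM gN])
    show "region (prod_patch P' \<phi> Q') = region (prod_patch G \<omega> S)"
      by (simp add: prod_patch_simps(1) G_def S_def P'_def Q'_def)
    fix z assume "z \<in> region (prod_patch P' \<phi> Q')"
    then have z: "z \<in> B1 \<times> B2" using R(2) by simp
    then have z': "fst z \<in> B1" "snd z \<in> B2" by (auto simp: mem_Times_iff)
    show "\<Phi> (param (prod_patch P' \<phi> Q') z) = param (prod_patch G \<omega> S) z"
      by (simp add: R \<Phi>[OF z] prod_patch_simps(2) G_def S_def)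
    show "metric (prod_patch P' \<phi> Q') z u v = metric (prod_patch G \<omega> S) z u v" for u v
      using \<tau>(5,6)[OF z'(1)] \<sigma>(4)[OF z'(2)]
      by (simp add: prod_patch_simps(3) P'_def Q'_def G_def S_def \<omega>_def b_def split_beta)
  qed
  have UI: "fst z \<in> I" if "z \<in> U" for z using that \<tau>(4) by (auto simp: U_def)
  have hU: "smooth_on U h" using h(1) by (simp add: U_def)
  have dh: "dd a h z \<bullet> dd a' h z = (1 - b (fst z)) * fst a * fst a' + b (fst z) * snd a * snd a'" if "z \<in> U" for z a a'
    using h(2) that by (simp add: U_def b_def)
  have b01: "0 < b (fst z)" "b (fst z) < 1" if "z \<in> U" for z
    unfolding b_def using ode[OF UI[OF that]] by blast+
  \<comment> \<open>The metric (1 - b) dt^2 + b du^2 is definite because 0 < b < 1. Hence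
    \<open>h\<close> is an immersion, and so is the surface \<open>g\<close>, of which
    \<open>h\<close> is a component.\<close>
  have h0D: "v = 0" if z: "z \<in> U" and v0: "dd v h z = 0" for z v
  proof -
    have "(1 - b (fst z)) * (fst v * fst v) + b (fst z) * (snd v * snd v) = 0"
      using dh[OF z, of v v] v0 by (simp add: mult.assoc)
    moreover have "(1 - b (fst z)) * (fst v * fst v) \<ge> 0" "b (fst z) * (snd v * snd v) \<ge> 0"
      using b01[OF z] by auto
    ultimately have "(1 - b (fst z)) * (fst v * fst v) = 0" "b (fst z) * (snd v * snd v) = 0" by linarith+
    then show "v = 0" using b01[OF z] by (simp add: prod_eq_iff)
  qed
  have isoh: "isometric_immersion (plane_domain U (\<lambda>t. 1 - b t) b) h"
  proof -
    have "inj (frechet_derivative h (at z))" if z: "z \<in> U" for z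
      unfolding linear_injective_0[OF linear_dd[OF smooth_onD[OF hU z]]]
    proof (intro allI impI)
      fix v assume "dd v h z = 0"
      then show "v = 0" by (rule h0D[OF z])
    qed
    moreover have "h \<circ> (\<lambda>x. x) = h" by auto
    ultimately show ?thesis
      unfolding isometric_immersion_def immersion_def smooth_function_def plane_domain_def
      using hU dh by (simp add: split_beta)
  qed
  define g where "g = (\<lambda>(t, u). (h (t, u), \<psi> t))"
  have g: "g z = (h z, \<psi> (fst z))" for z by (simp add: g_def split_beta)
  have img: "immersion pl g"
  proof -
    have \<psi>U: "smooth_on U (\<lambda>z. \<psi> (fst z))"
      by (rule smooth_on_compose[OF I(3) smooth_on_fst[OF U smooth_on_id] U I(1)]) (use UI in auto)
    have gs: "smooth_on U g" unfolding g[abs_def] by (intro smooth_intros U hU \<psi>U)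
    have "inj (frechet_derivative g (at z))" if z: "z \<in> U" for z
      unfolding linear_injective_0[OF linear_dd[OF smooth_onD[OF gs z]]]
    proof (intro allI impI)
      fix v assume v0: "dd v g z = 0"
      have \<psi>d: "\<psi> differentiable (at (fst z))" by (rule smooth_onD[OF I(3) UI[OF z]])
      have "(g has_derivative (\<lambda>v. (dd v h z, dd v (\<lambda>z. \<psi> (fst z)) z))) (at z)"
        unfolding g[abs_def]
        by (intro has_derivative_Pair dd_derivative smooth_onD[OF hU z] smooth_onD[OF \<psi>U z])
      from fun_cong[OF frechet_derivative_at[OF this], of v] have h0: "dd v h z = 0"
        unfolding v0 zero_prod_def prod.inject by (rule conjunct1)
      then show "v = 0" by (rule h0D[OF z])
    qed
    moreover have "g \<circ> (\<lambda>x. x) = g" by auto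
    ultimately show ?thesis
      unfolding immersion_def smooth_function_def pl_def plane_domain_def using gs by simp
  qed
  have Mo: "open (region P'')" if "P'' \<in> atlas M" for P''
  proof -
    obtain P1 Q1 where "P'' = prod_patch P1 \<phi> Q1" "P1 \<in> atlas L" "Q1 \<in> atlas F"
      using \<open>P'' \<in> atlas M\<close> unfolding M warped_product_simps(2) by blast
    moreover have "regular_patch L P1" "regular_patch F Q1"
      using calculation(2,3) L F unfolding regular_atlas_def by blast+
    ultimately show ?thesis using regular_patchD(1)[of L P1] regular_patchD(1)[of F Q1] by (simp add: prod_patch_simps(1) open_Times)
  qed
  have Tf: "T (f (R z)) = (h (\<tau> (fst z)), \<psi> (fst (\<tau> (fst z))) *\<^sub>R \<sigma> (snd z))" if "z \<in> B1 \<times> B2" for z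
    using T(2)[of "fst z" "snd z"] \<tau>(5)[of "fst z"] that by (auto simp: R_def)
  have rot: "rotational_submanifold (open_submanifold M V) (T \<circ> f) pl g"
    unfolding rotational_submanifold_def
  proof (intro conjI)
    show "immersion (open_submanifold M V) (T \<circ> f)" by (rule immersion_rigid_motion[OF Mo f T(1)])
    show "immersion pl g" by (rule img)
    have pp: "points pl = U" by (simp add: pl_def plane_domain_def)
    show "\<forall>x\<in>points pl. snd (g x) \<noteq> 0" unfolding pp using ode UI by (force simp: g)
    have "(T \<circ> f) p \<in> {R (fst (g x), snd (g x) *\<^sub>R axis i 1) |R x. R \<in> axis_rotations \<and> x \<in> points pl}"
      if p: "p \<in> V" for p
    proof -
      obtain z where z: "z \<in> B1 \<times> B2" "p = R z" using p RV by auto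
      have "2 \<le> CARD('k)" using card by (simp add: Suc_le_eq)
      moreover have "norm (\<sigma> (snd z)) = 1" using \<sigma>(3) z by auto
      ultimately obtain R' :: "(real ^ 3) \<times> (real ^ 'k) \<Rightarrow> (real ^ 3) \<times> (real ^ 'k)" where R': "R' \<in> axis_rotations"
        "\<And>z' s. R' (z', s *\<^sub>R axis i 1) = (z', s *\<^sub>R \<sigma> (snd z))"
        by (rule rotation_of_axis) blast
      have "(T \<circ> f) p = R' (fst (g (\<tau> (fst z))), snd (g (\<tau> (fst z))) *\<^sub>R axis i 1)"
        using Tf[OF z(1)] by (simp add: g R'(2) z(2))
      moreover have "\<tau> (fst z) \<in> points pl" using z unfolding pp U_def by auto
      ultimately show ?thesis using R'(1) by blast
    qed
    then show "\<exists>e. norm e = 1 \<and> (T \<circ> f) ` points (open_submanifold M V)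
        \<subseteq> {R (fst (g x), snd (g x) *\<^sub>R e) |R x. R \<in> axis_rotations \<and> x \<in> points pl}"
      unfolding pV by (intro exI[of _ "axis i 1"]) auto
  qed
  have fin: "T (f p) = (h (t, u), \<psi> t *\<^sub>R y)" if p: "p \<in> V" "\<Phi> p = ((t, u), y)" for p t u y
  proof -
    obtain z where z: "z \<in> B1 \<times> B2" "p = R z" using p(1) RV by auto
    then have "\<tau> (fst z) = (t, u)" "\<sigma> (snd z) = y" using \<Phi>[OF z(1)] p(2) by auto
    then show ?thesis using Tf[OF z(1)] z(2) by simp
  qed
  have oW: "openin (topo N) W"
  proof -
    have "openin (top_of_set (sphere 0 1)) (\<sigma> ` B2)" using S by (auto simp: unit_sphere_def S_def)
    then show ?thesis
      unfolding N_def W_def warped_product_simps(1) pl_def plane_domain_def unit_sphere_def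
      by (simp add: openin_Times)
  qed
  \<comment> \<open>The second coordinate is not confined to a smaller interval: \<open>I0\<close>
    will be the whole line.\<close>
  have UI': "U \<subseteq> I \<times> UNIV" using UI by auto
  have ode': "\<psi> t > 0 \<and> (deriv \<psi> t)\<^sup>2 = 1 - \<rho> / (real n - 1) * (\<psi> t)\<^sup>2 + c / (\<psi> t) ^ (n - 3) \<and>
           0 < (deriv \<psi> t)\<^sup>2 \<and> (deriv \<psi> t)\<^sup>2 < 1" if "t \<in> I" for t
  proof -
    have n: "real n - 1 = real DIM(real ^ 'm) + 1" "n - 3 = DIM(real ^ 'm) - 1" using card(2) by auto
    show ?thesis unfolding n by (rule ode[OF that])
  qed
  show ?thesis
    unfolding rotational_normal_form_def V_def[symmetric]
    by (rule exI[of _ c], rule exI[of _ I], rule exI[of _ UNIV], rule exI[of _ \<psi>], rule exI[of _ U],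
        rule exI[of _ h], rule exI[of _ N], rule exI[of _ W], rule exI[of _ \<Phi>], rule exI[of _ T],
        intro conjI)
      (use I UI' U T(1) oW iso fin ode' isoh[unfolded b_def[abs_def]] rot[unfolded pl_def b_def[abs_def] g_def]
          N_def[unfolded pl_def b_def[abs_def] \<omega>_def]
        in \<open>assumption | rule open_UNIV is_interval_univ | blast\<close>)+
qed

text \<open>\<open>q\<close>, \<open>lam\<close> and \<open>K1\<close> are computed pointwise from
  the metric and \<open>w\<close>, so shrinking the base to \<open>B\<close> leaves them as they
  are.\<close>

lemma (in einstein_warped) generic_immersion_restrict:
  fixes X :: "'d \<times> 'e \<Rightarrow> 'z::euclidean_space"
  assumes B: "open B" "B \<subseteq> S1" "convex B" "B \<noteq> {}" and S2: "convex S2"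
    and generic: "\<And>x. x \<in> B \<Longrightarrow> q x \<noteq> 0 \<and> lam x \<noteq> 0 \<and> kappa - q x \<noteq> 0 \<and> K1 x * (kappa - q x) \<noteq> (lam x)\<^sup>2"
    and X: "smooth_on (S1 \<times> S2) X"
      "\<And>x u v. x \<in> S1 \<times> S2 \<Longrightarrow> dd u X x \<bullet> dd v X x = gM x u v"
    and dim: "DIM('z) = DIM('d) + DIM('e) + 2" and k: "kappa \<in> {1, -1, 0}"
  shows "generic_immersion B gL S2 gF w rho kappa X"
proof -
  have BS: "B \<times> S2 \<subseteq> S1 \<times> S2" using B(2) by auto
  show ?thesis
  proof (unfold_locales)
    show "open B" by (rule B(1))
    show "riemannian_metric_on B gL"
      using L.metric B(2) smooth_on_subset[OF _ B(2)] unfolding riemannian_metric_on_def by blast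
    show "smooth_on B w" by (rule smooth_on_subset[OF smooth_w B(2)])
    show "smooth_on (B \<times> S2) X" by (rule smooth_on_subset[OF X(1) BS])
    show "w x > 0" if "x \<in> B" for x using w_pos that B(2) by blast
    show "ricci gM x v u = rho * gM x v u" if "x \<in> B \<times> S2" for x v u
      using einst that BS by blast
    show "dd u X x \<bullet> dd v X x = gM x u v" if "x \<in> B \<times> S2" for x u v
      using X(2) that BS by blast
  qed (use assms generic dims S2_nonempty F_curv in \<open>blast | simp\<close>)+
qed

text \<open>The trace of the space form tensor is (dim - 1) k g. Comparing it with the Einstein
  equation on a nonzero vector identifies the curvature of the fiber with its normalized Ricci
  constant.\<close>

lemma einstein_constant_sectional:
  assumes "metric_chart S g" and x: "x \<in> S" and d: "DIM('e::euclidean_space) \<ge> 2"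
    and sec: "\<And>u v. u \<noteq> v \<Longrightarrow> independent {u, v} \<Longrightarrow> sectional_curvature g x (u::'e) v = k"
    and ein: "\<And>v w. ricci g x v w = (real DIM('e) - 1) * e * g x v w"
  shows "k = e"
proof -
  interpret metric_chart S g by fact
  obtain b :: 'e where "b \<in> Basis" using nonempty_Basis by blast
  then have "b \<noteq> 0" by auto
  then have "g x b b > 0" using metric x unfolding riemannian_metric_on_def by blast
  moreover have "k * (real DIM('e) - 1) * g x b b = (real DIM('e) - 1) * e * g x b b"
  proof -
    have "ricci g x b b = k * (real DIM('e) - 1) * g x b b"
      by (rule ricci_constant[OF x constant_sectional_Rlow[OF x]]) (rule sec)
    then show ?thesis using ein[of b b] by argo
  qed
  ultimately show ?thesis using d by simp
qed

section \<open>Passage from the manifolds to charts\<close>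

lemma warped_patch_einstein:
  fixes P :: "('l, 'd::euclidean_space) patch" and Q :: "('f, 'e::euclidean_space) patch"
  assumes L: "riemannian_manifold L" "P \<in> atlas L" and F: "riemannian_manifold F" "Q \<in> atlas F"
    and \<phi>: "smooth_function L \<phi>" "\<forall>p\<in>points L. \<phi> p > 0"
    and ein: "einstein F ((real DIM('e) - 1) * \<epsilon>)" "einstein (warped_product L \<phi> F) \<rho>"
    and sec: "constant_sectional_curvature F" and dims: "DIM('d) = 2" "DIM('e) \<ge> 3"
    and A: "open A" "A \<subseteq> region P" and B: "open B" "B \<subseteq> region Q" "B \<noteq> {}"
  shows "einstein_warped A (metric P) B (metric Q) (\<lambda>x. \<phi> (param P x)) \<rho> \<epsilon>"
    and "warped_chart.gM (metric P) (metric Q) (\<lambda>x. \<phi> (param P x)) = metric (prod_patch P \<phi> Q)"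
proof -
  have mP: "riemannian_metric_on (region P) (metric P)" and pP: "param P ` region P \<subseteq> points L"
    using L unfolding riemannian_manifold_def by blast+
  have mQ: "riemannian_metric_on (region Q) (metric Q)"
    using F unfolding riemannian_manifold_def by blast
  have "riemannian_metric_on A (metric P)" "riemannian_metric_on B (metric Q)"
    using mP mQ A(2) B(2) smooth_on_subset[OF _ A(2)] smooth_on_subset[OF _ B(2)]
    unfolding riemannian_metric_on_def by blast+
  moreover have "smooth_on A (\<lambda>x. \<phi> (param P x))"
    using \<phi>(1) L(2) smooth_on_subset[OF _ A(2)] unfolding smooth_function_def o_def by blast
  moreover have "\<phi> (param P x) > 0" if "x \<in> A" for x
    using \<phi>(2) pP A(2) that by blast
  ultimately interpret warped_chart A "metric P" B "metric Q" "\<lambda>x. \<phi> (param P x)"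
    using A(1) B(1) by unfold_locales
  show g: "gM = metric (prod_patch P \<phi> Q)" by (simp add: gM_def prod_patch_def)
  obtain k where k: "\<And>y u v. y \<in> region Q \<Longrightarrow> u \<noteq> v \<Longrightarrow> independent {u, v} \<Longrightarrow>
      sectional_curvature (metric Q) y u v = k"
    using sec F(2) unfolding constant_sectional_curvature_def by blast
  have ke: "k = \<epsilon>"
  proof -
    obtain y where y: "y \<in> B" using B(3) by blast
    show ?thesis
    proof (rule einstein_constant_sectional[OF F.metric_chart_axioms y])
      show "sectional_curvature (metric Q) y u v = k" if "u \<noteq> v" "independent {u, v}" for u v
        using k y B(2) that by blast
      show "ricci (metric Q) y v w = (real DIM('e) - 1) * \<epsilon> * metric Q y v w" for v w
        using ein(1) F(2) y B(2) unfolding einstein_def by blast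
    qed (use dims in simp)
  qed
  have Fc: "F.Rlow y a b c d = \<epsilon> * (metric Q y b c * metric Q y a d - metric Q y a c * metric Q y b d)"
    if "y \<in> B" for y a b c d
    by (rule F.constant_sectional_Rlow[OF that]) (use k that B(2) ke in blast)
  have eM: "ricci gM x v u = \<rho> * gM x v u" if "x \<in> A \<times> B" for x v u
  proof -
    have "prod_patch P \<phi> Q \<in> atlas (warped_product L \<phi> F)"
      using L(2) F(2) unfolding warped_product_simps(2) by blast
    moreover have "x \<in> region (prod_patch P \<phi> Q)" using that A(2) B(2) by (auto simp: prod_patch_simps(1))
    ultimately show ?thesis using ein(2) unfolding g einstein_def by blast
  qed
  show "einstein_warped A (metric P) B (metric Q) (\<lambda>x. \<phi> (param P x)) \<rho> \<epsilon>"
    by unfold_locales (use dims B(3) Fc eM in blast)+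
qed

text \<open>Failure of constancy is applied to one prescribed value \<open>k\<close>; in use this is
  \<rho> / (m + 1), m the fiber dimension, the only curvature compatible with \<open>C\<close> = 0.
  The point \<open>z\<close> with another value is then enclosed in a product of balls inside
  \<open>B\<close>.\<close>

lemma nonconstant_sectional_box:
  fixes L :: "('l, 'd::euclidean_space) riem" and F :: "('f, 'e::euclidean_space) riem"
  assumes L: "regular_atlas L" and F: "regular_atlas F"
    and B: "openin (topo (warped_product L \<phi> F)) B"
    and nc: "\<not> constant_sectional_curvature (open_submanifold (warped_product L \<phi> F) B)"
  obtains P Q z r s u v where "P \<in> atlas L" "Q \<in> atlas F" "r > 0" "s > 0"
    "ball (fst z) r \<subseteq> region P" "ball (snd z) s \<subseteq> region Q"
    "param P ` ball (fst z) r \<times> param Q ` ball (snd z) s \<subseteq> B"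
    "u \<noteq> v" "independent {u, v}" "sectional_curvature (metric (prod_patch P \<phi> Q)) z u v \<noteq> k"
proof -
  obtain R' z u v where R': "R' \<in> atlas (open_submanifold (warped_product L \<phi> F) B)" "z \<in> region R'"
    and uv: "u \<noteq> v" "independent {u, v}" "sectional_curvature (metric R') z u v \<noteq> k"
    using nc unfolding constant_sectional_curvature_def by blast
  then obtain P Q where PQ: "P \<in> atlas L" "Q \<in> atlas F"
    and R: "R' = (prod_patch P \<phi> Q)\<lparr>region := {x \<in> region (prod_patch P \<phi> Q). param (prod_patch P \<phi> Q) x \<in> B}\<rparr>"
    unfolding open_submanifold_def warped_product_simps(2) by auto
  define D where "D = {x \<in> region (prod_patch P \<phi> Q). param (prod_patch P \<phi> Q) x \<in> B}"
  have "regular_patch (warped_product L \<phi> F) (prod_patch P \<phi> Q)"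
    using PQ L F unfolding regular_atlas_def by (blast intro: regular_prod_patch)
  then have D: "open D" unfolding D_def by (rule regular_patch_preimage[OF _ B])
  have "(fst z, snd z) \<in> D" using R'(2) by (simp add: R D_def)
  then obtain A1 A2 where A12: "open A1" "open A2" "(fst z, snd z) \<in> A1 \<times> A2" "A1 \<times> A2 \<subseteq> D"
    using open_prod_elim[OF D] by blast
  obtain r where r: "r > 0" "ball (fst z) r \<subseteq> A1" using A12 by (auto elim: openE)
  obtain s where s: "s > 0" "ball (snd z) s \<subseteq> A2" using A12 by (auto elim: openE)
  have sub: "ball (fst z) r \<times> ball (snd z) s \<subseteq> D" using r s A12(4) by blast
  have D': "D \<subseteq> region P \<times> region Q" "\<And>x. x \<in> D \<Longrightarrow> (param P (fst x), param Q (snd x)) \<in> B"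
    by (auto simp: D_def prod_patch_simps)
  have c: "fst z \<in> ball (fst z) r" "snd z \<in> ball (snd z) s" using r s by auto
  show ?thesis
  proof (rule that[OF PQ r(1) s(1) _ _ _ uv(1,2)])
    show "ball (fst z) r \<subseteq> region P" "ball (snd z) s \<subseteq> region Q" using sub D'(1) c by blast+
    show "param P ` ball (fst z) r \<times> param Q ` ball (snd z) s \<subseteq> B"
    proof
      fix p assume "p \<in> param P ` ball (fst z) r \<times> param Q ` ball (snd z) s"
      then obtain x y where xy: "x \<in> ball (fst z) r" "y \<in> ball (snd z) s" "p = (param P x, param Q y)" by blast
      then have "(x, y) \<in> D" using sub by blast
      then show "p \<in> B" using D'(2)[of "(x, y)"] xy(3) by simp
    qed
    show "sectional_curvature (metric (prod_patch P \<phi> Q)) z u v \<noteq> k" using uv(3) by (simp add: R)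
  qed
qed

text \<open>At the point given by \<open>nonconstant_sectional_box\<close> the first integral
  \<open>C\<close> is not 0, and being constant it vanishes nowhere on the box. The base ball is
  then replaced by one of generic points inside it, while the fiber ball keeps its center. The final
  \<open>V\<close> is connected as the image of a product of balls.\<close>

lemma rotational_neighbourhood:
  fixes L :: "('l, real ^ 2) riem" and F :: "('f, real ^ 'm) riem"
    and f :: "'l \<times> 'f \<Rightarrow> (real ^ 3) \<times> (real ^ 'k)"
  assumes card: "CARD('m) \<ge> 3" "CARD('k) = CARD('m) + 1" "n = CARD('m) + 2"
    and L: "riemannian_manifold L" and F: "riemannian_manifold F"
    and \<epsilon>: "\<epsilon> \<in> {1, -1, 0}" "einstein F ((real DIM(real ^ 'm) - 1) * \<epsilon>)"
    and \<phi>: "smooth_function L \<phi>" "\<forall>p\<in>points L. \<phi> p > 0"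
    and M: "M = warped_product L \<phi> F" "einstein M \<rho>"
    and nc: "\<And>A. openin (topo L) A \<Longrightarrow> A \<noteq> {} \<Longrightarrow> \<not> \<phi> constant_on A"
    and ns: "\<not> constant_sectional_curvature (open_submanifold M B)"
    and sec: "constant_sectional_curvature F" and f: "isometric_immersion M f"
    and B: "openin (topo M) B"
  shows "\<exists>V. openin (topo M) V \<and> connectedin (topo M) V \<and> V \<noteq> {} \<and> V \<subseteq> B \<and>
    rotational_normal_form n \<rho> M f V"
proof -
  note rL = riemannian_manifold_regular_atlas[OF L] and rF = riemannian_manifold_regular_atlas[OF F]
  obtain P Q z r0 s0 u v where PQ: "P \<in> atlas L" "Q \<in> atlas F" and rs: "r0 > 0" "s0 > 0"
    "ball (fst z) r0 \<subseteq> region P" "ball (snd z) s0 \<subseteq> region Q"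
    "param P ` ball (fst z) r0 \<times> param Q ` ball (snd z) s0 \<subseteq> B"
    and uv: "u \<noteq> v" "independent {u, v}"
      "sectional_curvature (metric (prod_patch P \<phi> Q)) z u v \<noteq> \<rho> / (real DIM(real ^ 'm) + 1)"
    by (rule nonconstant_sectional_box[OF rL rF B[unfolded M(1)] ns[unfolded M(1)]])
  have rP: "regular_patch L P" and rQ: "regular_patch F Q"
    using rL rF PQ unfolding regular_atlas_def by blast+
  define R where "R = prod_patch P \<phi> Q"
  have RM: "R \<in> atlas M" unfolding R_def M(1) warped_product_simps(2) using PQ by blast
  have rR: "regular_patch M R" unfolding R_def M(1) by (rule regular_prod_patch[OF rP rQ])
  define A0 where "A0 = ball (fst z) r0"
  define B0 where "B0 = ball (snd z) s0"
  have A0: "open A0" "A0 \<subseteq> region P" "fst z \<in> A0" "convex A0" "A0 \<noteq> {}"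
    and B0: "open B0" "B0 \<subseteq> region Q" "snd z \<in> B0" "convex B0" "B0 \<noteq> {}"
    using rs by (auto simp: A0_def B0_def)
  define w where "w x = \<phi> (param P x)" for x
  have ew: "einstein_warped A0 (metric P) B0 (metric Q) w \<rho> \<epsilon>"
    and g: "warped_chart.gM (metric P) (metric Q) w = metric R"
    unfolding w_def[abs_def] R_def
    using warped_patch_einstein[OF L PQ(1) F PQ(2) \<phi> \<epsilon>(2) M(2)[unfolded M(1)] sec _ _ A0(1,2) B0(1,2,5)] card(1)
    by auto
  interpret W: einstein_warped A0 "metric P" B0 "metric Q" w \<rho> \<epsilon> by (rule ew)
  have Cz: "W.C (fst z) \<noteq> 0"
    using W.sectional_if_C_zero[OF A0(3) B0(3) _ uv(1,2)] uv(3) unfolding g R_def by blast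
  have "W.C constant_on A0"
  proof -
    have "W.C x = W.C (fst z)" if "x \<in> A0" for x
      by (rule dd_zero_const[OF A0(4,1) smooth_onD[OF W.smooth_C] W.dd_C that A0(3)])
    then show ?thesis unfolding constant_on_def by blast
  qed
  then have C: "W.C x \<noteq> 0" if "x \<in> A0" for x
    using that A0(3) Cz unfolding constant_on_def by metis
  have nw: "\<not> w constant_on A0"
  proof
    assume "w constant_on A0"
    then have "\<phi> constant_on param P ` A0" unfolding constant_on_def w_def by blast
    then show False using nc[OF regular_patchD(4)[OF rP A0(1,2)]] A0(5) by blast
  qed
  obtain p r where pr: "r > 0" "ball p r \<subseteq> A0" and generic: "\<And>x. x \<in> ball p r \<Longrightarrow>
      W.q x \<noteq> 0 \<and> W.lam x \<noteq> 0 \<and> \<epsilon> - W.q x \<noteq> 0 \<and> W.K1 x * (\<epsilon> - W.q x) \<noteq> (W.lam x)\<^sup>2"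
  proof (rule W.generic_ball[OF A0(4,5) _ nw])
    show "W.C x \<noteq> 0" if "x \<in> A0" for x by (rule C[OF that])
  qed (rule that)
  have AB: "A0 \<times> B0 \<subseteq> region R" using A0(2) B0(2) by (auto simp: R_def prod_patch_simps(1))
  have im: "immersion M f" using f unfolding isometric_immersion_def by blast
  have gi: "generic_immersion (ball p r) (metric P) B0 (metric Q) w \<rho> \<epsilon> (f \<circ> param R)"
  proof (rule W.generic_immersion_restrict[OF open_ball pr(2) convex_ball _ B0(4) generic])
    show "ball p r \<noteq> {}" using pr(1) by simp
    show "smooth_on (A0 \<times> B0) (f \<circ> param R)"
      using im RM smooth_on_subset[OF _ AB] unfolding immersion_def smooth_function_def by blast
    show "dd u (f \<circ> param R) x \<bullet> dd v (f \<circ> param R) x = W.gM x u v" if "x \<in> A0 \<times> B0" for x u v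
      using f RM AB that unfolding g isometric_immersion_def by blast
    show "DIM((real ^ 3) \<times> (real ^ 'k)) = DIM(real ^ 2) + DIM(real ^ 'm) + 2" using card(2) by simp
  qed (assumption | rule \<epsilon>(1))+
  have dk: "DIM(real ^ 'k) = DIM(real ^ 'm) + 1" using card(2) by simp
  have p: "p \<in> ball p r" using pr(1) by simp
  obtain r1 r2 c I \<psi> \<tau> h \<sigma> T where nf:
    "r1 > 0" "ball p r1 \<subseteq> ball p r" "r2 > 0" "ball (snd z) r2 \<subseteq> B0"
    "open I" "is_interval I" "smooth_on I \<psi>"
    "\<And>t. t \<in> I \<Longrightarrow> \<psi> t > 0 \<and>
      (deriv \<psi> t)\<^sup>2 = 1 - \<rho> / (real DIM(real ^ 'm) + 1) * (\<psi> t)\<^sup>2 + c / \<psi> t ^ (DIM(real ^ 'm) - 1) \<and>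
      0 < (deriv \<psi> t)\<^sup>2 \<and> (deriv \<psi> t)\<^sup>2 < 1"
    "smooth_on (ball p r1) \<tau>" "inj_on \<tau> (ball p r1)"
    "\<And>x. x \<in> ball p r1 \<Longrightarrow> inj (frechet_derivative \<tau> (at x))"
    "\<And>x. x \<in> ball p r1 \<Longrightarrow> fst (\<tau> x) \<in> I" "\<And>x. x \<in> ball p r1 \<Longrightarrow> \<psi> (fst (\<tau> x)) = w x"
    "\<And>x u v. x \<in> ball p r1 \<Longrightarrow> metric P x u v = fst (dd u \<tau> x) * fst (dd v \<tau> x)
      + (deriv \<psi> (fst (\<tau> x)))\<^sup>2 * snd (dd u \<tau> x) * snd (dd v \<tau> x)"
    "smooth_on (\<tau> ` ball p r1) h"
    "\<And>z a b. z \<in> \<tau> ` ball p r1 \<Longrightarrow> dd a h z \<bullet> dd b h z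
      = (1 - (deriv \<psi> (fst z))\<^sup>2) * fst a * fst b + (deriv \<psi> (fst z))\<^sup>2 * snd a * snd b"
    "smooth_on (ball (snd z) r2) \<sigma>" "inj_on \<sigma> (ball (snd z) r2)"
    "\<And>y. y \<in> ball (snd z) r2 \<Longrightarrow> norm (\<sigma> y) = 1"
    "\<And>y u v. y \<in> ball (snd z) r2 \<Longrightarrow> dd u \<sigma> y \<bullet> dd v \<sigma> y = metric Q y u v"
    "rigid_motion T"
    "\<And>x y. x \<in> ball p r1 \<Longrightarrow> y \<in> ball (snd z) r2 \<Longrightarrow> T ((f \<circ> param R) (x, y)) = (h (\<tau> x), w x *\<^sub>R \<sigma> y)"
    by (rule chart_normal_form[OF gi dk p B0(3)]) blast
  define B1 where "B1 = ball p r1"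
  define B2 where "B2 = ball (snd z) r2"
  have B1: "open B1" "B1 \<subseteq> A0" "p \<in> B1" and B2: "open B2" "B2 \<subseteq> B0" "snd z \<in> B2"
    using nf(1-4) pr(2) by (auto simp: B1_def B2_def)
  have sub: "B1 \<subseteq> region P" "B2 \<subseteq> region Q" using B1(2) B2(2) A0(2) B0(2) by blast+
  have \<sigma>inj: "inj (frechet_derivative \<sigma> (at y))" if y: "y \<in> B2" for y
  proof -
    have d: "\<sigma> differentiable (at y)" by (rule smooth_onD[OF nf(17)]) (use y B2_def in simp)
    show ?thesis
      unfolding linear_injective_0[OF linear_dd[OF d]]
    proof (intro allI impI)
      fix v assume "dd v \<sigma> y = 0"
      then have "metric Q y v v = 0" using nf(20)[of y v v] y by (simp add: B2_def)
      then show "v = 0"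
        using W.F.metric y B2(2) unfolding riemannian_metric_on_def by (metis less_irrefl subsetD)
    qed
  qed
  have T: "T (f (param P x, param Q y)) = (h (\<tau> x), \<phi> (param P x) *\<^sub>R \<sigma> y)" if "x \<in> B1" "y \<in> B2" for x y
    using nf(22) that by (simp add: B1_def B2_def R_def prod_patch_simps(2) w_def)
  define V where "V = param P ` B1 \<times> param Q ` B2"
  have VR: "V = param R ` (B1 \<times> B2)" unfolding V_def R_def by (rule prod_patch_image[symmetric])
  have BR: "B1 \<times> B2 \<subseteq> region R" using B1(2) B2(2) AB by blast
  have "rotational_normal_form n \<rho> M f V"
    unfolding V_def
    by (rule rotational_normal_formI[OF rL PQ(1) rF PQ(2) M(1) im card(2,3) B1(1) sub(1) B2(1) sub(2)
          nf(5-8) nf(9-13)[folded B1_def, unfolded w_def] nf(14-16)[folded B1_def]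
          nf(17-20)[folded B2_def] \<sigma>inj nf(21) T])
  moreover have "openin (topo M) V"
    unfolding VR by (rule regular_patchD(4)[OF rR open_Times[OF B1(1) B2(1)] BR])
  moreover have "connectedin (topo M) V"
    unfolding VR
    by (rule connectedin_continuous_map_image[OF regular_patchD(3)[OF rR]])
      (use BR in \<open>simp add: connectedin_subtopology B1_def B2_def convex_Times convex_connected\<close>)
  moreover have "V \<noteq> {}" unfolding V_def using B1(3) B2(3) by blast
  moreover have "V \<subseteq> B"
    using rs(5) B1(2) B2(2) unfolding V_def A0_def B0_def by blast
  ultimately show ?thesis by blast
qed

theorem theorem9:
  fixes n :: nat and \<rho> \<epsilon> :: real
    and L :: "('l, real ^ 2) riem"
    and F :: "('f, real ^ 'm) riem"
    and \<phi> :: "'l \<Rightarrow> real"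
    and M :: "('l \<times> 'f, (real ^ 2) \<times> (real ^ 'm)) riem"
    and f :: "'l \<times> 'f \<Rightarrow> (real ^ 3) \<times> (real ^ 'k)"
  assumes "n \<ge> 5" and "CARD('m) = n - 2" and "CARD('k) = n - 1"
    and "riemannian_manifold L"
    and "riemannian_manifold F" and "\<epsilon> \<in> {1, -1, 0}" and "einstein F ((real n - 3) * \<epsilon>)"
    and "smooth_function L \<phi>" and "\<forall>p\<in>points L. \<phi> p > 0"
    and "M = warped_product L \<phi> F" and "einstein M \<rho>"
    and "\<forall>B. openin (topo L) B \<and> B \<noteq> {} \<longrightarrow> \<not> \<phi> constant_on B"
    and "\<forall>B. openin (topo M) B \<and> B \<noteq> {} \<longrightarrow>
           \<not> constant_sectional_curvature (open_submanifold M B)"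
    and "constant_sectional_curvature F"
    and "isometric_immersion M f"
  shows "\<exists>D. openin (topo M) D \<and> (topo M) closure_of D = points M \<and>
    (\<forall>V\<in>connected_components_of (subtopology (topo M) D).
      \<exists>(c::real) (I::real set) (I0::real set) (\<psi>::real \<Rightarrow> real) (U::(real \<times> real) set)
        (h::real \<times> real \<Rightarrow> real ^ 3)
        (N::((real \<times> real) \<times> (real ^ 'k), (real \<times> real) \<times> (real ^ 'm)) riem) W \<Phi> T.
        open I \<and> is_interval I \<and> open I0 \<and> is_interval I0 \<and>
        smooth_on I \<psi> \<and>
        (\<forall>t\<in>I. \<psi> t > 0 \<and>
           (deriv \<psi> t)\<^sup>2 = 1 - \<rho> / (real n - 1) * (\<psi> t)\<^sup>2 + c / (\<psi> t) ^ (n - 3) \<and>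
           0 < (deriv \<psi> t)\<^sup>2 \<and> (deriv \<psi> t)\<^sup>2 < 1) \<and>
        open U \<and> U \<subseteq> I \<times> I0 \<and>
        isometric_immersion
          (plane_domain U (\<lambda>t. 1 - (deriv \<psi> t)\<^sup>2) (\<lambda>t. (deriv \<psi> t)\<^sup>2)) h \<and>
        N = warped_product (plane_domain U (\<lambda>t. 1) (\<lambda>t. (deriv \<psi> t)\<^sup>2))
              (\<lambda>(t, u). \<psi> t) unit_sphere \<and>
        openin (topo N) W \<and>
        isometry (open_submanifold M V) (open_submanifold N W) \<Phi> \<and>
        rigid_motion T \<and>
        rotational_submanifold (open_submanifold M V) (T \<circ> f)
          (plane_domain U (\<lambda>t. 1) (\<lambda>t. (deriv \<psi> t)\<^sup>2)) (\<lambda>(t, u). (h (t, u), \<psi> t)) \<and>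
        (\<forall>p\<in>V. \<forall>t u y. \<Phi> p = ((t, u), y) \<longrightarrow> T (f p) = (h (t, u), \<psi> t *\<^sub>R y)))"
proof -
  have card: "CARD('m) \<ge> 3" "CARD('k) = CARD('m) + 1" "n = CARD('m) + 2"
    using assms(1-3) by auto
  have e: "einstein F ((real DIM(real ^ 'm) - 1) * \<epsilon>)"
    using assms(1,2,7) by (simp add: of_nat_diff)
  show ?thesis
  proof (rule dense_union_of_components[of "topo M" "rotational_normal_form n \<rho> M f"])
    fix B assume B: "openin (topo M) B" "B \<noteq> {}"
    show "\<exists>V. openin (topo M) V \<and> connectedin (topo M) V \<and> V \<noteq> {} \<and> V \<subseteq> B \<and>
        rotational_normal_form n \<rho> M f V"
    proof (rule rotational_neighbourhood[OF card assms(4,5,6) e assms(8,9,10,11) _ _ assms(14,15) B(1)])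
      show "\<not> \<phi> constant_on A" if "openin (topo L) A" "A \<noteq> {}" for A
        using assms(12) that by blast
      show "\<not> constant_sectional_curvature (open_submanifold M B)" using assms(13) B by blast
    qed
  next
    fix D assume D: "openin (topo M) D" "topo M closure_of D = points M"
      "\<And>V. V \<in> connected_components_of (subtopology (topo M) D) \<Longrightarrow> rotational_normal_form n \<rho> M f V"
    show ?thesis
      by (intro exI[of _ D] conjI ballI D(1,2) D(3)[unfolded rotational_normal_form_def])
  qed
qed

end
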